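(* If $u\in H^{1,1}(\mathbb{R})$, then the function $a(k)$ is continued analytically in $\mathbb{C}^+=\{z:\mathrm{Im}\,z>0\}$ with respect to $z=k^2$. In addition, $$a(k)-1,\quad kb(k),\quad k^{-1}b(k)\in H^1_z(\mathbb{R}).$$ Moreover, if $u\in H^2(\mathbb{R})\cap H^{1,1}(\mathbb{R})$, then $$kb(k),\quad k^{-1}b(k)\in L^{2,1}_z(\mathbb{R}).$$ In addition, the maps $$H^{1,1}(\mathbb{R})\ni u\mapsto a(k)-1,\ kb(k),\ k^{-1}b(k)\in H^1_z(\mathbb{R})$$ and $$H^2(\mathbb{R})\cap H^{1,1}(\mathbb{R})\ni u\mapsto kb(k),\ k^{-1}b(k)\in L^{2,1}_z(\mathbb{R})$$ are Lipschitz continuous.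
   Context: Spaces: $\langle x\rangle=(1+x^2)^{1/2}$; $L^{2,1}(\mathbb{R})=\{f:\langle x\rangle f\in L^2(\mathbb{R})\}$; $H^{1,1}(\mathbb{R})=\{f:f,f'\in L^{2,1}(\mathbb{R})\}$; $H^m$ are the usual Sobolev spaces; intersections carry the sum of the norms. A subscript $z$ means the space of functions of the variable $z\in\mathbb{R}$. Scattering data: $z=k^2$. For $k\in\mathbb{R}\cup i\mathbb{R}$ (so $z\in\mathbb{R}$) let $Q(x;k)=\begin{pmatrix}\frac i2|u|^2 & ku\\ -k\overline u & -\frac i2|u|^2\end{pmatrix}$, and let $\varphi_\pm(x;k),\phi_\pm(x;k)\in\mathbb{C}^2$ solve $\varphi_\pm(x;k)=e_1+\int_{\pm\infty}^x\mathrm{diag}(1,e^{2i(k^2+1)(x-y)})Q(y;k)\varphi_\pm(y;k)\,dy$, $\phi_\pm(x;k)=e_2+\int_{\pm\infty}^x\mathrm{diag}(e^{-2i(k^2+1)(x-y)},1)Q(y;k)\phi_\pm(y;k)\,dy$, with $e_1=(1,0)^T$, $e_2=(0,1)^T$. The coefficients $a(k),b(k)$ are defined by $\varphi_-(x;k)=a(k)\varphi_+(x;k)+b(k)e^{2i(k^2+1)x}\phi_+(x;k)$; $a$ is even and $b$ is odd in $k$, so $a(k)$, $kb(k)$ and $k^{-1}b(k)$ are functions of $z=k^2$. "Lipschitz continuous" is meant on bounded sets: for every $B>0$ there is $C(B)>0$ such that the norm of the difference of the images of $u,\tilde u$ is at most $C(B)\|u-\tilde u\|$ whenever $\|u\|,\|\tilde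 u\|\le B$, norms being those of the indicated domain. *)

theory Defs
  imports "HOL-Analysis.Analysis"
begin

text \<open>Elements of the spaces are represented by Borel functions; the membership predicates and the
  norms depend only on the class of a function modulo Lebesgue null sets.\<close>

definition L2 :: "(real \<Rightarrow> complex) set" where
  "L2 = {f \<in> borel_measurable lborel. integrable lborel (\<lambda>x. (cmod (f x))\<^sup>2)}"

definition norm_L2 :: "(real \<Rightarrow> complex) \<Rightarrow> real" where
  "norm_L2 f = sqrt (LINT x|lborel. (cmod (f x))\<^sup>2)"

definition jbracket :: "real \<Rightarrow> real" where
  "jbracket x = sqrt (1 + x\<^sup>2)"

definition L21 :: "(real \<Rightarrow> complex) set" where
  "L21 = {f. (\<lambda>x. jbracket x *\<^sub>R f x) \<in> L2}"

definition norm_L21 :: "(real \<Rightarrow> complex) \<Rightarrow> real" where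
  "norm_L21 f = norm_L2 (\<lambda>x. jbracket x *\<^sub>R f x)"

definition test_function :: "(real \<Rightarrow> real) \<Rightarrow> bool" where
  "test_function \<psi> \<longleftrightarrow>
     (\<forall>n x. (deriv ^^ n) \<psi> differentiable (at x)) \<and> (\<exists>R. \<forall>x. \<bar>x\<bar> > R \<longrightarrow> \<psi> x = 0)"

definition locally_integrable :: "(real \<Rightarrow> complex) \<Rightarrow> bool" where
  "locally_integrable f \<longleftrightarrow> (\<forall>R. set_integrable lborel {-R..R} f)"

definition has_weak_deriv :: "(real \<Rightarrow> complex) \<Rightarrow> (real \<Rightarrow> complex) \<Rightarrow> bool" where
  "has_weak_deriv f g \<longleftrightarrow> locally_integrable f \<and> locally_integrable g \<and>
     (\<forall>\<psi>. test_function \<psi> \<longrightarrow>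
        (LINT x|lborel. deriv \<psi> x *\<^sub>R f x) = - (LINT x|lborel. \<psi> x *\<^sub>R g x))"

text \<open>The weak derivative is unique almost everywhere, so the norms below do not depend on the choice.\<close>

definition weak_deriv :: "(real \<Rightarrow> complex) \<Rightarrow> (real \<Rightarrow> complex)" where
  "weak_deriv f = (SOME g. has_weak_deriv f g)"

primrec Hm :: "nat \<Rightarrow> (real \<Rightarrow> complex) set" where
  "Hm 0 = L2"
| "Hm (Suc m) = {f \<in> L2. \<exists>g \<in> Hm m. has_weak_deriv f g}"

definition norm_Hm :: "nat \<Rightarrow> (real \<Rightarrow> complex) \<Rightarrow> real" where
  "norm_Hm m f = sqrt (\<Sum>j\<le>m. (norm_L2 ((weak_deriv ^^ j) f))\<^sup>2)"

definition H11 :: "(real \<Rightarrow> complex) set" where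
  "H11 = {f \<in> L21. \<exists>g \<in> L21. has_weak_deriv f g}"

definition norm_H11 :: "(real \<Rightarrow> complex) \<Rightarrow> real" where
  "norm_H11 f = norm_L21 f + norm_L21 (weak_deriv f)"

definition norm_H2_H11 :: "(real \<Rightarrow> complex) \<Rightarrow> real" where
  "norm_H2_H11 f = norm_Hm 2 f + norm_H11 f"

definition lipschitz_on_bounded_sets ::
    "(real \<Rightarrow> complex) set \<Rightarrow> ((real \<Rightarrow> complex) \<Rightarrow> real) \<Rightarrow>
     (real \<Rightarrow> complex) set \<Rightarrow> ((real \<Rightarrow> complex) \<Rightarrow> real) \<Rightarrow>
     ((real \<Rightarrow> complex) \<Rightarrow> (real \<Rightarrow> complex)) \<Rightarrow> bool" where
  "lipschitz_on_bounded_sets X nX Y nY F \<longleftrightarrow>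
     (\<forall>u\<in>X. F u \<in> Y) \<and>
     (\<forall>B>0. \<exists>C>0. \<forall>u\<in>X. \<forall>v\<in>X. nX u \<le> B \<longrightarrow> nX v \<le> B \<longrightarrow>
        nY (\<lambda>z. F u z - F v z) \<le> C * nX (\<lambda>x. u x - v x))"

definition diag2 :: "complex \<Rightarrow> complex \<Rightarrow> complex^2^2" where
  "diag2 p q = vector [vector [p, 0], vector [0, q]]"

definition Qmat :: "(real \<Rightarrow> complex) \<Rightarrow> real \<Rightarrow> complex \<Rightarrow> complex^2^2" where
  "Qmat u x k = vector
     [vector [\<i> / 2 * of_real ((cmod (u x))\<^sup>2), k * u x],
      vector [- k * cnj (u x), - (\<i> / 2 * of_real ((cmod (u x))\<^sup>2))]]"

text \<open>Both integral equations have the shape \<open>\<phi> x = e + \<integral>\<^sub>s\<^sup>x D (x - y) Q(y;k) \<phi> y dy\<close> with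
  \<open>s = \<plusminus>\<infinity>\<close>; the interval integral is oriented, i.e. from \<open>\<infinity>\<close> to \<open>x\<close> it is minus the integral
  over \<open>(x, \<infinity>)\<close>. Integrability is demanded because the Lebesgue integral of a non-integrable
  function is 0 by convention.\<close>

definition solves_volterra ::
    "ereal \<Rightarrow> complex^2 \<Rightarrow> (real \<Rightarrow> complex^2^2) \<Rightarrow> (real \<Rightarrow> complex) \<Rightarrow> complex \<Rightarrow> (real \<Rightarrow> complex^2) \<Rightarrow> bool"
  where
  "solves_volterra s e D u k \<phi> \<longleftrightarrow>
     (\<forall>x. interval_lebesgue_integrable lborel s (ereal x) (\<lambda>y. D (x - y) *v (Qmat u y k *v \<phi> y)) \<and>
          \<phi> x = e + (LBINT y=s..ereal x. D (x - y) *v (Qmat u y k *v \<phi> y)))"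

definition jost1 :: "ereal \<Rightarrow> (real \<Rightarrow> complex) \<Rightarrow> complex \<Rightarrow> real \<Rightarrow> complex^2" where
  "jost1 s u k = (THE \<phi>. solves_volterra s (vector [1, 0])
     (\<lambda>t. diag2 1 (exp (2 * \<i> * (k\<^sup>2 + 1) * of_real t))) u k \<phi>)"

definition jost2 :: "ereal \<Rightarrow> (real \<Rightarrow> complex) \<Rightarrow> complex \<Rightarrow> real \<Rightarrow> complex^2" where
  "jost2 s u k = (THE \<phi>. solves_volterra s (vector [0, 1])
     (\<lambda>t. diag2 (exp (- 2 * \<i> * (k\<^sup>2 + 1) * of_real t)) 1) u k \<phi>)"

definition scattering :: "(real \<Rightarrow> complex) \<Rightarrow> complex \<Rightarrow> complex \<times> complex" where
  "scattering u k = (THE (a, b). \<forall>x.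
     jost1 (-\<infinity>) u k x =
       a *s jost1 \<infinity> u k x + (b * exp (2 * \<i> * (k\<^sup>2 + 1) * of_real x)) *s jost2 \<infinity> u k x)"

definition scat_a :: "(real \<Rightarrow> complex) \<Rightarrow> complex \<Rightarrow> complex" where
  "scat_a u k = fst (scattering u k)"

definition scat_b :: "(real \<Rightarrow> complex) \<Rightarrow> complex \<Rightarrow> complex" where
  "scat_b u k = snd (scattering u k)"

text \<open>An even function of \<open>k \<in> \<real> \<union> i\<real>\<close> as a function of \<open>z = k\<^sup>2 \<in> \<real>\<close>: by evenness the branch of
  the square root is immaterial. At \<open>z = 0\<close> the expression \<open>b(k)/k\<close> gets the value 0 because division
  by 0 is 0 in HOL; a single point does not affect the class in the spaces above.\<close>

definition in_z :: "(complex \<Rightarrow> complex) \<Rightarrow> real \<Rightarrow> complex" where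
  "in_z f z = f (csqrt (of_real z))"

definition map_a :: "(real \<Rightarrow> complex) \<Rightarrow> real \<Rightarrow> complex" where
  "map_a u = in_z (\<lambda>k. scat_a u k - 1)"

definition map_kb :: "(real \<Rightarrow> complex) \<Rightarrow> real \<Rightarrow> complex" where
  "map_kb u = in_z (\<lambda>k. k * scat_b u k)"

definition map_b_over_k :: "(real \<Rightarrow> complex) \<Rightarrow> real \<Rightarrow> complex" where
  "map_b_over_k u = in_z (\<lambda>k. scat_b u k / k)"

end

theory Submission
  imports Defs "HOL-Probability.Probability" "HOL-Complex_Analysis.Complex_Analysis"
begin

text \<open>Write \<open>\<phi>\<^sub>- = (p, k q)\<close>; then \<open>p\<close> and \<open>q\<close> depend on \<open>k\<close> only through \<open>z = k\<^sup>2\<close>. Eliminating the term with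
  the factor \<open>k\<^sup>2\<close> by means of \<open>w = cnj u * p - 2 \<i> (z + 1) q\<close> gives a Volterra system for \<open>(p, w, q)\<close> whose
  kernel entries are \<open>M\<^sub>i\<^sub>j(y) exp (2 \<i> c\<^sub>i\<^sub>j (z + 1) y)\<close> with \<open>c\<^sub>i\<^sub>j \<in> {-1, 0, 1}\<close> and weighted \<open>L\<^sup>2\<close> coefficients
  built from \<open>u\<close> and \<open>u'\<close>. The limits of \<open>p\<close>, \<open>w\<close> and \<open>q\<close> at \<open>\<infinity>\<close> (the latter two freed of their phases) are
  \<open>a\<close>, a function \<open>w\<^sub>\<infinity>\<close> and \<open>b / k\<close>, and \<open>(\<i> / 2) w\<^sub>\<infinity> = (z + 1) b / k\<close>, so that \<open>k b = (\<i> / 2) w\<^sub>\<infinity> - b / k\<close>.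

  By Plancherel an oscillatory integral of an \<open>L\<^sup>2\<close> function is in \<open>L\<^sup>2\<close> with respect to \<open>z\<close>, uniformly in the
  upper limit of integration, and Gronwall's inequality carries this over to the solution, to its difference
  quotients in \<open>z\<close> (each costs one factor \<open>y\<close>, which the weight pays for) and to differences of solutions
  for two potentials. This yields the \<open>H\<^sup>1\<close> statements. With the phases multiplied back in, the kernel of the
  system decays for \<open>Im z > 0\<close>, whence the analytic continuation of \<open>a\<close>. If \<open>u \<in> H\<^sup>2\<close>, one integration by parts
  expresses \<open>(z + 1) w\<^sub>\<infinity>\<close> through oscillatory integrals of the same kind.\<close>

section \<open>Cumulative integrals and Volterra systems\<close>

text \<open>The obstacle is the factor \<open>k\<close> in \<open>Q\<close>: Picard iteration for
  the given system yields bounds that grow with |z|. Eliminating (z + 1) q through w removes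
  \<open>k\<close> at the price of one derivative of u, and it also cancels diagonal coefficients:
  p' = (i/2) u w - u q contains no p, and in w' the w terms drop out up to the phase. The first
  cancellation is decisive: p starts from 1, so a coefficient of p without phase would contribute a
  forcing term constant in z, which is not in L^2. Every other phase-free coefficient acts on w or
  q, which start from 0 and are themselves L^2 in z. In the enlarged system w is an independent
  unknown, so its defining relation has to be recovered afterwards (\<open>constraint\<close>). All
  bounds are explicit in a bound B for u, and solutions, quotients and their differences obey one
  kind of linear Volterra equation. Existence of the z-derivative and its Lipschitz dependence on u
  therefore come from a single estimate for quotients with different steps and different kernels
  (\<open>quo_diff_L2\<close>).\<close>

definition cum :: "(real \<Rightarrow> 'a::{banach,second_countable_topology}) \<Rightarrow> real \<Rightarrow> 'a" where
  "cum f x = (LINT y|lborel. (if y < x then f y else 0))"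

lemma integrable_if:
  fixes f :: "real \<Rightarrow> 'a::{banach,second_countable_topology}"
  assumes "integrable lborel f" "Measurable.pred borel P"
  shows "integrable lborel (\<lambda>y. if P y then f y else 0)"
proof (rule Bochner_Integration.integrable_bound[OF assms(1)])
  have [measurable]: "f \<in> borel_measurable borel" using borel_measurable_integrable[OF assms(1)] by simp
  note [measurable] = assms(2)
  show "(\<lambda>y. if P y then f y else 0) \<in> borel_measurable lborel" by measurable
qed auto

lemma integrable_below [simp, intro]:
  fixes f :: "real \<Rightarrow> 'a::{banach,second_countable_topology}"
  shows "integrable lborel f \<Longrightarrow> integrable lborel (\<lambda>y. if y < x then f y else 0)"
  by (rule integrable_if) auto

lemma cum_measurable [measurable (raw)]:
  fixes f :: "'b \<Rightarrow> real \<Rightarrow> 'a::{banach,second_countable_topology}"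
  assumes [measurable]: "(\<lambda>p. f (fst p) (snd p)) \<in> borel_measurable (M \<Otimes>\<^sub>M borel)" "g \<in> borel_measurable M"
  shows "(\<lambda>w. cum (f w) (g w)) \<in> borel_measurable M"
proof -
  have s: "sets (M \<Otimes>\<^sub>M lborel) = sets (M \<Otimes>\<^sub>M (borel::real measure))" by (rule sets_pair_measure_cong) auto
  have "(\<lambda>p. if snd p < g (fst p) then f (fst p) (snd p) else 0) \<in> borel_measurable (M \<Otimes>\<^sub>M borel)"
    by measurable
  hence "(\<lambda>p. if snd p < g (fst p) then f (fst p) (snd p) else 0) \<in> borel_measurable (M \<Otimes>\<^sub>M lborel)"
    by (simp only: measurable_cong_sets[OF s refl])
  hence "(\<lambda>w. LINT y|lborel. (if y < g w then f w y else 0)) \<in> borel_measurable M"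
    by (intro lborel.borel_measurable_lebesgue_integral) (simp add: case_prod_unfold)
  thus ?thesis unfolding cum_def .
qed

lemma cum_measurable1:
  fixes f :: "real \<Rightarrow> 'a::{banach,second_countable_topology}"
  assumes [measurable]: "f \<in> borel_measurable borel" shows "cum f \<in> borel_measurable borel"
proof -
  have "(\<lambda>w. cum ((\<lambda>_. f) w) w) \<in> borel_measurable borel"
    by (rule cum_measurable) measurable
  thus ?thesis by simp
qed

lemma cum_add: "integrable lborel f \<Longrightarrow> integrable lborel g \<Longrightarrow> cum (\<lambda>y. f y + g y) x = cum f x + cum g x"
proof -
  assume "integrable lborel f" "integrable lborel g"
  moreover have "(\<lambda>y. if y < x then f y + g y else 0) = (\<lambda>y. (if y < x then f y else 0) + (if y < x then g y else 0))" by auto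
  ultimately show ?thesis unfolding cum_def by simp
qed

lemma cum_diff: "integrable lborel f \<Longrightarrow> integrable lborel g \<Longrightarrow> cum (\<lambda>y. f y - g y) x = cum f x - cum g x"
proof -
  assume "integrable lborel f" "integrable lborel g"
  moreover have "(\<lambda>y. if y < x then f y - g y else 0) = (\<lambda>y. (if y < x then f y else 0) - (if y < x then g y else 0))" by auto
  ultimately show ?thesis unfolding cum_def by simp
qed

lemma cum_sum: "(\<And>i. i \<in> A \<Longrightarrow> integrable lborel (f i)) \<Longrightarrow> cum (\<lambda>y. \<Sum>i\<in>A. f i y) x = (\<Sum>i\<in>A. cum (f i) x)"
proof -
  assume "\<And>i. i \<in> A \<Longrightarrow> integrable lborel (f i)"
  moreover have "(\<lambda>y. if y < x then (\<Sum>i\<in>A. f i y) else 0) = (\<lambda>y. \<Sum>i\<in>A. (if y < x then f i y else 0))" by auto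
  ultimately show ?thesis unfolding cum_def by simp
qed

lemma cum_mult:
  fixes f :: "real \<Rightarrow> 'a::{banach,second_countable_topology,real_normed_field}"
  shows "cum (\<lambda>y. c * f y) x = c * cum f x"
proof -
  have "(\<lambda>y. if y < x then c * f y else 0) = (\<lambda>y. c * (if y < x then f y else 0))" by auto
  thus ?thesis unfolding cum_def by (simp only: integral_mult_right_zero)
qed

lemma cum_mono:
  fixes f :: "real \<Rightarrow> real"
  assumes "integrable lborel f" "integrable lborel g" "\<And>y. y < x \<Longrightarrow> f y \<le> g y"
  shows "cum f x \<le> cum g x"
  unfolding cum_def using assms by (intro integral_mono) auto

lemma cum_norm:
  assumes "integrable lborel f" shows "norm (cum f x) \<le> cum (\<lambda>y. norm (f y)) x"
proof -
  have "norm (cum f x) \<le> (LINT y|lborel. norm (if y < x then f y else 0))" unfolding cum_def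
    by (rule integral_norm_bound)
  also have "(\<lambda>y. norm (if y < x then f y else 0)) = (\<lambda>y. if y < x then norm (f y) else 0)" by auto
  finally show ?thesis unfolding cum_def .
qed

lemma cum_nonneg: "(\<And>y. 0 \<le> f y) \<Longrightarrow> 0 \<le> (cum f x :: real)"
  unfolding cum_def by (intro integral_nonneg_AE) auto

lemma cum_le_total:
  fixes f :: "real \<Rightarrow> real"
  assumes "integrable lborel f" "\<And>y. 0 \<le> f y" shows "cum f x \<le> (LINT y|lborel. f y)"
  unfolding cum_def using assms by (intro integral_mono) auto

lemma norm_cum_le:
  fixes f :: "real \<Rightarrow> 'a::{banach,second_countable_topology}"
  assumes "integrable lborel f" shows "norm (cum f x) \<le> (LINT y|lborel. norm (f y))"
  by (rule order_trans[OF cum_norm[OF assms] cum_le_total]) (use assms in auto)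

lemma cum_cong: "(\<And>y. y < x \<Longrightarrow> f y = g y) \<Longrightarrow> cum f x = cum g x"
  unfolding cum_def by (intro Bochner_Integration.integral_cong) auto

lemma AE_neq_real: "AE y in lborel. y \<noteq> (x::real)"
proof -
  have "{x} \<in> null_sets lborel" by (simp add: null_setsI)
  thus ?thesis by (auto simp: AE_iff_null elim: AE_I' )
qed

text \<open>The cut-off integrands converge except at y = x, a null set, and
  \<open>norm (f y)\<close> dominates them.\<close>

lemma cum_tendsto:
  fixes f :: "real \<Rightarrow> 'a::{banach,second_countable_topology}"
  assumes i: "integrable lborel f" and X: "X \<longlonglongrightarrow> x"
  shows "(\<lambda>n. cum f (X n)) \<longlonglongrightarrow> cum f x"
  unfolding cum_def
proof (rule integral_dominated_convergence[where w="\<lambda>y. norm (f y)"])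
  have [measurable]: "f \<in> borel_measurable borel" using borel_measurable_integrable[OF i] by simp
  show "AE y in lborel. (\<lambda>n. if y < X n then f y else 0) \<longlonglongrightarrow> (if y < x then f y else 0)"
    using AE_neq_real[of x]
  proof eventually_elim
    fix y assume "y \<noteq> x"
    then consider "y < x" | "x < y" by linarith
    thus "(\<lambda>n. if y < X n then f y else 0) \<longlonglongrightarrow> (if y < x then f y else 0)"
    proof cases
      case 1
      have "eventually (\<lambda>n. y < X n) sequentially" using order_tendstoD(1)[OF X 1] .
      hence "eventually (\<lambda>n. (if y < X n then f y else 0) = f y) sequentially" by eventually_elim auto
      thus ?thesis using 1 by (simp add: tendsto_eventually)
    next
      case 2
      have "eventually (\<lambda>n. X n < y) sequentially" using order_tendstoD(2)[OF X 2] .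
      hence "eventually (\<lambda>n. (if y < X n then f y else 0) = 0) sequentially" by eventually_elim auto
      thus ?thesis using 2 by (simp add: tendsto_eventually)
    qed
  qed
qed (use i borel_measurable_integrable[OF i] in \<open>auto\<close>)

lemma cum_continuous:
  fixes f :: "real \<Rightarrow> 'a::{banach,second_countable_topology}"
  assumes i: "integrable lborel f"
  shows "continuous_on UNIV (cum f)"
  unfolding continuous_on_sequentially comp_def using cum_tendsto[OF i] by auto

lemma cum_at_top:
  fixes f :: "real \<Rightarrow> 'a::{banach,second_countable_topology}"
  assumes i: "integrable lborel f" and X: "filterlim X at_top sequentially"
  shows "(\<lambda>n. cum f (X n)) \<longlonglongrightarrow> (LINT y|lborel. f y)"
  unfolding cum_def
proof (rule integral_dominated_convergence[where w="\<lambda>y. norm (f y)"])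
  show "AE y in lborel. (\<lambda>n. if y < X n then f y else 0) \<longlonglongrightarrow> f y"
  proof (rule AE_I2)
    fix y
    have "eventually (\<lambda>n. y < X n) sequentially" using X by (simp add: filterlim_at_top_dense)
    hence "eventually (\<lambda>n. (if y < X n then f y else 0) = f y) sequentially" by eventually_elim auto
    thus "(\<lambda>n. if y < X n then f y else 0) \<longlonglongrightarrow> f y" by (simp add: tendsto_eventually)
  qed
qed (use i borel_measurable_integrable[OF i] in \<open>auto\<close>)

lemma cum_at_bot:
  fixes f :: "real \<Rightarrow> 'a::{banach,second_countable_topology}"
  assumes i: "integrable lborel f" and X: "filterlim X at_bot sequentially"
  shows "(\<lambda>n. cum f (X n)) \<longlonglongrightarrow> 0"
proof -
  have "(\<lambda>n. LINT y|lborel. (if y < X n then f y else 0)) \<longlonglongrightarrow> (LINT y|(lborel::real measure). (0::'a))"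
  proof (rule integral_dominated_convergence[where w="\<lambda>y. norm (f y)"])
    show "AE y in lborel. (\<lambda>n. if y < X n then f y else 0) \<longlonglongrightarrow> 0"
    proof (rule AE_I2)
      fix y
      have "eventually (\<lambda>n. X n < y) sequentially" using X by (simp add: filterlim_at_bot_dense)
      hence "eventually (\<lambda>n. (if y < X n then f y else 0) = 0) sequentially" by eventually_elim auto
      thus "(\<lambda>n. if y < X n then f y else 0) \<longlonglongrightarrow> 0" by (simp add: tendsto_eventually)
    qed
  qed (use i borel_measurable_integrable[OF i] in \<open>auto\<close>)
  thus ?thesis by (simp add: cum_def)
qed

text \<open>On the plane the integrand is dominated by |g| |h|, a product of integrable functions.
  The product rule below and \<open>L2b_oscillatory\<close> both rest on this exchange.\<close>

lemma triangle_Fubini: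
  fixes g h :: "real \<Rightarrow> 'a::{banach,second_countable_topology,real_normed_field}"
  assumes g: "integrable lborel g" and h: "integrable lborel h"
  shows "(LINT y|lborel. g y * cum h y) = (LINT s|lborel. h s * (LINT y|lborel. (if s < y then g y else 0)))"
    and "integrable lborel (\<lambda>y. g y * cum h y)"
proof -
  have [measurable]: "g \<in> borel_measurable borel" "h \<in> borel_measurable borel"
    using borel_measurable_integrable[OF g] borel_measurable_integrable[OF h] by auto
  have i1: "integrable (lborel \<Otimes>\<^sub>M lborel) (\<lambda>p. norm (g (fst p)) * norm (h (snd p)))"
  proof (rule lborel_pair.Fubini_integrable)
    show "integrable lborel (\<lambda>x. LINT y|lborel. norm (norm (g (fst (x, y))) * norm (h (snd (x, y)))))"
      using g by (simp add: abs_mult)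
  qed (use h in \<open>auto\<close>)
  have i2: "integrable (lborel \<Otimes>\<^sub>M lborel) (\<lambda>(y,s). g y * (if s < y then h s else 0))"
    by (rule Bochner_Integration.integrable_bound[OF i1]) (auto simp: norm_mult)
  have "(LINT s|lborel. LINT y|lborel. g y * (if s < y then h s else 0)) = (LINT y|lborel. LINT s|lborel. g y * (if s < y then h s else 0))"
    by (rule lborel_pair.Fubini_integral[OF i2])
  moreover have E: "(LINT s|lborel. g y * (if s < y then h s else 0)) = g y * cum h y" for y
    unfolding cum_def by (rule integral_mult_right_zero)
  moreover have "(LINT y|lborel. g y * (if s < y then h s else 0)) = h s * (LINT y|lborel. (if s < y then g y else 0))" for s
  proof -
    have "(\<lambda>y. g y * (if s < y then h s else 0)) = (\<lambda>y. h s * (if s < y then g y else 0))" by auto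
    thus ?thesis by simp
  qed
  ultimately show "(LINT y|lborel. g y * cum h y) = (LINT s|lborel. h s * (LINT y|lborel. (if s < y then g y else 0)))"
    by (simp only:)
  have "integrable lborel (\<lambda>y. LINT s|lborel. g y * (if s < y then h s else 0))"
    using lborel_pair.integrable_fst'[OF i2] by simp
  thus "integrable lborel (\<lambda>y. g y * cum h y)"
    unfolding cum_def by simp
qed

lemma int_gt_eq:
  fixes g :: "real \<Rightarrow> 'a::{banach,second_countable_topology}"
  assumes g: "integrable lborel g"
  shows "(LINT y|lborel. (if s < y then g y else 0)) = (LINT y|lborel. g y) - cum g s"
proof -
  have [measurable]: "g \<in> borel_measurable borel"
    using borel_measurable_integrable[OF g] by auto
  have "(LINT y|lborel. g y) = (LINT y|lborel. (if s < y then g y else 0) + (if y < s then g y else 0))"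
    by (rule integral_cong_AE) (use AE_neq_real[of s] in \<open>auto elim: eventually_mono\<close>)
  also have "\<dots> = (LINT y|lborel. (if s < y then g y else 0)) + cum g s"
    unfolding cum_def using g by (intro Bochner_Integration.integral_add integrable_if) auto
  finally show ?thesis by simp
qed

text \<open>The plane is cut along its diagonal, and each half is one triangle integral. This is
  integration by parts for primitives of integrable functions; it yields \<open>cum_product\<close>
  and \<open>ac_mult\<close>.\<close>

lemma int_product:
  fixes g h :: "real \<Rightarrow> 'a::{banach,second_countable_topology,real_normed_field}"
  assumes g: "integrable lborel g" and h: "integrable lborel h"
  shows "(LINT y|lborel. g y) * (LINT y|lborel. h y) = (LINT y|lborel. g y * cum h y + cum g y * h y)"
proof -
  note tg = triangle_Fubini[OF g h] and th = triangle_Fubini[OF h g]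
  have e: "h s * (LINT y|lborel. (if s < y then g y else 0)) = (LINT y|lborel. g y) * h s - h s * cum g s" for s
    by (simp add: int_gt_eq[OF g] algebra_simps)
  have "(LINT y|lborel. g y * cum h y) = (LINT y|lborel. g y) * (LINT y|lborel. h y) - (LINT y|lborel. h y * cum g y)"
    unfolding tg(1) e using th(2) h by simp
  moreover have "(LINT y|lborel. g y * cum h y + cum g y * h y) = (LINT y|lborel. g y * cum h y) + (LINT y|lborel. h y * cum g y)"
    using tg(2) th(2) by (simp add: mult.commute)
  ultimately show ?thesis by simp
qed

lemma cum_below: "y \<le> x \<Longrightarrow> cum (\<lambda>y. if y < x then f y else 0) y = cum f y"
  by (rule cum_cong) auto

lemma cum_product:
  fixes g h :: "real \<Rightarrow> 'a::{banach,second_countable_topology,real_normed_field}"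
  assumes g: "integrable lborel g" and h: "integrable lborel h"
  shows "cum g x * cum h x = cum (\<lambda>y. g y * cum h y + cum g y * h y) x"
proof -
  let ?b = "\<lambda>f y. if y < x then f y else 0"
  have "cum g x * cum h x = (LINT y|lborel. ?b g y * cum (?b h) y + cum (?b g) y * ?b h y)"
    unfolding cum_def[of g x] cum_def[of h x] using g h by (intro int_product) auto
  also have "\<dots> = cum (\<lambda>y. g y * cum h y + cum g y * h y) x"
    unfolding cum_def[of _ x] by (intro Bochner_Integration.integral_cong) (auto simp: cum_below)
  finally show ?thesis .
qed

text \<open>Chain rule for powers of the primitive of an integrable function, by induction from the
  product rule. The divisor \<open>Suc n\<close> is the source of the factorials in the Gronwall and
  Picard estimates.\<close>

lemma cum_power:
  fixes k :: "real \<Rightarrow> real"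
  assumes k: "integrable lborel k"
  shows "integrable lborel (\<lambda>y. k y * cum k y ^ n) \<and> cum (\<lambda>y. k y * cum k y ^ n) x = cum k x ^ Suc n / Suc n"
proof (induction n arbitrary: x)
  case 0 then show ?case using k by simp
next
  case (Suc n)
  have i: "integrable lborel (\<lambda>y. k y * cum k y ^ n)" and e: "\<And>x. cum k x ^ Suc n = Suc n * cum (\<lambda>y. k y * cum k y ^ n) x"
    using Suc by auto
  have i2: "integrable lborel (\<lambda>y. k y * cum k y ^ Suc n)"
    unfolding e using triangle_Fubini(2)[OF k i, THEN integrable_mult_right, of "Suc n"] by (simp add: algebra_simps)
  have "cum k x ^ Suc (Suc n) = Suc n * (cum k x * cum (\<lambda>y. k y * cum k y ^ n) x)"
    using e[of x] by simp
  also have "\<dots> = Suc n * cum (\<lambda>y. k y * cum (\<lambda>y. k y * cum k y ^ n) y + cum k y * (k y * cum k y ^ n)) x"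
    by (simp add: cum_product[OF k i])
  also have "\<dots> = cum (\<lambda>y. Suc n * (k y * cum (\<lambda>y. k y * cum k y ^ n) y + cum k y * (k y * cum k y ^ n))) x"
    by (simp only: cum_mult)
  also have "(\<lambda>y. Suc n * (k y * cum (\<lambda>y. k y * cum k y ^ n) y + cum k y * (k y * cum k y ^ n)))
     = (\<lambda>y. Suc (Suc n) * (k y * cum k y ^ Suc n))"
  proof
    fix y
    have "Suc n * (k y * cum (\<lambda>y. k y * cum k y ^ n) y + cum k y * (k y * cum k y ^ n))
      = k y * (Suc n * cum (\<lambda>y. k y * cum k y ^ n) y) + Suc n * (k y * cum k y ^ Suc n)"
      by (simp add: algebra_simps)
    also have "\<dots> = Suc (Suc n) * (k y * cum k y ^ Suc n)"
      unfolding e[symmetric] by (simp add: algebra_simps)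
    finally show "Suc n * (k y * cum (\<lambda>y. k y * cum k y ^ n) y + cum k y * (k y * cum k y ^ n)) = Suc (Suc n) * (k y * cum k y ^ Suc n)" .
  qed
  also have "cum (\<lambda>y. Suc (Suc n) * (k y * cum k y ^ Suc n)) x = Suc (Suc n) * cum (\<lambda>y. k y * cum k y ^ Suc n) x"
    by (simp only: cum_mult)
  finally show ?case using i2 by (simp add: field_simps)
qed

lemma integrable_bounded_mult:
  fixes k :: "real \<Rightarrow> 'a::{banach,second_countable_topology,real_normed_field}"
  assumes k: "integrable lborel k" and f: "f \<in> borel_measurable borel" and b: "\<And>y. norm (f y) \<le> B"
  shows "integrable lborel (\<lambda>y. k y * f y)"
proof (rule Bochner_Integration.integrable_bound[where f="\<lambda>y. B * norm (k y)"])
  have [measurable]: "k \<in> borel_measurable borel" "f \<in> borel_measurable borel"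
    using borel_measurable_integrable[OF k] f by auto
  show "(\<lambda>y. k y * f y) \<in> borel_measurable lborel" by measurable
  have B: "0 \<le> B" using b[of 0] by (metis norm_ge_zero order_trans)
  show "AE y in lborel. norm (k y * f y) \<le> norm (B * norm (k y))"
    using B b by (intro AE_I2) (auto simp: norm_mult abs_mult mult.commute intro!: mult_right_mono)
qed (use k in auto)

text \<open>The hypothesis is iterated: after \<open>n\<close> steps \<open>f\<close> is bounded by the truncated exponential series
  plus a remainder \<open>B G\<^sup>n / n!\<close>, where \<open>G\<close> is the cumulative integral of \<open>k\<close>.\<close>

lemma Gronwall:
  fixes f k :: "real \<Rightarrow> real"
  assumes k: "integrable lborel k" and k0: "\<And>y. 0 \<le> k y" and f: "f \<in> borel_measurable borel"
    and b: "\<And>y. \<bar>f y\<bar> \<le> B" and H: "0 \<le> H" and le: "\<And>x. f x \<le> H + cum (\<lambda>y. k y * f y) x"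
  shows "f x \<le> H * exp (cum k x)"
proof -
  let ?G = "cum k"
  have G0: "0 \<le> ?G x" for x by (rule cum_nonneg) (rule k0)
  have B: "0 \<le> B" using b[of 0] by linarith
  have ik: "integrable lborel (\<lambda>y. k y * f y)" using k f b by (intro integrable_bounded_mult) auto
  have "f x \<le> H * (\<Sum>j<n. ?G x ^ j / fact j) + B * (?G x ^ n / fact n)" for n x
  proof (induction n arbitrary: x)
    case 0
    then show ?case using b[of x] by auto
  next
    case (Suc n)
    have i: "integrable lborel (\<lambda>y. k y * ?G y ^ j)" for j using cum_power[OF k] by auto
    have e: "cum (\<lambda>y. k y * ?G y ^ j) x = ?G x ^ Suc j / Suc j" for j using cum_power[OF k] by auto
    let ?R = "\<lambda>y. (\<Sum>j<n. H / fact j * (k y * ?G y ^ j)) + B / fact n * (k y * ?G y ^ n)"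
    have R: "k y * f y \<le> ?R y" for y
    proof -
      have "k y * f y \<le> k y * (H * (\<Sum>j<n. ?G y ^ j / fact j) + B * (?G y ^ n / fact n))"
        using Suc k0 by (intro mult_left_mono) auto
      also have "\<dots> = ?R y" by (simp add: sum_distrib_left algebra_simps)
      finally show ?thesis .
    qed
    have iR: "integrable lborel ?R" using i by (intro Bochner_Integration.integrable_add Bochner_Integration.integrable_sum integrable_mult_right) auto
    have "f x \<le> H + cum ?R x"
      using le[of x] cum_mono[OF ik iR R, of x] by auto
    also have "cum ?R x = (\<Sum>j<n. H / fact j * (?G x ^ Suc j / Suc j)) + B / fact n * (?G x ^ Suc n / Suc n)"
    proof -
      have "cum ?R x = cum (\<lambda>y. \<Sum>j<n. H / fact j * (k y * ?G y ^ j)) x + cum (\<lambda>y. B / fact n * (k y * ?G y ^ n)) x"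
        using i by (intro cum_add Bochner_Integration.integrable_sum integrable_mult_right) auto
      also have "cum (\<lambda>y. \<Sum>j<n. H / fact j * (k y * ?G y ^ j)) x = (\<Sum>j<n. cum (\<lambda>y. H / fact j * (k y * ?G y ^ j)) x)"
        using i by (intro cum_sum integrable_mult_right) auto
      finally show ?thesis unfolding cum_mult e .
    qed
    also have "\<dots> = (\<Sum>j<n. H * (?G x ^ Suc j / fact (Suc j))) + B * (?G x ^ Suc n / fact (Suc n))"
      by (simp add: field_simps)
    also have "H + ((\<Sum>j<n. H * (?G x ^ Suc j / fact (Suc j))) + B * (?G x ^ Suc n / fact (Suc n))) =
        H * (\<Sum>j<Suc n. ?G x ^ j / fact j) + B * (?G x ^ Suc n / fact (Suc n))"
      by (subst sum.lessThan_Suc_shift) (simp add: sum_distrib_left algebra_simps)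
    finally show ?case .
  qed
  note main = this
  have s: "(\<lambda>n. ?G x ^ n / fact n) sums exp (?G x)"
    using exp_converges[of "?G x"] by (simp add: divide_inverse mult.commute)
  have "(\<lambda>n. H * (\<Sum>j<n. ?G x ^ j / fact j) + B * (?G x ^ n / fact n)) \<longlonglongrightarrow> H * exp (?G x) + B * 0"
    using s by (intro tendsto_intros summable_LIMSEQ_zero[of "\<lambda>n. ?G x ^ n / fact n"])
      (auto simp: sums_def summable_def)
  thus ?thesis using main[of x] by (intro LIMSEQ_le_const[of _ "H * exp (?G x)"]) auto
qed

section \<open>Picard iteration for Volterra systems\<close>

primrec picard :: "('n::finite \<Rightarrow> 'n \<Rightarrow> real \<Rightarrow> real \<Rightarrow> complex) \<Rightarrow> ('n \<Rightarrow> complex) \<Rightarrow> nat \<Rightarrow> 'n \<Rightarrow> real \<Rightarrow> complex" where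
  "picard K e 0 = (\<lambda>i x. e i)"
| "picard K e (Suc n) = (\<lambda>i x. e i + cum (\<lambda>y. \<Sum>j\<in>UNIV. K i j x y * picard K e n j y) x)"

definition volsol :: "('n::finite \<Rightarrow> 'n \<Rightarrow> real \<Rightarrow> real \<Rightarrow> complex) \<Rightarrow> ('n \<Rightarrow> complex) \<Rightarrow> 'n \<Rightarrow> real \<Rightarrow> complex" where
  "volsol K e i x = lim (\<lambda>n. picard K e n i x)"

text \<open>Taking L^2 norms in z of a solution involves Tonelli's theorem, so measurability is
  needed jointly in x and in the parameter through which the kernel depends on z. A cumulative
  integral with parameters preserves it.\<close>

lemma picard_measurable_param:
  fixes K :: "'p \<Rightarrow> 'n::finite \<Rightarrow> 'n \<Rightarrow> real \<Rightarrow> real \<Rightarrow> complex"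
  assumes [measurable]: "\<And>i j. (\<lambda>q. K (fst q) i j (fst (snd q)) (snd (snd q))) \<in> borel_measurable (M \<Otimes>\<^sub>M (borel \<Otimes>\<^sub>M borel))"
  shows "(\<lambda>q. picard (K (fst q)) e n i (snd q)) \<in> borel_measurable (M \<Otimes>\<^sub>M borel)"
proof (induction n arbitrary: i)
  case 0 then show ?case by simp
next
  case (Suc n)
  note [measurable] = Suc
  have 1: "(\<lambda>q. K (fst (fst q)) i j (snd (fst q)) (snd q)) \<in> borel_measurable ((M \<Otimes>\<^sub>M borel) \<Otimes>\<^sub>M borel)" for j
  proof -
    have "(\<lambda>q. (\<lambda>q. K (fst q) i j (fst (snd q)) (snd (snd q))) (fst (fst q), (snd (fst q), snd q))) \<in> borel_measurable ((M \<Otimes>\<^sub>M borel) \<Otimes>\<^sub>M borel)"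
      by measurable
    thus ?thesis by simp
  qed
  have 2: "(\<lambda>q. picard (K (fst (fst q))) e n j (snd q)) \<in> borel_measurable ((M \<Otimes>\<^sub>M borel) \<Otimes>\<^sub>M borel)" for j
  proof -
    have "(\<lambda>q. (\<lambda>q. picard (K (fst q)) e n j (snd q)) (fst (fst q), snd q)) \<in> borel_measurable ((M \<Otimes>\<^sub>M borel) \<Otimes>\<^sub>M borel)"
      by measurable
    thus ?thesis by simp
  qed
  have "(\<lambda>q. cum ((\<lambda>q y. \<Sum>j\<in>UNIV. K (fst q) i j (snd q) y * picard (K (fst q)) e n j y) q) (snd q)) \<in> borel_measurable (M \<Otimes>\<^sub>M borel)"
    by (rule cum_measurable) (use 1 2 in measurable)
  then show ?case by simp
qed

lemma volsol_measurable_param: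
  fixes K :: "'p \<Rightarrow> 'n::finite \<Rightarrow> 'n \<Rightarrow> real \<Rightarrow> real \<Rightarrow> complex"
  assumes "\<And>i j. (\<lambda>q. K (fst q) i j (fst (snd q)) (snd (snd q))) \<in> borel_measurable (M \<Otimes>\<^sub>M (borel \<Otimes>\<^sub>M borel))"
  shows "(\<lambda>q. volsol (K (fst q)) e i (snd q)) \<in> borel_measurable (M \<Otimes>\<^sub>M borel)"
  unfolding volsol_def by (intro borel_measurable_lim_metric picard_measurable_param assms)

text \<open>The majorant \<open>k\<close> does not depend on x nor, in the oscillating systems
  below, on the spectral parameter, so the bounds obtained there are uniform in z. The dependence of
  \<open>K\<close> on x serves the kernel \<open>hker\<close>, whose phase involves x - y.\<close>

locale volterra =
  fixes K :: "'n::finite \<Rightarrow> 'n \<Rightarrow> real \<Rightarrow> real \<Rightarrow> complex" and k :: "real \<Rightarrow> real" and e :: "'n \<Rightarrow> complex"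
  assumes K_meas: "\<And>i j. (\<lambda>p. K i j (fst p) (snd p)) \<in> borel_measurable (borel \<Otimes>\<^sub>M borel)"
    and K_le: "\<And>x y. (\<Sum>i\<in>UNIV. \<Sum>j\<in>UNIV. cmod (K i j x y)) \<le> k y"
    and k_int: "integrable lborel k"
begin

lemma k_nonneg: "0 \<le> k y"
  by (rule order_trans[OF _ K_le[of undefined y]]) (intro sum_nonneg, auto)

lemma K_measurable:
  assumes [measurable]: "f \<in> borel_measurable M" "g \<in> borel_measurable M"
  shows "(\<lambda>w. K i j (f w) (g w)) \<in> borel_measurable M"
proof -
  have "(\<lambda>w. (\<lambda>p. K i j (fst p) (snd p)) (f w, g w)) \<in> borel_measurable M"
    using K_meas[of i j, measurable] by measurable
  thus ?thesis by simp
qed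

lemma apply_le: "(\<Sum>i\<in>UNIV. cmod (\<Sum>j\<in>UNIV. K i j x y * v j)) \<le> k y * (\<Sum>j\<in>UNIV. cmod (v j))"
proof -
  have "(\<Sum>i\<in>UNIV. cmod (\<Sum>j\<in>UNIV. K i j x y * v j)) \<le> (\<Sum>i\<in>UNIV. \<Sum>j\<in>UNIV. cmod (K i j x y) * (\<Sum>j\<in>UNIV. cmod (v j)))"
  proof (rule sum_mono)
    fix i
    have "cmod (\<Sum>j\<in>UNIV. K i j x y * v j) \<le> (\<Sum>j\<in>UNIV. cmod (K i j x y * v j))" by (rule norm_sum)
    also have "\<dots> \<le> (\<Sum>j\<in>UNIV. cmod (K i j x y) * (\<Sum>j\<in>UNIV. cmod (v j)))"
      by (intro sum_mono) (auto simp: norm_mult intro!: mult_left_mono member_le_sum)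
    finally show "cmod (\<Sum>j\<in>UNIV. K i j x y * v j) \<le> (\<Sum>j\<in>UNIV. cmod (K i j x y) * (\<Sum>j\<in>UNIV. cmod (v j)))" .
  qed
  also have "\<dots> = (\<Sum>i\<in>UNIV. \<Sum>j\<in>UNIV. cmod (K i j x y)) * (\<Sum>j\<in>UNIV. cmod (v j))"
    by (simp add: sum_distrib_right)
  also have "\<dots> \<le> k y * (\<Sum>j\<in>UNIV. cmod (v j))"
    by (intro mult_right_mono K_le sum_nonneg) auto
  finally show ?thesis .
qed

lemma apply_le1: "cmod (\<Sum>j\<in>UNIV. K i j x y * v j) \<le> k y * (\<Sum>j\<in>UNIV. cmod (v j))"
  by (rule order_trans[OF _ apply_le[of x y v]]) (rule member_le_sum[of i UNIV "\<lambda>i. cmod (\<Sum>j\<in>UNIV. K i j x y * v j)"], auto)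

lemma apply_integrable:
  assumes [measurable]: "\<And>j. \<psi> j \<in> borel_measurable borel" and b: "\<And>y. (\<Sum>j\<in>UNIV. cmod (\<psi> j y)) \<le> B"
  shows "integrable lborel (\<lambda>y. \<Sum>j\<in>UNIV. K i j x y * \<psi> j y)"
  supply [measurable (raw)] = K_measurable
proof (rule Bochner_Integration.integrable_bound[where f="\<lambda>y. k y * B"])
  show "(\<lambda>y. \<Sum>j\<in>UNIV. K i j x y * \<psi> j y) \<in> borel_measurable lborel" by measurable
  have "0 \<le> B" by (rule order_trans[OF _ b[of undefined]]) (simp add: sum_nonneg)
  then show "AE y in lborel. cmod (\<Sum>j\<in>UNIV. K i j x y * \<psi> j y) \<le> norm (k y * B)"
    using k_nonneg by (intro AE_I2 order_trans[OF apply_le1]) (auto simp: abs_mult intro!: mult_left_mono b)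
qed (use k_int in auto)

lemma sum_cum_le:
  assumes m: "\<And>j. \<psi> j \<in> borel_measurable borel" and b: "\<And>y. (\<Sum>j\<in>UNIV. cmod (\<psi> j y)) \<le> B"
  shows "(\<Sum>i\<in>UNIV. cmod (cum (\<lambda>y. \<Sum>j\<in>UNIV. K i j x y * \<psi> j y) x)) \<le> cum (\<lambda>y. k y * (\<Sum>j\<in>UNIV. cmod (\<psi> j y))) x"
proof -
  note [measurable] = m
  have i: "integrable lborel (\<lambda>y. \<Sum>j\<in>UNIV. K i j x y * \<psi> j y)" for i by (rule apply_integrable[OF m b])
  have "(\<Sum>i\<in>UNIV. cmod (cum (\<lambda>y. \<Sum>j\<in>UNIV. K i j x y * \<psi> j y) x)) \<le> (\<Sum>i\<in>UNIV. cum (\<lambda>y. cmod (\<Sum>j\<in>UNIV. K i j x y * \<psi> j y)) x)"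
    by (intro sum_mono cum_norm i)
  also have "\<dots> = cum (\<lambda>y. \<Sum>i\<in>UNIV. cmod (\<Sum>j\<in>UNIV. K i j x y * \<psi> j y)) x"
    using i by (intro cum_sum[symmetric]) auto
  also have "\<dots> \<le> cum (\<lambda>y. k y * (\<Sum>j\<in>UNIV. cmod (\<psi> j y))) x"
    using i k_int b by (intro cum_mono apply_le integrable_bounded_mult[where B=B] Bochner_Integration.integrable_sum)
      (auto simp: abs_of_nonneg sum_nonneg)
  finally show ?thesis .
qed

definition E where "E = (\<Sum>i\<in>UNIV. cmod (e i))"
definition T where "T = (LINT y|lborel. k y)"

lemma E_nonneg: "0 \<le> E" unfolding E_def by (simp add: sum_nonneg)
lemma T_nonneg: "0 \<le> T" unfolding T_def by (simp add: k_nonneg)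
lemma cum_k: "0 \<le> cum k x" "cum k x \<le> T"
  unfolding T_def using cum_nonneg cum_le_total[OF k_int] k_nonneg by auto

lemma picard_measurable [measurable]: "picard K e n i \<in> borel_measurable borel"
proof -
  have "(\<lambda>q. picard ((\<lambda>_::real. K) (fst q)) e n i (snd q)) \<in> borel_measurable (borel \<Otimes>\<^sub>M borel)"
    by (rule picard_measurable_param, rule K_measurable) measurable
  hence [measurable]: "(\<lambda>q. picard K e n i (snd q)) \<in> borel_measurable ((borel::real measure) \<Otimes>\<^sub>M borel)"  by simp
  have "(\<lambda>x. (\<lambda>q. picard K e n i (snd q)) (0::real, x)) \<in> borel_measurable borel" by measurable
  thus ?thesis by simp
qed

text \<open>The two bounds are proved together: the increments add up to the bound for the iterates,
  which in turn gives the integrability needed to subtract two integrals. By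
  \<open>cum_power\<close> each step raises the power of \<open>cum k\<close> by one and supplies
  the next factorial.\<close>

lemma picard_step: "(\<Sum>i\<in>UNIV. cmod (picard K e n i x)) \<le> E * (\<Sum>j\<le>n. T ^ j / fact j) \<and>
  (\<Sum>i\<in>UNIV. cmod (picard K e (Suc n) i x - picard K e n i x)) \<le> E * (cum k x ^ Suc n / fact (Suc n))"
proof (induction n arbitrary: x)
  case 0
  have "(\<Sum>i\<in>UNIV. cmod (picard K e (Suc 0) i x - picard K e 0 i x)) \<le> cum (\<lambda>y. k y * E) x"
    using sum_cum_le[of "\<lambda>j y. e j" E x] by (simp add: E_def)
  also have "\<dots> = E * cum k x" using cum_mult[of E k x] by (simp add: mult.commute)
  finally show ?case by (simp add: E_def)
next
  case (Suc n)
  have p: "(\<Sum>i\<in>UNIV. cmod (picard K e (Suc n) i x)) \<le> E * (\<Sum>j\<le>Suc n. T ^ j / fact j)" for x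
  proof -
    have "(\<Sum>i\<in>UNIV. cmod (picard K e (Suc n) i x)) \<le> (\<Sum>i\<in>UNIV. cmod (picard K e n i x) + cmod (picard K e (Suc n) i x - picard K e n i x))"
      by (intro sum_mono) (rule norm_triangle_sub)
    also have "\<dots> \<le> E * (\<Sum>j\<le>n. T ^ j / fact j) + E * (cum k x ^ Suc n / fact (Suc n))"
      unfolding sum.distrib using Suc by (intro add_mono) auto
    also have "\<dots> \<le> E * (\<Sum>j\<le>n. T ^ j / fact j) + E * (T ^ Suc n / fact (Suc n))"
      using cum_k[of x] E_nonneg by (intro add_mono mult_left_mono divide_right_mono power_mono) auto
    finally show ?thesis by (simp add: algebra_simps)
  qed
  let ?d = "\<lambda>j y. picard K e (Suc n) j y - picard K e n j y"
  have B1: "(\<Sum>j\<in>UNIV. cmod (?d j y)) \<le> E * (T ^ Suc n / fact (Suc n))" for y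
  proof -
    have "(\<Sum>j\<in>UNIV. cmod (?d j y)) \<le> E * (cum k y ^ Suc n / fact (Suc n))" using Suc by blast
    also have "\<dots> \<le> E * (T ^ Suc n / fact (Suc n))"
      using cum_k[of y] E_nonneg by (intro mult_left_mono divide_right_mono power_mono) auto
    finally show ?thesis .
  qed
  have m: "?d j \<in> borel_measurable borel" for j by (intro borel_measurable_diff picard_measurable)
  have ik: "integrable lborel (\<lambda>y. k y * cum k y ^ Suc n)" using cum_power[OF k_int] by blast
  have eq: "picard K e (Suc (Suc n)) i x - picard K e (Suc n) i x = cum (\<lambda>y. \<Sum>j\<in>UNIV. K i j x y * ?d j y) x" for i
  proof -
    have 1: "integrable lborel (\<lambda>y. \<Sum>j\<in>UNIV. K i j x y * picard K e (Suc n) j y)"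
      by (rule apply_integrable[OF picard_measurable p])
    have 2: "integrable lborel (\<lambda>y. \<Sum>j\<in>UNIV. K i j x y * picard K e n j y)"
      by (rule apply_integrable[OF picard_measurable]) (use Suc in blast)
    have "picard K e (Suc (Suc n)) i x - picard K e (Suc n) i x =
       cum (\<lambda>y. \<Sum>j\<in>UNIV. K i j x y * picard K e (Suc n) j y) x - cum (\<lambda>y. \<Sum>j\<in>UNIV. K i j x y * picard K e n j y) x"
      by (subst (1 2) picard.simps(2)) simp
    also have "\<dots> = cum (\<lambda>y. (\<Sum>j\<in>UNIV. K i j x y * picard K e (Suc n) j y) - (\<Sum>j\<in>UNIV. K i j x y * picard K e n j y)) x"
      by (rule cum_diff[OF 1 2, symmetric])
    finally show ?thesis by (simp only: sum_subtractf right_diff_distrib)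
  qed
  have "(\<Sum>i\<in>UNIV. cmod (picard K e (Suc (Suc n)) i x - picard K e (Suc n) i x)) \<le> cum (\<lambda>y. k y * (\<Sum>j\<in>UNIV. cmod (?d j y))) x"
    unfolding eq by (rule sum_cum_le[OF m B1])
  also have "\<dots> \<le> cum (\<lambda>y. E / fact (Suc n) * (k y * cum k y ^ Suc n)) x"
  proof (rule cum_mono)
    show "integrable lborel (\<lambda>y. k y * (\<Sum>j\<in>UNIV. cmod (?d j y)))"
      using B1 m by (intro integrable_bounded_mult[OF k_int] borel_measurable_sum) (auto simp: abs_of_nonneg sum_nonneg simp del: picard.simps)
    fix y
    have "k y * (\<Sum>j\<in>UNIV. cmod (?d j y)) \<le> k y * (E * (cum k y ^ Suc n / fact (Suc n)))"
      using Suc k_nonneg by (intro mult_left_mono) blast+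
    also have "\<dots> = E / fact (Suc n) * (k y * cum k y ^ Suc n)" by (simp add: field_simps)
    finally show "k y * (\<Sum>j\<in>UNIV. cmod (?d j y)) \<le> E / fact (Suc n) * (k y * cum k y ^ Suc n)" .
  qed (use ik in \<open>rule integrable_mult_right\<close>)
  also have "\<dots> = E / fact (Suc n) * (cum k x ^ Suc (Suc n) / Suc (Suc n))"
    unfolding cum_mult cum_power[OF k_int, THEN conjunct2] ..
  also have "\<dots> = E * (cum k x ^ Suc (Suc n) / fact (Suc (Suc n)))"
    by (simp add: field_simps)
  finally show ?case using p by blast
qed

text \<open>Remainder of the exponential series. It depends on the kernel only through the mass of
  \<open>k\<close>, which makes the convergence in \<open>hamp_analytic\<close> uniform in
  z.\<close>

definition tail :: "nat \<Rightarrow> real" where "tail n = E * (exp T - (\<Sum>j\<le>n. T ^ j / fact j))"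

lemma exp_partial_tendsto: "(\<lambda>n. \<Sum>j\<le>n. T ^ j / fact j) \<longlonglongrightarrow> exp T"
  using exp_converges[of T] unfolding sums_def_le by (simp add: divide_inverse mult.commute)

lemma tail_tendsto: "tail \<longlonglongrightarrow> 0"
proof -
  have "tail \<longlonglongrightarrow> E * (exp T - exp T)" unfolding tail_def
    by (intro tendsto_intros exp_partial_tendsto)
  thus ?thesis by simp
qed

lemma exp_partial_le: "(\<Sum>j\<le>n. T ^ j / fact j) \<le> exp T"
proof -
  have "(\<Sum>j\<in>{..n}. T ^ j /\<^sub>R fact j) \<le> exp T"
    unfolding exp_def by (rule sum_le_suminf[OF summable_exp_generic]) (auto simp: T_nonneg)
  thus ?thesis by (simp add: divide_inverse mult.commute)
qed

lemma picard_diff: "n \<le> m \<Longrightarrow> (\<Sum>i\<in>UNIV. cmod (picard K e m i x - picard K e n i x)) \<le> E * ((\<Sum>j\<le>m. T ^ j / fact j) - (\<Sum>j\<le>n. T ^ j / fact j))"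
proof (induction m rule: dec_induct)
  case base then show ?case by simp
next
  case (step m)
  have "(\<Sum>i\<in>UNIV. cmod (picard K e (Suc m) i x - picard K e n i x)) \<le> (\<Sum>i\<in>UNIV. cmod (picard K e (Suc m) i x - picard K e m i x) + cmod (picard K e m i x - picard K e n i x))"
    by (intro sum_mono order_trans[OF _ norm_triangle_ineq]) (simp del: picard.simps)
  also have "\<dots> \<le> E * (cum k x ^ Suc m / fact (Suc m)) + E * ((\<Sum>j\<le>m. T ^ j / fact j) - (\<Sum>j\<le>n. T ^ j / fact j))"
    unfolding sum.distrib using picard_step step by (intro add_mono) auto
  also have "E * (cum k x ^ Suc m / fact (Suc m)) \<le> E * (T ^ Suc m / fact (Suc m))"
    using cum_k[of x] E_nonneg by (intro add_mono mult_left_mono divide_right_mono power_mono) auto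
  finally show ?case by (simp add: algebra_simps)
qed

lemma picard_convergent: "convergent (\<lambda>n. picard K e n i x)"
proof -
  have C: "Cauchy (\<lambda>n. E * (\<Sum>j\<le>n. T ^ j / fact j))"
    using tendsto_mult_left[OF exp_partial_tendsto] LIMSEQ_imp_Cauchy by blast
  have "Cauchy (\<lambda>n. picard K e n i x)"
    unfolding Cauchy_altdef
  proof (intro allI impI)
    fix \<epsilon> :: real assume "0 < \<epsilon>"
    then obtain M where M: "\<And>m n. m \<ge> M \<Longrightarrow> n > m \<Longrightarrow> dist (E * (\<Sum>j\<le>m. T ^ j / fact j)) (E * (\<Sum>j\<le>n. T ^ j / fact j)) < \<epsilon>"
      using C unfolding Cauchy_altdef by blast
    show "\<exists>M. \<forall>m\<ge>M. \<forall>n>m. dist (picard K e m i x) (picard K e n i x) < \<epsilon>"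
    proof (intro exI[of _ M] allI impI)
      fix m n assume mn: "M \<le> m" "m < n"
      have "dist (picard K e m i x) (picard K e n i x) = cmod (picard K e n i x - picard K e m i x)" by (simp add: dist_norm norm_minus_commute)
      also have "\<dots> \<le> (\<Sum>i\<in>UNIV. cmod (picard K e n i x - picard K e m i x))" by (rule member_le_sum) auto
      also have "\<dots> \<le> E * ((\<Sum>j\<le>n. T ^ j / fact j) - (\<Sum>j\<le>m. T ^ j / fact j))" using mn by (intro picard_diff) auto
      also have "\<dots> \<le> dist (E * (\<Sum>j\<le>m. T ^ j / fact j)) (E * (\<Sum>j\<le>n. T ^ j / fact j))"
        by (simp add: dist_real_def right_diff_distrib)
      also have "\<dots> < \<epsilon>" using M mn by blast
      finally show "dist (picard K e m i x) (picard K e n i x) < \<epsilon>" .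
    qed
  qed
  thus ?thesis by (rule Cauchy_convergent)
qed

lemma picard_tendsto: "(\<lambda>n. picard K e n i x) \<longlonglongrightarrow> volsol K e i x"
  unfolding volsol_def using picard_convergent convergent_LIMSEQ_iff by blast

lemma picard_volsol: "(\<Sum>i\<in>UNIV. cmod (volsol K e i x - picard K e n i x)) \<le> tail n"
proof (rule LIMSEQ_le_const2)
  show "(\<lambda>m. \<Sum>i\<in>UNIV. cmod (picard K e m i x - picard K e n i x)) \<longlonglongrightarrow> (\<Sum>i\<in>UNIV. cmod (volsol K e i x - picard K e n i x))"
    by (intro tendsto_intros picard_tendsto)
  show "\<exists>N. \<forall>m\<ge>N. (\<Sum>i\<in>UNIV. cmod (picard K e m i x - picard K e n i x)) \<le> tail n"
  proof (intro exI[of _ n] allI impI)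
    fix m assume "n \<le> m"
    from picard_diff[OF this, of x] show "(\<Sum>i\<in>UNIV. cmod (picard K e m i x - picard K e n i x)) \<le> tail n"
      unfolding tail_def using exp_partial_le[of m] E_nonneg
      by (elim order_trans) (intro mult_left_mono, auto)
  qed
qed

lemma picard_bound: "(\<Sum>i\<in>UNIV. cmod (picard K e n i x)) \<le> E * exp T"
  by (rule order_trans[OF picard_step[THEN conjunct1] mult_left_mono[OF exp_partial_le E_nonneg]])

lemma volsol_bound: "(\<Sum>i\<in>UNIV. cmod (volsol K e i x)) \<le> E * exp T"
proof (rule LIMSEQ_le_const2)
  show "(\<lambda>m. \<Sum>i\<in>UNIV. cmod (picard K e m i x)) \<longlonglongrightarrow> (\<Sum>i\<in>UNIV. cmod (volsol K e i x))"
    by (intro tendsto_intros picard_tendsto)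
qed (use picard_bound in auto)

lemma volsol_measurable [measurable]: "volsol K e i \<in> borel_measurable borel"
  unfolding volsol_def[abs_def] by (intro borel_measurable_lim_metric picard_measurable)

lemma volsol_integrable: "integrable lborel (\<lambda>y. \<Sum>j\<in>UNIV. K i j x y * volsol K e j y)"
  by (rule apply_integrable[OF volsol_measurable volsol_bound])

lemma volsol_eq: "volsol K e i x = e i + cum (\<lambda>y. \<Sum>j\<in>UNIV. K i j x y * volsol K e j y) x"
  supply [measurable (raw)] = K_measurable
proof (rule LIMSEQ_unique)
  show "(\<lambda>n. picard K e (Suc n) i x) \<longlonglongrightarrow> volsol K e i x"
    by (rule LIMSEQ_Suc[OF picard_tendsto])
  show "(\<lambda>n. picard K e (Suc n) i x) \<longlonglongrightarrow> e i + cum (\<lambda>y. \<Sum>j\<in>UNIV. K i j x y * volsol K e j y) x"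
    unfolding picard.simps cum_def
  proof (intro tendsto_intros integral_dominated_convergence[where w="\<lambda>y. k y * (E * exp T)"])
    show "AE y in lborel. (\<lambda>n. if y < x then \<Sum>j\<in>UNIV. K i j x y * picard K e n j y else 0) \<longlonglongrightarrow> (if y < x then \<Sum>j\<in>UNIV. K i j x y * volsol K e j y else 0)"
      by (rule AE_I2) (auto intro!: tendsto_intros picard_tendsto)
    show "AE y in lborel. cmod (if y < x then \<Sum>j\<in>UNIV. K i j x y * picard K e n j y else 0) \<le> k y * (E * exp T)" for n
    proof (rule AE_I2)
      fix y
      have "cmod (\<Sum>j\<in>UNIV. K i j x y * picard K e n j y) \<le> k y * (E * exp T)"
        by (rule order_trans[OF apply_le1]) (intro mult_left_mono picard_bound k_nonneg)
      thus "cmod (if y < x then \<Sum>j\<in>UNIV. K i j x y * picard K e n j y else 0) \<le> k y * (E * exp T)"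
        using k_nonneg E_nonneg by auto
    qed
    show "integrable lborel (\<lambda>y. k y * (E * exp T))" using k_int by simp
  qed measurable
qed

end

text \<open>The integrand is integrable on left half-lines, hence \<open>d\<close> is bounded there and Gronwall applies.\<close>

lemma volterra_unique:
  fixes N :: "'n::finite \<Rightarrow> 'n \<Rightarrow> real \<Rightarrow> complex"
  assumes N_meas: "\<And>i j. N i j \<in> borel_measurable borel"
    and N_le: "\<And>y. (\<Sum>i\<in>UNIV. \<Sum>j\<in>UNIV. cmod (N i j y)) \<le> k y"
    and k_int: "integrable lborel k"
    and int: "\<And>i x. integrable lborel (\<lambda>y. if y < x then \<Sum>j\<in>UNIV. N i j y * d j y else 0)"
    and eq: "\<And>i x. d i x = cum (\<lambda>y. \<Sum>j\<in>UNIV. N i j y * d j y) x"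
  shows "d i x = 0"
proof -
  interpret volterra "\<lambda>i j x y. N i j y" k "\<lambda>_. 0"
    by unfold_locales (use N_meas N_le k_int in auto)
  \<comment> \<open>A point strictly to the right of \<open>x\<close>, so that the truncation
    \<open>D\<close> still agrees with \<open>d\<close> at \<open>x\<close> itself.\<close>
  define x0 where "x0 = x + 1"
  define r where "r = (\<lambda>i y. if y < x0 then \<Sum>j\<in>UNIV. N i j y * d j y else 0)"
  have ri: "integrable lborel (r i)" for i unfolding r_def by (rule int)
  have dr: "d i y = cum (r i) y" if "y \<le> x0" for i y
    unfolding eq[of i y] using that by (intro cum_cong) (auto simp: r_def)
  define D where "D = (\<lambda>j y. if y < x0 then d j y else 0)"
  have D': "D = (\<lambda>j y. if y < x0 then cum (r j) y else 0)" unfolding D_def using dr by (auto simp: fun_eq_iff)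
  have Dm: "D j \<in> borel_measurable borel" for j
    unfolding D' using cum_measurable1[of "r j"] borel_measurable_integrable[OF ri[of j]] by measurable
  define B where "B = (\<Sum>j\<in>UNIV. LINT y|lborel. cmod (r j y))"
  have Db: "(\<Sum>j\<in>UNIV. cmod (D j y)) \<le> B" for y
    unfolding B_def D' using norm_cum_le[OF ri] by (intro sum_mono) auto
  have "(\<Sum>j\<in>UNIV. cmod (D j x)) \<le> 0 * exp (cum k x)"
  proof (rule Gronwall[where B=B])
    show "\<bar>\<Sum>j\<in>UNIV. cmod (D j y)\<bar> \<le> B" for y using Db[of y] by (simp add: abs_of_nonneg sum_nonneg)
    show "(\<lambda>x. \<Sum>j\<in>UNIV. cmod (D j x)) \<in> borel_measurable borel" using Dm by measurable
    fix x
    show "(\<Sum>j\<in>UNIV. cmod (D j x)) \<le> 0 + cum (\<lambda>y. k y * (\<Sum>j\<in>UNIV. cmod (D j y))) x"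
    proof (cases "x < x0")
      case True
      have Deq: "D i x = cum (\<lambda>y. \<Sum>j\<in>UNIV. N i j y * D j y) x" for i
      proof -
        have "D i x = cum (\<lambda>y. \<Sum>j\<in>UNIV. N i j y * d j y) x" using True unfolding D_def by (simp add: eq[symmetric])
        also have "\<dots> = cum (\<lambda>y. \<Sum>j\<in>UNIV. N i j y * D j y) x"
          using True by (intro cum_cong) (auto simp: D_def)
        finally show ?thesis .
      qed
      have "(\<Sum>j\<in>UNIV. cmod (D j x)) = (\<Sum>i\<in>UNIV. cmod (cum (\<lambda>y. \<Sum>j\<in>UNIV. N i j y * D j y) x))"
        by (rule sum.cong[OF refl], subst Deq, rule refl)
      thus ?thesis using sum_cum_le[OF Dm Db, of x] by simp
    next
      case False
      hence "(\<Sum>j\<in>UNIV. cmod (D j x)) = 0" by (simp add: D_def)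
      moreover have "0 \<le> cum (\<lambda>y. k y * (\<Sum>j\<in>UNIV. cmod (D j y))) x"
        using k_nonneg by (intro cum_nonneg mult_nonneg_nonneg sum_nonneg) auto
      ultimately show ?thesis by simp
    qed
  qed (use k_int k_nonneg in auto)
  moreover have "cmod (D i x) \<le> (\<Sum>j\<in>UNIV. cmod (D j x))" by (rule member_le_sum) auto
  ultimately have "cmod (D i x) \<le> 0" by linarith
  hence "D i x = 0" by simp
  thus ?thesis by (simp add: D_def x0_def)
qed

section \<open>Square-integrable functions and oscillatory integrals\<close>

text \<open>A bound instead of a norm, so that measurability, finiteness and estimate travel
  together. The nonnegative integral makes sense before integrability is known, and by Fatou's lemma
  the predicate survives pointwise limits.\<close>

definition L2b :: "(real \<Rightarrow> 'a::{banach,second_countable_topology}) \<Rightarrow> real \<Rightarrow> bool" where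
  "L2b f B \<longleftrightarrow> f \<in> borel_measurable borel \<and> 0 \<le> B \<and> (\<integral>\<^sup>+x. ennreal ((norm (f x))\<^sup>2) \<partial>lborel) \<le> ennreal (B\<^sup>2)"

lemma L2bD: assumes "L2b f B" shows "f \<in> borel_measurable borel" "0 \<le> B"
  "(\<integral>\<^sup>+x. ennreal ((norm (f x))\<^sup>2) \<partial>lborel) \<le> ennreal (B\<^sup>2)"
  using assms unfolding L2b_def by auto

lemma L2b_bound_mono: assumes "L2b f A" "A \<le> B" shows "L2b f B"
proof -
  have "ennreal (A\<^sup>2) \<le> ennreal (B\<^sup>2)" using assms L2bD(2)[of f A] by (intro ennreal_leI power_mono)
  thus ?thesis using assms unfolding L2b_def by (auto elim: order_trans)
qed

lemma L2b_mono:
  assumes g: "L2b g B" and f: "f \<in> borel_measurable borel" and le: "\<And>x. norm (f x) \<le> norm (g x)"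
  shows "L2b f B"
proof -
  have "(\<integral>\<^sup>+x. ennreal ((norm (f x))\<^sup>2) \<partial>lborel) \<le> (\<integral>\<^sup>+x. ennreal ((norm (g x))\<^sup>2) \<partial>lborel)"
    by (intro nn_integral_mono ennreal_leI power_mono le norm_ge_zero)
  thus ?thesis using g f unfolding L2b_def by (meson order_trans)
qed

lemma L2b_cong_AE:
  assumes "L2b g B" "f \<in> borel_measurable borel" "AE x in lborel. f x = g x"
  shows "L2b f B"
proof -
  have "(\<integral>\<^sup>+x. ennreal ((norm (f x))\<^sup>2) \<partial>lborel) = (\<integral>\<^sup>+x. ennreal ((norm (g x))\<^sup>2) \<partial>lborel)"
    using assms(3) by (intro nn_integral_cong_AE) auto
  thus ?thesis using assms unfolding L2b_def by simp
qed

lemma L2b_zero [simp]: "0 \<le> B \<Longrightarrow> L2b (\<lambda>x. 0) B"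
  unfolding L2b_def by simp

lemma L2b_uminus: "L2b f B \<Longrightarrow> L2b (\<lambda>x. - f x) B"
  by (rule L2b_mono) (auto simp: L2b_def)

lemma L2b_mult:
  fixes f :: "real \<Rightarrow> 'a::{banach,second_countable_topology,real_normed_field}"
  assumes f: "L2b f B" and m: "g \<in> borel_measurable borel" and g: "\<And>x. norm (g x) \<le> c"
  shows "L2b (\<lambda>x. g x * f x) (c * B)"
proof -
  have c: "0 \<le> c" by (rule order_trans[OF norm_ge_zero g])
  note [measurable] = L2bD(1)[OF f] m
  have "(\<integral>\<^sup>+x. ennreal ((norm (g x * f x))\<^sup>2) \<partial>lborel) \<le> (\<integral>\<^sup>+x. ennreal (c\<^sup>2) * ennreal ((norm (f x))\<^sup>2) \<partial>lborel)"
    using g c by (intro nn_integral_mono) (auto simp: norm_mult power_mult_distrib ennreal_mult[symmetric] intro!: ennreal_leI mult_right_mono power_mono)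
  also have "\<dots> = ennreal (c\<^sup>2) * (\<integral>\<^sup>+x. ennreal ((norm (f x))\<^sup>2) \<partial>lborel)"
    by (rule nn_integral_cmult) measurable
  also have "\<dots> \<le> ennreal (c\<^sup>2) * ennreal (B\<^sup>2)" using L2bD(3)[OF f] by (intro mult_left_mono) auto
  also have "\<dots> = ennreal ((c * B)\<^sup>2)" by (simp add: ennreal_mult power_mult_distrib)
  finally show ?thesis using c L2bD(2)[OF f] unfolding L2b_def by auto
qed

lemma L2b_cmult:
  fixes f :: "real \<Rightarrow> 'a::{banach,second_countable_topology,real_normed_field}"
  shows "L2b f B \<Longrightarrow> L2b (\<lambda>x. c * f x) (norm c * B)"
  by (rule L2b_mult) auto

lemma L2b_eps:
  assumes "0 \<le> B" "\<And>\<epsilon>. 0 < \<epsilon> \<Longrightarrow> L2b f (B + \<epsilon>)"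
  shows "L2b f B"
proof -
  have "(\<lambda>n. ennreal ((B + inverse (real (Suc n)))\<^sup>2)) \<longlonglongrightarrow> ennreal ((B + 0)\<^sup>2)"
    by (intro tendsto_intros tendsto_ennrealI LIMSEQ_inverse_real_of_nat)
  hence "(\<integral>\<^sup>+x. ennreal ((norm (f x))\<^sup>2) \<partial>lborel) \<le> ennreal ((B + 0)\<^sup>2)"
    by (rule LIMSEQ_le_const) (auto intro!: L2bD(3) assms(2))
  thus ?thesis using assms(1) assms(2)[of 1] unfolding L2b_def by auto
qed

text \<open>Minkowski's inequality by a weighted pointwise estimate: the weights (a + b)/a and (a +
  b)/b make the integral at most a (a + b) + b (a + b). They require positive a and b, whence the
  added \<epsilon>, which \<open>L2b_eps\<close> removes.\<close>

lemma L2b_add: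
  assumes f: "L2b f A" and g: "L2b g B"
  shows "L2b (\<lambda>x. f x + g x) (A + B)"
proof (rule L2b_eps)
  show "0 \<le> A + B" using L2bD(2)[OF f] L2bD(2)[OF g] by simp
  fix \<epsilon> :: real assume "0 < \<epsilon>"
  define a where "a = A + \<epsilon>/2" define b where "b = B + \<epsilon>/2"
  have ab: "0 < a" "0 < b" "A + B + \<epsilon> = a + b" using \<open>0 < \<epsilon>\<close> L2bD(2)[OF f] L2bD(2)[OF g] by (auto simp: a_def b_def)
  have fa: "L2b f a" and gb: "L2b g b" using f g \<open>0 < \<epsilon>\<close> by (auto simp: a_def b_def elim!: L2b_bound_mono)
  note [measurable] = L2bD(1)[OF f] L2bD(1)[OF g]
  let ?F = "\<lambda>x. ennreal ((norm (f x))\<^sup>2)" and ?G = "\<lambda>x. ennreal ((norm (g x))\<^sup>2)"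
  define r where "r = b / a"
  have r: "0 < r" "(a + b) / a = 1 + r" "(a + b) / b = 1 + 1 / r"
    using ab by (auto simp: r_def add_divide_distrib)
  have *: "(norm (f x + g x))\<^sup>2 \<le> (a + b) / a * (norm (f x))\<^sup>2 + (a + b) / b * (norm (g x))\<^sup>2" for x
  proof -
    let ?u = "norm (f x)" and ?v = "norm (g x)"
    have "(norm (f x + g x))\<^sup>2 \<le> (?u + ?v)\<^sup>2" by (intro power_mono norm_triangle_ineq) auto
    \<comment> \<open>The added square is chosen so that its expansion cancels the mixed term 2 u
      v.\<close>
    also have "\<dots> \<le> (?u + ?v)\<^sup>2 + (r * ?u - ?v)\<^sup>2 / r" using r by simp
    also have "(r * ?u - ?v)\<^sup>2 / r = r * ?u\<^sup>2 - 2 * ?u * ?v + 1 / r * ?v\<^sup>2"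
      using r(1) by (simp add: field_simps power2_eq_square)
    finally show ?thesis unfolding r by (simp add: power2_sum algebra_simps)
  qed
  have "(\<integral>\<^sup>+x. ennreal ((norm (f x + g x))\<^sup>2) \<partial>lborel) \<le> (\<integral>\<^sup>+x. ennreal ((a + b) / a) * ?F x + ennreal ((a + b) / b) * ?G x \<partial>lborel)"
  proof (rule nn_integral_mono)
    fix x
    have "ennreal ((norm (f x + g x))\<^sup>2) \<le> ennreal ((a + b) / a * (norm (f x))\<^sup>2 + (a + b) / b * (norm (g x))\<^sup>2)"
      using * by (rule ennreal_leI)
    also have "\<dots> = ennreal ((a + b) / a) * ?F x + ennreal ((a + b) / b) * ?G x"
      using ab by (simp add: ennreal_mult[symmetric] ennreal_plus[symmetric] del: ennreal_plus)
    finally show "ennreal ((norm (f x + g x))\<^sup>2) \<le> ennreal ((a + b) / a) * ?F x + ennreal ((a + b) / b) * ?G x" .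
  qed
  also have "\<dots> = ennreal ((a + b) / a) * (\<integral>\<^sup>+x. ?F x \<partial>lborel) + ennreal ((a + b) / b) * (\<integral>\<^sup>+x. ?G x \<partial>lborel)"
    by (subst nn_integral_add) (auto simp: nn_integral_cmult)
  also have "\<dots> \<le> ennreal ((a + b) / a) * ennreal (a\<^sup>2) + ennreal ((a + b) / b) * ennreal (b\<^sup>2)"
    by (intro add_mono mult_left_mono L2bD(3) fa gb) auto
  also have "\<dots> = ennreal ((a + b) / a * a\<^sup>2 + (a + b) / b * b\<^sup>2)"
    using ab by (simp add: ennreal_mult[symmetric] ennreal_plus[symmetric] del: ennreal_plus)
  also have "(a + b) / a * a\<^sup>2 + (a + b) / b * b\<^sup>2 = (a + b)\<^sup>2"
    using ab(1,2) by (simp add: power2_eq_square distrib_left)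
  finally show "L2b (\<lambda>x. f x + g x) (A + B + \<epsilon>)" using ab unfolding L2b_def by auto
qed

lemma L2b_diff: "L2b f A \<Longrightarrow> L2b g B \<Longrightarrow> L2b (\<lambda>x. f x - g x) (A + B)"
  using L2b_add[OF _ L2b_uminus] by fastforce

lemma L2b_sum: "finite I \<Longrightarrow> (\<And>i. i \<in> I \<Longrightarrow> L2b (f i) (B i)) \<Longrightarrow> L2b (\<lambda>x. \<Sum>i\<in>I. f i x) (\<Sum>i\<in>I. B i)"
proof (induction I rule: finite_induct)
  case (insert i I)
  then show ?case using L2b_add[of "f i" "B i" "\<lambda>x. \<Sum>i\<in>I. f i x" "\<Sum>i\<in>I. B i"] by simp
qed simp

text \<open>Fatou's lemma. Bounds uniform in the upper limit x pass in this way to the limits at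
  infinity, that is, to the scattering coefficients.\<close>

lemma L2b_lim_AE:
  assumes f: "\<And>n. L2b (f n) B" and [measurable]: "g \<in> borel_measurable borel"
    and lim: "AE x in lborel. (\<lambda>n. f n x) \<longlonglongrightarrow> g x"
  shows "L2b g B"
proof -
  have [measurable]: "f n \<in> borel_measurable borel" for n using L2bD(1)[OF f] .
  have "(\<integral>\<^sup>+x. ennreal ((norm (g x))\<^sup>2) \<partial>lborel) = (\<integral>\<^sup>+x. liminf (\<lambda>n. ennreal ((norm (f n x))\<^sup>2)) \<partial>lborel)"
  proof (rule nn_integral_cong_AE)
    show "AE x in lborel. ennreal ((norm (g x))\<^sup>2) = liminf (\<lambda>n. ennreal ((norm (f n x))\<^sup>2))"
      using lim
    proof eventually_elim
      fix x assume "(\<lambda>n. f n x) \<longlonglongrightarrow> g x"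
      hence "(\<lambda>n. ennreal ((norm (f n x))\<^sup>2)) \<longlonglongrightarrow> ennreal ((norm (g x))\<^sup>2)"
        by (intro tendsto_ennrealI tendsto_intros)
      thus "ennreal ((norm (g x))\<^sup>2) = liminf (\<lambda>n. ennreal ((norm (f n x))\<^sup>2))"
        by (intro lim_imp_Liminf[symmetric]) auto
    qed
  qed
  also have "\<dots> \<le> liminf (\<lambda>n. \<integral>\<^sup>+x. ennreal ((norm (f n x))\<^sup>2) \<partial>lborel)"
    by (rule nn_integral_liminf) measurable
  also have "\<dots> \<le> ennreal (B\<^sup>2)"
    using L2bD(3)[OF f] by (simp add: Liminf_le)
  finally show ?thesis using L2bD(2)[OF f] unfolding L2b_def by auto
qed

lemma L2b_lim:
  assumes f: "\<And>n. L2b (f n) B" and lim: "\<And>x. (\<lambda>n. f n x) \<longlonglongrightarrow> g x"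
  shows "L2b g B"
proof (rule L2b_lim_AE[where f=f, OF f])
  show "g \<in> borel_measurable borel"
    by (rule borel_measurable_LIMSEQ_metric[of f]) (use L2bD(1)[OF f] lim in auto)
qed (use lim in auto)

text \<open>Cauchy-Schwarz with weight \<open>k\<close>, then Tonelli.\<close>

lemma L2b_Minkowski:
  fixes h :: "real \<Rightarrow> real \<Rightarrow> 'a::{banach,second_countable_topology}"
  assumes k: "integrable lborel k" and k0: "\<And>y. 0 \<le> k y"
    and hm: "(\<lambda>p. h (fst p) (snd p)) \<in> borel_measurable (borel \<Otimes>\<^sub>M borel)"
    and h: "\<And>y. L2b (h y) B" and Hm: "H \<in> borel_measurable borel"
    and le: "\<And>z. ennreal (norm (H z)) \<le> (\<integral>\<^sup>+y. ennreal (k y * norm (h y z)) \<partial>lborel)"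
  shows "L2b H ((LINT y|lborel. k y) * B)"
proof -
  note [measurable] = hm Hm
  have [measurable]: "k \<in> borel_measurable borel" using borel_measurable_integrable[OF k] by simp
  let ?K = "\<integral>\<^sup>+y. ennreal (k y) \<partial>lborel"
  have K: "?K = ennreal (LINT y|lborel. k y)" using k k0 by (intro nn_integral_eq_integral) auto
  have K0: "0 \<le> (LINT y|lborel. k y)" using k0 by (intro integral_nonneg_AE) auto
  have hym: "(\<lambda>y. h y z) \<in> borel_measurable borel" for z
  proof -
    have "(\<lambda>y. (\<lambda>p. h (fst p) (snd p)) (y, z)) \<in> borel_measurable borel" by measurable
    thus ?thesis by simp
  qed
  note [measurable] = hym
  have hm2: "(\<lambda>p. ennreal (k (snd p) * (norm (h (snd p) (fst p)))\<^sup>2)) \<in> borel_measurable (lborel \<Otimes>\<^sub>M lborel)"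
  proof -
    have "(\<lambda>q. (\<lambda>p. h (fst p) (snd p)) (snd q, fst q)) \<in> borel_measurable (lborel \<Otimes>\<^sub>M lborel)" by measurable
    hence [measurable]: "(\<lambda>q. h (snd q) (fst q)) \<in> borel_measurable (lborel \<Otimes>\<^sub>M lborel)" by simp
    show ?thesis by measurable
  qed
  have CS: "ennreal ((norm (H z))\<^sup>2) \<le> ?K * (\<integral>\<^sup>+y. ennreal (k y * (norm (h y z))\<^sup>2) \<partial>lborel)" for z
  proof -
    have "ennreal ((norm (H z))\<^sup>2) = (ennreal (norm (H z)))\<^sup>2" by (simp add: ennreal_power)
    also have "\<dots> \<le> (\<integral>\<^sup>+y. ennreal (k y * norm (h y z)) \<partial>lborel)\<^sup>2" by (intro power_mono le) auto
    also have "(\<integral>\<^sup>+y. ennreal (k y * norm (h y z)) \<partial>lborel) = (\<integral>\<^sup>+y. ennreal (sqrt (k y)) * ennreal (sqrt (k y) * norm (h y z)) \<partial>lborel)"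
      using k0 by (intro nn_integral_cong) (simp add: ennreal_mult[symmetric])
    also have "\<dots>\<^sup>2 \<le> (\<integral>\<^sup>+y. (ennreal (sqrt (k y)))\<^sup>2 \<partial>lborel) * (\<integral>\<^sup>+y. (ennreal (sqrt (k y) * norm (h y z)))\<^sup>2 \<partial>lborel)"
      by (rule Cauchy_Schwarz_nn_integral) measurable
    also have "\<dots> = ?K * (\<integral>\<^sup>+y. ennreal (k y * (norm (h y z))\<^sup>2) \<partial>lborel)"
      using k0 by (simp add: ennreal_power power_mult_distrib)
    finally show ?thesis .
  qed
  have "(\<integral>\<^sup>+z. ennreal ((norm (H z))\<^sup>2) \<partial>lborel) \<le> (\<integral>\<^sup>+z. ?K * (\<integral>\<^sup>+y. ennreal (k y * (norm (h y z))\<^sup>2) \<partial>lborel) \<partial>lborel)"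
    by (intro nn_integral_mono CS)
  also have "\<dots> = ?K * (\<integral>\<^sup>+z. (\<integral>\<^sup>+y. ennreal (k y * (norm (h y z))\<^sup>2) \<partial>lborel) \<partial>lborel)"
    using lborel.borel_measurable_nn_integral_fst[OF hm2] by (intro nn_integral_cmult) simp
  also have "(\<integral>\<^sup>+z. (\<integral>\<^sup>+y. ennreal (k y * (norm (h y z))\<^sup>2) \<partial>lborel) \<partial>lborel) = (\<integral>\<^sup>+y. (\<integral>\<^sup>+z. ennreal (k y * (norm (h y z))\<^sup>2) \<partial>lborel) \<partial>lborel)"
    using lborel_pair.Fubini[OF hm2] by simp
  also have "\<dots> = (\<integral>\<^sup>+y. ennreal (k y) * (\<integral>\<^sup>+z. ennreal ((norm (h y z))\<^sup>2) \<partial>lborel) \<partial>lborel)"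
    using k0 L2bD(1)[OF h] by (intro nn_integral_cong) (simp add: ennreal_mult nn_integral_cmult)
  also have "\<dots> \<le> (\<integral>\<^sup>+y. ennreal (k y) * ennreal (B\<^sup>2) \<partial>lborel)"
    by (intro nn_integral_mono mult_left_mono L2bD(3)[OF h]) auto
  also have "\<dots> = ?K * ennreal (B\<^sup>2)" by (rule nn_integral_multc) measurable
  also have "?K * (?K * ennreal (B\<^sup>2)) = ennreal (((LINT y|lborel. k y) * B)\<^sup>2)"
    unfolding K using K0 L2bD(2)[OF h] by (simp add: ennreal_mult[symmetric] power2_eq_square algebra_simps)
  finally have "(\<integral>\<^sup>+z. ennreal ((norm (H z))\<^sup>2) \<partial>lborel) \<le> ennreal (((LINT y|lborel. k y) * B)\<^sup>2)"
    by (simp add: mult_left_mono)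
  thus ?thesis using K0 L2bD(2)[OF h] Hm unfolding L2b_def by auto
qed

lemma L2b_Minkowski_int:
  fixes h :: "real \<Rightarrow> real \<Rightarrow> 'a::{banach,second_countable_topology}"
  assumes k: "integrable lborel k" and k0: "\<And>y. 0 \<le> k y"
    and hm: "(\<lambda>p. h (fst p) (snd p)) \<in> borel_measurable (borel \<Otimes>\<^sub>M borel)"
    and h: "\<And>y. L2b (h y) B" and Hm: "H \<in> borel_measurable borel"
    and int: "\<And>z. integrable lborel (\<lambda>y. k y * norm (h y z))"
    and le: "\<And>z. norm (H z) \<le> (LINT y|lborel. k y * norm (h y z))"
  shows "L2b H ((LINT y|lborel. k y) * B)"
proof (rule L2b_Minkowski[OF k k0 hm h Hm])
  fix z
  have "ennreal (norm (H z)) \<le> ennreal (LINT y|lborel. k y * norm (h y z))" by (rule ennreal_leI[OF le])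
  also have "\<dots> = (\<integral>\<^sup>+y. ennreal (k y * norm (h y z)) \<partial>lborel)"
    using k0 by (intro nn_integral_eq_integral[symmetric] int) auto
  finally show "ennreal (norm (H z)) \<le> (\<integral>\<^sup>+y. ennreal (k y * norm (h y z)) \<partial>lborel)" .
qed

lemma norm_integral_le_nn_integral:
  fixes f :: "'a \<Rightarrow> 'b::{banach,second_countable_topology}"
  shows "ennreal (norm (integral\<^sup>L M f)) \<le> (\<integral>\<^sup>+x. ennreal (norm (f x)) \<partial>M)"
  by (cases "integrable M f") (auto simp: integral_norm_bound_ennreal not_integrable_integral_eq)

lemma cnj_measurable [measurable (raw)]:
  "f \<in> borel_measurable M \<Longrightarrow> (\<lambda>x. cnj (f x)) \<in> borel_measurable M"
  by (rule measurable_compose[of f M borel cnj borel])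
    (auto intro!: borel_measurable_continuous_onI continuous_intros)

section \<open>Plancherel's inequality\<close>

lemma integrable_product_bound:
  fixes F :: "real \<times> real \<Rightarrow> complex"
  assumes [measurable]: "F \<in> borel_measurable (lborel \<Otimes>\<^sub>M lborel)"
    and f: "integrable lborel f" and g: "integrable lborel g"
    and le: "\<And>x y. cmod (F (x, y)) \<le> norm (f x :: complex) * norm (g y :: complex)"
  shows "integrable (lborel \<Otimes>\<^sub>M lborel) F"
proof -
  have [measurable]: "f \<in> borel_measurable borel" "g \<in> borel_measurable borel"
    using borel_measurable_integrable[OF g] borel_measurable_integrable[OF f] by auto
  have i1: "integrable (lborel \<Otimes>\<^sub>M lborel) (\<lambda>p. norm (f (fst p)) * norm (g (snd p)))"
  proof (rule lborel_pair.Fubini_integrable)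
    show "integrable lborel (\<lambda>x. LINT y|lborel. norm (norm (f (fst (x, y))) * norm (g (snd (x, y)))))"
      using f by (simp add: abs_mult)
  qed (use g in \<open>auto\<close>)
  show ?thesis
    by (rule Bochner_Integration.integrable_bound[OF i1]) (use le in auto)
qed

text \<open>The characteristic function of the standard normal distribution, rescaled by s.\<close>

lemma gaussian_char:
  assumes s: "0 < s"
  shows "(LINT x|lborel. complex_of_real (exp (- x\<^sup>2 / (2 * s\<^sup>2))) * cis (x * t)) = complex_of_real (s * sqrt (2 * pi) * exp (- (s * t)\<^sup>2 / 2))"
    and "integrable lborel (\<lambda>x. complex_of_real (exp (- x\<^sup>2 / (2 * s\<^sup>2))))"
proof -
  have "complex_of_real (exp (- (u\<^sup>2) / 2)) = (LINT x|lborel. std_normal_density x *\<^sub>R cis (u * x))" for u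
  proof -
    have "complex_of_real (exp (- (u\<^sup>2) / 2)) = (CLINT x|std_normal_distribution. iexp (u * x))"
      using char_std_normal_distribution unfolding char_def by (simp add: fun_eq_iff)
    also have "\<dots> = (LINT x|lborel. std_normal_density x *\<^sub>R iexp (u * x))"
      by (subst integral_density) auto
    finally show ?thesis by (simp add: cis_conv_exp)
  qed
  note c = this
  have "(LINT x|lborel. complex_of_real (exp (- x\<^sup>2 / (2 * s\<^sup>2))) * cis (x * t))
     = \<bar>s\<bar> *\<^sub>R (LINT x|lborel. complex_of_real (exp (- (0 + s * x)\<^sup>2 / (2 * s\<^sup>2))) * cis ((0 + s * x) * t))"
    using s by (intro lborel_integral_real_affine) auto
  also have "\<dots> = s *\<^sub>R (LINT x|lborel. complex_of_real (sqrt (2 * pi)) * (std_normal_density x *\<^sub>R cis (s * t * x)))"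
    using s by (auto simp: std_normal_density_def power_mult_distrib scaleR_conv_of_real field_simps intro!: Bochner_Integration.integral_cong)
  also have "\<dots> = s *\<^sub>R (complex_of_real (sqrt (2 * pi)) * complex_of_real (exp (- ((s*t)\<^sup>2) / 2)))"
    unfolding integral_mult_right_zero c ..
  finally show "(LINT x|lborel. complex_of_real (exp (- x\<^sup>2 / (2 * s\<^sup>2))) * cis (x * t)) = complex_of_real (s * sqrt (2 * pi) * exp (- (s * t)\<^sup>2 / 2))"
    by (simp add: scaleR_conv_of_real)
  have "integrable lborel (\<lambda>x. complex_of_real (sqrt (2 * pi * s\<^sup>2) * normal_density 0 s x))"
    using integrable_normal_density[OF s, of 0] by simp
  moreover have "sqrt (2 * pi * s\<^sup>2) * normal_density 0 s x = exp (- x\<^sup>2 / (2 * s\<^sup>2))" for x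
    using s by (simp add: normal_density_def)
  ultimately show "integrable lborel (\<lambda>x. complex_of_real (exp (- x\<^sup>2 / (2 * s\<^sup>2))))" by simp
qed

text \<open>Only the inequality half of Plancherel's theorem is needed. Against a Gaussian weight the
  squared transform becomes a convolution form with a kernel of total mass \<open>\<pi>\<close>, bounded by Schur's test.\<close>

lemma Plancherel_weighted:
  fixes A :: "real \<Rightarrow> complex"
  assumes A: "integrable lborel A" and A2: "L2b A \<alpha>" and c: "c\<^sup>2 = (1::real)" and s: "0 < s"
  shows "(\<integral>\<^sup>+z. ennreal (exp (- z\<^sup>2 / (2 * s\<^sup>2)) * (cmod (LINT y|lborel. cis (2 * z * c * y) * A y))\<^sup>2) \<partial>lborel) \<le> ennreal (pi * \<alpha>\<^sup>2)"
proof -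
  have Am [measurable]: "A \<in> borel_measurable borel" using L2bD[OF A2] by auto
  define w where "w = (\<lambda>z::real. exp (- z\<^sup>2 / (2 * s\<^sup>2)))"
  define F where "F = (\<lambda>z. LINT y|lborel. cis (2 * z * c * y) * A y)"
  define g where "g = (\<lambda>t. s * sqrt (2 * pi) * exp (- (s * (2 * c * t))\<^sup>2 / 2))"
  have [measurable]: "w \<in> borel_measurable borel" "g \<in> borel_measurable borel" unfolding w_def g_def by measurable
  have cism [measurable]: "cis \<in> borel_measurable borel" unfolding cis_conv_exp by measurable
  have Fm [measurable]: "F \<in> borel_measurable borel" unfolding F_def by measurable
  have wi: "integrable lborel (\<lambda>z. complex_of_real (w z))" unfolding w_def by (rule gaussian_char(2)[OF s])
  have Ac: "integrable lborel (\<lambda>y. cnj (A y))" using A by simp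
  have gch: "(LINT z|lborel. complex_of_real (w z) * cis (2 * z * c * t)) = complex_of_real (g t)" for t
    using gaussian_char(1)[OF s, of "2 * c * t"] unfolding w_def g_def by (simp add: mult_ac)
  have cA: "integrable lborel (\<lambda>y. cis (2 * z * c * y) * A y)" for z
    using integrable_bounded_mult[OF A, of "\<lambda>y. cis (2 * z * c * y)" 1] by (simp add: mult.commute)
  have Fb: "cmod (F z) \<le> (LINT y|lborel. cmod (A y))" for z
    using integral_norm_bound[of lborel "\<lambda>y. cis (2 * z * c * y) * A y"] unfolding F_def by (simp add: norm_mult)
  have wFi: "integrable lborel (\<lambda>z. complex_of_real (w z) * cnj (F z))"
    by (rule integrable_bounded_mult[OF wi, where B="LINT y|lborel. cmod (A y)"]) (use Fb in \<open>auto intro!: cnj_measurable\<close>)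
  have nn: "(\<integral>\<^sup>+z. ennreal (w z * (cmod (F z))\<^sup>2) \<partial>lborel) = ennreal (LINT z|lborel. w z * (cmod (F z))\<^sup>2)"
  proof (rule nn_integral_eq_integral)
    have "integrable lborel (\<lambda>z. w z * (cmod (F z))\<^sup>2)"
    proof (rule integrable_bounded_mult[where B="(LINT y|lborel. cmod (A y))\<^sup>2"])
      show "integrable lborel w" using wi by (simp add: complex_of_real_integrable_eq)
    qed (use Fb in \<open>auto intro!: power_mono\<close>)
    thus "integrable lborel (\<lambda>z. w z * (cmod (F z))\<^sup>2)" .
  qed (auto simp: w_def)
  have "complex_of_real (LINT z|lborel. w z * (cmod (F z))\<^sup>2) = (LINT z|lborel. complex_of_real (w z * (cmod (F z))\<^sup>2))"
    by (rule integral_complex_of_real[symmetric])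
  \<comment> \<open>Only one factor \<open>F\<close> is opened here, the conjugate one after the
    first exchange. Each exchange then has a product majorant: \<open>w * cnj F\<close> is
    integrable because \<open>F\<close> is bounded and \<open>w\<close> is integrable.\<close>
  also have "\<dots> = (LINT z|lborel. LINT x|lborel. complex_of_real (w z) * cnj (F z) * (cis (2 * z * c * x) * A x))"
  proof (rule Bochner_Integration.integral_cong[OF refl])
    fix z
    have "complex_of_real (w z * (cmod (F z))\<^sup>2) = complex_of_real (w z) * cnj (F z) * F z"
      unfolding of_real_mult complex_norm_square by (simp only: mult_ac)
    thus "complex_of_real (w z * (cmod (F z))\<^sup>2) = (LINT x|lborel. complex_of_real (w z) * cnj (F z) * (cis (2 * z * c * x) * A x))"
      unfolding F_def by (simp only: integral_mult_right_zero)
  qed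
  also have "\<dots> = (LINT x|lborel. LINT z|lborel. complex_of_real (w z) * cnj (F z) * (cis (2 * z * c * x) * A x))"
    by (rule lborel_pair.Fubini_integral[symmetric], rule integrable_product_bound[OF _ wFi A]) (auto simp: norm_mult)
  also have "\<dots> = (LINT x|lborel. A x * (LINT y|lborel. cnj (A y) * complex_of_real (g (x - y))))"
  proof (rule Bochner_Integration.integral_cong[OF refl])
    fix x
    have "(LINT z|lborel. complex_of_real (w z) * cnj (F z) * (cis (2 * z * c * x) * A x))
       = (LINT z|lborel. A x * (complex_of_real (w z) * cnj (F z) * cis (2 * z * c * x)))"
      by (simp only: mult_ac)
    also have "\<dots> = A x * (LINT z|lborel. complex_of_real (w z) * cnj (F z) * cis (2 * z * c * x))"
      by (rule integral_mult_right_zero)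
    also have "(LINT z|lborel. complex_of_real (w z) * cnj (F z) * cis (2 * z * c * x)) =
       (LINT z|lborel. LINT y|lborel. complex_of_real (w z) * cis (2 * z * c * (x - y)) * cnj (A y))"
    proof (rule Bochner_Integration.integral_cong[OF refl])
      fix z
      have "cnj (F z) = (LINT y|lborel. cnj (cis (2 * z * c * y) * A y))" unfolding F_def by (rule Bochner_Integration.integral_cnj[symmetric])
      hence "complex_of_real (w z) * cnj (F z) * cis (2 * z * c * x) = (complex_of_real (w z) * cis (2 * z * c * x)) * (LINT y|lborel. cnj (cis (2 * z * c * y) * A y))"
        by simp
      also have "\<dots> = (LINT y|lborel. (complex_of_real (w z) * cis (2 * z * c * x)) * cnj (cis (2 * z * c * y) * A y))"
        by (rule integral_mult_right_zero[symmetric])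
      also have "\<dots> = (LINT y|lborel. complex_of_real (w z) * cis (2 * z * c * (x - y)) * cnj (A y))"
      proof (rule Bochner_Integration.integral_cong[OF refl])
        fix y
        have "cis (2 * z * c * (x - y)) = cis (2 * z * c * x) * cnj (cis (2 * z * c * y))"
          by (simp add: cis_cnj cis_mult right_diff_distrib)
        thus "(complex_of_real (w z) * cis (2 * z * c * x)) * cnj (cis (2 * z * c * y) * A y) = complex_of_real (w z) * cis (2 * z * c * (x - y)) * cnj (A y)"
          by simp
      qed
      finally show "complex_of_real (w z) * cnj (F z) * cis (2 * z * c * x) = (LINT y|lborel. complex_of_real (w z) * cis (2 * z * c * (x - y)) * cnj (A y))" .
    qed
    also have "\<dots> = (LINT y|lborel. LINT z|lborel. complex_of_real (w z) * cis (2 * z * c * (x - y)) * cnj (A y))"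
      by (rule lborel_pair.Fubini_integral[symmetric], rule integrable_product_bound[OF _ wi Ac]) (auto simp: norm_mult)
    also have "\<dots> = (LINT y|lborel. cnj (A y) * complex_of_real (g (x - y)))"
    proof (rule Bochner_Integration.integral_cong[OF refl])
      fix y
      show "(LINT z|lborel. complex_of_real (w z) * cis (2 * z * c * (x - y)) * cnj (A y)) = cnj (A y) * complex_of_real (g (x - y))"
        unfolding gch[symmetric] by (subst integral_mult_left_zero) (rule mult.commute)
    qed
    finally show "(LINT z|lborel. complex_of_real (w z) * cnj (F z) * (cis (2 * z * c * x) * A x)) = A x * (LINT y|lborel. cnj (A y) * complex_of_real (g (x - y)))" .
  qed
  finally have eq: "complex_of_real (LINT z|lborel. w z * (cmod (F z))\<^sup>2) = (LINT x|lborel. A x * (LINT y|lborel. cnj (A y) * complex_of_real (g (x - y))))" .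
  have g0: "0 \<le> g t" for t unfolding g_def using s by simp
  \<comment> \<open>Since c^2 = 1 and the phase is 2 z c y, \<open>g\<close> is pi times the normal
    density of standard deviation 1/(2 s).\<close>
  have gpi: "(\<integral>\<^sup>+t. ennreal (g t) \<partial>lborel) = ennreal pi"
  proof -
    have "g t = pi * normal_density 0 (1 / (2 * s)) t" for t
    proof -
      have "- (s * (2 * c * t))\<^sup>2 / 2 = - (t - 0)\<^sup>2 / (2 * (1 / (2 * s))\<^sup>2)" using c s by (simp add: power_mult_distrib power_divide field_simps)
      moreover have "pi * (1 / sqrt (2 * pi * (1 / (2 * s))\<^sup>2)) = s * sqrt (2 * pi)"
        using s by (simp add: real_sqrt_mult real_sqrt_divide power_divide field_simps real_sqrt_pow2)
      ultimately show ?thesis unfolding g_def normal_density_def by (simp only: mult.assoc[symmetric])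
    qed
    hence "(\<integral>\<^sup>+t. ennreal (g t) \<partial>lborel) = ennreal (LINT t|lborel. pi * normal_density 0 (1 / (2 * s)) t)"
      using s by (simp only:, intro nn_integral_eq_integral integrable_mult_right integrable_normal_density) auto
    also have "\<dots> = ennreal pi" using s integral_normal_density[of "1 / (2 * s)" 0] by simp
    finally show ?thesis .
  qed
  have gx: "(\<integral>\<^sup>+y. ennreal (g (x - y)) \<partial>lborel) = ennreal pi" for x
    using nn_integral_real_affine[of "\<lambda>t. ennreal (g t)" "-1" x] gpi by simp
  have gy: "(\<integral>\<^sup>+x. ennreal (g (x - y)) \<partial>lborel) = ennreal pi" for y
    using nn_integral_real_affine[of "\<lambda>t. ennreal (g t)" "1" "-y"] gpi by simp
  let ?a = "\<lambda>x. ennreal ((cmod (A x))\<^sup>2)"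
  let ?n = "\<integral>\<^sup>+x. ?a x \<partial>lborel"
  \<comment> \<open>Twice |A x| |A y| is at most the sum of the squares, hence the 1/2; the two
    resulting terms are integrated with the two marginals of \<open>g\<close>, both of mass
    pi.\<close>
  define h :: real where "h = 1/2"
  have h0: "0 \<le> h" by (simp add: h_def)
  have "ennreal (LINT z|lborel. w z * (cmod (F z))\<^sup>2) \<le> ennreal (cmod (LINT x|lborel. A x * (LINT y|lborel. cnj (A y) * complex_of_real (g (x - y)))))"
    unfolding eq[symmetric] by (intro ennreal_leI) simp
  also have "\<dots> \<le> (\<integral>\<^sup>+x. ennreal (cmod (A x * (LINT y|lborel. cnj (A y) * complex_of_real (g (x - y))))) \<partial>lborel)"
    by (rule norm_integral_le_nn_integral)
  also have "\<dots> \<le> (\<integral>\<^sup>+x. \<integral>\<^sup>+y. ennreal h * (?a x * ennreal (g (x - y)) + ?a y * ennreal (g (x - y))) \<partial>lborel \<partial>lborel)"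
  proof (rule nn_integral_mono)
    fix x
    have "ennreal (cmod (A x * (LINT y|lborel. cnj (A y) * complex_of_real (g (x - y))))) = ennreal (cmod (A x)) * ennreal (cmod (LINT y|lborel. cnj (A y) * complex_of_real (g (x - y))))"
      by (simp add: norm_mult ennreal_mult)
    also have "\<dots> \<le> ennreal (cmod (A x)) * (\<integral>\<^sup>+y. ennreal (cmod (cnj (A y) * complex_of_real (g (x - y)))) \<partial>lborel)"
      by (intro mult_left_mono norm_integral_le_nn_integral) auto
    also have "\<dots> = (\<integral>\<^sup>+y. ennreal (cmod (A x)) * ennreal (cmod (cnj (A y) * complex_of_real (g (x - y)))) \<partial>lborel)"
      by (rule nn_integral_cmult[symmetric]) measurable
    also have "\<dots> \<le> (\<integral>\<^sup>+y. ennreal h * (?a x * ennreal (g (x - y)) + ?a y * ennreal (g (x - y))) \<partial>lborel)"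
    proof (rule nn_integral_mono)
      fix y
      have "cmod (A x) * cmod (A y) * g (x - y) \<le> (h * ((cmod (A x))\<^sup>2 + (cmod (A y))\<^sup>2)) * g (x - y)"
        using sum_squares_bound[of "cmod (A x)" "cmod (A y)"] by (intro mult_right_mono g0) (auto simp: h_def)
      hence "ennreal (cmod (A x) * cmod (A y) * g (x - y)) \<le> ennreal (h * ((cmod (A x))\<^sup>2 * g (x - y) + (cmod (A y))\<^sup>2 * g (x - y)))"
        by (intro ennreal_leI) (simp add: algebra_simps)
      thus "ennreal (cmod (A x)) * ennreal (cmod (cnj (A y) * complex_of_real (g (x - y)))) \<le> ennreal h * (?a x * ennreal (g (x - y)) + ?a y * ennreal (g (x - y)))"
        using g0 h0 by (simp add: ennreal_mult[symmetric] ennreal_plus[symmetric] norm_mult abs_of_nonneg mult.assoc del: ennreal_plus)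
    qed
    finally show "ennreal (cmod (A x * (LINT y|lborel. cnj (A y) * complex_of_real (g (x - y))))) \<le> (\<integral>\<^sup>+y. ennreal h * (?a x * ennreal (g (x - y)) + ?a y * ennreal (g (x - y))) \<partial>lborel)" .
  qed
  also have "\<dots> = ennreal h * (\<integral>\<^sup>+x. \<integral>\<^sup>+y. (?a x * ennreal (g (x - y)) + ?a y * ennreal (g (x - y))) \<partial>lborel \<partial>lborel)"
    by (simp add: nn_integral_cmult)
  also have "(\<integral>\<^sup>+x. \<integral>\<^sup>+y. (?a x * ennreal (g (x - y)) + ?a y * ennreal (g (x - y))) \<partial>lborel \<partial>lborel)
     = (\<integral>\<^sup>+x. \<integral>\<^sup>+y. ?a x * ennreal (g (x - y)) \<partial>lborel \<partial>lborel) + (\<integral>\<^sup>+x. \<integral>\<^sup>+y. ?a y * ennreal (g (x - y)) \<partial>lborel \<partial>lborel)"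
    by (simp add: nn_integral_add)
  also have "(\<integral>\<^sup>+x. \<integral>\<^sup>+y. ?a y * ennreal (g (x - y)) \<partial>lborel \<partial>lborel) = (\<integral>\<^sup>+y. \<integral>\<^sup>+x. ?a y * ennreal (g (x - y)) \<partial>lborel \<partial>lborel)"
    by (rule lborel_pair.Fubini') measurable
  also have "(\<integral>\<^sup>+x. \<integral>\<^sup>+y. ?a x * ennreal (g (x - y)) \<partial>lborel \<partial>lborel) = ?n * ennreal pi"
    by (simp add: nn_integral_cmult nn_integral_multc gx)
  also have "(\<integral>\<^sup>+y. \<integral>\<^sup>+x. ?a y * ennreal (g (x - y)) \<partial>lborel \<partial>lborel) = ?n * ennreal pi"
    by (simp add: nn_integral_cmult nn_integral_multc gy)
  also have "ennreal h * (?n * ennreal pi + ?n * ennreal pi) = ?n * ennreal pi"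
  proof -
    have "ennreal h * (u + u) = u" for u :: ennreal
    proof -
      have "ennreal h * (u + u) = (ennreal h * 2) * u" by (simp add: mult_2[symmetric] mult.assoc)
      also have "ennreal h * 2 = ennreal h * ennreal 2" by simp
      also have "\<dots> = ennreal (h * 2)" using h0 by (intro ennreal_mult[symmetric]) auto
      also have "\<dots> = 1" by (simp add: h_def)
      finally show ?thesis by simp
    qed
    thus ?thesis .
  qed
  also have "\<dots> \<le> ennreal (\<alpha>\<^sup>2) * ennreal pi" by (intro mult_right_mono L2bD(3)[OF A2]) auto
  also have "\<dots> = ennreal (pi * \<alpha>\<^sup>2)" by (simp add: ennreal_mult[symmetric] mult.commute)
  finally have "(\<integral>\<^sup>+z. ennreal (w z * (cmod (F z))\<^sup>2) \<partial>lborel) \<le> ennreal (pi * \<alpha>\<^sup>2)" unfolding nn .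
  thus ?thesis unfolding w_def F_def .
qed

lemma cis_measurable [measurable]: "cis \<in> borel_measurable borel"
  unfolding cis_conv_exp by measurable

text \<open>The Gaussian weight tends to 1 as s grows, and Fatou's lemma removes it. The constant
  sqrt pi is rounded up to 2.\<close>

lemma L2b_Fourier:
  fixes A :: "real \<Rightarrow> complex"
  assumes A: "integrable lborel A" and A2: "L2b A \<alpha>" and c: "c\<^sup>2 = (1::real)"
  shows "L2b (\<lambda>z. LINT y|lborel. cis (2 * z * c * y) * A y) (2 * \<alpha>)"
proof -
  have [measurable]: "A \<in> borel_measurable borel" using L2bD[OF A2] by auto
  define F where "F = (\<lambda>z. LINT y|lborel. cis (2 * z * c * y) * A y)"
  have [measurable]: "F \<in> borel_measurable borel" unfolding F_def by measurable
  have "L2b F (sqrt pi * \<alpha>)"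
  proof (rule L2b_lim)
    fix n :: nat
    let ?f = "\<lambda>z::real. sqrt (exp (- z\<^sup>2 / (2 * (real (Suc n))\<^sup>2))) *\<^sub>R F z"
    have "(norm (?f z))\<^sup>2 = exp (- z\<^sup>2 / (2 * (real (Suc n))\<^sup>2)) * (cmod (F z))\<^sup>2" for z
      by (simp add: power_mult_distrib)
    thus "L2b ?f (sqrt pi * \<alpha>)"
      using Plancherel_weighted[OF A A2 c, of "real (Suc n)"] L2bD(2)[OF A2] unfolding L2b_def
      by (auto simp: power_mult_distrib F_def)
  next
    fix z
    have "(\<lambda>n. - z\<^sup>2 / 2 * (inverse (real (Suc n)))\<^sup>2) \<longlonglongrightarrow> - z\<^sup>2 / 2 * 0\<^sup>2"
      by (intro tendsto_intros LIMSEQ_inverse_real_of_nat)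
    hence "(\<lambda>n. sqrt (exp (- z\<^sup>2 / 2 * (inverse (real (Suc n)))\<^sup>2)) *\<^sub>R F z) \<longlonglongrightarrow> sqrt (exp (- z\<^sup>2 / 2 * 0\<^sup>2)) *\<^sub>R F z"
      by (intro tendsto_intros LIMSEQ_inverse_real_of_nat)
    thus "(\<lambda>n. sqrt (exp (- z\<^sup>2 / (2 * (real (Suc n))\<^sup>2))) *\<^sub>R F z) \<longlonglongrightarrow> F z"
      by (simp add: field_simps)
  qed
  moreover have "sqrt pi * \<alpha> \<le> 2 * \<alpha>"
  proof (rule mult_right_mono)
    have "sqrt pi \<le> sqrt (2\<^sup>2)" using pi_less_4 by (intro real_sqrt_le_mono) simp
    thus "sqrt pi \<le> 2" by simp
  qed (rule L2bD(2)[OF A2])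
  ultimately show ?thesis unfolding F_def by (rule L2b_bound_mono)
qed

lemma L2b_norm: "L2b f B \<Longrightarrow> L2b (\<lambda>x. norm (f x)) B"
  unfolding L2b_def by auto

text \<open>Interchanging the two integrations puts the oscillating factor next to \<open>A\<close>, so that \<open>A\<close> enters
  only through its \<open>L\<^sup>2\<close> norm.\<close>

lemma L2b_oscillatory:
  fixes A :: "real \<Rightarrow> complex" and g :: "real \<Rightarrow> real \<Rightarrow> complex"
  assumes A: "integrable lborel A" and A2: "L2b A \<alpha>" and c: "c\<^sup>2 = (1::real)"
    and gm: "(\<lambda>p. g (fst p) (snd p)) \<in> borel_measurable (borel \<Otimes>\<^sub>M borel)"
    and g: "\<And>z y. cmod (g z y) \<le> \<gamma> y" and \<gamma>: "integrable lborel \<gamma>"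
    and \<phi>: "\<And>z y. \<phi> z y = \<epsilon> + cum (g z) y"
  shows "L2b (\<lambda>z. cum (\<lambda>y. cis (2 * z * c * y) * A y * \<phi> z y) x) (2 * \<alpha> * (cmod \<epsilon> + (LINT y|lborel. \<gamma> y)))"
proof -
  note [measurable] = gm
  have [measurable]: "A \<in> borel_measurable borel" using L2bD[OF A2] by auto
  have g1 [measurable]: "g z \<in> borel_measurable borel" for z
  proof -
    have "(\<lambda>y. (\<lambda>p. g (fst p) (snd p)) (z, y)) \<in> borel_measurable borel" by measurable
    thus ?thesis by simp
  qed
  have \<gamma>0: "0 \<le> \<gamma> y" for y using g[of 0 y] norm_ge_zero order_trans by blast
  have gi: "integrable lborel (g z)" for z
    by (rule Bochner_Integration.integrable_bound[OF \<gamma>]) (use g \<gamma>0 in auto)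
  let ?B = "\<lambda>z y. cis (2 * z * c * y) * A y"
  have Bi: "integrable lborel (?B z)" for z
    using integrable_bounded_mult[OF A, of "\<lambda>y. cis (2 * z * c * y)" 1] by (simp add: mult.commute)
  \<comment> \<open>For fixed s this is the transform of \<open>A\<close> cut down to (s, x),
    bounded by 2 \<alpha> uniformly in s. Minkowski's inequality then integrates it against the
    majorant \<gamma> of \<open>g\<close>.\<close>
  define h where "h = (\<lambda>s z. LINT y|lborel. cis (2 * z * c * y) * (if s < y \<and> y < x then A y else 0))"
  have L2h: "L2b (h s) (2 * \<alpha>)" for s
    unfolding h_def
    by (rule L2b_Fourier[OF integrable_if[OF A] L2b_mono[OF A2] c]) auto
  have hm [measurable]: "(\<lambda>p. h (fst p) (snd p)) \<in> borel_measurable (borel \<Otimes>\<^sub>M borel)"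
    unfolding h_def by measurable
  have hm1 [measurable]: "(\<lambda>s. h s z) \<in> borel_measurable borel" for z
  proof -
    have "(\<lambda>y. (\<lambda>p. h (fst p) (snd p)) (y, z)) \<in> borel_measurable borel" by measurable
    thus ?thesis by simp
  qed
  have hb: "cmod (h s z) \<le> (LINT y|lborel. cmod (A y))" for s z
  proof -
    have "cmod (h s z) \<le> (LINT y|lborel. cmod (cis (2 * z * c * y) * (if s < y \<and> y < x then A y else 0)))"
      unfolding h_def by (rule integral_norm_bound)
    also have "\<dots> \<le> (LINT y|lborel. cmod (A y))"
      using A by (intro integral_mono integrable_norm integrable_bounded_mult[of "\<lambda>y. if s < y \<and> y < x then A y else 0", where B=1, simplified mult.commute] integrable_if) (auto simp: norm_mult)
    finally show ?thesis .
  qed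
  have eq: "cum (\<lambda>y. ?B z y * \<phi> z y) x = \<epsilon> * cum (?B z) x + (LINT s|lborel. g z s * h s z)" for z
  proof -
    have i1: "integrable lborel (\<lambda>y. \<epsilon> * ?B z y)" using Bi by simp
    have i2: "integrable lborel (\<lambda>y. ?B z y * cum (g z) y)" by (rule triangle_Fubini(2)[OF Bi gi])
    have "cum (\<lambda>y. ?B z y * \<phi> z y) x = cum (\<lambda>y. \<epsilon> * ?B z y + ?B z y * cum (g z) y) x"
      unfolding \<phi> by (simp add: algebra_simps)
    also have "\<dots> = \<epsilon> * cum (?B z) x + cum (\<lambda>y. ?B z y * cum (g z) y) x"
      unfolding cum_add[OF i1 i2] cum_mult ..
    also have "cum (\<lambda>y. ?B z y * cum (g z) y) x = (LINT y|lborel. (if y < x then ?B z y else 0) * cum (g z) y)"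
      unfolding cum_def[of _ x] by (intro Bochner_Integration.integral_cong) auto
    also have "\<dots> = (LINT s|lborel. g z s * (LINT y|lborel. (if s < y then (if y < x then ?B z y else 0) else 0)))"
      by (rule triangle_Fubini(1)[OF integrable_if[OF Bi] gi]) auto
    also have "\<dots> = (LINT s|lborel. g z s * h s z)"
      unfolding h_def by (intro Bochner_Integration.integral_cong refl arg_cong2[where f="(*)"]) auto
    finally show ?thesis .
  qed
  have "L2b (\<lambda>z. cum (?B z) x) (2 * \<alpha>)"
  proof -
    have "L2b (\<lambda>z. LINT y|lborel. cis (2 * z * c * y) * (if y < x then A y else 0)) (2 * \<alpha>)"
      by (rule L2b_Fourier[OF integrable_if[OF A] L2b_mono[OF A2] c]) auto
    moreover have "(LINT y|lborel. cis (2 * z * c * y) * (if y < x then A y else 0)) = cum (?B z) x" for z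
      unfolding cum_def by (intro Bochner_Integration.integral_cong) auto
    ultimately show ?thesis by simp
  qed
  hence L1: "L2b (\<lambda>z. \<epsilon> * cum (?B z) x) (cmod \<epsilon> * (2 * \<alpha>))" by (rule L2b_cmult)
  have L2: "L2b (\<lambda>z. LINT s|lborel. g z s * h s z) ((LINT y|lborel. \<gamma> y) * (2 * \<alpha>))"
  proof (rule L2b_Minkowski_int[OF \<gamma> \<gamma>0 hm L2h])
    show "(\<lambda>z. LINT s|lborel. g z s * h s z) \<in> borel_measurable borel"
    proof -
      have [measurable]: "(\<lambda>p. h (snd p) (fst p)) \<in> borel_measurable (borel \<Otimes>\<^sub>M borel)"
      proof -
        have "(\<lambda>q. (\<lambda>p. h (fst p) (snd p)) (snd q, fst q)) \<in> borel_measurable (borel \<Otimes>\<^sub>M borel)" by measurable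
        thus ?thesis by simp
      qed
      show ?thesis by measurable
    qed
    fix z
    show i: "integrable lborel (\<lambda>y. \<gamma> y * cmod (h y z))"
      by (rule integrable_bounded_mult[OF \<gamma>]) (use hb in auto)
    have "cmod (LINT s|lborel. g z s * h s z) \<le> (LINT s|lborel. cmod (g z s * h s z))"
      by (rule integral_norm_bound)
    also have "\<dots> \<le> (LINT s|lborel. \<gamma> s * cmod (h s z))"
      using g hb by (intro integral_mono i integrable_norm integrable_bounded_mult[OF gi, where B="LINT y|lborel. cmod (A y)"]) (auto simp: norm_mult intro!: mult_right_mono)
    finally show "cmod (LINT s|lborel. g z s * h s z) \<le> (LINT s|lborel. \<gamma> s * cmod (h s z))" .
  qed
  show ?thesis using L2b_add[OF L1 L2] unfolding eq by (simp add: algebra_simps)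
qed

text \<open>The counterpart of \<open>L2b_oscillatory\<close> for kernels without oscillation: the
  decay in z must come from \<phi> itself, and Minkowski's inequality only integrates it.\<close>

lemma L2b_cum_weighted:
  fixes N :: "real \<Rightarrow> real \<Rightarrow> complex" and \<phi> :: "real \<Rightarrow> real \<Rightarrow> complex"
  assumes k: "integrable lborel k" and N: "\<And>z y. cmod (N z y) \<le> k y"
    and Nm: "(\<lambda>p. N (fst p) (snd p)) \<in> borel_measurable (borel \<Otimes>\<^sub>M borel)"
    and \<phi>m: "(\<lambda>p. \<phi> (fst p) (snd p)) \<in> borel_measurable (borel \<Otimes>\<^sub>M borel)"
    and b: "\<And>z y. cmod (\<phi> z y) \<le> B" and L: "\<And>y. L2b (\<lambda>z. \<phi> z y) \<Phi>"
  shows "L2b (\<lambda>z. cum (\<lambda>y. N z y * \<phi> z y) x) ((LINT y|lborel. k y) * \<Phi>)"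
proof (rule L2b_Minkowski_int[OF k, where h="\<lambda>y z. \<phi> z y"])
  note [measurable] = Nm \<phi>m
  have k0: "0 \<le> k y" for y using N[of 0 y] norm_ge_zero order_trans by blast
  show "0 \<le> k y" for y by (rule k0)
  show "(\<lambda>p. \<phi> (snd p) (fst p)) \<in> borel_measurable (borel \<Otimes>\<^sub>M borel)"
  proof -
    have "(\<lambda>q. (\<lambda>p. \<phi> (fst p) (snd p)) (snd q, fst q)) \<in> borel_measurable (borel \<Otimes>\<^sub>M borel)" by measurable
    thus ?thesis by simp
  qed
  show "L2b (\<lambda>z. \<phi> z y) \<Phi>" for y by (rule L)
  show "(\<lambda>z. cum (\<lambda>y. N z y * \<phi> z y) x) \<in> borel_measurable borel" by measurable
  fix z
  have \<phi>1: "(\<lambda>y. \<phi> z y) \<in> borel_measurable borel"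
  proof -
    have "(\<lambda>y. (\<lambda>p. \<phi> (fst p) (snd p)) (z, y)) \<in> borel_measurable borel" by measurable
    thus ?thesis by simp
  qed
  have N1: "(\<lambda>y. N z y) \<in> borel_measurable borel"
  proof -
    have "(\<lambda>y. (\<lambda>p. N (fst p) (snd p)) (z, y)) \<in> borel_measurable borel" by measurable
    thus ?thesis by simp
  qed
  have Ni: "integrable lborel (N z)"
    by (rule Bochner_Integration.integrable_bound[OF k]) (use N k0 N1 in auto)
  have Np: "integrable lborel (\<lambda>y. N z y * \<phi> z y)"
    by (rule integrable_bounded_mult[OF Ni \<phi>1 b])
  show i: "integrable lborel (\<lambda>y. k y * norm (\<phi> z y))"
    by (rule integrable_bounded_mult[OF k]) (use b \<phi>1 in auto)
  have "cmod (cum (\<lambda>y. N z y * \<phi> z y) x) \<le> (LINT y|lborel. cmod (N z y * \<phi> z y))"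
    by (rule norm_cum_le[OF Np])
  also have "\<dots> \<le> (LINT y|lborel. k y * norm (\<phi> z y))"
    using N by (intro integral_mono integrable_norm Np i) (auto simp: norm_mult intro!: mult_right_mono)
  finally show "cmod (cum (\<lambda>y. N z y * \<phi> z y) x) \<le> (LINT y|lborel. k y * norm (\<phi> z y))" .
qed

text \<open>Gronwall's inequality is applied for each fixed \<open>z\<close>, with a forcing term that depends on \<open>x\<close>;
  the \<open>L\<^sup>2\<close> norm in \<open>z\<close> is taken afterwards.\<close>

lemma L2b_Gronwall:
  fixes N :: "real \<Rightarrow> 'n::finite \<Rightarrow> 'n \<Rightarrow> real \<Rightarrow> complex" and d H :: "real \<Rightarrow> 'n \<Rightarrow> real \<Rightarrow> complex"
  assumes k: "integrable lborel k" and N: "\<And>z y. (\<Sum>i\<in>UNIV. \<Sum>j\<in>UNIV. cmod (N z i j y)) \<le> k y"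
    and Nm: "\<And>i j. (\<lambda>p. N (fst p) i j (snd p)) \<in> borel_measurable (borel \<Otimes>\<^sub>M borel)"
    and dm: "\<And>i. (\<lambda>p. d (fst p) i (snd p)) \<in> borel_measurable (borel \<Otimes>\<^sub>M borel)"
    and db: "\<And>z i y. cmod (d z i y) \<le> B"
    and eq: "\<And>z i x. d z i x = H z i x + cum (\<lambda>y. \<Sum>j\<in>UNIV. N z i j y * d z j y) x"
    and H: "\<And>i x. L2b (\<lambda>z. H z i x) h"
  shows "L2b (\<lambda>z. d z i x) (real CARD('n) * h * (1 + (LINT y|lborel. k y) * exp (LINT y|lborel. k y)))"
proof -
  note [measurable] = Nm dm
  let ?T = "LINT y|lborel. k y"
  have N1: "(\<lambda>y. N z i j y) \<in> borel_measurable borel" for z i j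
  proof -
    have "(\<lambda>y. (\<lambda>p. N (fst p) i j (snd p)) (z, y)) \<in> borel_measurable borel" by measurable
    thus ?thesis by simp
  qed
  have d1: "(\<lambda>y. d z i y) \<in> borel_measurable borel" for z i
  proof -
    have "(\<lambda>y. (\<lambda>p. d (fst p) i (snd p)) (z, y)) \<in> borel_measurable borel" by measurable
    thus ?thesis by simp
  qed
  interpret V: volterra "\<lambda>i j x y. N z i j y" k "\<lambda>_. 0" for z
    by unfold_locales (use N1 N k in auto)
  have k0: "0 \<le> k y" for y using V.k_nonneg by blast
  have T0: "0 \<le> ?T" using k0 by simp
  have h0: "0 \<le> h" using L2bD(2)[OF H] .
  define D where "D = (\<lambda>z x. \<Sum>i\<in>UNIV. cmod (d z i x))"
  define Hs where "Hs = (\<lambda>z x. \<Sum>i\<in>UNIV. cmod (H z i x))"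
  \<comment> \<open>Gronwall's inequality is applied to \<open>U\<close> rather than to
    \<open>D\<close>, because \<open>U\<close> obeys an inequality whose forcing term
    \<open>Hc z\<close> no longer depends on x. Afterwards D \<le> Hs + U.\<close>
  define U where "U = (\<lambda>z x. cum (\<lambda>y. k y * D z y) x)"
  define B' where "B' = real CARD('n) * B"
  have Db: "D z x \<le> B'" "0 \<le> D z x" for z x
    unfolding D_def B'_def using sum_mono[of UNIV "\<lambda>i. cmod (d z i x)" "\<lambda>_. B"] db by (auto simp: sum_nonneg)
  have Dm1: "D z \<in> borel_measurable borel" for z unfolding D_def using d1 by measurable
  have kD: "integrable lborel (\<lambda>y. k y * D z y)" for z
    by (rule integrable_bounded_mult[OF k Dm1, where B=B']) (use Db in auto)
  have Ub: "0 \<le> U z x" "U z x \<le> ?T * B'" for z x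
  proof -
    show "0 \<le> U z x" unfolding U_def using k0 Db by (intro cum_nonneg) auto
    have "U z x \<le> (LINT y|lborel. k y * D z y)" unfolding U_def by (rule cum_le_total[OF kD]) (use k0 Db in auto)
    also have "\<dots> \<le> (LINT y|lborel. k y * B')" using k0 Db k by (intro integral_mono kD mult_left_mono) auto
    finally show "U z x \<le> ?T * B'" by simp
  qed
  have Um1: "U z \<in> borel_measurable borel" for z
    unfolding U_def using cum_measurable1[OF borel_measurable_integrable[OF kD, simplified]] .
  have kU: "integrable lborel (\<lambda>y. k y * U z y)" for z
    by (rule integrable_bounded_mult[OF k Um1, where B="?T * B'"]) (use Ub in auto)
  \<comment> \<open>About \<open>H\<close> only the L^2 bound in z is known, for each x separately.
    Its joint measurability and its boundedness are read off from the equation.\<close>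
  have Heq: "H z i x = d z i x - cum (\<lambda>y. \<Sum>j\<in>UNIV. N z i j y * d z j y) x" for z i x
    using eq[of z i x] by (metis add_diff_cancel_right')
  have [measurable]: "k \<in> borel_measurable borel" using borel_measurable_integrable[OF k] by simp
  have Hm [measurable]: "(\<lambda>p. H (fst p) i (snd p)) \<in> borel_measurable (borel \<Otimes>\<^sub>M borel)" for i
  proof -
    have [measurable]: "(\<lambda>q. N (fst (fst q)) i j (snd q)) \<in> borel_measurable ((borel \<Otimes>\<^sub>M borel) \<Otimes>\<^sub>M borel)" for i j
    proof -
      have "(\<lambda>q. (\<lambda>p. N (fst p) i j (snd p)) (fst (fst q), snd q)) \<in> borel_measurable ((borel \<Otimes>\<^sub>M borel) \<Otimes>\<^sub>M borel)" by measurable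
      thus ?thesis by simp
    qed
    have [measurable]: "(\<lambda>q. d (fst (fst q)) i (snd q)) \<in> borel_measurable ((borel \<Otimes>\<^sub>M borel) \<Otimes>\<^sub>M borel)" for i
    proof -
      have "(\<lambda>q. (\<lambda>p. d (fst p) i (snd p)) (fst (fst q), snd q)) \<in> borel_measurable ((borel \<Otimes>\<^sub>M borel) \<Otimes>\<^sub>M borel)" by measurable
      thus ?thesis by simp
    qed
    show ?thesis unfolding Heq by measurable
  qed
  have Hm1: "(\<lambda>y. H z i y) \<in> borel_measurable borel" for z i
  proof -
    have "(\<lambda>y. (\<lambda>p. H (fst p) i (snd p)) (z, y)) \<in> borel_measurable borel" by measurable
    thus ?thesis by simp
  qed
  have cumle: "(\<Sum>i\<in>UNIV. cmod (cum (\<lambda>y. \<Sum>j\<in>UNIV. N z i j y * d z j y) x)) \<le> U z x" for z x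
    unfolding U_def D_def using V.sum_cum_le[of "d z" B' z x] d1 Db unfolding D_def by auto
  have Hsb: "0 \<le> Hs z x" "Hs z x \<le> B' + ?T * B'" for z x
  proof -
    show "0 \<le> Hs z x" unfolding Hs_def by (simp add: sum_nonneg)
    have "Hs z x \<le> (\<Sum>i\<in>UNIV. cmod (d z i x) + cmod (cum (\<lambda>y. \<Sum>j\<in>UNIV. N z i j y * d z j y) x))"
      unfolding Hs_def Heq by (intro sum_mono norm_triangle_ineq4)
    also have "\<dots> \<le> D z x + U z x" unfolding sum.distrib D_def using cumle by (intro add_mono) auto
    finally show "Hs z x \<le> B' + ?T * B'" using Db[of z x] Ub[of z x] by linarith
  qed
  have kH: "integrable lborel (\<lambda>y. k y * Hs z y)" for z
    by (rule integrable_bounded_mult[OF k, where B="B' + ?T * B'"]) (use Hsb Hm1 in \<open>auto simp: Hs_def\<close>)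
  have DH: "D z x \<le> Hs z x + U z x" for z x
  proof -
    have "D z x \<le> (\<Sum>i\<in>UNIV. cmod (H z i x) + cmod (cum (\<lambda>y. \<Sum>j\<in>UNIV. N z i j y * d z j y) x))"
      unfolding D_def by (intro sum_mono, subst eq) (rule norm_triangle_ineq)
    also have "\<dots> \<le> Hs z x + U z x" unfolding sum.distrib Hs_def using cumle by (intro add_mono) auto
    finally show ?thesis .
  qed
  define Hc where "Hc = (\<lambda>z. LINT y|lborel. k y * Hs z y)"
  have Hc0: "0 \<le> Hc z" for z unfolding Hc_def using k0 Hsb by (intro integral_nonneg_AE) auto
  have UG: "U z x \<le> Hc z * exp ?T" for z x
  proof -
    have "U z x \<le> Hc z * exp (cum k x)"
    proof (rule Gronwall[OF k k0 Um1, where B="?T * B'"])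
      show "\<bar>U z y\<bar> \<le> ?T * B'" for y using Ub[of z y] by simp
      fix x
      have "U z x \<le> cum (\<lambda>y. k y * Hs z y + k y * U z y) x"
        unfolding U_def[of ] using DH k0 kH kU kD unfolding U_def
        by (intro cum_mono Bochner_Integration.integrable_add) (auto simp: distrib_left[symmetric] intro!: mult_left_mono)
      also have "\<dots> = cum (\<lambda>y. k y * Hs z y) x + cum (\<lambda>y. k y * U z y) x" by (rule cum_add[OF kH kU])
      also have "cum (\<lambda>y. k y * Hs z y) x \<le> Hc z" unfolding Hc_def using k0 Hsb by (intro cum_le_total kH) auto
      finally show "U z x \<le> Hc z + cum (\<lambda>y. k y * U z y) x" by simp
    qed (rule Hc0)
    also have "\<dots> \<le> Hc z * exp ?T" using Hc0 cum_le_total[OF k k0] by (intro mult_left_mono) auto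
    finally show ?thesis .
  qed
  have LHs: "L2b (\<lambda>z. Hs z y) (real CARD('n) * h)" for y
  proof -
    have "L2b (\<lambda>z. \<Sum>i\<in>UNIV. cmod (H z i y)) (\<Sum>i\<in>(UNIV::'n set). h)"
      by (intro L2b_sum L2b_norm H) auto
    thus ?thesis unfolding Hs_def by simp
  qed
  have [measurable]: "(\<lambda>p. Hs (fst p) (snd p)) \<in> borel_measurable (borel \<Otimes>\<^sub>M borel)" unfolding Hs_def by measurable
  have LHc: "L2b Hc (?T * (real CARD('n) * h))"
  proof (rule L2b_Minkowski_int[OF k k0, where h="\<lambda>y z. Hs z y"])
    show "(\<lambda>p. Hs (snd p) (fst p)) \<in> borel_measurable (borel \<Otimes>\<^sub>M borel)"
    proof -
      have "(\<lambda>q. (\<lambda>p. Hs (fst p) (snd p)) (snd q, fst q)) \<in> borel_measurable (borel \<Otimes>\<^sub>M borel)" by measurable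
      thus ?thesis by simp
    qed
    show "Hc \<in> borel_measurable borel" unfolding Hc_def by measurable
    show "integrable lborel (\<lambda>y. k y * norm (Hs z y))" for z using kH Hsb by simp
    show "norm (Hc z) \<le> (LINT y|lborel. k y * norm (Hs z y))" for z using Hc0[of z] Hsb unfolding Hc_def by simp
  qed (rule LHs)
  have "L2b (\<lambda>z. Hs z x + exp ?T * Hc z) (real CARD('n) * h + norm (exp ?T) * (?T * (real CARD('n) * h)))"
    by (intro L2b_add LHs L2b_cmult LHc)
  hence L: "L2b (\<lambda>z. Hs z x + exp ?T * Hc z) (real CARD('n) * h * (1 + ?T * exp ?T))"
    by (simp add: algebra_simps)
  show ?thesis
  proof (rule L2b_mono[OF L])
    show "(\<lambda>z. d z i x) \<in> borel_measurable borel"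
    proof -
      have "(\<lambda>z. (\<lambda>p. d (fst p) i (snd p)) (z, x)) \<in> borel_measurable borel" by measurable
      thus ?thesis by simp
    qed
    fix z
    have "cmod (d z i x) \<le> D z x" unfolding D_def by (rule member_le_sum) auto
    also have "\<dots> \<le> Hs z x + exp ?T * Hc z" using DH[of z x] UG[of z x] by (simp add: mult.commute)
    finally show "norm (d z i x) \<le> norm (Hs z x + exp ?T * Hc z)" by simp
  qed
qed

section \<open>Oscillating Volterra systems with weighted coefficients\<close>

definition L21b :: "(real \<Rightarrow> complex) \<Rightarrow> real \<Rightarrow> bool" where
  "L21b f B \<longleftrightarrow> L2b (\<lambda>x. jbracket x *\<^sub>R f x) B"

lemma jbracket_measurable [measurable]: "jbracket \<in> borel_measurable borel"
  unfolding jbracket_def[abs_def] by measurable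

lemma jbracket_ge: "1 \<le> jbracket x" "\<bar>x\<bar> \<le> jbracket x" "0 < jbracket x"
proof -
  show "1 \<le> jbracket x" unfolding jbracket_def by (rule real_le_rsqrt) simp
  thus "0 < jbracket x" by linarith
  show "\<bar>x\<bar> \<le> jbracket x" unfolding jbracket_def by (rule real_le_rsqrt) simp
qed

lemma L21b_measurable: assumes "L21b f B" shows "f \<in> borel_measurable borel"
proof -
  have [measurable]: "(\<lambda>x. jbracket x *\<^sub>R f x) \<in> borel_measurable borel" using assms unfolding L21b_def by (rule L2bD)
  have "f = (\<lambda>x. (1 / jbracket x) *\<^sub>R (jbracket x *\<^sub>R f x))" using jbracket_ge(3) by (auto simp: fun_eq_iff less_imp_neq[symmetric])
  also have "\<dots> \<in> borel_measurable borel" by measurable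
  finally show ?thesis .
qed

lemma L21b_nonneg: "L21b f B \<Longrightarrow> 0 \<le> B" unfolding L21b_def by (rule L2bD(2))

lemma L21b_L2b: assumes "L21b f B" shows "L2b f B" "L2b (\<lambda>x. complex_of_real x * f x) B"
proof -
  have [measurable]: "f \<in> borel_measurable borel" by (rule L21b_measurable[OF assms])
  have a: "L2b (\<lambda>x. jbracket x *\<^sub>R f x) B" using assms unfolding L21b_def .
  show "L2b f B" by (rule L2b_mono[OF a]) (use jbracket_ge mult_right_mono[OF jbracket_ge(1) norm_ge_zero] in \<open>auto simp: abs_of_pos\<close>)
  show "L2b (\<lambda>x. complex_of_real x * f x) B"
    by (rule L2b_mono[OF a]) (use jbracket_ge in \<open>auto simp: norm_mult abs_of_pos intro!: mult_right_mono\<close>)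
qed

lemma nn_integral_inverse_one_plus_square: "(\<integral>\<^sup>+x. ennreal (1 / (1 + x\<^sup>2)) \<partial>lborel) = ennreal pi"
proof -
  have *: "set_integrable lborel (einterval (-\<infinity>) \<infinity>) (\<lambda>x::real. 1 / (1 + x\<^sup>2))"
    "(LBINT x=-\<infinity>..\<infinity>. 1 / (1 + x\<^sup>2)) = pi / 2 - (- (pi / 2))"
  proof (rule_tac [!] interval_integral_FTC_nonneg[where F=arctan])
    show "DERIV arctan x :> 1 / (1 + x\<^sup>2)" for x using DERIV_arctan[of x] by (simp add: divide_inverse)
    show "DERIV arctan x :> 1 / (1 + x\<^sup>2)" for x using DERIV_arctan[of x] by (simp add: divide_inverse)
    show "isCont (\<lambda>x. 1 / (1 + x\<^sup>2)) x" for x :: real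
      by (intro continuous_intros) (metis add_pos_nonneg less_numeral_extra(1) less_numeral_extra(3) zero_le_power2)
    show "isCont (\<lambda>x. 1 / (1 + x\<^sup>2)) x" for x :: real
      by (intro continuous_intros) (metis add_pos_nonneg less_numeral_extra(1) less_numeral_extra(3) zero_le_power2)
    show "((arctan \<circ> real_of_ereal) \<longlongrightarrow> - (pi / 2)) (at_right (- \<infinity>))"
      using tendsto_arctan_at_bot by (simp only: ereal_tendsto_simps1)
    show "((arctan \<circ> real_of_ereal) \<longlongrightarrow> - (pi / 2)) (at_right (- \<infinity>))"
      using tendsto_arctan_at_bot by (simp only: ereal_tendsto_simps1)
    show "((arctan \<circ> real_of_ereal) \<longlongrightarrow> pi / 2) (at_left \<infinity>)"
      using tendsto_arctan_at_top by (simp only: ereal_tendsto_simps1)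
    show "((arctan \<circ> real_of_ereal) \<longlongrightarrow> pi / 2) (at_left \<infinity>)"
      using tendsto_arctan_at_top by (simp only: ereal_tendsto_simps1)
  qed auto
  have e: "einterval (-\<infinity>) \<infinity> = UNIV" by (auto simp: einterval_def)
  have i: "integrable lborel (\<lambda>x::real. 1 / (1 + x\<^sup>2))" using *(1) unfolding e set_integrable_def by simp
  have "(LINT x|lborel. 1 / (1 + x\<^sup>2)) = pi" using *(2) unfolding interval_lebesgue_integral_def e set_lebesgue_integral_def by simp
  thus ?thesis using nn_integral_eq_integral[OF i] by simp
qed

lemma ennreal_power2_le:
  fixes a :: ennreal assumes "a\<^sup>2 \<le> (ennreal b)\<^sup>2" "0 \<le> b" shows "a \<le> ennreal b"
proof (cases a)
  case (real r)
  hence "r\<^sup>2 \<le> b\<^sup>2" using assms by (simp add: ennreal_power)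
  thus ?thesis using real assms(2) by (auto intro: power2_le_imp_le ennreal_leI)
next
  case top
  thus ?thesis using assms by (simp add: power2_eq_square ennreal_top_mult top_unique ennreal_mult[symmetric])
qed

text \<open>Cauchy-Schwarz against 1/<x>, whose square has integral pi. The resulting sqrt pi is
  rounded up to 2; this 2 recurs in the constants below and in the sup bound for potentials.\<close>

lemma L21b_integrable:
  assumes "L21b f B" shows "integrable lborel f" "(LINT x|lborel. cmod (f x)) \<le> 2 * B"
proof -
  have [measurable]: "f \<in> borel_measurable borel" by (rule L21b_measurable[OF assms])
  have B: "0 \<le> B" by (rule L21b_nonneg[OF assms])
  have "(\<integral>\<^sup>+x. ennreal (cmod (f x)) \<partial>lborel) = (\<integral>\<^sup>+x. ennreal (1 / jbracket x) * ennreal (jbracket x * cmod (f x)) \<partial>lborel)"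
    using jbracket_ge(3) by (intro nn_integral_cong) (auto simp: ennreal_mult[symmetric] less_imp_le less_imp_neq[symmetric])
  hence "(\<integral>\<^sup>+x. ennreal (cmod (f x)) \<partial>lborel)\<^sup>2 = (\<integral>\<^sup>+x. ennreal (1 / jbracket x) * ennreal (jbracket x * cmod (f x)) \<partial>lborel)\<^sup>2" by simp
  also have "\<dots> \<le> (\<integral>\<^sup>+x. (ennreal (1 / jbracket x))\<^sup>2 \<partial>lborel) * (\<integral>\<^sup>+x. (ennreal (jbracket x * cmod (f x)))\<^sup>2 \<partial>lborel)"
    by (rule Cauchy_Schwarz_nn_integral) measurable
  also have "(\<integral>\<^sup>+x. (ennreal (1 / jbracket x))\<^sup>2 \<partial>lborel) = (\<integral>\<^sup>+x. ennreal (1 / (1 + x\<^sup>2)) \<partial>lborel)"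
    using jbracket_ge(3) by (intro nn_integral_cong) (auto simp: ennreal_power less_imp_le power_divide jbracket_def)
  also have "(\<integral>\<^sup>+x. (ennreal (jbracket x * cmod (f x)))\<^sup>2 \<partial>lborel) = (\<integral>\<^sup>+x. ennreal ((norm (jbracket x *\<^sub>R f x))\<^sup>2) \<partial>lborel)"
    using jbracket_ge(3) by (intro nn_integral_cong) (auto simp: ennreal_power less_imp_le abs_of_pos)
  also have "(\<integral>\<^sup>+x. ennreal (1 / (1 + x\<^sup>2)) \<partial>lborel) * (\<integral>\<^sup>+x. ennreal ((norm (jbracket x *\<^sub>R f x))\<^sup>2) \<partial>lborel) \<le> ennreal pi * ennreal (B\<^sup>2)"
    unfolding nn_integral_inverse_one_plus_square using assms unfolding L21b_def by (intro mult_left_mono L2bD(3)) auto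
  also have "\<dots> \<le> ennreal (4 * B\<^sup>2)"
    unfolding ennreal_mult[OF pi_ge_zero zero_le_power2, symmetric] using pi_less_4 by (intro ennreal_leI mult_right_mono) auto
  also have "ennreal (4 * B\<^sup>2) = (ennreal (2 * B))\<^sup>2" using B by (simp add: ennreal_power power_mult_distrib)
  finally have le: "(\<integral>\<^sup>+x. ennreal (cmod (f x)) \<partial>lborel) \<le> ennreal (2 * B)"
    using B by (intro ennreal_power2_le) auto
  have "(\<integral>\<^sup>+x. ennreal (cmod (f x)) \<partial>lborel) < \<infinity>" by (rule le_less_trans[OF le]) simp
  thus i: "integrable lborel f" by (intro integrableI_bounded) auto
  have "ennreal (LINT x|lborel. cmod (f x)) \<le> ennreal (2 * B)"
    using le nn_integral_eq_integral[of lborel "\<lambda>x. cmod (f x)"] i by simp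
  thus "(LINT x|lborel. cmod (f x)) \<le> 2 * B" using B by simp
qed

lemma L21b_mult:
  assumes f: "L21b f B" and m: "g \<in> borel_measurable borel" and g: "\<And>x. cmod (g x) \<le> c"
  shows "L21b (\<lambda>x. g x * f x) (c * B)"
proof -
  have "L2b (\<lambda>x. g x * (jbracket x *\<^sub>R f x)) (c * B)" by (rule L2b_mult[OF f[unfolded L21b_def] m g])
  thus ?thesis unfolding L21b_def by simp
qed

lemma L21b_add: "L21b f A \<Longrightarrow> L21b g B \<Longrightarrow> L21b (\<lambda>x. f x + g x) (A + B)"
  unfolding L21b_def scaleR_add_right by (rule L2b_add)

lemma L21b_diff: "L21b f A \<Longrightarrow> L21b g B \<Longrightarrow> L21b (\<lambda>x. f x - g x) (A + B)"
  unfolding L21b_def scaleR_diff_right by (rule L2b_diff)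

lemma L21b_mono: assumes "L21b g B" "f \<in> borel_measurable borel" "\<And>x. cmod (f x) \<le> cmod (g x)" shows "L21b f B"
  using assms unfolding L21b_def
  by (elim L2b_mono) (auto intro!: mult_left_mono)

lemma L21b_bound_mono: "L21b f A \<Longrightarrow> A \<le> B \<Longrightarrow> L21b f B"
  unfolding L21b_def by (rule L2b_bound_mono)

lemma L21b_zero [simp]: "0 \<le> B \<Longrightarrow> L21b (\<lambda>x. 0) B"
  unfolding L21b_def by simp

lemma section_measurable:
  assumes [measurable]: "(\<lambda>p. F (fst p) (snd p)) \<in> measurable (borel \<Otimes>\<^sub>M borel) N"
  shows "F z \<in> measurable borel N" and "(\<lambda>z. F z y) \<in> measurable borel N"
    and "(\<lambda>p. F (snd p) (fst p)) \<in> measurable (borel \<Otimes>\<^sub>M borel) N"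
proof -
  have "(\<lambda>y. (\<lambda>p. F (fst p) (snd p)) (z, y)) \<in> measurable borel N" by measurable
  thus "F z \<in> measurable borel N" by simp
  have "(\<lambda>z. (\<lambda>p. F (fst p) (snd p)) (z, y)) \<in> measurable borel N" by measurable
  thus "(\<lambda>z. F z y) \<in> measurable borel N" by simp
  have "(\<lambda>q. (\<lambda>p. F (fst p) (snd p)) (snd q, fst q)) \<in> measurable (borel \<Otimes>\<^sub>M borel) N" by measurable
  thus "(\<lambda>p. F (snd p) (fst p)) \<in> measurable (borel \<Otimes>\<^sub>M borel) N" by simp
qed

lemma shift_measurable:
  fixes F :: "real \<Rightarrow> real \<Rightarrow> _"
  assumes [measurable]: "(\<lambda>p. F (fst p) (snd p)) \<in> measurable (borel \<Otimes>\<^sub>M borel) N"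
  shows "(\<lambda>p. F (fst p + h) (snd p)) \<in> measurable (borel \<Otimes>\<^sub>M borel) N"
proof -
  have "(\<lambda>q. (\<lambda>p. F (fst p) (snd p)) (fst q + h, snd q)) \<in> measurable (borel \<Otimes>\<^sub>M borel) N" by measurable
  thus ?thesis by simp
qed

definition iker :: "('n \<Rightarrow> 'n \<Rightarrow> real) \<Rightarrow> ('n \<Rightarrow> 'n \<Rightarrow> real \<Rightarrow> complex) \<Rightarrow> real \<Rightarrow> 'n \<Rightarrow> 'n \<Rightarrow> real \<Rightarrow> complex" where
  "iker c M z i j y = cis (2 * z * c i j * y) * M i j y"

definition ksum :: "('n::finite \<Rightarrow> 'n \<Rightarrow> real \<Rightarrow> complex) \<Rightarrow> real \<Rightarrow> real" where
  "ksum M y = (\<Sum>i\<in>UNIV. \<Sum>j\<in>UNIV. cmod (M i j y))"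

text \<open>Collects what the estimates use of a solution and so separates them from the Picard
  construction. The last conjunct is the exponential bound of \<open>volsol_bound\<close>.\<close>

definition isol :: "('n::finite \<Rightarrow> 'n \<Rightarrow> real) \<Rightarrow> ('n \<Rightarrow> 'n \<Rightarrow> real \<Rightarrow> complex) \<Rightarrow> ('n \<Rightarrow> complex) \<Rightarrow> (real \<Rightarrow> 'n \<Rightarrow> real \<Rightarrow> complex) \<Rightarrow> bool" where
  "isol c M e f \<longleftrightarrow> (\<forall>i. (\<lambda>p. f (fst p) i (snd p)) \<in> borel_measurable (borel \<Otimes>\<^sub>M borel)) \<and>
     (\<forall>z i x. f z i x = e i + cum (\<lambda>y. \<Sum>j\<in>UNIV. iker c M z i j y * f z j y) x) \<and>
     (\<forall>z x. (\<Sum>i\<in>UNIV. cmod (f z i x)) \<le> (\<Sum>i\<in>UNIV. cmod (e i)) * exp (LINT y|lborel. ksum M y))"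

text \<open>Difference quotient in z of the phase \<open>cis (2 * z * c * y)\<close>, divided by
  that phase; the result is independent of z.\<close>

definition difq :: "real \<Rightarrow> real \<Rightarrow> real \<Rightarrow> complex" where
  "difq h c y = (cis (2 * h * c * y) - 1) / complex_of_real h"

lemma difq_measurable [measurable]: "difq h c \<in> borel_measurable borel"
  unfolding difq_def[abs_def] by measurable

lemma cmod_cis_minus_1: "cmod (cis t - 1) \<le> \<bar>t\<bar>"
  using iexp_approx1[of t 0] by (simp add: cis_conv_exp)

text \<open>The first bound is uniform in h and costs the factor |y| that the weight absorbs. The
  second is uniform in y for fixed h and gives the integrability of difference quotients of the
  kernel.\<close>

lemma difq_bound: assumes "h \<noteq> 0" "\<bar>c\<bar> \<le> 1" shows "cmod (difq h c y) \<le> 2 * \<bar>y\<bar>" "cmod (difq h c y) \<le> 2 / \<bar>h\<bar>"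
proof -
  have "cmod (cis (2 * h * c * y) - 1) \<le> \<bar>2 * h * c * y\<bar>" by (rule cmod_cis_minus_1)
  also have "\<dots> = (2 * \<bar>h\<bar> * \<bar>y\<bar>) * \<bar>c\<bar>" by (simp add: abs_mult)
  also have "\<dots> \<le> (2 * \<bar>h\<bar> * \<bar>y\<bar>) * 1" using assms by (intro mult_left_mono) auto
  finally show "cmod (difq h c y) \<le> 2 * \<bar>y\<bar>" using assms by (simp add: difq_def norm_divide field_simps)
  have "cmod (cis (2 * h * c * y) - 1) \<le> 2" using norm_triangle_ineq4[of "cis (2 * h * c * y)" 1] by simp
  thus "cmod (difq h c y) \<le> 2 / \<bar>h\<bar>" by (simp add: difq_def norm_divide divide_right_mono)
qed

lemma difq_zero [simp]: "difq h 0 y = 0" by (simp add: difq_def)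

locale osc =
  fixes c :: "'n::finite \<Rightarrow> 'n \<Rightarrow> real" and e :: "'n \<Rightarrow> complex"
  assumes c_cases: "\<And>i j. c i j = 0 \<or> (c i j)\<^sup>2 = 1"
begin

lemma c_abs: "\<bar>c i j\<bar> \<le> 1" using c_cases[of i j] by (auto simp: power2_eq_1_iff)

text \<open>An entry with \<open>c i j = 0\<close> and \<open>e j \<noteq> 0\<close> would
  contribute \<open>e j * cum (M i j) x\<close> to the first iterate, a constant in z; such entries
  have to vanish for an L^2 statement.\<close>

definition adm :: "('n \<Rightarrow> 'n \<Rightarrow> real \<Rightarrow> complex) \<Rightarrow> real \<Rightarrow> bool" where
  "adm M B \<longleftrightarrow> (\<forall>i j. L21b (M i j) B) \<and> (\<forall>i j. c i j = 0 \<longrightarrow> e j \<noteq> 0 \<longrightarrow> M i j = (\<lambda>_. 0))"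

text \<open>Origin of the constants, for entries bounded by B: \<open>TB\<close> bounds the kernel
  mass, \<open>EB\<close> the solution, \<open>R\<close> its initial value plus the mass of its
  integrand, and \<open>G\<close> is the Gronwall factor. \<open>C3\<close> and \<open>C5\<close>
  bound f - e and its quotients in L^2; \<open>C4\<close> and \<open>C6\<close> are the
  corresponding Lipschitz constants. \<open>S2\<close> and \<open>R2\<close> control a difference of
  solutions in the sup norm and in the mass of its integrand.\<close>

definition "n = real CARD('n)"
definition "E = (\<Sum>i\<in>UNIV. cmod (e i))"
definition "TB B = 2 * n\<^sup>2 * B"
definition "EB B = E * exp (TB B)"
definition "R B = E + TB B * EB B"
definition "G B = n * (1 + TB B * exp (TB B))"
definition "C3 B = G B * (n * (2 * B) * (2 * E))"
definition "S2 B = 2 * n\<^sup>2 * EB B * exp (TB B)"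
definition "C4 B = G B * (n * 2 * (2 * R B + C3 B))"
definition "C5 B = G B * (n * (2 * B) * (2 * R B))"
definition "R2 B = TB B * S2 B + 2 * n\<^sup>2 * EB B"
definition "C6 B = G B * (n * C5 B + n * (2 * B) * (2 * R2 B) + n * (2 * R B))"

lemma n_pos: "0 < n" unfolding n_def by simp
lemma E_nonneg: "0 \<le> E" unfolding E_def by (simp add: sum_nonneg)

lemma nonneg: assumes "0 \<le> B"
  shows "0 \<le> TB B" "0 \<le> EB B" "0 \<le> R B" "0 \<le> G B" "0 \<le> C3 B" "0 \<le> S2 B" "0 \<le> C4 B" "0 \<le> C5 B" "0 \<le> R2 B" "0 \<le> C6 B"
  using assms n_pos E_nonneg
  unfolding TB_def EB_def R_def G_def C3_def S2_def C4_def C5_def R2_def C6_def by auto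

lemma ksum_integral:
  fixes M :: "'n \<Rightarrow> 'n \<Rightarrow> real \<Rightarrow> complex"
  assumes "\<And>i j. L21b (M i j) B"
  shows "integrable lborel (ksum M)" "(LINT y|lborel. ksum M y) \<le> TB B"
proof -
  have i: "integrable lborel (\<lambda>y. cmod (M i j y))" for i j using L21b_integrable(1)[OF assms] by simp
  show "integrable lborel (ksum M)" unfolding ksum_def[abs_def] using i by simp
  have "(LINT y|lborel. ksum M y) = (\<Sum>i\<in>UNIV. \<Sum>j\<in>UNIV. LINT y|lborel. cmod (M i j y))" unfolding ksum_def using i by simp
  also have "\<dots> \<le> (\<Sum>i\<in>(UNIV::'n set). \<Sum>j\<in>(UNIV::'n set). 2 * B)" by (intro sum_mono L21b_integrable(2)[OF assms])
  also have "\<dots> = TB B" by (simp add: TB_def n_def power2_eq_square)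
  finally show "(LINT y|lborel. ksum M y) \<le> TB B" .
qed

lemma ksum_nonneg: "0 \<le> ksum M y" unfolding ksum_def by (simp add: sum_nonneg)

lemma admD: assumes "adm M B" shows "L21b (M i j) B" "M i j \<in> borel_measurable borel" "integrable lborel (ksum M)" "(LINT y|lborel. ksum M y) \<le> TB B" "0 \<le> B"
  "c i j = 0 \<Longrightarrow> e j \<noteq> 0 \<Longrightarrow> M i j = (\<lambda>_. 0)"
proof -
  show *: "L21b (M i j) B" for i j using assms unfolding adm_def by auto
  show "M i j \<in> borel_measurable borel" by (rule L21b_measurable[OF *])
  show "integrable lborel (ksum M)" "(LINT y|lborel. ksum M y) \<le> TB B" by (rule ksum_integral[OF *])+
  show "0 \<le> B" by (rule L21b_nonneg[OF *])
  show "c i j = 0 \<Longrightarrow> e j \<noteq> 0 \<Longrightarrow> M i j = (\<lambda>_. 0)" using assms unfolding adm_def by auto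
qed

lemma iker_measurable:
  fixes M :: "'n \<Rightarrow> 'n \<Rightarrow> real \<Rightarrow> complex"
  assumes [measurable]: "M i j \<in> borel_measurable borel"
  shows "(\<lambda>p. iker c M (fst p) i j (snd p)) \<in> borel_measurable (borel \<Otimes>\<^sub>M borel)" "iker c M z i j \<in> borel_measurable borel"
  unfolding iker_def[abs_def] by measurable

lemma iker_sum: "(\<Sum>i\<in>UNIV. \<Sum>j\<in>UNIV. cmod (iker c M z i j y)) = ksum M y"
  unfolding iker_def ksum_def by (simp add: norm_mult)

lemma vol:
  fixes M :: "'n \<Rightarrow> 'n \<Rightarrow> real \<Rightarrow> complex"
  assumes "\<And>i j. L21b (M i j) B" shows "volterra (\<lambda>i j x y. iker c M z i j y) (ksum M)"
proof
  have [measurable]: "M i j \<in> borel_measurable borel" for i j by (rule L21b_measurable[OF assms])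
  have [measurable]: "iker c M z i j \<in> borel_measurable borel" for i j by (rule iker_measurable) measurable
  show "(\<lambda>p. iker c M z i j (snd p)) \<in> borel_measurable (borel \<Otimes>\<^sub>M borel)" for i j by measurable
  show "(\<Sum>i\<in>UNIV. \<Sum>j\<in>UNIV. cmod (iker c M z i j y)) \<le> ksum M y" for y by (simp add: iker_sum)
  show "integrable lborel (ksum M)" by (rule ksum_integral[OF assms])
qed

lemma isolD:
  assumes "adm M B" "isol c M e f"
  shows "(\<lambda>p. f (fst p) i (snd p)) \<in> borel_measurable (borel \<Otimes>\<^sub>M borel)"
    "f z i \<in> borel_measurable borel"
    "f z i x = e i + cum (\<lambda>y. \<Sum>j\<in>UNIV. iker c M z i j y * f z j y) x"
    "(\<Sum>i\<in>UNIV. cmod (f z i x)) \<le> EB B" "cmod (f z i x) \<le> EB B"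
    "integrable lborel (\<lambda>y. \<Sum>j\<in>UNIV. iker c M z i j y * f z j y)"
    "cmod (\<Sum>j\<in>UNIV. iker c M z i j y * f z j y) \<le> ksum M y * EB B"
    "(\<lambda>p. \<Sum>j\<in>UNIV. iker c M (fst p) i j (snd p) * f (fst p) j (snd p)) \<in> borel_measurable (borel \<Otimes>\<^sub>M borel)"
proof -
  note sol = assms(2)[unfolded isol_def]
  show *: "(\<lambda>p. f (fst p) i (snd p)) \<in> borel_measurable (borel \<Otimes>\<^sub>M borel)" for i by (rule sol[THEN conjunct1, rule_format])
  show m: "f z i \<in> borel_measurable borel" for z i using section_measurable(1)[of "\<lambda>z x. f z i x", OF *] by simp
  show "f z i x = e i + cum (\<lambda>y. \<Sum>j\<in>UNIV. iker c M z i j y * f z j y) x"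
    by (rule sol[THEN conjunct2, THEN conjunct1, rule_format])
  show b: "(\<Sum>i\<in>UNIV. cmod (f z i x)) \<le> EB B" for z x
  proof -
    have "(\<Sum>i\<in>UNIV. cmod (f z i x)) \<le> E * exp (LINT y|lborel. ksum M y)" unfolding E_def by (rule sol[THEN conjunct2, THEN conjunct2, rule_format])
    also have "\<dots> \<le> EB B" unfolding EB_def using admD(4)[OF assms(1)] E_nonneg by (intro mult_left_mono) auto
    finally show ?thesis .
  qed
  show "cmod (f z i x) \<le> EB B" by (rule order_trans[OF _ b[of z x]]) (rule member_le_sum, auto)
  interpret V: volterra "\<lambda>i j x y. iker c M z i j y" "ksum M" e for z by (rule vol[OF admD(1)[OF assms(1)]])
  show "integrable lborel (\<lambda>y. \<Sum>j\<in>UNIV. iker c M z i j y * f z j y)"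
    by (rule V.apply_integrable[OF m b])
  show "cmod (\<Sum>j\<in>UNIV. iker c M z i j y * f z j y) \<le> ksum M y * EB B"
    by (rule order_trans[OF V.apply_le1]) (intro mult_left_mono b ksum_nonneg)
  show "(\<lambda>p. \<Sum>j\<in>UNIV. iker c M (fst p) i j (snd p) * f (fst p) j (snd p)) \<in> borel_measurable (borel \<Otimes>\<^sub>M borel)"
    using * iker_measurable(1)[OF admD(2)[OF assms(1)]] by measurable
qed

text \<open>The shift t is there for difference quotients, whose equation has the kernel at z + h;
  the modulus of \<open>iker\<close> does not depend on z. The bound \<open>D\<close> only
  guarantees the boundedness that Gronwall's inequality presupposes and leaves no trace in the
  result.\<close>

lemma gron:
  assumes M: "adm M B"
    and dm: "\<And>i. (\<lambda>p. d (fst p) i (snd p)) \<in> borel_measurable (borel \<Otimes>\<^sub>M borel)"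
    and db: "\<And>z i y. cmod (d z i y) \<le> D"
    and eq: "\<And>z i x. d z i x = H z i x + cum (\<lambda>y. \<Sum>j\<in>UNIV. iker c M (z + t) i j y * d z j y) x"
    and H: "\<And>i x. L2b (\<lambda>z. H z i x) h"
  shows "L2b (\<lambda>z. d z i x) (G B * h)"
proof -
  let ?T = "LINT y|lborel. ksum M y"
  have "L2b (\<lambda>z. d z i x) (real CARD('n) * h * (1 + ?T * exp ?T))"
  proof (rule L2b_Gronwall[OF admD(3)[OF M] _ _ dm db eq H])
    show "(\<Sum>i\<in>UNIV. \<Sum>j\<in>UNIV. cmod (iker c M (z + t) i j y)) \<le> ksum M y" for z y by (simp add: iker_sum)
    show "(\<lambda>p. iker c M (fst p + t) i j (snd p)) \<in> borel_measurable (borel \<Otimes>\<^sub>M borel)" for i j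
      by (rule shift_measurable) (rule iker_measurable(1)[OF admD(2)[OF M]])
  qed
  moreover have "real CARD('n) * h * (1 + ?T * exp ?T) \<le> real CARD('n) * h * (1 + TB B * exp (TB B))"
    using admD(4)[OF M] L2bD(2)[OF H] nonneg[OF admD(5)[OF M]]
    by (intro mult_left_mono add_mono mult_mono) auto
  ultimately show ?thesis unfolding G_def n_def by (elim L2b_bound_mono) (simp add: mult_ac)
qed

text \<open>The entries are treated according to their phase. For an oscillating one \<phi> only has
  to be controlled through initial value and mass of its integrand, at most \<open>Rb\<close>. A
  phase-free one must vanish or meet a \<phi> that is L^2 in z with bound \<Phi>; there \<alpha>
  also bounds the L^1 norm of the entry. All L^2 estimates of forcing terms that pair a phased
  kernel with a solution or a difference of solutions go through this lemma.\<close>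

lemma forcing:
  assumes A: "\<And>i j. integrable lborel (A i j)" and A2: "\<And>i j. L2b (A i j) \<alpha>"
    and gm: "\<And>j. (\<lambda>p. g (fst p) j (snd p)) \<in> borel_measurable (borel \<Otimes>\<^sub>M borel)"
    and g: "\<And>z j y. cmod (g z j y) \<le> \<gamma> y" and \<gamma>: "integrable lborel \<gamma>"
    and \<phi>: "\<And>z j y. \<phi> z j y = \<epsilon> j + cum (g z j) y"
    and c0: "\<And>i j. c i j = 0 \<Longrightarrow> A i j = (\<lambda>_. 0) \<or> ((LINT y|lborel. cmod (A i j y)) \<le> \<alpha> \<and> (\<forall>y. L2b (\<lambda>z. \<phi> z j y) \<Phi>))"
    and \<Phi>: "0 \<le> \<Phi>" and Rb: "\<And>j. cmod (\<epsilon> j) + (LINT y|lborel. \<gamma> y) \<le> Rb"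
  shows "L2b (\<lambda>z. cum (\<lambda>y. \<Sum>j\<in>UNIV. iker c A z i j y * \<phi> z j y) x) (n * \<alpha> * (2 * Rb + \<Phi>))"
proof -
  note [measurable] = gm
  have \<gamma>0: "0 \<le> \<gamma> y" for y using g[of 0 undefined y] norm_ge_zero order_trans by blast
  have g\<gamma>: "0 \<le> (LINT y|lborel. \<gamma> y)" using \<gamma>0 by simp
  have Rb0: "0 \<le> Rb" using Rb[of undefined] g\<gamma> norm_ge_zero[of "\<epsilon> undefined"] by linarith
  have \<alpha>0: "0 \<le> \<alpha>" using L2bD(2)[OF A2] .
  have [measurable]: "A i j \<in> borel_measurable borel" for i j using L2bD[OF A2] by auto
  have g1: "g z j \<in> borel_measurable borel" for z j using section_measurable(1)[of "\<lambda>z x. g z j x", OF gm] by simp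
  have gi: "integrable lborel (g z j)" for z j
    by (rule Bochner_Integration.integrable_bound[OF \<gamma>]) (use g \<gamma>0 g1 in auto)
  have gm3 [measurable]: "(\<lambda>q. g (fst (fst q)) j (snd q)) \<in> borel_measurable ((borel \<Otimes>\<^sub>M borel) \<Otimes>\<^sub>M borel)" for j
  proof -
    have "(\<lambda>q. (\<lambda>p. g (fst p) j (snd p)) (fst (fst q), snd q)) \<in> borel_measurable ((borel \<Otimes>\<^sub>M borel) \<Otimes>\<^sub>M borel)" by measurable
    thus ?thesis by simp
  qed
  have \<phi>m: "(\<lambda>p. \<phi> (fst p) j (snd p)) \<in> borel_measurable (borel \<Otimes>\<^sub>M borel)" for j
    unfolding \<phi> by measurable
  have \<phi>1: "\<phi> z j \<in> borel_measurable borel" for z j using section_measurable(1)[of "\<lambda>z x. \<phi> z j x", OF \<phi>m] by simp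
  have \<phi>b: "cmod (\<phi> z j y) \<le> Rb" for z j y
  proof -
    have "cmod (\<phi> z j y) \<le> cmod (\<epsilon> j) + cmod (cum (g z j) y)" unfolding \<phi> by (rule norm_triangle_ineq)
    also have "cmod (cum (g z j) y) \<le> (LINT y|lborel. cmod (g z j y))" by (rule norm_cum_le[OF gi])
    also have "\<dots> \<le> (LINT y|lborel. \<gamma> y)" using g gi by (intro integral_mono \<gamma>) auto
    finally show ?thesis using Rb[of j] by linarith
  qed
  have kb: "cmod (iker c A z i j y) \<le> cmod (A i j y)" for z i j y by (simp add: iker_def norm_mult)
  have ki: "integrable lborel (\<lambda>y. iker c A z i j y * \<phi> z j y)" for z i j
  proof (rule integrable_bounded_mult[OF _ \<phi>1 \<phi>b])
    show "integrable lborel (iker c A z i j)"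
      by (rule Bochner_Integration.integrable_bound[OF A[of i j]]) (auto simp: kb intro: iker_measurable)
  qed
  have trm: "L2b (\<lambda>z. cum (\<lambda>y. iker c A z i j y * \<phi> z j y) x) (\<alpha> * (2 * Rb + \<Phi>))" for j
  proof (cases "c i j = 0")
    case False
    hence "(c i j)\<^sup>2 = 1" using c_cases by blast
    have "L2b (\<lambda>z. cum (\<lambda>y. cis (2 * z * c i j * y) * A i j y * \<phi> z j y) x) (2 * \<alpha> * (cmod (\<epsilon> j) + (LINT y|lborel. \<gamma> y)))"
      by (rule L2b_oscillatory[where g="\<lambda>z. g z j"]) (use A A2 gm g \<gamma> \<phi> \<open>(c i j)\<^sup>2 = 1\<close> in auto)
    moreover have "2 * \<alpha> * (cmod (\<epsilon> j) + (LINT y|lborel. \<gamma> y)) \<le> 2 * \<alpha> * Rb" using Rb \<alpha>0 by (intro mult_left_mono) auto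
    moreover have "2 * \<alpha> * Rb \<le> \<alpha> * (2 * Rb + \<Phi>)" using \<alpha>0 \<Phi> by (simp add: algebra_simps)
    ultimately show ?thesis unfolding iker_def by (elim L2b_bound_mono) linarith
  next
    case True
    consider "A i j = (\<lambda>_. 0)" | "(LINT y|lborel. cmod (A i j y)) \<le> \<alpha>" "\<And>y. L2b (\<lambda>z. \<phi> z j y) \<Phi>" using c0[OF True] by blast
    thus ?thesis
    proof cases
      case 1
      then show ?thesis using \<alpha>0 Rb0 \<Phi> by (simp add: iker_def cum_def)
    next
      case 2
      have "L2b (\<lambda>z. cum (\<lambda>y. iker c A z i j y * \<phi> z j y) x) ((LINT y|lborel. cmod (A i j y)) * \<Phi>)"
        by (rule L2b_cum_weighted[OF _ kb _ \<phi>m \<phi>b]) (use A 2 iker_measurable in auto)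
      moreover have "(LINT y|lborel. cmod (A i j y)) * \<Phi> \<le> \<alpha> * \<Phi>" using 2 \<Phi> by (intro mult_right_mono) auto
      moreover have "\<alpha> * \<Phi> \<le> \<alpha> * (2 * Rb + \<Phi>)" using \<alpha>0 Rb0 by (intro mult_left_mono) auto
      ultimately show ?thesis by (elim L2b_bound_mono) linarith
    qed
  qed
  have "L2b (\<lambda>z. \<Sum>j\<in>UNIV. cum (\<lambda>y. iker c A z i j y * \<phi> z j y) x) (\<Sum>j\<in>(UNIV::'n set). \<alpha> * (2 * Rb + \<Phi>))"
    by (intro L2b_sum trm) auto
  moreover have "(\<Sum>j\<in>UNIV. cum (\<lambda>y. iker c A z i j y * \<phi> z j y) x) = cum (\<lambda>y. \<Sum>j\<in>UNIV. iker c A z i j y * \<phi> z j y) x" for z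
    using ki by (intro cum_sum[symmetric]) auto
  ultimately show ?thesis by (simp add: n_def mult.assoc)
qed

text \<open>Subtracting e leaves the kernel applied to e as forcing term, and f - e obeys the same
  equation. Each part of the forcing oscillates, or has \<open>e j = 0\<close>, or has a vanishing
  entry by \<open>adm\<close>.\<close>

lemma sol_minus_init_L2:
  assumes M: "adm M B" and f: "isol c M e f"
  shows "L2b (\<lambda>z. f z i x - e i) (C3 B)"
proof -
  note D = isolD[OF M f]
  have B: "0 \<le> B" by (rule admD(5)[OF M])
  interpret V: volterra "\<lambda>i j x y. iker c M z i j y" "ksum M" e for z by (rule vol[OF admD(1)[OF M]])
  have F: "L2b (\<lambda>z. cum (\<lambda>y. \<Sum>j\<in>UNIV. iker c M z i j y * e j) x) (n * (2 * B) * (2 * E + 0))" for i x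
  \<comment> \<open>The function \<phi> is the constant e, so its integrand \<open>g\<close> and the
    majorant \<gamma> are 0. Phase-free entries that survive meet \<open>e j = 0\<close>, hence
    \<Phi> = 0.\<close>
  proof (rule forcing[where g="\<lambda>_ _ _. 0" and \<gamma>="\<lambda>_. 0" and \<epsilon>=e])
    show "integrable lborel (M i j)" for i j by (rule L21b_integrable[OF admD(1)[OF M]])
    show "L2b (M i j) (2 * B)" for i j by (rule L2b_bound_mono[OF L21b_L2b(1)[OF admD(1)[OF M]]]) (use B in simp)
    show "e j = e j + cum (\<lambda>_. 0) y" for j y by (simp add: cum_def)
    show "cmod (e j) + (LINT y|lborel. 0) \<le> E" for j unfolding E_def using member_le_sum[of j UNIV "\<lambda>j. cmod (e j)"] by simp
    show "M i j = (\<lambda>_. 0) \<or> (LINT y|lborel. cmod (M i j y)) \<le> 2 * B \<and> (\<forall>y. L2b (\<lambda>z. e j) 0)" if "c i j = 0" for i j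
      using admD(6)[OF M that] L21b_integrable(2)[OF admD(1)[OF M]] by (cases "e j = 0") auto
  qed auto
  have "L2b (\<lambda>z. f z i x - e i) (G B * (n * (2 * B) * (2 * E + 0)))"
  proof (rule gron[OF M _ _ _ F, where t=0 and D="EB B + E"])
    show "(\<lambda>p. f (fst p) i (snd p) - e i) \<in> borel_measurable (borel \<Otimes>\<^sub>M borel)" for i using D(1) by measurable
    show "cmod (f z i y - e i) \<le> EB B + E" for z i y
    proof -
      have "cmod (e i) \<le> E" unfolding E_def by (rule member_le_sum) auto
      thus ?thesis using norm_triangle_ineq4[of "f z i y" "e i"] D(5)[of z i y] by linarith
    qed
    fix z i x
    have 1: "integrable lborel (\<lambda>y. \<Sum>j\<in>UNIV. iker c M z i j y * e j)"
      by (rule V.apply_integrable[where B=E]) (auto simp: E_def)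
    have 2: "integrable lborel (\<lambda>y. \<Sum>j\<in>UNIV. iker c M z i j y * (f z j y - e j))"
      using Bochner_Integration.integrable_diff[OF D(6)[of z i] 1] by (simp add: sum_subtractf right_diff_distrib)
    have "f z i x - e i = cum (\<lambda>y. \<Sum>j\<in>UNIV. iker c M z i j y * f z j y) x" by (subst D(3)) simp
    also have "\<dots> = cum (\<lambda>y. (\<Sum>j\<in>UNIV. iker c M z i j y * e j) + (\<Sum>j\<in>UNIV. iker c M z i j y * (f z j y - e j))) x"
      by (simp add: sum.distrib[symmetric] algebra_simps)
    also have "\<dots> = cum (\<lambda>y. \<Sum>j\<in>UNIV. iker c M z i j y * e j) x + cum (\<lambda>y. \<Sum>j\<in>UNIV. iker c M z i j y * (f z j y - e j)) x"
      by (rule cum_add[OF 1 2])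
    finally show "f z i x - e i = cum (\<lambda>y. \<Sum>j\<in>UNIV. iker c M z i j y * e j) x + cum (\<lambda>y. \<Sum>j\<in>UNIV. iker c M (z + 0) i j y * (f z j y - e j)) x"
      by simp
  qed
  thus ?thesis unfolding C3_def by simp
qed

lemma sol_L2_phi:
  assumes M: "adm M B" and f: "isol c M e f" and e: "e j = 0"
  shows "L2b (\<lambda>z. f z j y) (C3 B)"
  using sol_minus_init_L2[OF M f, of j y] e by simp

end

context osc begin

lemma iker_integrable:
  assumes i: "integrable lborel (M i j)" shows "integrable lborel (iker c M z i j)"
proof (rule Bochner_Integration.integrable_bound[OF i])
  have [measurable]: "M i j \<in> borel_measurable borel" using borel_measurable_integrable[OF i] by simp
  show "iker c M z i j \<in> borel_measurable lborel" unfolding iker_def[abs_def] by measurable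
qed (auto simp: iker_def norm_mult)

lemma iker_diff: "iker c (\<lambda>i j y. M i j y - M' i j y) z i j y = iker c M z i j y - iker c M' z i j y"
  by (simp add: iker_def right_diff_distrib)

text \<open>The kernel difference acts on the second solution, the first kernel on the difference of
  the solutions. The first form is for Gronwall; the second shows the difference as one cumulative
  integral, the shape that \<open>forcing\<close> requires of \<phi>.\<close>

lemma sol_diff_eq:
  assumes M: "adm M B" and f: "isol c M e f" and M': "adm M' B'" and f': "isol c M' e f'"
  defines "\<Delta> \<equiv> \<lambda>i j y. M i j y - M' i j y"
  shows "f z i x - f' z i x = cum (\<lambda>y. \<Sum>j\<in>UNIV. iker c \<Delta> z i j y * f' z j y) x
     + cum (\<lambda>y. \<Sum>j\<in>UNIV. iker c M z i j y * (f z j y - f' z j y)) x" (is ?eq)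
    and "f z i x - f' z i x = 0 + cum (\<lambda>y. (\<Sum>j\<in>UNIV. iker c \<Delta> z i j y * f' z j y)
     + (\<Sum>j\<in>UNIV. iker c M z i j y * (f z j y - f' z j y))) x"
    and "integrable lborel (\<lambda>y. \<Sum>j\<in>UNIV. iker c \<Delta> z i j y * f' z j y)"
    and "integrable lborel (\<lambda>y. \<Sum>j\<in>UNIV. iker c M z i j y * (f z j y - f' z j y))"
proof -
  note D = isolD[OF M f] and D' = isolD[OF M' f']
  have \<Delta>: "L21b (\<Delta> i j) (B + B')" for i j
    unfolding \<Delta>_def using admD(1)[OF M] admD(1)[OF M'] by (rule L21b_diff)
  interpret V: volterra "\<lambda>i j x y. iker c M w i j y" "ksum M" e for w by (rule vol[OF admD(1)[OF M]])
  interpret V\<Delta>: volterra "\<lambda>i j x y. iker c \<Delta> w i j y" "ksum \<Delta>" e for w by (rule vol[OF \<Delta>])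
  show 1: "integrable lborel (\<lambda>y. \<Sum>j\<in>UNIV. iker c \<Delta> z i j y * f' z j y)"
    by (rule V\<Delta>.apply_integrable[OF D'(2,4)])
  have "(\<Sum>j\<in>UNIV. cmod (f z j y - f' z j y)) \<le> EB B + EB B'" for y
  proof -
    have "(\<Sum>j\<in>UNIV. cmod (f z j y - f' z j y)) \<le> (\<Sum>j\<in>UNIV. cmod (f z j y) + cmod (f' z j y))"
      by (intro sum_mono norm_triangle_ineq4)
    thus ?thesis using D(4)[of z y] D'(4)[of z y] by (simp add: sum.distrib)
  qed
  thus 2: "integrable lborel (\<lambda>y. \<Sum>j\<in>UNIV. iker c M z i j y * (f z j y - f' z j y))"
    by (intro V.apply_integrable[where B="EB B + EB B'"] borel_measurable_diff D(2) D'(2))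
  have "f z i x - f' z i x = cum (\<lambda>y. \<Sum>j\<in>UNIV. iker c M z i j y * f z j y) x - cum (\<lambda>y. \<Sum>j\<in>UNIV. iker c M' z i j y * f' z j y) x"
    by (subst D(3), subst D'(3)) simp
  also have "\<dots> = cum (\<lambda>y. (\<Sum>j\<in>UNIV. iker c M z i j y * f z j y) - (\<Sum>j\<in>UNIV. iker c M' z i j y * f' z j y)) x"
    by (rule cum_diff[OF D(6) D'(6), symmetric])
  also have "(\<lambda>y. (\<Sum>j\<in>UNIV. iker c M z i j y * f z j y) - (\<Sum>j\<in>UNIV. iker c M' z i j y * f' z j y))
     = (\<lambda>y. (\<Sum>j\<in>UNIV. iker c \<Delta> z i j y * f' z j y) + (\<Sum>j\<in>UNIV. iker c M z i j y * (f z j y - f' z j y)))"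
    unfolding \<Delta>_def iker_diff sum.distrib[symmetric] sum_subtractf[symmetric] by (simp add: algebra_simps)
  finally show *: "f z i x - f' z i x = 0 + cum (\<lambda>y. (\<Sum>j\<in>UNIV. iker c \<Delta> z i j y * f' z j y)
     + (\<Sum>j\<in>UNIV. iker c M z i j y * (f z j y - f' z j y))) x" by simp
  show ?eq using * unfolding cum_add[OF 1 2] add_0_left .
qed

text \<open>A bound uniform in z rather than in L^2. It is used to control the mass of the integrand
  behind f - f' in \<open>sol_diff_forcing\<close>.\<close>

lemma sup_diff:
  assumes M: "adm M B" and f: "isol c M e f" and M': "adm M' B" and f': "isol c M' e f'"
    and \<delta>: "\<And>i j. L21b (\<lambda>y. M i j y - M' i j y) \<delta>"
  shows "(\<Sum>i\<in>UNIV. cmod (f z i x - f' z i x)) \<le> S2 B * \<delta>"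
proof -
  note D = isolD[OF M f] and D' = isolD[OF M' f']
  define \<Delta> where "\<Delta> = (\<lambda>i j y. M i j y - M' i j y)"
  note eq = sol_diff_eq[OF M f M' f', folded \<Delta>_def]
  have \<Delta>: "L21b (\<Delta> i j) \<delta>" for i j unfolding \<Delta>_def by (rule \<delta>)
  have B: "0 \<le> B" by (rule admD(5)[OF M])
  interpret V: volterra "\<lambda>i j x y. iker c M w i j y" "ksum M" e for w by (rule vol[OF admD(1)[OF M]])
  interpret V\<Delta>: volterra "\<lambda>i j x y. iker c \<Delta> w i j y" "ksum \<Delta>" e for w by (rule vol[OF \<Delta>])
  have d0: "0 \<le> \<delta>" by (rule L21b_nonneg[OF \<Delta>])
  define H where "H = 2 * n\<^sup>2 * \<delta> * EB B"
  let ?d = "\<lambda>j y. f z j y - f' z j y"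
  have db: "(\<Sum>j\<in>UNIV. cmod (?d j y)) \<le> EB B + EB B" for y
  proof -
    have "(\<Sum>j\<in>UNIV. cmod (?d j y)) \<le> (\<Sum>j\<in>UNIV. cmod (f z j y) + cmod (f' z j y))"
      by (intro sum_mono norm_triangle_ineq4)
    thus ?thesis using D(4)[of z y] D'(4)[of z y] by (simp add: sum.distrib)
  qed
  have "(\<Sum>i\<in>UNIV. cmod (?d i x)) \<le> H * exp (cum (ksum M) x)"
  proof (rule Gronwall[OF admD(3)[OF M] ksum_nonneg, where B="EB B + EB B"])
    show "(\<lambda>x. \<Sum>i\<in>UNIV. cmod (?d i x)) \<in> borel_measurable borel" using D(2) D'(2) by measurable
    show "\<bar>\<Sum>i\<in>UNIV. cmod (?d i y)\<bar> \<le> EB B + EB B" for y using db[of y] by (simp add: abs_of_nonneg sum_nonneg)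
    show "0 \<le> H" unfolding H_def using d0 nonneg[OF B] n_pos by simp
    fix x
    have "(\<Sum>i\<in>UNIV. cmod (?d i x)) \<le> (\<Sum>i\<in>UNIV. cmod (cum (\<lambda>y. \<Sum>j\<in>UNIV. iker c \<Delta> z i j y * f' z j y) x))
       + (\<Sum>i\<in>UNIV. cmod (cum (\<lambda>y. \<Sum>j\<in>UNIV. iker c M z i j y * ?d j y) x))"
      unfolding sum.distrib[symmetric] by (intro sum_mono, subst eq(1)) (rule norm_triangle_ineq)
    also have "(\<Sum>i\<in>UNIV. cmod (cum (\<lambda>y. \<Sum>j\<in>UNIV. iker c \<Delta> z i j y * f' z j y) x)) \<le> H"
    proof -
      have "(\<Sum>i\<in>UNIV. cmod (cum (\<lambda>y. \<Sum>j\<in>UNIV. iker c \<Delta> z i j y * f' z j y) x)) \<le> cum (\<lambda>y. ksum \<Delta> y * (\<Sum>j\<in>UNIV. cmod (f' z j y))) x"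
        by (rule V\<Delta>.sum_cum_le[OF D'(2,4)])
      also have "\<dots> \<le> cum (\<lambda>y. ksum \<Delta> y * EB B) x"
      proof (intro cum_mono mult_left_mono D'(4) ksum_nonneg)
        show "integrable lborel (\<lambda>y. ksum \<Delta> y * (\<Sum>j\<in>UNIV. cmod (f' z j y)))"
          using D'(2,4) by (intro integrable_bounded_mult[OF ksum_integral(1)[OF \<Delta>], where B="EB B"]) (auto simp: abs_of_nonneg sum_nonneg)
      qed (use ksum_integral(1)[OF \<Delta>] in simp)
      also have "\<dots> \<le> (LINT y|lborel. ksum \<Delta> y * EB B)"
        using ksum_integral(1)[OF \<Delta>] nonneg(2)[OF B] ksum_nonneg by (intro cum_le_total mult_nonneg_nonneg integrable_mult_left) auto
      also have "\<dots> \<le> TB \<delta> * EB B" using ksum_integral(2)[OF \<Delta>] nonneg[OF B] by (simp add: mult_right_mono)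
      finally show ?thesis by (simp add: H_def TB_def)
    qed
    also have "(\<Sum>i\<in>UNIV. cmod (cum (\<lambda>y. \<Sum>j\<in>UNIV. iker c M z i j y * ?d j y) x)) \<le> cum (\<lambda>y. ksum M y * (\<Sum>j\<in>UNIV. cmod (?d j y))) x"
      by (rule V.sum_cum_le[OF _ db]) (intro borel_measurable_diff D(2) D'(2))
    finally show "(\<Sum>i\<in>UNIV. cmod (?d i x)) \<le> H + cum (\<lambda>y. ksum M y * (\<Sum>i\<in>UNIV. cmod (?d i y))) x" by simp
  qed
  also have "\<dots> \<le> H * exp (TB B)"
  proof -
    have "cum (ksum M) x \<le> TB B" using cum_le_total[OF admD(3)[OF M] ksum_nonneg] admD(4)[OF M] by (rule order_trans)
    thus ?thesis unfolding H_def using d0 nonneg[OF B] n_pos by (intro mult_left_mono) auto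
  qed
  finally show ?thesis unfolding H_def S2_def by (simp add: mult_ac)
qed

text \<open>\<open>forcing\<close> with \<phi> the solution. If a phase-free entry survives, \<Phi>
  is the L^2 bound \<open>C3 B\<close> of the components starting from 0; if none does, as for
  difference quotients of the kernel, \<Phi> may be 0.\<close>

lemma sol_forcing:
  assumes M: "adm M B" and f: "isol c M e f"
    and A: "\<And>i j. integrable lborel (A i j)" and A2: "\<And>i j. L2b (A i j) \<alpha>"
    and c0: "\<And>i j. c i j = 0 \<Longrightarrow> A i j = (\<lambda>_. 0) \<or> (e j = 0 \<and> (LINT y|lborel. cmod (A i j y)) \<le> \<alpha> \<and> \<Phi> = C3 B)"
    and \<Phi>: "0 \<le> \<Phi>"
  shows "L2b (\<lambda>z. cum (\<lambda>y. \<Sum>j\<in>UNIV. iker c A z i j y * f z j y) x) (n * \<alpha> * (2 * R B + \<Phi>))"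
proof (rule forcing[OF A A2 isolD(8)[OF M f] isolD(7)[OF M f] _ isolD(3)[OF M f] _ \<Phi>])
  have B: "0 \<le> B" by (rule admD(5)[OF M])
  show "integrable lborel (\<lambda>y. ksum M y * EB B)" using admD(3)[OF M] by simp
  show "A i j = (\<lambda>_. 0) \<or> (LINT y|lborel. cmod (A i j y)) \<le> \<alpha> \<and> (\<forall>y. L2b (\<lambda>z. f z j y) \<Phi>)" if "c i j = 0" for i j
    using c0[OF that] sol_L2_phi[OF M f] by auto
  show "cmod (e j) + (LINT y|lborel. ksum M y * EB B) \<le> R B" for j
  proof -
    have "cmod (e j) \<le> E" unfolding E_def by (rule member_le_sum) auto
    moreover have "(LINT y|lborel. ksum M y) * EB B \<le> TB B * EB B" using admD(4)[OF M] nonneg[OF B] by (intro mult_right_mono) auto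
    ultimately show ?thesis by (simp add: R_def)
  qed
qed

lemma sol_diff_L2:
  assumes M: "adm M B" and f: "isol c M e f" and M': "adm M' B" and f': "isol c M' e f'"
    and \<delta>: "\<And>i j. L21b (\<lambda>y. M i j y - M' i j y) \<delta>"
  shows "L2b (\<lambda>z. f z i x - f' z i x) (C4 B * \<delta>)"
proof -
  note D = isolD[OF M f] and D' = isolD[OF M' f']
  have B: "0 \<le> B" by (rule admD(5)[OF M])
  define \<Delta> where "\<Delta> = (\<lambda>i j y. M i j y - M' i j y)"
  note eq = sol_diff_eq[OF M f M' f', folded \<Delta>_def]
  have \<Delta>: "L21b (\<Delta> i j) \<delta>" for i j unfolding \<Delta>_def by (rule \<delta>)
  have F: "L2b (\<lambda>z. cum (\<lambda>y. \<Sum>j\<in>UNIV. iker c \<Delta> z i j y * f' z j y) x) (n * (2 * \<delta>) * (2 * R B + C3 B))" for i x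
  proof (rule sol_forcing[OF M' f'])
    show "integrable lborel (\<Delta> i j)" for i j by (rule L21b_integrable[OF \<Delta>])
    show "L2b (\<Delta> i j) (2 * \<delta>)" for i j by (rule L2b_bound_mono[OF L21b_L2b(1)[OF \<Delta>]]) (use L21b_nonneg[OF \<delta>] in simp)
    show "\<Delta> i j = (\<lambda>_. 0) \<or> (e j = 0 \<and> (LINT y|lborel. cmod (\<Delta> i j y)) \<le> 2 * \<delta> \<and> C3 B = C3 B)" if "c i j = 0" for i j
      using admD(6)[OF M that] admD(6)[OF M' that] L21b_integrable(2)[OF \<Delta>] by (cases "e j = 0") (auto simp: \<Delta>_def)
    show "0 \<le> C3 B" using nonneg[OF B] by simp
  qed
  have "L2b (\<lambda>z. f z i x - f' z i x) (G B * (n * (2 * \<delta>) * (2 * R B + C3 B)))"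
  proof (rule gron[OF M _ _ _ F, where t=0 and D="EB B + EB B"])
    show "(\<lambda>p. f (fst p) i (snd p) - f' (fst p) i (snd p)) \<in> borel_measurable (borel \<Otimes>\<^sub>M borel)" for i using D(1) D'(1) by measurable
    show "cmod (f z i y - f' z i y) \<le> EB B + EB B" for z i y
      using norm_triangle_ineq4[of "f z i y" "f' z i y"] D(5)[of z i y] D'(5)[of z i y] by linarith
    show "f z i x - f' z i x = cum (\<lambda>y. \<Sum>j\<in>UNIV. iker c \<Delta> z i j y * f' z j y) x + cum (\<lambda>y. \<Sum>j\<in>UNIV. iker c M (z + 0) i j y * (f z j y - f' z j y)) x" for z i x
      unfolding add_0_right by (rule eq(1))
  qed
  thus ?thesis unfolding C4_def by (simp add: mult_ac)
qed

text \<open>The mass of the integrand behind f - f' is at most \<open>R2 B * \<delta>\<close>.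
  Linearity in \<delta> is what turns the later estimates into Lipschitz bounds.\<close>

lemma sol_diff_forcing:
  assumes M: "adm M B" and f: "isol c M e f" and M': "adm M' B" and f': "isol c M' e f'"
    and \<delta>: "\<And>i j. L21b (\<lambda>y. M i j y - M' i j y) \<delta>"
    and A: "\<And>i j. integrable lborel (A i j)" and A2: "\<And>i j. L2b (A i j) \<alpha>"
    and c0: "\<And>i j. c i j = 0 \<Longrightarrow> A i j = (\<lambda>_. 0) \<or> ((LINT y|lborel. cmod (A i j y)) \<le> \<alpha> \<and> \<Phi> = C4 B * \<delta>)"
    and \<Phi>: "0 \<le> \<Phi>"
  shows "L2b (\<lambda>z. cum (\<lambda>y. \<Sum>j\<in>UNIV. iker c A z i j y * (f z j y - f' z j y)) x) (n * \<alpha> * (2 * (R2 B * \<delta>) + \<Phi>))"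
proof -
  note D = isolD[OF M f] and D' = isolD[OF M' f']
  have B: "0 \<le> B" by (rule admD(5)[OF M])
  have d0: "0 \<le> \<delta>" by (rule L21b_nonneg[OF \<delta>])
  define \<Delta> where "\<Delta> = (\<lambda>i j y. M i j y - M' i j y)"
  note eq = sol_diff_eq[OF M f M' f', folded \<Delta>_def]
  have \<Delta>: "L21b (\<Delta> i j) \<delta>" for i j unfolding \<Delta>_def by (rule \<delta>)
  interpret V: volterra "\<lambda>i j x y. iker c M w i j y" "ksum M" e for w by (rule vol[OF admD(1)[OF M]])
  interpret V\<Delta>: volterra "\<lambda>i j x y. iker c \<Delta> w i j y" "ksum \<Delta>" e for w by (rule vol[OF \<Delta>])
  define g where "g = (\<lambda>z i y. (\<Sum>j\<in>UNIV. iker c \<Delta> z i j y * f' z j y) + (\<Sum>j\<in>UNIV. iker c M z i j y * (f z j y - f' z j y)))"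
  show ?thesis
  proof (rule forcing[OF A A2, where g=g and \<epsilon>="\<lambda>_. 0" and \<gamma>="\<lambda>y. ksum \<Delta> y * EB B + ksum M y * (S2 B * \<delta>)"])
    show "(\<lambda>p. g (fst p) i (snd p)) \<in> borel_measurable (borel \<Otimes>\<^sub>M borel)" for i
      unfolding g_def using D(1) D'(1) iker_measurable(1)[OF admD(2)[OF M]] iker_measurable(1)[OF L21b_measurable[OF \<Delta>]] by measurable
    show "cmod (g z j y) \<le> ksum \<Delta> y * EB B + ksum M y * (S2 B * \<delta>)" for z j y
    proof -
      have "cmod (\<Sum>k\<in>UNIV. iker c \<Delta> z j k y * f' z k y) \<le> ksum \<Delta> y * EB B"
        by (rule order_trans[OF V\<Delta>.apply_le1]) (intro mult_left_mono D'(4) ksum_nonneg)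
      moreover have "cmod (\<Sum>k\<in>UNIV. iker c M z j k y * (f z k y - f' z k y)) \<le> ksum M y * (S2 B * \<delta>)"
        by (rule order_trans[OF V.apply_le1]) (intro mult_left_mono sup_diff[OF M f M' f' \<delta>] ksum_nonneg)
      ultimately show ?thesis unfolding g_def by (rule order_trans[OF norm_triangle_ineq add_mono])
    qed
    show "integrable lborel (\<lambda>y. ksum \<Delta> y * EB B + ksum M y * (S2 B * \<delta>))"
      using ksum_integral(1)[OF \<Delta>] admD(3)[OF M] by simp
    show "f z j y - f' z j y = 0 + cum (g z j) y" for z j y unfolding g_def by (rule eq(2))
    show "A i j = (\<lambda>_. 0) \<or> (LINT y|lborel. cmod (A i j y)) \<le> \<alpha> \<and> (\<forall>y. L2b (\<lambda>z. f z j y - f' z j y) \<Phi>)" if "c i j = 0" for i j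
      using c0[OF that] sol_diff_L2[OF M f M' f' \<delta>] by auto
    have "(LINT y|lborel. ksum \<Delta> y * EB B + ksum M y * (S2 B * \<delta>)) = (LINT y|lborel. ksum \<Delta> y) * EB B + (LINT y|lborel. ksum M y) * (S2 B * \<delta>)"
      using ksum_integral(1)[OF \<Delta>] admD(3)[OF M] by simp
    also have "\<dots> \<le> TB \<delta> * EB B + TB B * (S2 B * \<delta>)"
      using ksum_integral(2)[OF \<Delta>] admD(4)[OF M] nonneg[OF B] d0 by (intro add_mono mult_right_mono) auto
    also have "\<dots> = R2 B * \<delta>" by (simp add: R2_def TB_def algebra_simps)
    finally show "cmod 0 + (LINT y|lborel. ksum \<Delta> y * EB B + ksum M y * (S2 B * \<delta>)) \<le> R2 B * \<delta>" by simp
  qed (rule \<Phi>)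
qed

section \<open>Difference quotients in the spectral parameter\<close>

definition quo :: "real \<Rightarrow> (real \<Rightarrow> 'n \<Rightarrow> real \<Rightarrow> complex) \<Rightarrow> real \<Rightarrow> 'n \<Rightarrow> real \<Rightarrow> complex" where
  "quo h f z i x = (f (z + h) i x - f z i x) / complex_of_real h"

text \<open>The difference quotient of \<open>iker c M\<close> in z is
  \<open>iker c (difM h M)\<close>, a kernel of the same form with the same phases, so
  \<open>forcing\<close> applies to it. Its phase-free entries are zero.\<close>

definition difM :: "real \<Rightarrow> ('n \<Rightarrow> 'n \<Rightarrow> real \<Rightarrow> complex) \<Rightarrow> 'n \<Rightarrow> 'n \<Rightarrow> real \<Rightarrow> complex" where
  "difM h M i j y = difq h (c i j) y * M i j y"

lemma difM:
  assumes "L21b (M i j) B" "h \<noteq> 0"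
  shows "integrable lborel (difM h M i j)" "L2b (difM h M i j) (2 * B)" "c i j = 0 \<Longrightarrow> difM h M i j = (\<lambda>_. 0)"
proof -
  have [measurable]: "M i j \<in> borel_measurable borel" by (rule L21b_measurable[OF assms(1)])
  show "integrable lborel (difM h M i j)" unfolding difM_def[abs_def]
    using integrable_bounded_mult[OF L21b_integrable(1)[OF assms(1)] difq_measurable difq_bound(2)[OF assms(2) c_abs]] by (simp add: mult.commute)
  have "L2b (\<lambda>y. 2 * (complex_of_real y * M i j y)) (norm (2::complex) * B)" by (intro L2b_cmult L21b_L2b(2) assms)
  hence "L2b (\<lambda>y. 2 * (complex_of_real y * M i j y)) (2 * B)" by simp
  thus "L2b (difM h M i j) (2 * B)"
  proof (rule L2b_mono)
    show "difM h M i j \<in> borel_measurable borel" unfolding difM_def[abs_def] by measurable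
    show "cmod (difM h M i j y) \<le> cmod (2 * (complex_of_real y * M i j y))" for y
      using mult_right_mono[OF difq_bound(1)[OF assms(2) c_abs[of i j]] norm_ge_zero] unfolding difM_def by (simp add: norm_mult mult.assoc[symmetric])
  qed
  show "c i j = 0 \<Longrightarrow> difM h M i j = (\<lambda>_. 0)" by (simp add: difM_def fun_eq_iff)
qed

lemma iker_shift: "h \<noteq> 0 \<Longrightarrow> iker c M (z + h) i j y = iker c M z i j y + complex_of_real h * iker c (difM h M) z i j y"
proof -
  assume h: "h \<noteq> 0"
  have "cis (2 * (z + h) * c i j * y) = cis (2 * z * c i j * y) * cis (2 * h * c i j * y)"
    by (simp add: cis_mult algebra_simps)
  moreover have "cis (2 * h * c i j * y) = 1 + complex_of_real h * difq h (c i j) y" using h by (simp add: difq_def)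
  ultimately show ?thesis unfolding iker_def difM_def by (simp add: algebra_simps)
qed

text \<open>Discrete product rule: the quotient solves the system at z + h with the differentiated
  kernel applied to f as forcing. The bound with 1/|h| degenerates as h tends to 0, but it only
  certifies boundedness for Gronwall; the L^2 bound \<open>C5 B\<close> is uniform in h.\<close>

lemma quo_props:
  assumes M: "adm M B" and f: "isol c M e f" and h: "h \<noteq> 0"
  shows "quo h f z i x = cum (\<lambda>y. \<Sum>j\<in>UNIV. iker c (difM h M) z i j y * f z j y) x + cum (\<lambda>y. \<Sum>j\<in>UNIV. iker c M (z + h) i j y * quo h f z j y) x" (is ?eq)
    and "(\<lambda>p. quo h f (fst p) i (snd p)) \<in> borel_measurable (borel \<Otimes>\<^sub>M borel)"
    and "cmod (quo h f z i x) \<le> 2 * EB B / \<bar>h\<bar>"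
    and "L2b (\<lambda>z. quo h f z i x) (C5 B)"
    and "integrable lborel (\<lambda>y. \<Sum>j\<in>UNIV. iker c (difM h M) z i j y * f z j y)"
    and "quo h f z i \<in> borel_measurable borel"
    and "integrable lborel (\<lambda>y. \<Sum>j\<in>UNIV. iker c M w i j y * quo h f z j y)"
proof -
  note D = isolD[OF M f]
  have B: "0 \<le> B" by (rule admD(5)[OF M])
  note dM = difM[OF admD(1)[OF M] h]
  show b: "cmod (quo h f z i x) \<le> 2 * EB B / \<bar>h\<bar>" for z i x
  proof -
    have "cmod (f (z + h) i x - f z i x) \<le> EB B + EB B"
      using norm_triangle_ineq4[of "f (z + h) i x" "f z i x"] D(5)[of "z + h" i x] D(5)[of z i x] by linarith
    thus ?thesis by (simp add: quo_def norm_divide divide_right_mono)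
  qed
  show m: "(\<lambda>p. quo h f (fst p) i (snd p)) \<in> borel_measurable (borel \<Otimes>\<^sub>M borel)" for i
    unfolding quo_def using D(1)[of i] shift_measurable[of "\<lambda>z. f z i", OF D(1)[of i], of h] by measurable
  show m1: "quo h f z i \<in> borel_measurable borel" for z i
    using section_measurable(1)[of "\<lambda>z x. quo h f z i x", OF m] by simp
  interpret V: volterra "\<lambda>i j x y. iker c M w i j y" "ksum M" e for w by (rule vol[OF admD(1)[OF M]])
  have mh [measurable]: "difM h M i j \<in> borel_measurable borel" for i j by (rule L2bD(1)[OF dM(2)])
  have i1: "integrable lborel (\<lambda>y. iker c (difM h M) z i j y * f z j y)" for z i j
  proof (rule integrable_bounded_mult[OF _ D(2,5)])
    show "integrable lborel (iker c (difM h M) z i j)"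
      by (rule iker_integrable[OF dM(1)])
  qed
  show I1: "integrable lborel (\<lambda>y. \<Sum>j\<in>UNIV. iker c (difM h M) z i j y * f z j y)" for z i
    using i1 by (intro Bochner_Integration.integrable_sum) auto
  show I2: "integrable lborel (\<lambda>y. \<Sum>j\<in>UNIV. iker c M w i j y * quo h f z j y)" for w z i
  proof (rule V.apply_integrable[OF m1])
    show "(\<Sum>j\<in>UNIV. cmod (quo h f z j y)) \<le> n * (2 * EB B / \<bar>h\<bar>)" for y
    proof -
      have "(\<Sum>j\<in>UNIV. cmod (quo h f z j y)) \<le> (\<Sum>j\<in>(UNIV::'n set). 2 * EB B / \<bar>h\<bar>)" by (intro sum_mono b)
      thus ?thesis by (simp add: n_def)
    qed
  qed
  show eq: "quo h f z i x = cum (\<lambda>y. \<Sum>j\<in>UNIV. iker c (difM h M) z i j y * f z j y) x + cum (\<lambda>y. \<Sum>j\<in>UNIV. iker c M (z + h) i j y * quo h f z j y) x" for z i x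
  proof -
    have "f (z + h) i x - f z i x = cum (\<lambda>y. \<Sum>j\<in>UNIV. iker c M (z + h) i j y * f (z + h) j y) x - cum (\<lambda>y. \<Sum>j\<in>UNIV. iker c M z i j y * f z j y) x"
      by (subst (1 2) D(3)) simp
    also have "\<dots> = cum (\<lambda>y. (\<Sum>j\<in>UNIV. iker c M (z + h) i j y * f (z + h) j y) - (\<Sum>j\<in>UNIV. iker c M z i j y * f z j y)) x"
      by (rule cum_diff[OF D(6) D(6), symmetric])
    also have "(\<lambda>y. (\<Sum>j\<in>UNIV. iker c M (z + h) i j y * f (z + h) j y) - (\<Sum>j\<in>UNIV. iker c M z i j y * f z j y))
       = (\<lambda>y. complex_of_real h * ((\<Sum>j\<in>UNIV. iker c (difM h M) z i j y * f z j y) + (\<Sum>j\<in>UNIV. iker c M (z + h) i j y * quo h f z j y)))"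
    proof
      fix y
      have q: "complex_of_real h * quo h f z j y = f (z + h) j y - f z j y" for j using h by (simp add: quo_def)
      have "iker c M (z + h) i j y * f (z + h) j y - iker c M z i j y * f z j y =
         complex_of_real h * (iker c (difM h M) z i j y * f z j y) + iker c M (z + h) i j y * (complex_of_real h * quo h f z j y)" for j
        unfolding q iker_shift[OF h] by (simp add: algebra_simps)
      thus "(\<Sum>j\<in>UNIV. iker c M (z + h) i j y * f (z + h) j y) - (\<Sum>j\<in>UNIV. iker c M z i j y * f z j y)
         = complex_of_real h * ((\<Sum>j\<in>UNIV. iker c (difM h M) z i j y * f z j y) + (\<Sum>j\<in>UNIV. iker c M (z + h) i j y * quo h f z j y))"
        unfolding sum_subtractf[symmetric] by (simp add: sum.distrib[symmetric] sum_distrib_left distrib_left mult_ac)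
    qed
    finally show ?thesis unfolding cum_mult cum_add[OF I1 I2] using h unfolding quo_def[of h f z i x] by simp
  qed
  have F: "L2b (\<lambda>z. cum (\<lambda>y. \<Sum>j\<in>UNIV. iker c (difM h M) z i j y * f z j y) x) (n * (2 * B) * (2 * R B + 0))" for i x
    by (rule sol_forcing[OF M f dM(1,2)]) (use dM(3) in auto)
  have "L2b (\<lambda>z. quo h f z i x) (G B * (n * (2 * B) * (2 * R B + 0)))"
    by (rule gron[OF M m b eq F])
  thus "L2b (\<lambda>z. quo h f z i x) (C5 B)" unfolding C5_def by simp
qed

text \<open>Steps and kernels may both differ: M' = M gives the Cauchy property as h tends to 0, h'
  = h the Lipschitz dependence on the potential. Subtracting the equations leaves three forcing
  terms: the kernel difference against \<open>quo h' f'\<close>, the differentiated kernel against f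
  - f', and the difference of the differentiated kernels against f'. In the first, the quotient is
  L^2 already, so closeness in L^1 is enough for the kernels; in the other two only oscillating
  entries remain.\<close>

lemma quo_diff_L2:
  assumes M: "adm M B" and f: "isol c M e f" and M': "adm M' B" and f': "isol c M' e f'"
    and h: "h \<noteq> 0" and h': "h' \<noteq> 0"
    and \<delta>: "\<And>i j. L21b (\<lambda>y. M i j y - M' i j y) \<delta>"
    and \<delta>1: "\<And>i j. (LINT y|lborel. cmod (iker c M h i j y - iker c M' h' i j y)) \<le> \<delta>"
    and \<delta>2: "\<And>i j. L2b (\<lambda>y. difM h M i j y - difM h' M' i j y) \<delta>"
  shows "L2b (\<lambda>z. quo h f z i x - quo h' f' z i x) (C6 B * \<delta>)"
proof -
  note D = isolD[OF M f] and D' = isolD[OF M' f']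
  note Q = quo_props[OF M f h] and Q' = quo_props[OF M' f' h']
  have B: "0 \<le> B" by (rule admD(5)[OF M])
  have d0: "0 \<le> \<delta>" by (rule L21b_nonneg[OF \<delta>])
  define K where "K = (\<lambda>z i j y. iker c M (z + h) i j y - iker c M' (z + h') i j y)"
  define A where "A = (\<lambda>i j y. difM h M i j y - difM h' M' i j y)"
  have [measurable]: "M i j \<in> borel_measurable borel" "M' i j \<in> borel_measurable borel" for i j using admD(2)[OF M] admD(2)[OF M'] by auto
  have iki: "integrable lborel (iker c M h i j)" "integrable lborel (iker c M' h' i j)" for i j h h'
    by (rule iker_integrable[OF L21b_integrable(1)[OF admD(1)[OF M]]], rule iker_integrable[OF L21b_integrable(1)[OF admD(1)[OF M']]])
  \<comment> \<open>Moving from h to z + h multiplies both kernels by the same unimodular phase, so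
    \<delta>1, stated at h and h' alone, controls the difference for all z.\<close>
  have K: "cmod (K z i j y) \<le> cmod (iker c M h i j y - iker c M' h' i j y)" for z i j y
  proof -
    have "iker c M (z + h) i j y = cis (2 * z * c i j * y) * iker c M h i j y" for M h
    proof -
      have "cis (2 * (z + h) * c i j * y) = cis (2 * z * c i j * y) * cis (2 * h * c i j * y)"
        by (simp add: cis_mult algebra_simps)
      thus ?thesis unfolding iker_def by (simp only: mult.assoc)
    qed
    thus ?thesis unfolding K_def by (simp add: right_diff_distrib[symmetric] norm_mult)
  qed
  have Km: "(\<lambda>p. K (fst p) i j (snd p)) \<in> borel_measurable (borel \<Otimes>\<^sub>M borel)" for i j
    unfolding K_def iker_def by measurable
  have K1: "L2b (\<lambda>z. cum (\<lambda>y. K z i j y * quo h' f' z j y) x) (\<delta> * C5 B)" for i j x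
  proof -
    have "L2b (\<lambda>z. cum (\<lambda>y. K z i j y * quo h' f' z j y) x) ((LINT y|lborel. cmod (iker c M h i j y - iker c M' h' i j y)) * C5 B)"
      by (rule L2b_cum_weighted[OF _ K Km Q'(2,3) Q'(4)]) (use iki in auto)
    thus ?thesis using \<delta>1 nonneg[OF B] by (elim L2b_bound_mono) (intro mult_right_mono, auto)
  qed
  have Ki: "integrable lborel (\<lambda>y. K z i j y * quo h' f' z j y)" for z i j
    unfolding K_def by (intro integrable_bounded_mult[OF _ Q'(6,3)] Bochner_Integration.integrable_diff iki)
  have KS: "L2b (\<lambda>z. cum (\<lambda>y. \<Sum>j\<in>UNIV. K z i j y * quo h' f' z j y) x) (n * (\<delta> * C5 B))" for i x
  proof -
    have "L2b (\<lambda>z. \<Sum>j\<in>UNIV. cum (\<lambda>y. K z i j y * quo h' f' z j y) x) (\<Sum>j\<in>(UNIV::'n set). \<delta> * C5 B)"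
      by (intro L2b_sum K1) auto
    moreover have "(\<Sum>j\<in>UNIV. cum (\<lambda>y. K z i j y * quo h' f' z j y) x) = cum (\<lambda>y. \<Sum>j\<in>UNIV. K z i j y * quo h' f' z j y) x" for z
      using Ki by (intro cum_sum[symmetric]) auto
    ultimately show ?thesis by (simp add: n_def)
  qed
  interpret V: volterra "\<lambda>i j x y. iker c M w i j y" "ksum M" e for w by (rule vol[OF admD(1)[OF M]])
  have F1: "L2b (\<lambda>z. cum (\<lambda>y. \<Sum>j\<in>UNIV. iker c (difM h M) z i j y * (f z j y - f' z j y)) x) (n * (2 * B) * (2 * (R2 B * \<delta>) + 0))" for i x
    by (rule sol_diff_forcing[OF M f M' f' \<delta> difM(1,2)[OF admD(1)[OF M] h]]) (use difM(3)[OF admD(1)[OF M] h] in auto)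
  have Ai: "integrable lborel (A i j)" for i j unfolding A_def
    by (intro Bochner_Integration.integrable_diff difM(1)[OF admD(1)[OF M] h] difM(1)[OF admD(1)[OF M'] h'])
  have F2: "L2b (\<lambda>z. cum (\<lambda>y. \<Sum>j\<in>UNIV. iker c A z i j y * f' z j y) x) (n * \<delta> * (2 * R B + 0))" for i x
  proof (rule sol_forcing[OF M' f' Ai])
    show "L2b (A i j) \<delta>" for i j unfolding A_def by (rule \<delta>2)
    show "A i j = (\<lambda>_. 0) \<or> (e j = 0 \<and> (LINT y|lborel. cmod (A i j y)) \<le> \<delta> \<and> 0 = C3 B)" if "c i j = 0" for i j
    proof -
      have "difM h M i j = (\<lambda>_. 0)" by (rule difM(3)[OF admD(1)[OF M] h that])
      moreover have "difM h' M' i j = (\<lambda>_. 0)" by (rule difM(3)[OF admD(1)[OF M'] h' that])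
      ultimately show ?thesis by (simp add: A_def)
    qed
  qed simp
  define H where "H = (\<lambda>z i x. cum (\<lambda>y. \<Sum>j\<in>UNIV. K z i j y * quo h' f' z j y) x +
     (cum (\<lambda>y. \<Sum>j\<in>UNIV. iker c (difM h M) z i j y * (f z j y - f' z j y)) x + cum (\<lambda>y. \<Sum>j\<in>UNIV. iker c A z i j y * f' z j y) x))"
  have LH: "L2b (\<lambda>z. H z i x) (n * (\<delta> * C5 B) + (n * (2 * B) * (2 * (R2 B * \<delta>) + 0) + n * \<delta> * (2 * R B + 0)))" for i x
    unfolding H_def by (intro L2b_add KS F1 F2)
  have "L2b (\<lambda>z. quo h f z i x - quo h' f' z i x) (G B * (n * (\<delta> * C5 B) + (n * (2 * B) * (2 * (R2 B * \<delta>) + 0) + n * \<delta> * (2 * R B + 0))))"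
  proof (rule gron[OF M _ _ _ LH])
    show "(\<lambda>p. quo h f (fst p) i (snd p) - quo h' f' (fst p) i (snd p)) \<in> borel_measurable (borel \<Otimes>\<^sub>M borel)" for i using Q(2) Q'(2) by measurable
    show "cmod (quo h f z i y - quo h' f' z i y) \<le> 2 * EB B / \<bar>h\<bar> + 2 * EB B / \<bar>h'\<bar>" for z i y
      using norm_triangle_ineq4[of "quo h f z i y" "quo h' f' z i y"] Q(3)[of z i y] Q'(3)[of z i y] by linarith
    fix z i x
    let ?a = "\<lambda>y. \<Sum>j\<in>UNIV. iker c (difM h M) z i j y * f z j y" and ?b = "\<lambda>y. \<Sum>j\<in>UNIV. iker c M (z + h) i j y * quo h f z j y"
    let ?a' = "\<lambda>y. \<Sum>j\<in>UNIV. iker c (difM h' M') z i j y * f' z j y" and ?b' = "\<lambda>y. \<Sum>j\<in>UNIV. iker c M' (z + h') i j y * quo h' f' z j y"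
    let ?b'' = "\<lambda>y. \<Sum>j\<in>UNIV. iker c M (z + h) i j y * quo h' f' z j y"
    let ?d = "\<lambda>y. \<Sum>j\<in>UNIV. iker c (difM h M) z i j y * f' z j y"
    have ib'': "integrable lborel ?b''"
    proof (rule V.apply_integrable[OF Q'(6)])
      fix y
      have "(\<Sum>j\<in>UNIV. cmod (quo h' f' z j y)) \<le> (\<Sum>j\<in>(UNIV::'n set). 2 * EB B / \<bar>h'\<bar>)" by (intro sum_mono Q'(3))
      thus "(\<Sum>j\<in>UNIV. cmod (quo h' f' z j y)) \<le> n * (2 * EB B / \<bar>h'\<bar>)" by (simp add: n_def)
    qed
    have dMi: "integrable lborel (\<lambda>y. iker c (difM h M) z i j y * f' z j y)" for j
    proof (rule integrable_bounded_mult[OF _ D'(2,5)])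
      show "integrable lborel (iker c (difM h M) z i j)"
        by (rule iker_integrable[OF difM(1)[OF admD(1)[OF M] h]])
    qed
    have id: "integrable lborel ?d" using dMi by (intro Bochner_Integration.integrable_sum) auto
    have "quo h f z i x - quo h' f' z i x = (cum ?a x - cum ?a' x) + (cum ?b x - cum ?b' x)"
      by (subst Q(1), subst Q'(1)) simp
    also have "cum ?a x - cum ?a' x = (cum ?a x - cum ?d x) + (cum ?d x - cum ?a' x)" by simp
    also have "cum ?a x - cum ?d x = cum (\<lambda>y. \<Sum>j\<in>UNIV. iker c (difM h M) z i j y * (f z j y - f' z j y)) x"
      unfolding cum_diff[OF Q(5) id, symmetric] by (simp add: sum_subtractf[symmetric] right_diff_distrib)
    also have "cum ?d x - cum ?a' x = cum (\<lambda>y. \<Sum>j\<in>UNIV. iker c A z i j y * f' z j y) x"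
      unfolding cum_diff[OF id Q'(5), symmetric] A_def iker_diff by (simp add: sum_subtractf[symmetric] left_diff_distrib)
    also have "cum ?b x - cum ?b' x = (cum ?b'' x - cum ?b' x) + (cum ?b x - cum ?b'' x)" by simp
    also have "cum ?b'' x - cum ?b' x = cum (\<lambda>y. \<Sum>j\<in>UNIV. K z i j y * quo h' f' z j y) x"
      unfolding cum_diff[OF ib'' Q'(7), symmetric] K_def by (simp add: sum_subtractf[symmetric] left_diff_distrib)
    also have "cum ?b x - cum ?b'' x = cum (\<lambda>y. \<Sum>j\<in>UNIV. iker c M (z + h) i j y * (quo h f z j y - quo h' f' z j y)) x"
      unfolding cum_diff[OF Q(7) ib'', symmetric] by (simp add: sum_subtractf[symmetric] right_diff_distrib)
    finally show "quo h f z i x - quo h' f' z i x = H z i x + cum (\<lambda>y. \<Sum>j\<in>UNIV. iker c M (z + h) i j y * (quo h f z j y - quo h' f' z j y)) x"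
      unfolding H_def by (simp add: add_ac)
  qed
  moreover have "G B * (n * (\<delta> * C5 B) + (n * (2 * B) * (2 * (R2 B * \<delta>) + 0) + n * \<delta> * (2 * R B + 0))) = C6 B * \<delta>"
    unfolding C6_def by (simp add: algebra_simps)
  ultimately show ?thesis by simp
qed

end

section \<open>Limits at infinity as functions of the spectral parameter\<close>

lemma L2b_product:
  fixes f g :: "real \<Rightarrow> complex"
  assumes f: "L2b f A" and g: "L2b g B"
  shows "integrable lborel (\<lambda>x. f x * g x)" "(LINT x|lborel. cmod (f x * g x)) \<le> A * B"
    "cmod (LINT x|lborel. f x * g x) \<le> A * B"
proof -
  have [measurable]: "f \<in> borel_measurable borel" "g \<in> borel_measurable borel" using L2bD(1)[OF f] L2bD(1)[OF g] .
  have A: "0 \<le> A" "0 \<le> B" using L2bD(2)[OF f] L2bD(2)[OF g] .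
  have "(\<integral>\<^sup>+x. ennreal (cmod (f x * g x)) \<partial>lborel)\<^sup>2 = (\<integral>\<^sup>+x. ennreal (cmod (f x)) * ennreal (cmod (g x)) \<partial>lborel)\<^sup>2"
    by (simp add: norm_mult ennreal_mult)
  also have "\<dots> \<le> (\<integral>\<^sup>+x. (ennreal (cmod (f x)))\<^sup>2 \<partial>lborel) * (\<integral>\<^sup>+x. (ennreal (cmod (g x)))\<^sup>2 \<partial>lborel)"
    by (rule Cauchy_Schwarz_nn_integral) measurable
  also have "\<dots> \<le> ennreal (A\<^sup>2) * ennreal (B\<^sup>2)"
    using L2bD(3)[OF f] L2bD(3)[OF g] by (intro mult_mono) (auto simp: ennreal_power)
  also have "\<dots> = (ennreal (A * B))\<^sup>2" using A by (simp add: ennreal_mult[symmetric] ennreal_power power_mult_distrib)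
  finally have le: "(\<integral>\<^sup>+x. ennreal (cmod (f x * g x)) \<partial>lborel) \<le> ennreal (A * B)"
    using A by (intro ennreal_power2_le) auto
  have "(\<integral>\<^sup>+x. ennreal (cmod (f x * g x)) \<partial>lborel) < \<infinity>" by (rule le_less_trans[OF le]) simp
  thus i: "integrable lborel (\<lambda>x. f x * g x)" by (intro integrableI_bounded) auto
  have "ennreal (LINT x|lborel. cmod (f x * g x)) \<le> ennreal (A * B)"
    using le nn_integral_eq_integral[of lborel "\<lambda>x. cmod (f x * g x)"] i by simp
  thus *: "(LINT x|lborel. cmod (f x * g x)) \<le> A * B" using A by simp
  show "cmod (LINT x|lborel. f x * g x) \<le> A * B" by (rule order_trans[OF integral_norm_bound *])
qed

lemma L2b_indicator: assumes "0 \<le> R" shows "L2b (\<lambda>x. indicator {-R..R} x :: complex) (sqrt (2 * R))"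
proof -
  have "(\<integral>\<^sup>+x. ennreal ((cmod (indicator {-R..R} x))\<^sup>2) \<partial>lborel) = (\<integral>\<^sup>+x. indicator {-R..R} x \<partial>lborel)"
    by (intro nn_integral_cong) (auto simp: indicator_def)
  also have "\<dots> = ennreal (2 * R)" using assms by simp
  finally show ?thesis using assms unfolding L2b_def by simp
qed

lemma L2b_locally_integrable: assumes f: "L2b f B" shows "locally_integrable f"
  unfolding locally_integrable_def
proof
  fix R
  show "set_integrable lborel {-R..R} f"
  proof (cases "0 \<le> R")
    case True
    show ?thesis unfolding set_integrable_def
    proof -
      have "(\<lambda>x. indicator {-R..R} x *\<^sub>R f x) = (\<lambda>x. indicator {-R..R} x * f x)" by (auto simp: fun_eq_iff indicator_def)
      thus "integrable lborel (\<lambda>x. indicator {-R..R} x *\<^sub>R f x)"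
        using L2b_product(1)[OF L2b_indicator[OF True] f] by simp
    qed
  next
    case False
    then show ?thesis by simp
  qed
qed

lemma L2b_dominated:
  fixes f :: "nat \<Rightarrow> real \<Rightarrow> complex"
  assumes m: "\<And>n. f n \<in> borel_measurable borel" and lim: "\<And>x. (\<lambda>n. f n x) \<longlonglongrightarrow> F x"
    and le: "\<And>n x. cmod (f n x) \<le> cmod (g x)" and g: "L2b g B" and \<epsilon>: "0 < \<epsilon>"
  shows "\<forall>\<^sub>F n in sequentially. L2b (\<lambda>x. f n x - F x) \<epsilon>"
proof -
  note [measurable] = m L2bD(1)[OF g]
  have [measurable]: "F \<in> borel_measurable borel" by (rule borel_measurable_LIMSEQ_metric[OF m lim])
  have leF: "cmod (F x) \<le> cmod (g x)" for x
    by (rule LIMSEQ_le_const2[OF tendsto_norm[OF lim]]) (use le in auto)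
  have "(\<lambda>n. \<integral>\<^sup>+x. ennreal ((cmod (f n x - F x))\<^sup>2) \<partial>lborel) \<longlonglongrightarrow> (\<integral>\<^sup>+x. 0 \<partial>(lborel::real measure))"
  proof (rule nn_integral_dominated_convergence[where w="\<lambda>x. ennreal (4 * (cmod (g x))\<^sup>2)"])
    show "AE x in lborel. ennreal ((cmod (f n x - F x))\<^sup>2) \<le> ennreal (4 * (cmod (g x))\<^sup>2)" for n
    proof (rule AE_I2)
      fix x
      have "cmod (f n x - F x) \<le> 2 * cmod (g x)" using norm_triangle_ineq4[of "f n x" "F x"] le[of n x] leF[of x] by linarith
      hence "(cmod (f n x - F x))\<^sup>2 \<le> (2 * cmod (g x))\<^sup>2" by (intro power_mono) auto
      thus "ennreal ((cmod (f n x - F x))\<^sup>2) \<le> ennreal (4 * (cmod (g x))\<^sup>2)" by (intro ennreal_leI) (simp add: power_mult_distrib)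
    qed
    have "(\<integral>\<^sup>+x. ennreal (4 * (cmod (g x))\<^sup>2) \<partial>lborel) = ennreal 4 * (\<integral>\<^sup>+x. ennreal ((cmod (g x))\<^sup>2) \<partial>lborel)"
      by (simp add: ennreal_mult nn_integral_cmult)
    also have "\<dots> \<le> ennreal 4 * ennreal (B\<^sup>2)" by (intro mult_left_mono L2bD(3)[OF g]) auto
    also have "\<dots> < \<infinity>" by (simp add: ennreal_mult_less_top)
    finally show "(\<integral>\<^sup>+x. ennreal (4 * (cmod (g x))\<^sup>2) \<partial>lborel) < \<infinity>" .
    show "AE x in lborel. (\<lambda>n. ennreal ((cmod (f n x - F x))\<^sup>2)) \<longlonglongrightarrow> 0"
    proof (rule AE_I2)
      fix x
      have "(\<lambda>n. ennreal ((cmod (f n x - F x))\<^sup>2)) \<longlonglongrightarrow> ennreal ((cmod (F x - F x))\<^sup>2)"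
        by (intro tendsto_ennrealI tendsto_intros lim)
      thus "(\<lambda>n. ennreal ((cmod (f n x - F x))\<^sup>2)) \<longlonglongrightarrow> 0" by simp
    qed
  qed measurable
  hence "\<forall>\<^sub>F n in sequentially. (\<integral>\<^sup>+x. ennreal ((cmod (f n x - F x))\<^sup>2) \<partial>lborel) < ennreal (\<epsilon>\<^sup>2)"
    using \<epsilon> by (intro order_tendstoD(2)) auto
  thus ?thesis by eventually_elim (use \<epsilon> in \<open>auto simp: L2b_def\<close>)
qed

text \<open>Dividing by \<open>jbracket\<close> turns an \<open>L\<^sup>2\<close> Cauchy sequence into an \<open>L\<^sup>1\<close> Cauchy sequence.\<close>

lemma Riesz_Fischer:
  fixes D :: "nat \<Rightarrow> real \<Rightarrow> complex"
  assumes D: "\<And>n. L2b (D n) B"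
    and C: "\<And>\<epsilon>. 0 < \<epsilon> \<Longrightarrow> \<exists>N. \<forall>m\<ge>N. \<forall>n\<ge>N. L2b (\<lambda>x. D m x - D n x) \<epsilon>"
  obtains g where "L2b g B" "\<And>\<epsilon>. 0 < \<epsilon> \<Longrightarrow> \<exists>N. \<forall>n\<ge>N. L2b (\<lambda>x. D n x - g x) \<epsilon>"
proof -
  have [measurable]: "D n \<in> borel_measurable borel" for n using L2bD(1)[OF D] .
  define s where "s = (\<lambda>n x. complex_of_real (1 / jbracket x) * D n x)"
  have j: "jbracket x \<noteq> 0" for x using jbracket_ge(3)[of x] by simp
  have sL: "L21b (s n) B" for n
    using D[of n] j unfolding L21b_def s_def by (simp add: scaleR_conv_of_real)
  have sd: "L21b (\<lambda>x. s m x - s n x) \<epsilon>" if "L2b (\<lambda>x. D m x - D n x) \<epsilon>" for m n \<epsilon>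
  proof -
    have "jbracket x *\<^sub>R (s m x - s n x) = D m x - D n x" for x
      using j[of x] by (simp add: s_def scaleR_conv_of_real right_diff_distrib)
    thus ?thesis using that unfolding L21b_def by simp
  qed
  have "\<exists>N. \<forall>i\<ge>N. \<forall>j\<ge>N. LINT x|lborel. norm (s i x - s j x) < e" if "e > 0" for e
  proof -
    obtain N where N: "\<forall>m\<ge>N. \<forall>n\<ge>N. L2b (\<lambda>x. D m x - D n x) (e / 4)" using C[of "e/4"] \<open>e > 0\<close> by auto
    have "LINT x|lborel. norm (s i x - s j x) < e" if "i \<ge> N" "j \<ge> N" for i j
      using L21b_integrable(2)[OF sd[of i j "e/4"]] N that \<open>e > 0\<close> by force
    thus ?thesis by blast
  qed
  then obtain r where r: "strict_mono r" and ae: "AE x in lborel. Cauchy (\<lambda>i. s (r i) x)"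
    using cauchy_L1_AE_cauchy_subseq[of lborel s] L21b_integrable(1)[OF sL] by blast
  define g where "g = (\<lambda>x. lim (\<lambda>i. D (r i) x))"
  have gm [measurable]: "g \<in> borel_measurable borel" unfolding g_def by measurable
  have lim: "AE x in lborel. (\<lambda>i. D (r i) x) \<longlonglongrightarrow> g x"
    using ae
  proof eventually_elim
    fix x assume "Cauchy (\<lambda>i. s (r i) x)"
    then obtain l where "(\<lambda>i. s (r i) x) \<longlonglongrightarrow> l" using Cauchy_convergent_iff convergent_def by blast
    hence "(\<lambda>i. complex_of_real (jbracket x) * s (r i) x) \<longlonglongrightarrow> complex_of_real (jbracket x) * l" by (intro tendsto_intros)
    hence "convergent (\<lambda>i. D (r i) x)" using j[of x] by (auto simp: s_def convergent_def)
    thus "(\<lambda>i. D (r i) x) \<longlonglongrightarrow> g x" unfolding g_def by (simp add: convergent_LIMSEQ_iff)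
  qed
  show thesis
  proof
    show "L2b g B" by (rule L2b_lim_AE[OF D gm lim])
    fix \<epsilon> :: real assume "0 < \<epsilon>"
    then obtain N where N: "\<forall>m\<ge>N. \<forall>n\<ge>N. L2b (\<lambda>x. D m x - D n x) \<epsilon>" using C by blast
    \<comment> \<open>The index \<open>r (i + N)\<close> is at least N, so Fatou's lemma along the
      subsequence turns the Cauchy estimate into convergence of the whole sequence.\<close>
    have "L2b (\<lambda>x. D n x - g x) \<epsilon>" if "n \<ge> N" for n
    proof (rule L2b_lim_AE[where f="\<lambda>i x. D n x - D (r (i + N)) x"])
      show "L2b (\<lambda>x. D n x - D (r (i + N)) x) \<epsilon>" for i
        using N that seq_suble[OF r, of "i + N"] by auto
      show "AE x in lborel. (\<lambda>i. D n x - D (r (i + N)) x) \<longlonglongrightarrow> D n x - g x"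
        using lim by eventually_elim (intro tendsto_intros LIMSEQ_ignore_initial_segment)
    qed measurable
    thus "\<exists>N. \<forall>n\<ge>N. L2b (\<lambda>x. D n x - g x) \<epsilon>" by blast
  qed
qed

section \<open>Weak derivatives as limits of difference quotients\<close>

lemma test_functionD:
  assumes "test_function \<psi>"
  obtains R C where "0 < R" "0 \<le> C" "\<And>x. \<bar>x\<bar> > R \<Longrightarrow> \<psi> x = 0" "\<And>x. \<bar>\<psi> x\<bar> \<le> C" "\<And>x. \<bar>deriv \<psi> x\<bar> \<le> C"
    "\<And>x. \<bar>x\<bar> > R \<Longrightarrow> deriv \<psi> x = 0" "\<And>x. (\<psi> has_real_derivative deriv \<psi> x) (at x)"
    "continuous_on UNIV \<psi>" "continuous_on UNIV (deriv \<psi>)"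
proof -
  have d0: "\<psi> differentiable (at x)" and d1: "deriv \<psi> differentiable (at x)" for x
    using assms unfolding test_function_def by (metis funpow_0, metis funpow.simps(2) funpow_0 comp_apply)
  have D: "(\<psi> has_real_derivative deriv \<psi> x) (at x)" for x
    using d0[of x] by (simp add: DERIV_deriv_iff_real_differentiable)
  have c0: "continuous_on UNIV \<psi>" and c1: "continuous_on UNIV (deriv \<psi>)"
    using d0 d1 by (auto intro!: differentiable_imp_continuous_within continuous_at_imp_continuous_on)
  obtain R' where R': "\<And>x. \<bar>x\<bar> > R' \<Longrightarrow> \<psi> x = 0" using assms unfolding test_function_def by auto
  define R where "R = \<bar>R'\<bar> + 1"
  have R: "0 < R" "\<And>x. \<bar>x\<bar> > R \<Longrightarrow> \<psi> x = 0" using R' by (auto simp: R_def)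
  have R1: "deriv \<psi> x = 0" if "\<bar>x\<bar> > R" for x
  proof -
    have "eventually (\<lambda>y. y \<in> {y. \<bar>y\<bar> > R}) (nhds x)"
      using that by (intro eventually_nhds_in_open open_Collect_less continuous_intros) auto
    hence "eventually (\<lambda>y. \<psi> y = 0) (nhds x)" by eventually_elim (use R in auto)
    hence "deriv \<psi> x = deriv (\<lambda>_. 0) x" by (rule deriv_cong_ev) simp
    thus ?thesis by simp
  qed
  have "bounded (\<psi> ` {-R..R})" "bounded (deriv \<psi> ` {-R..R})"
    using c0 c1 by (auto intro!: compact_imp_bounded compact_continuous_image intro: continuous_on_subset)
  then obtain a b where "\<forall>x\<in>{-R..R}. \<bar>\<psi> x\<bar> \<le> a" "\<forall>x\<in>{-R..R}. \<bar>deriv \<psi> x\<bar> \<le> b"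
    unfolding bounded_iff by auto
  hence ab: "\<And>x. x \<in> {-R..R} \<Longrightarrow> \<bar>\<psi> x\<bar> \<le> a" "\<And>x. x \<in> {-R..R} \<Longrightarrow> \<bar>deriv \<psi> x\<bar> \<le> b" by blast+
  define C where "C = max 0 (max a b)"
  have "\<bar>\<psi> x\<bar> \<le> C" "\<bar>deriv \<psi> x\<bar> \<le> C" for x
    using ab[of x] R(2)[of x] R1[of x] unfolding C_def by (cases "\<bar>x\<bar> > R"; force)+
  thus thesis using that[of R C] R R1 D c0 c1 by (simp add: C_def)
qed

lemma compact_support_L2b:
  fixes \<eta> :: "real \<Rightarrow> real"
  assumes [measurable]: "\<eta> \<in> borel_measurable borel" and "0 \<le> R" and "\<And>x. \<bar>x\<bar> > R \<Longrightarrow> \<eta> x = 0" "\<And>x. \<bar>\<eta> x\<bar> \<le> C"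
  shows "L2b (\<lambda>x. complex_of_real (\<eta> x)) (C * sqrt (2 * R))"
proof -
  have C: "0 \<le> C" using assms(4)[of 0] by linarith
  have "L2b (\<lambda>x. complex_of_real C * indicator {-R..R} x) (norm (complex_of_real C) * sqrt (2 * R))"
    by (intro L2b_cmult L2b_indicator assms)
  hence "L2b (\<lambda>x. complex_of_real C * indicator {-R..R} x) (C * sqrt (2 * R))" using C by simp
  thus ?thesis
  proof (rule L2b_mono)
    show "norm (complex_of_real (\<eta> x)) \<le> norm (complex_of_real C * indicator {-R..R} x)" for x
      using assms(3)[of x] assms(4)[of x] C by (cases "\<bar>x\<bar> > R") (auto simp: indicator_def norm_mult)
  qed measurable
qed

text \<open>A translation of the variable moves the difference quotient from s to the test function.
  The limit is then taken on both sides: by L^2 convergence where the quotient sits on s, by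
  dominated convergence where it sits on \<psi>.\<close>

lemma weak_deriv_of_quotients:
  fixes s :: "real \<Rightarrow> complex" and h :: "nat \<Rightarrow> real"
  assumes s: "L2b s B" and g: "L2b g B'" and h: "\<And>n. h n \<noteq> 0" "h \<longlonglongrightarrow> 0" "\<And>n. \<bar>h n\<bar> \<le> 1"
    and conv: "\<And>\<epsilon>. 0 < \<epsilon> \<Longrightarrow> \<exists>N. \<forall>n\<ge>N. L2b (\<lambda>x. (s (x + h n) - s x) / complex_of_real (h n) - g x) \<epsilon>"
  shows "has_weak_deriv s g"
  unfolding has_weak_deriv_def
proof (intro conjI allI impI L2b_locally_integrable[OF s] L2b_locally_integrable[OF g])
  fix \<psi> assume "test_function \<psi>"
  then obtain R C where R: "0 < R" and C0: "0 \<le> C" and R0: "\<And>x. \<bar>x\<bar> > R \<Longrightarrow> \<psi> x = 0" and C: "\<And>x. \<bar>\<psi> x\<bar> \<le> C" "\<And>x. \<bar>deriv \<psi> x\<bar> \<le> C"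
    and D: "\<And>x. (\<psi> has_real_derivative deriv \<psi> x) (at x)" and c: "continuous_on UNIV \<psi>" "continuous_on UNIV (deriv \<psi>)"
    by (rule test_functionD) blast
  have [measurable]: "\<psi> \<in> borel_measurable borel" "deriv \<psi> \<in> borel_measurable borel" using c by (auto intro: borel_measurable_continuous_onI)
  note [measurable] = L2bD(1)[OF s] L2bD(1)[OF g]
  let ?q = "\<lambda>n x. (s (x + h n) - s x) / complex_of_real (h n)"
  let ?p = "\<lambda>n x. (\<psi> (x - h n) - \<psi> x) / h n"
  have L\<psi>: "L2b (\<lambda>x. complex_of_real (\<psi> x)) (C * sqrt (2 * R))"
    by (rule compact_support_L2b) (use R R0 C in auto)
  have sh: "L2b (\<lambda>x. s (x + h n)) B" for n
  proof -
    have "(\<integral>\<^sup>+x. ennreal ((cmod (s x))\<^sup>2) \<partial>lborel) = ennreal \<bar>1\<bar> * (\<integral>\<^sup>+x. ennreal ((cmod (s (h n + 1 * x)))\<^sup>2) \<partial>lborel)"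
      by (rule nn_integral_real_affine) auto
    thus ?thesis using s unfolding L2b_def by (simp add: add.commute)
  qed
  have e: "(LINT x|lborel. complex_of_real (\<psi> x) * ?q n x) = (LINT x|lborel. complex_of_real (?p n x) * s x)" for n
  proof -
    have i1: "integrable lborel (\<lambda>x. complex_of_real (\<psi> x) * s (x + h n))" by (rule L2b_product(1)[OF L\<psi> sh])
    have i2: "integrable lborel (\<lambda>x. complex_of_real (\<psi> x) * s x)" by (rule L2b_product(1)[OF L\<psi> s])
    have i3: "integrable lborel (\<lambda>x. complex_of_real (\<psi> (x - h n)) * s x)"
      using lborel_integrable_real_affine[OF i1, of 1 "- h n"] by simp
    have "(LINT x|lborel. complex_of_real (\<psi> x) * s (x + h n)) = (LINT x|lborel. complex_of_real (\<psi> (x - h n)) * s x)"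
      using lborel_integral_real_affine[of 1 "\<lambda>x. complex_of_real (\<psi> x) * s (x + h n)" "- h n"] by simp
    hence "(LINT x|lborel. (complex_of_real (\<psi> x) * s (x + h n) - complex_of_real (\<psi> x) * s x) / complex_of_real (h n))
      = (LINT x|lborel. (complex_of_real (\<psi> (x - h n)) * s x - complex_of_real (\<psi> x) * s x) / complex_of_real (h n))"
      using i1 i2 i3 by simp
    thus ?thesis by (simp add: right_diff_distrib left_diff_distrib diff_divide_distrib)
  qed
  \<comment> \<open>The translated test functions have support in [-R - 1, R + 1] because |h n|
    \<le> 1, and the mean value theorem bounds their quotients by C.\<close>
  have "(\<lambda>n. LINT x|lborel. complex_of_real (?p n x) * s x) \<longlonglongrightarrow> (LINT x|lborel. complex_of_real (- deriv \<psi> x) * s x)"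
  proof (rule integral_dominated_convergence[where w="\<lambda>x. cmod ((complex_of_real C * indicator {-(R+1)..R+1} x) * s x)"])
    have "L2b (\<lambda>x. complex_of_real C * indicator {-(R+1)..R+1} x) (norm (complex_of_real C) * sqrt (2 * (R+1)))"
      using R by (intro L2b_cmult L2b_indicator) auto
    thus "integrable lborel (\<lambda>x. cmod ((complex_of_real C * indicator {-(R+1)..R+1} x) * s x))"
      by (intro integrable_norm L2b_product(1)[OF _ s])
    show "AE x in lborel. (\<lambda>n. complex_of_real (?p n x) * s x) \<longlonglongrightarrow> complex_of_real (- deriv \<psi> x) * s x"
    proof (intro AE_I2 tendsto_intros tendsto_of_real)
      fix x
      have "(\<lambda>t. (\<psi> (x + t) - \<psi> x) / t) \<midarrow>0\<rightarrow> deriv \<psi> x" using D[of x] by (simp add: DERIV_def)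
      moreover have "(\<lambda>n. - h n) \<longlonglongrightarrow> - 0" using h(2) by (rule tendsto_minus)
      hence "filterlim (\<lambda>n. - h n) (at 0) sequentially" using h(1) by (simp add: filterlim_at)
      ultimately have "(\<lambda>n. (\<psi> (x + - h n) - \<psi> x) / (- h n)) \<longlonglongrightarrow> deriv \<psi> x" by (rule filterlim_compose)
      hence "(\<lambda>n. - ((\<psi> (x + - h n) - \<psi> x) / (- h n))) \<longlonglongrightarrow> - deriv \<psi> x" by (rule tendsto_minus)
      thus "(\<lambda>n. ?p n x) \<longlonglongrightarrow> - deriv \<psi> x" by simp
    qed
    fix n
    have "\<bar>?p n x\<bar> \<le> C" for x
    proof -
      have "\<bar>\<psi> (x - h n) - \<psi> x\<bar> \<le> C * \<bar>(x - h n) - x\<bar>"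
        using field_differentiable_bound[of UNIV \<psi> "deriv \<psi>" C "x" "x - h n"] D C(2) by (auto simp: has_field_derivative_at_within)
      thus ?thesis using h(1)[of n] by (simp add: field_simps)
    qed
    moreover have "?p n x = 0" if "\<bar>x\<bar> > R + 1" for x using that R0[of x] R0[of "x - h n"] h(3)[of n] by auto
    ultimately have "\<bar>?p n x\<bar> \<le> C * indicator {-(R+1)..R+1} x" for x by (cases "\<bar>x\<bar> > R + 1") (auto simp: indicator_def)
    moreover have "cmod (complex_of_real C * indicator {-(R+1)..R+1} x) = C * indicator {-(R+1)..R+1} x" for x
      using C0 by (simp add: norm_mult indicator_def)
    ultimately have "cmod (complex_of_real (?p n x)) \<le> cmod (complex_of_real C * indicator {-(R+1)..R+1} x)" for x
      by (simp only: norm_of_real)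
    thus "AE x in lborel. cmod (complex_of_real (?p n x) * s x) \<le> cmod ((complex_of_real C * indicator {-(R+1)..R+1} x) * s x)"
      unfolding norm_mult[of _ "s _"] by (intro AE_I2 mult_right_mono) auto
  qed measurable
  moreover have "(\<lambda>n. LINT x|lborel. complex_of_real (\<psi> x) * ?q n x) \<longlonglongrightarrow> (LINT x|lborel. complex_of_real (\<psi> x) * g x)"
  proof (rule LIMSEQ_I)
    fix r :: real assume r: "0 < r"
    define K where "K = C * sqrt (2 * R) + 1"
    have K: "0 < K" "C * sqrt (2 * R) < K" unfolding K_def using C0 R by (auto intro: add_nonneg_pos)
    obtain N where N: "\<forall>n\<ge>N. L2b (\<lambda>x. ?q n x - g x) (r / K)" using conv[of "r / K"] r K by auto
    have "cmod ((LINT x|lborel. complex_of_real (\<psi> x) * ?q n x) - (LINT x|lborel. complex_of_real (\<psi> x) * g x)) < r" if "n \<ge> N" for n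
    proof -
      have Lq: "L2b (\<lambda>x. (?q n x - g x) + g x) (r / K + B')" using N that by (intro L2b_add g) auto
      hence i1: "integrable lborel (\<lambda>x. complex_of_real (\<psi> x) * ?q n x)" using L2b_product(1)[OF L\<psi> Lq] by simp
      have i2: "integrable lborel (\<lambda>x. complex_of_real (\<psi> x) * g x)" by (rule L2b_product(1)[OF L\<psi> g])
      have "(LINT x|lborel. complex_of_real (\<psi> x) * ?q n x) - (LINT x|lborel. complex_of_real (\<psi> x) * g x) = (LINT x|lborel. complex_of_real (\<psi> x) * (?q n x - g x))"
        unfolding right_diff_distrib[of "complex_of_real _" "?q n _"] by (rule Bochner_Integration.integral_diff[OF i1 i2, symmetric])
      hence "cmod ((LINT x|lborel. complex_of_real (\<psi> x) * ?q n x) - (LINT x|lborel. complex_of_real (\<psi> x) * g x)) \<le> C * sqrt (2 * R) * (r / K)"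
        using L2b_product(3)[OF L\<psi>, of "\<lambda>x. ?q n x - g x" "r / K"] N that by simp
      also have "\<dots> < K * (r / K)" using K r by (intro mult_strict_right_mono) auto
      finally show ?thesis using K by simp
    qed
    thus "\<exists>N. \<forall>n\<ge>N. cmod ((LINT x|lborel. complex_of_real (\<psi> x) * ?q n x) - (LINT x|lborel. complex_of_real (\<psi> x) * g x)) < r" by blast
  qed
  ultimately have "(LINT x|lborel. complex_of_real (\<psi> x) * g x) = (LINT x|lborel. complex_of_real (- deriv \<psi> x) * s x)"
    unfolding e by (rule LIMSEQ_unique[OF _ , rotated])
  thus "(LINT x|lborel. deriv \<psi> x *\<^sub>R s x) = - (LINT x|lborel. \<psi> x *\<^sub>R g x)"
    by (simp add: scaleR_conv_of_real)
qed

definition H1b :: "(real \<Rightarrow> complex) \<Rightarrow> real \<Rightarrow> bool" where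
  "H1b f B \<longleftrightarrow> L2b f B \<and> (\<exists>g. has_weak_deriv f g \<and> L2b g B)"

text \<open>Completeness of L^2 provides a limit of the quotients, which is the weak derivative and
  inherits the bound B.\<close>

lemma H1b_of_quotients:
  fixes s :: "real \<Rightarrow> complex"
  defines "q \<equiv> \<lambda>n x. (s (x + 1 / real (Suc n)) - s x) / complex_of_real (1 / real (Suc n))"
  assumes s: "L2b s B" and b: "\<And>n. L2b (q n) B"
    and C: "\<And>\<epsilon>. 0 < \<epsilon> \<Longrightarrow> \<exists>N. \<forall>m\<ge>N. \<forall>n\<ge>N. L2b (\<lambda>x. q m x - q n x) \<epsilon>"
  shows "H1b s B"
proof -
  obtain g where g: "L2b g B" "\<And>\<epsilon>. 0 < \<epsilon> \<Longrightarrow> \<exists>N. \<forall>n\<ge>N. L2b (\<lambda>x. q n x - g x) \<epsilon>"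
    using Riesz_Fischer[OF b C] by blast
  have "has_weak_deriv s g"
    by (rule weak_deriv_of_quotients[OF s g(1), where h="\<lambda>n. 1 / real (Suc n)"])
      (use g(2) LIMSEQ_Suc[OF lim_1_over_n] in \<open>auto simp: q_def\<close>)
  thus ?thesis using s g(1) unfolding H1b_def by blast
qed

lemma difq_tendsto: "(\<lambda>n. difq (1 / real (Suc n)) c y) \<longlonglongrightarrow> 2 * \<i> * complex_of_real (c * y)"
proof -
  have "((\<lambda>t. exp (\<i> * complex_of_real (2 * c * y) * t)) has_field_derivative (\<i> * complex_of_real (2 * c * y)) * exp (\<i> * complex_of_real (2 * c * y) * 0)) (at 0)"
    by (auto intro!: derivative_eq_intros)
  hence "(\<lambda>t. (exp (\<i> * complex_of_real (2 * c * y) * t) - 1) / t) \<midarrow>0\<rightarrow> \<i> * complex_of_real (2 * c * y)"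
    by (simp add: DERIV_def)
  moreover have "filterlim (\<lambda>n. complex_of_real (1 / real (Suc n))) (at 0) sequentially"
  proof -
    have "(\<lambda>n. complex_of_real (1 / real (Suc n))) \<longlonglongrightarrow> complex_of_real 0"
      by (intro tendsto_of_real LIMSEQ_Suc[OF lim_1_over_n])
    thus ?thesis by (simp add: filterlim_at del: of_real_divide)
  qed
  ultimately have "(\<lambda>n. (exp (\<i> * complex_of_real (2 * c * y) * complex_of_real (1 / real (Suc n))) - 1) / complex_of_real (1 / real (Suc n))) \<longlonglongrightarrow> \<i> * complex_of_real (2 * c * y)"
    by (rule filterlim_compose)
  moreover have "\<i> * complex_of_real (2 * c * y) * complex_of_real (1 / real (Suc n)) = \<i> * complex_of_real (2 * (1 / real (Suc n)) * c * y)" for n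
    by simp
  ultimately show ?thesis unfolding difq_def cis_conv_exp by (simp add: mult_ac)
qed

section \<open>Limits of oscillating solutions and their regularity in z\<close>

context osc begin

text \<open>The limit of component i at plus infinity (\<open>amp_tendsto\<close>), written as a
  total integral.\<close>

definition amp :: "('n \<Rightarrow> 'n \<Rightarrow> real \<Rightarrow> complex) \<Rightarrow> (real \<Rightarrow> 'n \<Rightarrow> real \<Rightarrow> complex) \<Rightarrow> real \<Rightarrow> 'n \<Rightarrow> complex" where
  "amp M f z i = e i + (LINT y|lborel. (\<Sum>j\<in>UNIV. iker c M z i j y * f z j y))"

lemma isol_exists:
  fixes M :: "'n \<Rightarrow> 'n \<Rightarrow> real \<Rightarrow> complex"
  assumes L: "\<And>i j. L21b (M i j) B"
  shows "isol c M e (\<lambda>z. volsol (\<lambda>i j x y. iker c M z i j y) e)"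
proof -
  interpret V: volterra "\<lambda>i j x y. iker c M w i j y" "ksum M" e for w by (rule vol[OF L])
  show ?thesis unfolding isol_def
  proof (intro conjI allI)
    have [measurable]: "M i j \<in> borel_measurable borel" for i j by (rule L21b_measurable[OF L])
    show "(\<lambda>p. volsol (\<lambda>i j x y. iker c M (fst p) i j y) e i (snd p)) \<in> borel_measurable (borel \<Otimes>\<^sub>M borel)" for i
      by (rule volsol_measurable_param) (simp add: iker_def)
    show "volsol (\<lambda>i j x y. iker c M z i j y) e i x = e i + cum (\<lambda>y. \<Sum>j\<in>UNIV. iker c M z i j y * volsol (\<lambda>i j x y. iker c M z i j y) e j y) x" for z i x
      by (rule V.volsol_eq)
    show "(\<Sum>i\<in>UNIV. cmod (volsol (\<lambda>i j x y. iker c M z i j y) e i x)) \<le> (\<Sum>i\<in>UNIV. cmod (e i)) * exp (LINT y|lborel. ksum M y)" for z x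
      using V.volsol_bound[of z x] unfolding V.E_def V.T_def .
  qed
qed

lemma amp_tendsto:
  assumes M: "adm M B" and f: "isol c M e f"
  shows "(\<lambda>n. f z i (real n)) \<longlonglongrightarrow> amp M f z i"
  unfolding amp_def
  by (subst isolD(3)[OF M f], intro tendsto_intros cum_at_top isolD(6)[OF M f] filterlim_real_sequentially)

lemma amp_minus_init_L2: "adm M B \<Longrightarrow> isol c M e f \<Longrightarrow> L2b (\<lambda>z. amp M f z i - e i) (C3 B)"
  by (rule L2b_lim[OF sol_minus_init_L2]) (auto intro!: tendsto_intros amp_tendsto)

lemma amp_diff_L2:
  assumes "adm M B" "isol c M e f" "adm M' B" "isol c M' e f'" "\<And>i j. L21b (\<lambda>y. M i j y - M' i j y) \<delta>"
  shows "L2b (\<lambda>z. amp M f z i - amp M' f' z i) (C4 B * \<delta>)"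
  by (rule L2b_lim[where f="\<lambda>k z. f z i (real k) - f' z i (real k)", OF sol_diff_L2[OF assms]])
    (intro tendsto_intros amp_tendsto[OF assms(1,2)] amp_tendsto[OF assms(3,4)])

definition ampquo where "ampquo h M f z i = (amp M f (z + h) i - amp M f z i) / complex_of_real h"

lemma ampquo_tendsto:
  assumes M: "adm M B" and f: "isol c M e f" and h: "h \<noteq> 0"
  shows "(\<lambda>n. quo h f z i (real n)) \<longlonglongrightarrow> ampquo h M f z i"
  unfolding quo_def ampquo_def using h by (intro tendsto_intros amp_tendsto[OF M f]) auto

lemma ampquo_L2: "adm M B \<Longrightarrow> isol c M e f \<Longrightarrow> h \<noteq> 0 \<Longrightarrow> L2b (\<lambda>z. ampquo h M f z i) (C5 B)"
  by (rule L2b_lim[OF quo_props(4)]) (auto intro!: ampquo_tendsto)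

lemma iker_minus: "iker c M h i j y - iker c M' h i j y = iker c (\<lambda>i j y. M i j y - M' i j y) h i j y"
  by (simp add: iker_def right_diff_distrib)

text \<open>The hypotheses of \<open>quo_diff_L2\<close> hold with 2 \<delta>: the L^1 norm costs a
  factor 2 by \<open>L21b_integrable\<close>, the differentiated kernel by |difq| \<le> 2
  |y|.\<close>

lemma ampquo_diff_L2:
  assumes M: "adm M B" and f: "isol c M e f" and M': "adm M' B" and f': "isol c M' e f'" and h: "h \<noteq> 0"
    and \<delta>: "\<And>i j. L21b (\<lambda>y. M i j y - M' i j y) \<delta>"
  shows "L2b (\<lambda>z. ampquo h M f z i - ampquo h M' f' z i) (C6 B * (2 * \<delta>))"
proof (rule L2b_lim)
  have d0: "0 \<le> \<delta>" by (rule L21b_nonneg[OF \<delta>])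
  show "L2b (\<lambda>z. quo h f z i (real n) - quo h f' z i (real n)) (C6 B * (2 * \<delta>))" for n
  proof (rule quo_diff_L2[OF M f M' f' h h])
    show "L21b (\<lambda>y. M i j y - M' i j y) (2 * \<delta>)" for i j by (rule L21b_bound_mono[OF \<delta>]) (use d0 in simp)
    show "(LINT y|lborel. cmod (iker c M h i j y - iker c M' h i j y)) \<le> 2 * \<delta>" for i j
      using L21b_integrable(2)[OF \<delta>, of i j] unfolding iker_minus by (simp add: iker_def norm_mult)
    have "(\<lambda>y. difM h M i j y - difM h M' i j y) = difM h (\<lambda>i j y. M i j y - M' i j y) i j" for i j
      by (simp add: difM_def fun_eq_iff right_diff_distrib)
    thus "L2b (\<lambda>y. difM h M i j y - difM h M' i j y) (2 * \<delta>)" for i j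
      using difM(2)[of "\<lambda>i j y. M i j y - M' i j y", OF \<delta> h] by simp
  qed
  show "(\<lambda>n. quo h f z i (real n) - quo h f' z i (real n)) \<longlonglongrightarrow> ampquo h M f z i - ampquo h M' f' z i" for z
    by (intro tendsto_intros ampquo_tendsto[OF M f h] ampquo_tendsto[OF M' f' h])
qed

text \<open>\<open>quo_diff_L2\<close> with M' = M. Its hypotheses hold for all small steps by
  dominated convergence: the kernels at parameter h tend to \<open>M\<close> in L^1, and the
  differentiated kernels tend in L^2 to 2 i c y M, with majorant 2 |y M|.\<close>

lemma ampquo_Cauchy:
  assumes M: "adm M B" and f: "isol c M e f" and \<epsilon>: "0 < \<epsilon>"
  shows "\<exists>N. \<forall>m\<ge>N. \<forall>n\<ge>N. L2b (\<lambda>z. ampquo (1 / real (Suc m)) M f z i - ampquo (1 / real (Suc n)) M f z i) \<epsilon>"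
proof -
  have B: "0 \<le> B" by (rule admD(5)[OF M])
  define \<delta> where "\<delta> = \<epsilon> / (C6 B + 1)"
  have \<delta>: "0 < \<delta>" "C6 B * \<delta> \<le> \<epsilon>" using \<epsilon> nonneg(10)[OF B] by (auto simp: \<delta>_def field_simps)
  let ?h = "\<lambda>n. 1 / real (Suc n)"
  have [measurable]: "M i j \<in> borel_measurable borel" for i j by (rule admD(2)[OF M])
  have Mi: "integrable lborel (M i j)" for i j by (rule L21b_integrable[OF admD(1)[OF M]])
  have h0: "?h \<longlonglongrightarrow> 0" by (rule LIMSEQ_Suc[OF lim_1_over_n])
  have 1: "\<forall>\<^sub>F n in sequentially. (LINT y|lborel. cmod (iker c M (?h n) i j y - M i j y)) < \<delta> / 2" for i j
  proof (rule order_tendstoD(2))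
    have "(\<lambda>n. LINT y|lborel. cmod (iker c M (?h n) i j y - M i j y)) \<longlonglongrightarrow> (LINT y|(lborel::real measure). 0)"
    proof (rule integral_dominated_convergence[where w="\<lambda>y. 2 * cmod (M i j y)"])
      show "AE y in lborel. (\<lambda>n. cmod (iker c M (?h n) i j y - M i j y)) \<longlonglongrightarrow> 0"
      proof (rule AE_I2)
        fix y
        have "(\<lambda>n. cmod (exp (\<i> * complex_of_real (2 * ?h n * c i j * y)) * M i j y - M i j y)) \<longlonglongrightarrow> cmod (exp (\<i> * complex_of_real (2 * 0 * c i j * y)) * M i j y - M i j y)"
          by (intro tendsto_intros h0)
        thus "(\<lambda>n. cmod (iker c M (?h n) i j y - M i j y)) \<longlonglongrightarrow> 0" by (simp add: iker_def cis_conv_exp)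
      qed
      show "AE y in lborel. norm (cmod (iker c M (?h n) i j y - M i j y)) \<le> 2 * cmod (M i j y)" for n
      proof (rule AE_I2)
        fix y
        show "norm (cmod (iker c M (?h n) i j y - M i j y)) \<le> 2 * cmod (M i j y)"
          using norm_triangle_ineq4[of "iker c M (?h n) i j y" "M i j y"] by (simp add: iker_def norm_mult)
      qed
      show "integrable lborel (\<lambda>y. 2 * cmod (M i j y))" using Mi by simp
    qed (auto simp: iker_def)
    thus "(\<lambda>n. LINT y|lborel. cmod (iker c M (?h n) i j y - M i j y)) \<longlonglongrightarrow> 0" by simp
  qed (use \<delta> in simp)
  define F where "F = (\<lambda>i j y. 2 * \<i> * complex_of_real (c i j * y) * M i j y)"
  have 2: "\<forall>\<^sub>F n in sequentially. L2b (\<lambda>y. difM (?h n) M i j y - F i j y) (\<delta> / 2)" for i j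
  proof (rule L2b_dominated)
    show "difM (?h n) M i j \<in> borel_measurable borel" for n unfolding difM_def[abs_def] by measurable
    show "(\<lambda>n. difM (?h n) M i j y) \<longlonglongrightarrow> F i j y" for y
      unfolding difM_def F_def by (intro tendsto_intros difq_tendsto)
    show "cmod (difM (?h n) M i j y) \<le> cmod (2 * (complex_of_real y * M i j y))" for n y
      using mult_right_mono[OF difq_bound(1)[OF _ c_abs[of i j], of "?h n" y] norm_ge_zero[of "M i j y"]] unfolding difM_def by (simp add: norm_mult mult.assoc[symmetric])
    show "L2b (\<lambda>y. 2 * (complex_of_real y * M i j y)) (norm (2::complex) * B)" by (intro L2b_cmult L21b_L2b(2) admD(1)[OF M])
  qed (use \<delta> in simp)
  have "\<forall>\<^sub>F n in sequentially. \<forall>i j. (LINT y|lborel. cmod (iker c M (?h n) i j y - M i j y)) < \<delta> / 2 \<and> L2b (\<lambda>y. difM (?h n) M i j y - F i j y) (\<delta> / 2)"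
    by (intro eventually_all_finite eventually_conj 1 2)
  then obtain N where N: "\<And>n i j. n \<ge> N \<Longrightarrow> (LINT y|lborel. cmod (iker c M (?h n) i j y - M i j y)) < \<delta> / 2"
     "\<And>n i j. n \<ge> N \<Longrightarrow> L2b (\<lambda>y. difM (?h n) M i j y - F i j y) (\<delta> / 2)"
    unfolding eventually_sequentially by blast
  have "L2b (\<lambda>z. ampquo (?h m) M f z i - ampquo (?h n) M f z i) \<epsilon>" if mn: "m \<ge> N" "n \<ge> N" for m n
  proof (rule L2b_lim)
    show "(\<lambda>k. quo (?h m) f z i (real k) - quo (?h n) f z i (real k)) \<longlonglongrightarrow> ampquo (?h m) M f z i - ampquo (?h n) M f z i" for z
      by (intro tendsto_intros ampquo_tendsto[OF M f]) auto
    fix k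
    have "L2b (\<lambda>z. quo (?h m) f z i (real k) - quo (?h n) f z i (real k)) (C6 B * \<delta>)"
    proof (rule quo_diff_L2[OF M f M f])
      show "L21b (\<lambda>y. M i j y - M i j y) \<delta>" for i j using \<delta> by simp
      show "(LINT y|lborel. cmod (iker c M (?h m) i j y - iker c M (?h n) i j y)) \<le> \<delta>" for i j
      proof -
        have ii: "integrable lborel (\<lambda>y. cmod (iker c M h i j y - M i j y))" for h
          by (intro integrable_norm Bochner_Integration.integrable_diff iker_integrable Mi)
        have "(LINT y|lborel. cmod (iker c M (?h m) i j y - iker c M (?h n) i j y)) \<le> (LINT y|lborel. cmod (iker c M (?h m) i j y - M i j y) + cmod (iker c M (?h n) i j y - M i j y))"
        proof (rule integral_mono)
          show "cmod (iker c M (?h m) i j y - iker c M (?h n) i j y) \<le> cmod (iker c M (?h m) i j y - M i j y) + cmod (iker c M (?h n) i j y - M i j y)" for y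
            using norm_triangle_ineq4[of "iker c M (?h m) i j y - M i j y" "iker c M (?h n) i j y - M i j y"] by simp
        qed (intro integrable_norm Bochner_Integration.integrable_diff Bochner_Integration.integrable_add iker_integrable Mi)+
        also have "\<dots> = (LINT y|lborel. cmod (iker c M (?h m) i j y - M i j y)) + (LINT y|lborel. cmod (iker c M (?h n) i j y - M i j y))"
          by (rule Bochner_Integration.integral_add[OF ii ii])
        also have "\<dots> \<le> \<delta>" using N(1)[OF mn(1), of i j] N(1)[OF mn(2), of i j] by linarith
        finally show ?thesis .
      qed
      show "L2b (\<lambda>y. difM (?h m) M i j y - difM (?h n) M i j y) \<delta>" for i j
        using L2b_diff[OF N(2)[OF mn(1), of i j] N(2)[OF mn(2), of i j]] by simp
    qed auto
    thus "L2b (\<lambda>z. quo (?h m) f z i (real k) - quo (?h n) f z i (real k)) \<epsilon>" by (rule L2b_bound_mono) (rule \<delta>)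
  qed
  thus ?thesis by blast
qed

lemma amp_H1:
  assumes M: "adm M B" and f: "isol c M e f"
  shows "H1b (\<lambda>z. amp M f z i - e i) (C3 B + C5 B)"
proof (rule H1b_of_quotients)
  have B: "0 \<le> B" by (rule admD(5)[OF M])
  show "L2b (\<lambda>z. amp M f z i - e i) (C3 B + C5 B)"
    by (rule L2b_bound_mono[OF amp_minus_init_L2[OF M f]]) (use nonneg[OF B] in simp)
  have eq: "(amp M f (z + 1 / real (Suc n)) i - e i - (amp M f z i - e i)) / complex_of_real (1 / real (Suc n)) = ampquo (1 / real (Suc n)) M f z i" for z n
    by (simp add: ampquo_def)
  show "L2b (\<lambda>z. (amp M f (z + 1 / real (Suc n)) i - e i - (amp M f z i - e i)) / complex_of_real (1 / real (Suc n))) (C3 B + C5 B)" for n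
    unfolding eq by (rule L2b_bound_mono[OF ampquo_L2[OF M f]]) (use nonneg[OF B] in auto)
  show "\<exists>N. \<forall>m\<ge>N. \<forall>n\<ge>N. L2b (\<lambda>z. (amp M f (z + 1 / real (Suc m)) i - e i - (amp M f z i - e i)) / complex_of_real (1 / real (Suc m))
      - (amp M f (z + 1 / real (Suc n)) i - e i - (amp M f z i - e i)) / complex_of_real (1 / real (Suc n))) \<epsilon>" if "0 < \<epsilon>" for \<epsilon>
    unfolding eq by (rule ampquo_Cauchy[OF M f that])
qed

text \<open>The bound on the quotients has to be linear in \<delta> and comes from
  \<open>ampquo_diff_L2\<close>. Their Cauchy property is purely qualitative and can be taken from
  each solution separately.\<close>

lemma amp_diff_H1:
  assumes M: "adm M B" and f: "isol c M e f" and M': "adm M' B" and f': "isol c M' e f'"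
    and \<delta>: "\<And>i j. L21b (\<lambda>y. M i j y - M' i j y) \<delta>"
  shows "H1b (\<lambda>z. amp M f z i - amp M' f' z i) ((C4 B + 2 * C6 B) * \<delta>)"
proof (rule H1b_of_quotients)
  have B: "0 \<le> B" by (rule admD(5)[OF M])
  have d0: "0 \<le> \<delta>" by (rule L21b_nonneg[OF \<delta>])
  show "L2b (\<lambda>z. amp M f z i - amp M' f' z i) ((C4 B + 2 * C6 B) * \<delta>)"
    by (rule L2b_bound_mono[OF amp_diff_L2[OF M f M' f' \<delta>]]) (use nonneg[OF B] d0 in \<open>auto intro!: mult_right_mono\<close>)
  have eq: "(amp M f (z + 1 / real (Suc n)) i - amp M' f' (z + 1 / real (Suc n)) i - (amp M f z i - amp M' f' z i)) / complex_of_real (1 / real (Suc n))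
     = ampquo (1 / real (Suc n)) M f z i - ampquo (1 / real (Suc n)) M' f' z i" for z n
    unfolding ampquo_def diff_divide_distrib[symmetric] by (rule arg_cong2[where f="(/)"]) simp_all
  show "L2b (\<lambda>z. (amp M f (z + 1 / real (Suc n)) i - amp M' f' (z + 1 / real (Suc n)) i - (amp M f z i - amp M' f' z i)) / complex_of_real (1 / real (Suc n))) ((C4 B + 2 * C6 B) * \<delta>)" for n
    unfolding eq by (rule L2b_bound_mono[OF ampquo_diff_L2[OF M f M' f' _ \<delta>]]) (use nonneg[OF B] d0 in \<open>auto simp: algebra_simps\<close>)
  fix \<epsilon> :: real assume "0 < \<epsilon>"
  then obtain N N' where N: "\<forall>m\<ge>N. \<forall>n\<ge>N. L2b (\<lambda>z. ampquo (1 / real (Suc m)) M f z i - ampquo (1 / real (Suc n)) M f z i) (\<epsilon>/2)"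
    "\<forall>m\<ge>N'. \<forall>n\<ge>N'. L2b (\<lambda>z. ampquo (1 / real (Suc m)) M' f' z i - ampquo (1 / real (Suc n)) M' f' z i) (\<epsilon>/2)"
    using ampquo_Cauchy[OF M f, of "\<epsilon>/2" i] ampquo_Cauchy[OF M' f', of "\<epsilon>/2" i] by auto
  show "\<exists>N. \<forall>m\<ge>N. \<forall>n\<ge>N. L2b (\<lambda>z. (amp M f (z + 1 / real (Suc m)) i - amp M' f' (z + 1 / real (Suc m)) i - (amp M f z i - amp M' f' z i)) / complex_of_real (1 / real (Suc m))
      - (amp M f (z + 1 / real (Suc n)) i - amp M' f' (z + 1 / real (Suc n)) i - (amp M f z i - amp M' f' z i)) / complex_of_real (1 / real (Suc n))) \<epsilon>"
    unfolding eq
  proof (intro exI[of _ "max N N'"] allI impI)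
    fix m n assume "max N N' \<le> m" "max N N' \<le> n"
    hence "L2b (\<lambda>z. (ampquo (1 / real (Suc m)) M f z i - ampquo (1 / real (Suc n)) M f z i) - (ampquo (1 / real (Suc m)) M' f' z i - ampquo (1 / real (Suc n)) M' f' z i)) (\<epsilon>/2 + \<epsilon>/2)"
      using N by (intro L2b_diff) auto
    thus "L2b (\<lambda>z. ampquo (1 / real (Suc m)) M f z i - ampquo (1 / real (Suc m)) M' f' z i - (ampquo (1 / real (Suc n)) M f z i - ampquo (1 / real (Suc n)) M' f' z i)) \<epsilon>"
      by (simp add: algebra_simps)
  qed
qed

end

section \<open>Integrals depending analytically on a parameter\<close>

lemma integrable_dominated:
  fixes f :: "real \<Rightarrow> complex"
  assumes g: "integrable lborel g" and m: "f \<in> borel_measurable borel" and le: "\<And>y. cmod (f y) \<le> g y"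
  shows "integrable lborel f"
proof (rule Bochner_Integration.integrable_bound[OF g])
  show "AE y in lborel. cmod (f y) \<le> norm (g y)"
    unfolding real_norm_def by (intro AE_I2 order_trans[OF le abs_ge_self])
qed (use m in simp)

text \<open>Differentiation under the integral needs a majorant for the difference quotients.
  Cauchy's inequality on discs of radius r/2 inside a disc of radius r around z0 derives it from the
  bound on f itself: 2 g / r.\<close>

lemma holomorphic_integral:
  fixes f :: "complex \<Rightarrow> real \<Rightarrow> complex"
  assumes S: "open S" and hol: "\<And>y. (\<lambda>z. f z y) holomorphic_on S"
    and meas: "\<And>z. z \<in> S \<Longrightarrow> f z \<in> borel_measurable borel"
    and le: "\<And>z y. z \<in> S \<Longrightarrow> cmod (f z y) \<le> g y" and g: "integrable lborel g"
  shows "(\<lambda>z. LINT y|lborel. f z y) holomorphic_on S"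
  unfolding holomorphic_on_open[OF S]
proof
  fix z0 assume z0: "z0 \<in> S"
  obtain r where r: "0 < r" "cball z0 r \<subseteq> S" using S z0 open_contains_cball by blast
  have fi: "integrable lborel (f z)" if "z \<in> S" for z
    by (rule integrable_dominated[OF g meas[OF that] le[OF that]])
  have dbound: "cmod (deriv (\<lambda>z. f z y) w) \<le> 2 * g y / r" if w: "w \<in> ball z0 (r/2)" for w y
  proof -
    have sub: "cball w (r/2) \<subseteq> cball z0 r"
    proof
      fix v assume "v \<in> cball w (r/2)"
      hence "dist z0 v \<le> r/2 + r/2" using w dist_triangle[of z0 v w] by simp
      thus "v \<in> cball z0 r" by simp
    qed
    have "norm ((deriv ^^ 1) (\<lambda>z. f z y) w) \<le> fact 1 * g y / (r/2) ^ 1"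
    proof (rule Cauchy_inequality)
      show "(\<lambda>z. f z y) holomorphic_on ball w (r/2)" by (rule holomorphic_on_subset[OF hol]) (use sub r(2) ball_subset_cball[of w "r/2"] in blast)
      show "continuous_on (cball w (r/2)) (\<lambda>z. f z y)" by (rule holomorphic_on_imp_continuous_on, rule holomorphic_on_subset[OF hol]) (use sub r(2) in blast)
      show "cmod (f x y) \<le> g y" if "cmod (w - x) = r/2" for x
      proof -
        have "x \<in> cball w (r/2)" using that by (simp add: dist_norm)
        thus ?thesis using sub r le by blast
      qed
    qed (use r in auto)
    thus ?thesis by (simp add: mult.commute)
  qed
  define D where "D = (\<lambda>y. deriv (\<lambda>z. f z y) z0)"
  have "((\<lambda>z. LINT y|lborel. f z y) has_field_derivative (LINT y|lborel. D y)) (at z0)"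
    unfolding has_field_derivative_iff tendsto_at_iff_sequentially comp_def
  proof (intro allI impI)
    fix X :: "nat \<Rightarrow> complex" assume X: "\<forall>i. X i \<in> UNIV - {z0}" and Xl: "X \<longlonglongrightarrow> z0"
    have "eventually (\<lambda>n. dist (X n) z0 < r/2) sequentially" using Xl r by (intro tendstoD) auto
    then obtain N where N: "\<And>n. n \<ge> N \<Longrightarrow> dist (X n) z0 < r/2" unfolding eventually_sequentially by blast
    let ?Y = "\<lambda>n. X (n + N)"
    have Yb: "?Y n \<in> ball z0 (r/2)" for n using N[of "n + N"] by (simp add: dist_commute)
    have YS: "?Y n \<in> S" for n using Yb[of n] r by auto
    have Y0: "?Y n \<noteq> z0" for n using X by auto
    have "(\<lambda>n. LINT y|lborel. (f (?Y n) y - f z0 y) / (?Y n - z0)) \<longlonglongrightarrow> (LINT y|lborel. D y)"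
    proof (rule integral_dominated_convergence[where w="\<lambda>y. 2 * g y / r"])
      have lim: "(\<lambda>n. (f (?Y n) y - f z0 y) / (?Y n - z0)) \<longlonglongrightarrow> D y" for y
      proof -
        have "((\<lambda>z. f z y) has_field_derivative D y) (at z0)"
          unfolding D_def by (rule holomorphic_derivI[OF hol S z0])
        hence "((\<lambda>z. (f z y - f z0 y) / (z - z0)) \<longlongrightarrow> D y) (at z0)" by (simp add: has_field_derivative_iff)
        moreover have "filterlim ?Y (at z0) sequentially"
          using LIMSEQ_ignore_initial_segment[OF Xl] Y0 by (simp add: filterlim_at)
        ultimately show ?thesis by (rule filterlim_compose)
      qed
      thus "AE y in lborel. (\<lambda>n. (f (?Y n) y - f z0 y) / (?Y n - z0)) \<longlonglongrightarrow> D y" by simp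
      have m: "(\<lambda>y. (f (?Y n) y - f z0 y) / (?Y n - z0)) \<in> borel_measurable borel" for n
        using meas[OF YS] meas[OF z0] by measurable
      thus "(\<lambda>y. (f (?Y n) y - f z0 y) / (?Y n - z0)) \<in> borel_measurable lborel" for n by simp
      show "D \<in> borel_measurable lborel" using borel_measurable_LIMSEQ_metric[OF m lim] by simp
      show "integrable lborel (\<lambda>y. 2 * g y / r)" using g by simp
      show "AE y in lborel. cmod ((f (?Y n) y - f z0 y) / (?Y n - z0)) \<le> 2 * g y / r" for n
      proof (rule AE_I2)
        fix y
        have "cmod (f (?Y n) y - f z0 y) \<le> (2 * g y / r) * cmod (?Y n - z0)"
        proof (rule field_differentiable_bound[where S="ball z0 (r/2)"])
          show "((\<lambda>z. f z y) has_field_derivative deriv (\<lambda>z. f z y) w) (at w within ball z0 (r/2))" if "w \<in> ball z0 (r/2)" for w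
          proof -
            have "w \<in> S" using that r by auto
            thus ?thesis by (rule has_field_derivative_at_within[OF holomorphic_derivI[OF hol S]])
          qed
          show "cmod (deriv (\<lambda>z. f z y) w) \<le> 2 * g y / r" if "w \<in> ball z0 (r/2)" for w by (rule dbound[OF that])
          show "?Y n \<in> ball z0 (r/2)" by (rule Yb)
          show "z0 \<in> ball z0 (r/2)" using r(1) by simp
        qed (rule convex_ball)
        thus "cmod ((f (?Y n) y - f z0 y) / (?Y n - z0)) \<le> 2 * g y / r"
          using Y0[of n] unfolding norm_divide by (simp only: pos_divide_le_eq zero_less_norm_iff right_minus_eq not_False_eq_True)
      qed
    qed
    moreover have E: "(LINT y|lborel. (f (?Y n) y - f z0 y) / (?Y n - z0)) = ((LINT y|lborel. f (?Y n) y) - (LINT y|lborel. f z0 y)) / (?Y n - z0)" for n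
      using fi[OF YS] fi[OF z0] by simp
    ultimately have "(\<lambda>n. ((LINT y|lborel. f (?Y n) y) - (LINT y|lborel. f z0 y)) / (?Y n - z0)) \<longlonglongrightarrow> (LINT y|lborel. D y)" unfolding E[symmetric] by simp
    thus "(\<lambda>n. ((LINT y|lborel. f (X n) y) - (LINT y|lborel. f z0 y)) / (X n - z0)) \<longlonglongrightarrow> (LINT y|lborel. D y)"
      by (rule LIMSEQ_offset)
  qed
  thus "\<exists>f'. ((\<lambda>z. LINT y|lborel. f z y) has_field_derivative f') (at z0)" by blast
qed

lemma continuous_integral:
  fixes f :: "complex \<Rightarrow> real \<Rightarrow> complex"
  assumes cont: "\<And>y. continuous_on S (\<lambda>z. f z y)"
    and meas: "\<And>z. z \<in> S \<Longrightarrow> f z \<in> borel_measurable borel"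
    and le: "\<And>z y. z \<in> S \<Longrightarrow> cmod (f z y) \<le> g y" and g: "integrable lborel g"
  shows "continuous_on S (\<lambda>z. LINT y|lborel. f z y)"
  unfolding continuous_on_sequentially comp_def
proof (intro allI ballI impI)
  fix X z assume z: "z \<in> S" and X: "(\<forall>n. X n \<in> S) \<and> X \<longlonglongrightarrow> z"
  show "(\<lambda>n. LINT y|lborel. f (X n) y) \<longlonglongrightarrow> (LINT y|lborel. f z y)"
  proof (rule integral_dominated_convergence[where w=g])
    show "AE y in lborel. (\<lambda>n. f (X n) y) \<longlonglongrightarrow> f z y"
      using cont z X unfolding continuous_on_sequentially comp_def by (intro AE_I2) blast
  qed (use X z meas le g in auto)
qed

section \<open>Analytic continuation\<close>

text \<open>Phases of the form \<sigma> j - \<sigma> i arise by dividing component i by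
  \<open>exp (2 * \<i> * z * \<sigma> i * x)\<close>, so they can be multiplied back in. Nonnegative
  \<sigma> gives decay for Im z > 0, and \<open>e_\<sigma>\<close> ensures that the initial values
  carry no phase.\<close>

locale phased = osc c e for c :: "'n::finite \<Rightarrow> 'n \<Rightarrow> real" and e :: "'n \<Rightarrow> complex" +
  fixes \<sigma> :: "'n \<Rightarrow> real"
  assumes c_eq: "c i j = \<sigma> j - \<sigma> i" and \<sigma>_nonneg: "0 \<le> \<sigma> i" and e_\<sigma>: "e i = 0 \<or> \<sigma> i = 0"
begin

text \<open>Kernel of the system with the phases restored. For y < x and Im z \<ge> 0 the
  exponential has modulus at most 1; the cut-off at y < x is invisible under \<open>cum\<close> and
  makes the bound by \<open>ksum M\<close> hold for all x and y.\<close>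

definition hker :: "('n \<Rightarrow> 'n \<Rightarrow> real \<Rightarrow> complex) \<Rightarrow> complex \<Rightarrow> 'n \<Rightarrow> 'n \<Rightarrow> real \<Rightarrow> real \<Rightarrow> complex" where
  "hker M z i j x y = (if y < x then exp (2 * \<i> * z * complex_of_real (\<sigma> i * (x - y))) * M i j y else 0)"

definition hamp :: "('n \<Rightarrow> 'n \<Rightarrow> real \<Rightarrow> complex) \<Rightarrow> 'n \<Rightarrow> complex \<Rightarrow> complex" where
  "hamp M i z = e i + (LINT y|lborel. (\<Sum>j\<in>UNIV. M i j y * volsol (hker M z) e j y))"

lemma hvol:
  assumes L: "\<And>i j. L21b (M i j) B" and z: "0 \<le> Im z"
  shows "volterra (hker M z) (ksum M)"
proof
  have [measurable]: "M i j \<in> borel_measurable borel" for i j by (rule L21b_measurable[OF L])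
  show "(\<lambda>p. hker M z i j (fst p) (snd p)) \<in> borel_measurable (borel \<Otimes>\<^sub>M borel)" for i j
    unfolding hker_def by measurable
  show "integrable lborel (ksum M)" by (rule ksum_integral[OF L])
  fix x y
  have "cmod (hker M z i j x y) \<le> cmod (M i j y)" for i j
  proof (cases "y < x")
    case True
    have "cmod (exp (2 * \<i> * z * complex_of_real (\<sigma> i * (x - y)))) = exp (- 2 * Im z * (\<sigma> i * (x - y)))"
      by (simp add: norm_exp_eq_Re)
    also have "\<dots> \<le> 1" using z \<sigma>_nonneg[of i] True by (simp add: zero_le_mult_iff)
    finally show ?thesis using True by (simp add: hker_def norm_mult mult_left_le_one_le)
  qed (simp add: hker_def)
  thus "(\<Sum>i\<in>UNIV. \<Sum>j\<in>UNIV. cmod (hker M z i j x y)) \<le> ksum M y"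
    unfolding ksum_def by (intro sum_mono)
qed

text \<open>Taking the phases off the solution for \<open>hker\<close> gives a bounded solution of
  the \<open>iker\<close> system with the same initial values; uniqueness identifies it with
  f.\<close>

lemma hker_sol:
  assumes M: "adm M B" and f: "isol c M e f"
  shows "volsol (hker M (complex_of_real z)) e i x = cis (2 * z * \<sigma> i * x) * f z i x"
proof -
  note D = isolD[OF M f]
  interpret H: volterra "hker M (complex_of_real z)" "ksum M" e by (rule hvol[OF admD(1)[OF M]]) simp
  interpret V: volterra "\<lambda>i j x y. iker c M z i j y" "ksum M" e by (rule vol[OF admD(1)[OF M]])
  let ?F = "volsol (hker M (complex_of_real z)) e"
  define w where "w = (\<lambda>i x. cis (- (2 * z * \<sigma> i * x)) * ?F i x)"
  have wm: "w i \<in> borel_measurable borel" for i unfolding w_def[abs_def] using H.volsol_measurable by measurable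
  have wb: "(\<Sum>i\<in>UNIV. cmod (w i x)) \<le> H.E * exp H.T" for x
    using H.volsol_bound[of x] by (simp add: w_def norm_mult)
  have iw: "integrable lborel (\<lambda>y. \<Sum>j\<in>UNIV. iker c M z i j y * w j y)" for i
    by (rule V.apply_integrable[OF wm wb])
  have weq: "w i x = e i + cum (\<lambda>y. \<Sum>j\<in>UNIV. iker c M z i j y * w j y) x" for i x
  proof -
    have "w i x = cis (- (2 * z * \<sigma> i * x)) * e i + cum (\<lambda>y. cis (- (2 * z * \<sigma> i * x)) * (\<Sum>j\<in>UNIV. hker M (complex_of_real z) i j x y * ?F j y)) x"
      unfolding w_def cum_mult distrib_left[symmetric] by (subst H.volsol_eq) (rule refl)
    also have "cis (- (2 * z * \<sigma> i * x)) * e i = e i" using e_\<sigma>[of i] by auto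
    also have "cum (\<lambda>y. cis (- (2 * z * \<sigma> i * x)) * (\<Sum>j\<in>UNIV. hker M (complex_of_real z) i j x y * ?F j y)) x = cum (\<lambda>y. \<Sum>j\<in>UNIV. iker c M z i j y * w j y) x"
    proof (rule cum_cong)
      fix y assume y: "y < x"
      have "cis (- (2 * z * \<sigma> i * x)) * hker M (complex_of_real z) i j x y = iker c M z i j y * cis (- (2 * z * \<sigma> j * y))" for j
      proof -
        have "exp (2 * \<i> * complex_of_real z * complex_of_real (\<sigma> i * (x - y))) = cis (2 * z * (\<sigma> i * (x - y)))"
          by (simp add: cis_conv_exp mult_ac)
        hence "cis (- (2 * z * \<sigma> i * x)) * hker M (complex_of_real z) i j x y = cis (- (2 * z * \<sigma> i * x)) * cis (2 * z * (\<sigma> i * (x - y))) * M i j y"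
          using y by (simp add: hker_def)
        also have "cis (- (2 * z * \<sigma> i * x)) * cis (2 * z * (\<sigma> i * (x - y))) = cis (2 * z * c i j * y) * cis (- (2 * z * \<sigma> j * y))"
          unfolding cis_mult c_eq by (simp add: algebra_simps)
        finally show ?thesis by (simp add: iker_def mult_ac)
      qed
      thus "cis (- (2 * z * \<sigma> i * x)) * (\<Sum>j\<in>UNIV. hker M (complex_of_real z) i j x y * ?F j y) = (\<Sum>j\<in>UNIV. iker c M z i j y * w j y)"
        unfolding w_def sum_distrib_left mult.assoc[symmetric] by simp
    qed
    finally show ?thesis .
  qed
  have "w i x - f z i x = 0"
  proof (rule volterra_unique[where N="iker c M z" and k="ksum M"])
    show "iker c M z i j \<in> borel_measurable borel" for i j by (rule iker_measurable(2)[OF admD(2)[OF M]])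
    show "(\<Sum>i\<in>UNIV. \<Sum>j\<in>UNIV. cmod (iker c M z i j y)) \<le> ksum M y" for y by (simp add: iker_sum)
    show "integrable lborel (ksum M)" by (rule admD(3)[OF M])
    have e: "(\<Sum>j\<in>UNIV. iker c M z i j y * (w j y - f z j y)) = (\<Sum>j\<in>UNIV. iker c M z i j y * w j y) - (\<Sum>j\<in>UNIV. iker c M z i j y * f z j y)" for i y
      by (simp add: right_diff_distrib sum_subtractf)
    show "integrable lborel (\<lambda>y. if y < x then \<Sum>j\<in>UNIV. iker c M z i j y * (w j y - f z j y) else 0)" for i x
      unfolding e by (intro integrable_below Bochner_Integration.integrable_diff iw D(6))
    show "w i x - f z i x = cum (\<lambda>y. \<Sum>j\<in>UNIV. iker c M z i j y * (w j y - f z j y)) x" for i x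
      unfolding e cum_diff[OF iw D(6)] by (subst weq, subst D(3)) simp
  qed
  hence "f z i x = cis (- (2 * z * \<sigma> i * x)) * ?F i x" by (simp add: w_def)
  hence "cis (2 * z * \<sigma> i * x) * f z i x = (cis (2 * z * \<sigma> i * x) * cis (- (2 * z * \<sigma> i * x))) * ?F i x" by simp
  also have "cis (2 * z * \<sigma> i * x) * cis (- (2 * z * \<sigma> i * x)) = 1" unfolding cis_mult by simp
  finally show ?thesis by simp
qed

lemma hamp_amp:
  assumes M: "adm M B" and f: "isol c M e f" and i: "\<sigma> i = 0"
  shows "hamp M i (complex_of_real z) = amp M f z i"
  unfolding hamp_def amp_def hker_sol[OF M f] iker_def c_eq i
  by (simp add: mult_ac)

text \<open>The Picard iterates are continuous on the closed and holomorphic on the open half plane,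
  by induction over parametrised integrals. The amplitudes formed from them converge uniformly,
  because the remainder \<open>tail\<close> is the same for all z.\<close>

lemma hamp_analytic:
  assumes M: "adm M B"
  shows "continuous_on {z. 0 \<le> Im z} (hamp M i)" "hamp M i holomorphic_on {z. 0 < Im z}"
proof -
  note L = admD(1)[OF M]
  note ivol = vol[OF L]
  have vol: "volterra (hker M z) (ksum M)" if "0 \<le> Im z" for z by (rule hvol[OF L that])
  have o: "open {z. 0 < Im z}" by (rule open_halfspace_Im_gt)
  define C where "C = (\<Sum>i\<in>UNIV. cmod (e i)) * exp (LINT y|lborel. ksum M y)"
  have C: "volterra.E e * exp (volterra.T (ksum M)) = C"
    using volterra.E_def[OF vol[of 0]] volterra.T_def[OF vol[of 0]] unfolding C_def by simp
  have pm: "picard (hker M z) e n i \<in> borel_measurable borel" if "0 \<le> Im z" for z n i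
    by (rule volterra.picard_measurable[OF vol[OF that]])
  have pb: "(\<Sum>i\<in>UNIV. cmod (picard (hker M z) e n i x)) \<le> C" if "0 \<le> Im z" for z n x
    using volterra.picard_bound[OF vol[OF that], of e n x] unfolding C .
  have gi: "integrable lborel (\<lambda>y. ksum M y * C)" using admD(3)[OF M] by simp
  have [measurable]: "M i j \<in> borel_measurable borel" for i j by (rule admD(2)[OF M])
  have pic: "continuous_on {z. 0 \<le> Im z} (\<lambda>z. picard (hker M z) e n i x) \<and> (\<lambda>z. picard (hker M z) e n i x) holomorphic_on {z. 0 < Im z}" for n i x
  proof (induction n arbitrary: i x)
    case 0 then show ?case by simp
  next
    case (Suc n)
    let ?f = "\<lambda>z y. if y < x then \<Sum>j\<in>UNIV. hker M z i j x y * picard (hker M z) e n j y else 0"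
    have m: "?f z \<in> borel_measurable borel" if "0 \<le> Im z" for z
    proof -
      have [measurable]: "(\<lambda>y. hker M z i j x y) \<in> borel_measurable borel" for j unfolding hker_def by measurable
      show ?thesis using pm[OF that, measurable] by measurable
    qed
    have b: "cmod (?f z y) \<le> ksum M y * C" if "0 \<le> Im z" for z y
    proof -
      have "cmod (\<Sum>j\<in>UNIV. hker M z i j x y * picard (hker M z) e n j y) \<le> ksum M y * C"
        by (rule order_trans[OF volterra.apply_le1[OF vol[OF that]]]) (intro mult_left_mono pb[OF that] ksum_nonneg)
      moreover have "0 \<le> C" unfolding C_def by (simp add: sum_nonneg)
      ultimately show ?thesis using ksum_nonneg[of M y] by auto
    qed
    let ?e = "\<lambda>z y j. exp (2 * \<i> * z * complex_of_real (\<sigma> i * (x - y))) * M i j y"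
    have f: "?f z y = (\<Sum>j\<in>UNIV. ?e z y j * picard (hker M z) e n j y)" if "y < x" for z y
      using that by (auto intro!: sum.cong simp: hker_def[of M z i _ x y])
    have c: "continuous_on {z. 0 \<le> Im z} (\<lambda>z. ?f z y)" for y
    proof (cases "y < x")
      case True
      show ?thesis unfolding f[OF True] by (intro continuous_intros Suc[THEN conjunct1])
    qed simp
    have h: "(\<lambda>z. ?f z y) holomorphic_on {z. 0 < Im z}" for y
    proof (cases "y < x")
      case True
      show ?thesis unfolding f[OF True] by (intro holomorphic_intros Suc[THEN conjunct2])
    qed simp
    have "continuous_on {z. 0 \<le> Im z} (\<lambda>z. LINT y|lborel. ?f z y)"
      by (rule continuous_integral[OF c _ _ gi]) (use m b in auto)
    moreover have "(\<lambda>z. LINT y|lborel. ?f z y) holomorphic_on {z. 0 < Im z}"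
      by (rule holomorphic_integral[OF o h _ _ gi]) (use m b in auto)
    ultimately show ?case unfolding picard.simps cum_def by (auto intro!: continuous_intros holomorphic_intros)
  qed
  define A where "A = (\<lambda>n z. e i + (LINT y|lborel. (\<Sum>j\<in>UNIV. M i j y * picard (hker M z) e n j y)))"
  \<comment> \<open>At z = 0 all phases equal 1, so the kernel estimate becomes one for
    \<open>M\<close> itself.\<close>
  have Mle: "cmod (\<Sum>j\<in>UNIV. M i j y * v j) \<le> ksum M y * (\<Sum>j\<in>UNIV. cmod (v j))" for y v
  proof -
    have "cmod (\<Sum>j\<in>UNIV. iker c M 0 i j y * v j) \<le> ksum M y * (\<Sum>j\<in>UNIV. cmod (v j))"
      by (rule volterra.apply_le1[OF ivol])
    thus ?thesis by (simp add: iker_def)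
  qed
  have m: "(\<lambda>y. \<Sum>j\<in>UNIV. M i j y * picard (hker M z) e n j y) \<in> borel_measurable borel" if "0 \<le> Im z" for z n
    using pm[OF that, measurable] by measurable
  have b: "cmod (\<Sum>j\<in>UNIV. M i j y * picard (hker M z) e n j y) \<le> ksum M y * C" if "0 \<le> Im z" for z n y
    by (rule order_trans[OF Mle]) (intro mult_left_mono pb[OF that] ksum_nonneg)
  have Ac: "continuous_on {z. 0 \<le> Im z} (A n)" for n
    unfolding A_def using m b pic by (intro continuous_intros continuous_integral[OF _ _ _ gi]) auto
  have Ah: "A n holomorphic_on {z. 0 < Im z}" for n
    unfolding A_def using m b pic by (intro holomorphic_intros holomorphic_integral[OF o _ _ _ gi]) auto
  have ul: "uniform_limit {z. 0 \<le> Im z} A (hamp M i) sequentially"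
  proof (rule uniform_limitI)
    fix \<epsilon> :: real assume "0 < \<epsilon>"
    let ?T = "LINT y|lborel. ksum M y"
    have "(\<lambda>n. ?T * volterra.tail (ksum M) e n) \<longlonglongrightarrow> ?T * 0"
      by (intro tendsto_intros volterra.tail_tendsto[OF vol[of 0]]) simp
    hence "eventually (\<lambda>n. ?T * volterra.tail (ksum M) e n < \<epsilon>) sequentially"
      using \<open>0 < \<epsilon>\<close> by (intro order_tendstoD(2)) auto
    thus "\<forall>\<^sub>F n in sequentially. \<forall>z\<in>{z. 0 \<le> Im z}. dist (A n z) (hamp M i z) < \<epsilon>"
    proof eventually_elim
      fix n assume n: "?T * volterra.tail (ksum M) e n < \<epsilon>"
      show "\<forall>z\<in>{z. 0 \<le> Im z}. dist (A n z) (hamp M i z) < \<epsilon>"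
      proof
        fix z assume "z \<in> {z. 0 \<le> Im z}" hence z: "0 \<le> Im z" by simp
        interpret H: volterra "hker M z" "ksum M" e by (rule vol[OF z])
        have i1: "integrable lborel (\<lambda>y. \<Sum>j\<in>UNIV. M i j y * picard (hker M z) e n j y)"
          by (rule integrable_dominated[OF gi m[OF z] b[OF z]])
        have b2: "cmod (\<Sum>j\<in>UNIV. M i j y * volsol (hker M z) e j y) \<le> ksum M y * C" for y
          by (rule order_trans[OF Mle]) (intro mult_left_mono H.volsol_bound[unfolded C] ksum_nonneg)
        have i2: "integrable lborel (\<lambda>y. \<Sum>j\<in>UNIV. M i j y * volsol (hker M z) e j y)"
        proof (rule integrable_dominated[OF gi _ b2])
          show "(\<lambda>y. \<Sum>j\<in>UNIV. M i j y * volsol (hker M z) e j y) \<in> borel_measurable borel"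
            using H.volsol_measurable by measurable
        qed
        have "dist (A n z) (hamp M i z) = cmod (hamp M i z - A n z)" by (simp add: dist_norm norm_minus_commute)
        also have "hamp M i z - A n z = (LINT y|lborel. (\<Sum>j\<in>UNIV. M i j y * volsol (hker M z) e j y) - (\<Sum>j\<in>UNIV. M i j y * picard (hker M z) e n j y))"
          unfolding hamp_def A_def using i1 i2 by simp
        also have "cmod \<dots> \<le> (LINT y|lborel. cmod ((\<Sum>j\<in>UNIV. M i j y * volsol (hker M z) e j y) - (\<Sum>j\<in>UNIV. M i j y * picard (hker M z) e n j y)))"
          by (rule integral_norm_bound)
        also have "\<dots> \<le> (LINT y|lborel. ksum M y * H.tail n)"
        proof (rule integral_mono)
          fix y
          have "(\<Sum>j\<in>UNIV. M i j y * volsol (hker M z) e j y) - (\<Sum>j\<in>UNIV. M i j y * picard (hker M z) e n j y) = (\<Sum>j\<in>UNIV. M i j y * (volsol (hker M z) e j y - picard (hker M z) e n j y))"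
            by (simp add: right_diff_distrib sum_subtractf)
          also have "cmod \<dots> \<le> ksum M y * H.tail n"
            by (rule order_trans[OF Mle]) (intro mult_left_mono H.picard_volsol ksum_nonneg)
          finally show "cmod ((\<Sum>j\<in>UNIV. M i j y * volsol (hker M z) e j y) - (\<Sum>j\<in>UNIV. M i j y * picard (hker M z) e n j y)) \<le> ksum M y * H.tail n" .
        qed (use i1 i2 admD(3)[OF M] in auto)
        also have "\<dots> = ?T * H.tail n" by simp
        finally show "dist (A n z) (hamp M i z) < \<epsilon>" using n by linarith
      qed
    qed
  qed
  show "continuous_on {z. 0 \<le> Im z} (hamp M i)"
    by (rule uniform_limit_theorem[OF _ ul]) (use Ac in auto)
  show "hamp M i holomorphic_on {z. 0 < Im z}"
  proof (rule holomorphic_uniform_sequence[OF o Ah])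
    fix z assume "z \<in> {z. 0 < Im z}"
    then obtain d where "0 < d" "cball z d \<subseteq> {z. 0 < Im z}" using o open_contains_cball by blast
    thus "\<exists>d>0. cball z d \<subseteq> {z. 0 < Im z} \<and> uniform_limit (cball z d) A (hamp M i) sequentially"
      by (intro exI[of _ d] conjI uniform_limit_on_subset[OF ul]) auto
  qed
qed

end

section \<open>Weak derivatives and absolutely continuous representatives\<close>

definition smooth :: "(real \<Rightarrow> real) \<Rightarrow> bool" where
  "smooth f \<longleftrightarrow> (\<forall>n x. (deriv ^^ n) f differentiable (at x))"

text \<open>A coinduction principle: smoothness reduces to exhibiting a class of functions that
  contains a derivative of each of its members.\<close>

lemma smooth_class:
  assumes f: "f \<in> P" and P: "\<And>f. f \<in> P \<Longrightarrow> \<exists>f'\<in>P. \<forall>x. (f has_real_derivative f' x) (at x)"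
  shows "smooth f"
proof -
  have "(deriv ^^ n) f \<in> P" for n
  proof (induction n)
    case 0 then show ?case using f by simp
  next
    case (Suc n)
    obtain f' where "f' \<in> P" "\<And>x. ((deriv ^^ n) f has_real_derivative f' x) (at x)" using P[OF Suc] by blast
    hence "deriv ((deriv ^^ n) f) = f'" by (auto simp: fun_eq_iff intro: DERIV_imp_deriv)
    thus ?case using \<open>f' \<in> P\<close> by simp
  qed
  thus ?thesis unfolding smooth_def using P real_differentiable_def by blast
qed

lemma smooth_deriv: "smooth f \<Longrightarrow> smooth (deriv f)"
proof -
  assume f: "smooth f"
  have "(deriv ^^ n) (deriv f) = (deriv ^^ Suc n) f" for n by (simp only: funpow_Suc_right comp_apply)
  thus ?thesis using f unfolding smooth_def by metis
qed

lemma smooth_DERIV: "smooth f \<Longrightarrow> (f has_real_derivative deriv f x) (at x)"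
proof -
  assume f: "smooth f"
  hence "(deriv ^^ 0) f differentiable (at x)" unfolding smooth_def by blast
  thus ?thesis by (simp add: DERIV_deriv_iff_real_differentiable)
qed

lemma smooth_continuous: "smooth f \<Longrightarrow> continuous_on UNIV f"
  by (intro continuous_at_imp_continuous_on ballI) (rule DERIV_isCont[OF smooth_DERIV])

text \<open>The algebra generated by the smooth functions. The Leibniz rule makes it closed under
  differentiation, so \<open>smooth_class\<close> applies and sums and products are smooth.\<close>

inductive_set smooth_alg :: "(real \<Rightarrow> real) set" where
  base: "smooth f \<Longrightarrow> f \<in> smooth_alg"
| add: "f \<in> smooth_alg \<Longrightarrow> g \<in> smooth_alg \<Longrightarrow> (\<lambda>x. f x + g x) \<in> smooth_alg"
| mult: "f \<in> smooth_alg \<Longrightarrow> g \<in> smooth_alg \<Longrightarrow> (\<lambda>x. f x * g x) \<in> smooth_alg"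

lemma smooth_alg: "f \<in> smooth_alg \<Longrightarrow> smooth f"
proof (rule smooth_class)
  fix f assume "f \<in> smooth_alg"
  thus "\<exists>f'\<in>smooth_alg. \<forall>x. (f has_real_derivative f' x) (at x)"
  proof induction
    case (base f)
    then show ?case using smooth_DERIV smooth_deriv smooth_alg.base by blast
  next
    case (add f g)
    then obtain f' g' where "f' \<in> smooth_alg" "g' \<in> smooth_alg" "\<And>x. (f has_real_derivative f' x) (at x)" "\<And>x. (g has_real_derivative g' x) (at x)" by blast
    thus ?case by (intro bexI[of _ "\<lambda>x. f' x + g' x"] smooth_alg.add) (auto intro!: derivative_eq_intros)
  next
    case (mult f g)
    then obtain f' g' where "f' \<in> smooth_alg" "g' \<in> smooth_alg" "\<And>x. (f has_real_derivative f' x) (at x)" "\<And>x. (g has_real_derivative g' x) (at x)" by blast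
    thus ?case using mult.hyps
      by (intro bexI[of _ "\<lambda>x. f' x * g x + f x * g' x"] smooth_alg.add smooth_alg.mult) (auto intro!: derivative_eq_intros)
  qed
qed

lemma smooth_const: "smooth (\<lambda>x. c)"
  by (rule smooth_class[where P="range (\<lambda>c x. c)"]) (auto intro!: exI[of _ 0])

lemma smooth_add: "smooth f \<Longrightarrow> smooth g \<Longrightarrow> smooth (\<lambda>x. f x + g x)"
  by (rule smooth_alg[OF smooth_alg.add[OF smooth_alg.base smooth_alg.base]])

lemma smooth_mult: "smooth f \<Longrightarrow> smooth g \<Longrightarrow> smooth (\<lambda>x. f x * g x)"
  by (rule smooth_alg[OF smooth_alg.mult[OF smooth_alg.base smooth_alg.base]])

lemma smooth_affine: "smooth f \<Longrightarrow> smooth (\<lambda>x. f (a * x + b))"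
proof (rule smooth_class[where P="{(\<lambda>x. c * g (a * x + b)) | c g. smooth g}"])
  assume "smooth f"
  thus "(\<lambda>x. f (a * x + b)) \<in> {(\<lambda>x. c * g (a * x + b)) | c g. smooth g}"
    by (auto intro!: exI[of _ 1] exI[of _ f])
next
  fix f assume "f \<in> {(\<lambda>x. c * g (a * x + b)) | c g. smooth g}"
  then obtain c g where f: "f = (\<lambda>x. c * g (a * x + b))" and g: "smooth g" by blast
  have "(f has_real_derivative (c * a) * deriv g (a * x + b)) (at x)" for x
  proof -
    have "((\<lambda>x. g (a * x + b)) has_real_derivative deriv g (a * x + b) * a) (at x)"
      by (rule DERIV_chain2[OF smooth_DERIV[OF g]]) (auto intro!: derivative_eq_intros)
    from DERIV_cmult[OF this, of c] show ?thesis unfolding f by (simp add: mult_ac)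
  qed
  thus "\<exists>f'\<in>{(\<lambda>x. c * g (a * x + b)) | c g. smooth g}. \<forall>x. (f has_real_derivative f' x) (at x)"
    using smooth_deriv[OF g] by (intro bexI[of _ "\<lambda>x. (c * a) * deriv g (a * x + b)"]) auto
qed

lemma smooth_antiderivative:
  assumes \<eta>: "smooth \<eta>" and D: "\<And>x. (\<psi> has_real_derivative \<eta> x) (at x)"
  shows "smooth \<psi>"
proof (rule smooth_class[where P="insert \<psi> {f. smooth f}"])
  fix f assume "f \<in> insert \<psi> {f. smooth f}"
  thus "\<exists>f'\<in>insert \<psi> {f. smooth f}. \<forall>x. (f has_real_derivative f' x) (at x)"
    using \<eta> D smooth_deriv smooth_DERIV by blast
qed simp

definition flat_exp :: "real \<Rightarrow> real" where
  "flat_exp x = (if x > 0 then exp (- 1 / x) else 0)"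

lemma poly_exp_at_right_0: "((\<lambda>x. poly p (1 / x) * exp (- 1 / x)) \<longlongrightarrow> 0) (at_right (0::real))"
proof -
  have "((\<lambda>t. \<Sum>i\<le>degree p. coeff p i * (t ^ i / exp t)) \<longlongrightarrow> (\<Sum>i\<le>degree p. coeff p i * 0)) at_top"
    by (intro tendsto_intros tendsto_power_div_exp_0)
  hence "((\<lambda>t. poly p t * exp (- t)) \<longlongrightarrow> 0) at_top"
    by (simp add: poly_altdef sum_distrib_right exp_minus divide_inverse mult.assoc)
  hence "((\<lambda>x. poly p (inverse x) * exp (- inverse x)) \<longlongrightarrow> 0) (at_right 0)"
    by (rule filterlim_compose[OF _ filterlim_inverse_at_top_right])
  thus ?thesis by (simp add: divide_inverse)
qed

lemma smooth_flat_exp: "smooth flat_exp"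
proof (rule smooth_class[where P="{\<lambda>x. if x > 0 then poly p (1 / x) * exp (- 1 / x) else 0 | p. True}"])
  show "flat_exp \<in> {\<lambda>x. if x > 0 then poly p (1 / x) * exp (- 1 / x) else 0 | p. True}"
    by (auto simp: flat_exp_def[abs_def] intro!: exI[of _ 1])
next
  fix f :: "real \<Rightarrow> real" assume "f \<in> {\<lambda>x. if x > 0 then poly p (1 / x) * exp (- 1 / x) else 0 | p. True}"
  then obtain p where f: "f = (\<lambda>x. if x > 0 then poly p (1 / x) * exp (- 1 / x) else 0)" by blast
  \<comment> \<open>In the variable t = 1/x the derivative with respect to x is -t^2 times the one
    with respect to t, so p(t) exp(-t) goes to t^2 (p - p')(t) exp(-t).\<close>
  define q where "q = [:0, 0, 1:] * (p - pderiv p)"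
  let ?f' = "\<lambda>x. if x > 0 then poly q (1 / x) * exp (- 1 / x) else 0"
  have "(f has_real_derivative ?f' x) (at x)" for x
  proof -
    consider "x > 0" | "x < 0" | "x = 0" by linarith
    thus ?thesis
    proof cases
      case 1
      have inv: "((\<lambda>x. 1 / x) has_real_derivative - (1 / x ^ 2)) (at x)"
        using 1 by (auto intro!: derivative_eq_intros simp: power2_eq_square)
      have "((\<lambda>x. poly p (1 / x)) has_real_derivative poly (pderiv p) (1 / x) * - (1 / x ^ 2)) (at x)"
        by (rule DERIV_chain2[OF poly_DERIV inv])
      moreover have "((\<lambda>x. exp (- 1 / x)) has_real_derivative exp (- 1 / x) * (1 / x ^ 2)) (at x)"
        using 1 by (auto intro!: derivative_eq_intros simp: power2_eq_square)
      ultimately have "((\<lambda>x. poly p (1 / x) * exp (- 1 / x)) has_real_derivative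
          poly (pderiv p) (1 / x) * - (1 / x ^ 2) * exp (- 1 / x) + exp (- 1 / x) * (1 / x ^ 2) * poly p (1 / x)) (at x)"
        by (rule DERIV_mult)
      also have "poly (pderiv p) (1 / x) * - (1 / x ^ 2) * exp (- 1 / x) + exp (- 1 / x) * (1 / x ^ 2) * poly p (1 / x) = ?f' x"
        using 1 by (simp add: q_def algebra_simps power2_eq_square)
      finally show ?thesis
        by (rule has_field_derivative_transform_within_open[where S="{0<..}"]) (use 1 f in auto)
    next
      case 2
      have "((\<lambda>_. 0::real) has_real_derivative ?f' x) (at x)" using 2 by simp
      thus ?thesis
        by (rule has_field_derivative_transform_within_open[where S="{..<0}"]) (use 2 f in auto)
    next
      case 3
      have "((\<lambda>y. (f y - f 0) / (y - 0)) \<longlongrightarrow> 0) (at_left 0)"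
        by (rule tendsto_eventually) (auto simp: f eventually_at_left_field intro!: exI[of _ "-1"])
      \<comment> \<open>Dividing by y multiplies the polynomial by t = 1/y, so the quotient at 0 is
        again of the form covered by \<open>poly_exp_at_right_0\<close>.\<close>
      moreover have "((\<lambda>y. (f y - f 0) / (y - 0)) \<longlongrightarrow> 0) (at_right 0)"
      proof (rule Lim_transform_eventually[OF poly_exp_at_right_0[of "[:0, 1:] * p"]])
        show "\<forall>\<^sub>F y in at_right 0. poly ([:0, 1:] * p) (1 / y) * exp (- 1 / y) = (f y - f 0) / (y - 0)"
          by (auto simp: f eventually_at_right_field intro!: exI[of _ "1"])
      qed
      ultimately have "((\<lambda>y. (f y - f 0) / (y - 0)) \<longlongrightarrow> 0) (at 0)" by (rule filterlim_split_at)
      thus ?thesis using 3 by (simp add: has_field_derivative_iff)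
    qed
  qed
  thus "\<exists>f'\<in>{\<lambda>x. if x > 0 then poly p (1 / x) * exp (- 1 / x) else 0 | p. True}. \<forall>x. (f has_real_derivative f' x) (at x)"
    by (intro bexI[of _ ?f']) auto
qed

lemma flat_exp_bounds: "0 \<le> flat_exp x" "flat_exp x \<le> 1" "x \<le> 0 \<Longrightarrow> flat_exp x = 0" "0 < x \<Longrightarrow> 0 < flat_exp x"
  by (auto simp: flat_exp_def)

text \<open>The factor n + 1 steepens the flanks and leaves the support in [a, b], so the bumps
  converge pointwise to the indicator of the open interval.\<close>

definition bump :: "nat \<Rightarrow> real \<Rightarrow> real \<Rightarrow> real \<Rightarrow> real" where
  "bump n a b x = flat_exp (real (Suc n) * (x - a)) * flat_exp (real (Suc n) * (b - x))"

lemma bump_outside: "x \<notin> {a<..<b} \<Longrightarrow> bump n a b x = 0"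
proof -
  assume "x \<notin> {a<..<b}"
  hence "x \<le> a \<or> b \<le> x" by auto
  thus ?thesis unfolding bump_def by (auto simp: mult_le_0_iff intro!: flat_exp_bounds(3))
qed

lemma bump_bounds: "0 \<le> bump n a b x" "bump n a b x \<le> 1" "x \<in> {a<..<b} \<Longrightarrow> 0 < bump n a b x"
  unfolding bump_def using flat_exp_bounds by (auto intro!: mult_le_one mult_pos_pos)

lemma smooth_bump: "smooth (bump n a b)"
proof -
  have "smooth (\<lambda>x. flat_exp (real (Suc n) * x + (- real (Suc n) * a)) * flat_exp ((- real (Suc n)) * x + real (Suc n) * b))"
    by (intro smooth_mult smooth_affine smooth_flat_exp)
  moreover have "(\<lambda>x. flat_exp (real (Suc n) * x + (- real (Suc n) * a)) * flat_exp ((- real (Suc n)) * x + real (Suc n) * b)) = bump n a b"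
    unfolding bump_def[abs_def] by (intro ext arg_cong2[where f="(*)"] arg_cong[where f=flat_exp]) (auto simp: algebra_simps)
  ultimately show ?thesis by simp
qed

lemma test_function_iff: "test_function \<psi> \<longleftrightarrow> smooth \<psi> \<and> (\<exists>R. \<forall>x. \<bar>x\<bar> > R \<longrightarrow> \<psi> x = 0)"
  by (simp add: test_function_def smooth_def)

lemma test_bump: "test_function (bump n a b)"
  unfolding test_function_iff
  by (intro conjI smooth_bump exI[of _ "max \<bar>a\<bar> \<bar>b\<bar>"] allI impI bump_outside) auto

lemma bump_tendsto: "(\<lambda>n. bump n a b x) \<longlonglongrightarrow> indicator {a<..<b} x"
proof (cases "x \<in> {a<..<b}")
  case True
  have lim: "(\<lambda>n. flat_exp (real (Suc n) * t)) \<longlonglongrightarrow> 1" if "0 < t" for t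
  proof -
    have "(\<lambda>n. exp (- (1 / t) * inverse (real (Suc n)))) \<longlonglongrightarrow> exp (- (1 / t) * 0)"
      by (intro tendsto_intros LIMSEQ_inverse_real_of_nat)
    moreover have "exp (- (1 / t) * inverse (real (Suc n))) = flat_exp (real (Suc n) * t)" for n
    proof -
      have p: "0 < real (Suc n) * t" using that by simp
      have "- (1 / t) * inverse (real (Suc n)) = - 1 / (real (Suc n) * t)" using that by (simp add: field_simps)
      thus ?thesis unfolding flat_exp_def if_P[OF p] by simp
    qed
    ultimately show ?thesis by simp
  qed
  have "(\<lambda>n. bump n a b x) \<longlonglongrightarrow> 1 * 1"
    unfolding bump_def using True by (intro tendsto_mult lim) auto
  thus ?thesis using True by simp
next
  case False
  then show ?thesis by (simp add: bump_outside)
qed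

section \<open>Fundamental lemma of the calculus of variations\<close>

lemma AE_zero_of_half_lines:
  fixes f :: "real \<Rightarrow> real"
  assumes f: "integrable lborel f" and z: "\<And>x. (LINT y|lborel. indicator {x<..} y * f y) = 0"
  shows "AE x in lborel. f x = 0"
proof -
  have [measurable]: "f \<in> borel_measurable borel" using borel_measurable_integrable[OF f] by simp
  let ?p = "\<lambda>y. max 0 (f y)" and ?m = "\<lambda>y. max 0 (- f y)"
  \<comment> \<open>Positive and negative part are the densities of two finite measures. These agree
    on all half lines, hence everywhere, so the densities agree almost everywhere.\<close>
  define M where "M = density lborel (\<lambda>y. ennreal (?p y))"
  define N where "N = density lborel (\<lambda>y. ennreal (?m y))"
  have ip: "integrable lborel (\<lambda>y. indicator {x<..} y * ?p y)" for x
    using integrable_real_mult_indicator[of "{x<..}" lborel ?p] f by (simp add: mult.commute)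
  have im: "integrable lborel (\<lambda>y. indicator {x<..} y * ?m y)" for x
    using integrable_real_mult_indicator[of "{x<..}" lborel ?m] f by (simp add: mult.commute)
  have eM: "emeasure M {x<..} = ennreal (LINT y|lborel. indicator {x<..} y * ?p y)" for x
  proof -
    have "emeasure M {x<..} = (\<integral>\<^sup>+y. ennreal (indicator {x<..} y * ?p y) \<partial>lborel)"
      unfolding M_def by (subst emeasure_density) (auto intro!: nn_integral_cong simp: indicator_def)
    also have "\<dots> = ennreal (LINT y|lborel. indicator {x<..} y * ?p y)" by (rule nn_integral_eq_integral[OF ip]) auto
    finally show ?thesis .
  qed
  have eN: "emeasure N {x<..} = ennreal (LINT y|lborel. indicator {x<..} y * ?m y)" for x
  proof -
    have "emeasure N {x<..} = (\<integral>\<^sup>+y. ennreal (indicator {x<..} y * ?m y) \<partial>lborel)"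
      unfolding N_def by (subst emeasure_density) (auto intro!: nn_integral_cong simp: indicator_def)
    also have "\<dots> = ennreal (LINT y|lborel. indicator {x<..} y * ?m y)" by (rule nn_integral_eq_integral[OF im]) auto
    finally show ?thesis .
  qed
  have "M = N"
  proof (rule measure_eqI_lessThan)
    show "sets M = sets borel" "sets N = sets borel" unfolding M_def N_def by auto
    show "emeasure M {x<..} < \<infinity>" for x unfolding eM by simp
    fix x
    have "0 = (LINT y|lborel. indicator {x<..} y * f y)" by (rule z[symmetric])
    also have "\<dots> = (LINT y|lborel. indicator {x<..} y * ?p y - indicator {x<..} y * ?m y)"
      by (intro Bochner_Integration.integral_cong) (auto simp: indicator_def)
    also have "\<dots> = (LINT y|lborel. indicator {x<..} y * ?p y) - (LINT y|lborel. indicator {x<..} y * ?m y)"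
      by (rule Bochner_Integration.integral_diff[OF ip im])
    finally show "emeasure M {x<..} = emeasure N {x<..}" unfolding eM eN by simp
  qed
  hence "AE x in lborel. ennreal (?p x) = ennreal (?m x)"
    unfolding M_def N_def by (subst (asm) sigma_finite_measure.density_unique_iff[OF lborel.sigma_finite_measure_axioms]) auto
  thus ?thesis by eventually_elim (auto simp: max_def split: if_splits)
qed

lemma locally_integrableD:
  assumes "locally_integrable w"
  shows "w \<in> borel_measurable borel" "integrable lborel (\<lambda>y. if a \<le> y \<and> y < b then w y else 0)"
    "integrable lborel (\<lambda>y. indicator {-R..R} y *\<^sub>R w y)"
proof -
  have i: "integrable lborel (\<lambda>y. indicator {-R..R} y *\<^sub>R w y)" for R
    using assms unfolding locally_integrable_def set_integrable_def by auto
  show "integrable lborel (\<lambda>y. indicator {-R..R} y *\<^sub>R w y)" by (rule i)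
  show m: "w \<in> borel_measurable borel"
  proof (rule borel_measurable_LIMSEQ_metric)
    show "(\<lambda>y. indicator {-real n..real n} y *\<^sub>R w y) \<in> borel_measurable borel" for n
      using borel_measurable_integrable[OF i[of "real n"]] by simp
    fix x :: real
    have "eventually (\<lambda>n. indicator {-real n..real n} x *\<^sub>R w x = w x) sequentially"
      using eventually_ge_at_top[of "nat \<lceil>\<bar>x\<bar>\<rceil>"] by eventually_elim (auto simp: indicator_def)
    thus "(\<lambda>n. indicator {-real n..real n} x *\<^sub>R w x) \<longlonglongrightarrow> w x" by (rule tendsto_eventually)
  qed
  define R where "R = max \<bar>a\<bar> \<bar>b\<bar>"
  show "integrable lborel (\<lambda>y. if a \<le> y \<and> y < b then w y else 0)"
    by (rule Bochner_Integration.integrable_bound[OF i[of R]]) (use m in \<open>auto simp: R_def indicator_def\<close>)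
qed

lemma test_mult_integrable:
  assumes w: "locally_integrable w" and \<eta>: "continuous_on UNIV \<eta>" "\<And>x. \<bar>x\<bar> > R \<Longrightarrow> \<eta> x = (0::real)" "\<And>x. \<bar>\<eta> x\<bar> \<le> C"
  shows "integrable lborel (\<lambda>x. \<eta> x *\<^sub>R w x)"
proof (rule Bochner_Integration.integrable_bound[where f="\<lambda>x. C *\<^sub>R (indicator {-R..R} x *\<^sub>R w x)"])
  have [measurable]: "\<eta> \<in> borel_measurable borel" using \<eta>(1) by (rule borel_measurable_continuous_onI)
  have [measurable]: "w \<in> borel_measurable borel" by (rule locally_integrableD[OF w])
  show "integrable lborel (\<lambda>x. C *\<^sub>R (indicator {-R..R} x *\<^sub>R w x))" by (rule integrable_scaleR_right) (rule locally_integrableD(3)[OF w])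
  show "(\<lambda>x. \<eta> x *\<^sub>R w x) \<in> borel_measurable lborel" by measurable
  show "AE x in lborel. cmod (\<eta> x *\<^sub>R w x) \<le> norm (C *\<^sub>R (indicator {-R..R} x *\<^sub>R w x))"
  proof (rule AE_I2)
    fix x
    show "cmod (\<eta> x *\<^sub>R w x) \<le> norm (C *\<^sub>R (indicator {-R..R} x *\<^sub>R w x))"
      using \<eta>(2)[of x] \<eta>(3)[of x] by (cases "\<bar>x\<bar> > R") (auto simp: indicator_def intro!: mult_right_mono)
  qed
qed

text \<open>Bumps converge to indicators of open intervals, so w has integral 0 over each of them.
  After restriction to a bounded interval the criterion on half lines applies to real and imaginary
  part.\<close>

lemma fundamental_lemma:
  assumes w: "locally_integrable w" and z: "\<And>\<eta>. test_function \<eta> \<Longrightarrow> (LINT x|lborel. \<eta> x *\<^sub>R w x) = 0"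
  shows "AE x in lborel. w x = 0"
proof -
  have [measurable]: "w \<in> borel_measurable borel" by (rule locally_integrableD[OF w])
  have z1: "(LINT x|lborel. indicator {a<..<b} x *\<^sub>R w x) = 0" for a b
  proof -
    define R where "R = max \<bar>a\<bar> \<bar>b\<bar>"
    have "(\<lambda>n. LINT x|lborel. bump n a b x *\<^sub>R w x) \<longlonglongrightarrow> (LINT x|lborel. indicator {a<..<b} x *\<^sub>R w x)"
    proof (rule integral_dominated_convergence[where w="\<lambda>x. norm (indicator {-R..R} x *\<^sub>R w x)"])
      show "integrable lborel (\<lambda>x. norm (indicator {-R..R} x *\<^sub>R w x))" using locally_integrableD(3)[OF w] by (rule integrable_norm)
      show "AE x in lborel. (\<lambda>n. bump n a b x *\<^sub>R w x) \<longlonglongrightarrow> indicator {a<..<b} x *\<^sub>R w x"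
        by (intro AE_I2 tendsto_intros bump_tendsto)
      have "bump n a b \<in> borel_measurable borel" for n
        by (intro borel_measurable_continuous_onI smooth_continuous smooth_bump)
      thus "(\<lambda>x. bump n a b x *\<^sub>R w x) \<in> borel_measurable lborel" for n by measurable
      show "AE x in lborel. cmod (bump n a b x *\<^sub>R w x) \<le> norm (indicator {-R..R} x *\<^sub>R w x)" for n
      proof (rule AE_I2)
        fix x
        have "\<bar>bump n a b x\<bar> \<le> indicator {-R..R} x"
          using bump_bounds(1,2)[of n a b x] bump_outside[of x a b n] by (cases "x \<in> {a<..<b}") (auto simp: R_def indicator_def)
        thus "cmod (bump n a b x *\<^sub>R w x) \<le> norm (indicator {-R..R} x *\<^sub>R w x)"
          by (simp add: mult_right_mono)
      qed
    qed measurable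
    moreover have "(LINT x|lborel. bump n a b x *\<^sub>R w x) = 0" for n by (rule z[OF test_bump])
    ultimately show ?thesis by (simp add: LIMSEQ_const_iff)
  qed
  have "AE x in lborel. x \<in> {-real n<..<real n} \<longrightarrow> w x = 0" for n
  proof -
    let ?I = "{-real n<..<real n}"
    have i: "integrable lborel (\<lambda>y. indicator {x<..} y *\<^sub>R (indicator ?I y *\<^sub>R w y))" for x
      by (rule Bochner_Integration.integrable_bound[OF locally_integrableD(3)[OF w, of "real n"]]) (auto simp: indicator_def)
    have i0: "integrable lborel (\<lambda>y. indicator ?I y *\<^sub>R w y)"
      by (rule Bochner_Integration.integrable_bound[OF locally_integrableD(3)[OF w, of "real n"]]) (auto simp: indicator_def)
    have 0: "(LINT y|lborel. indicator {x<..} y *\<^sub>R (indicator ?I y *\<^sub>R w y)) = 0" for x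
    proof -
      have "(\<lambda>y. indicator {x<..} y *\<^sub>R (indicator ?I y *\<^sub>R w y)) = (\<lambda>y. indicator {max x (-real n)<..<real n} y *\<^sub>R w y)"
        by (auto simp: fun_eq_iff indicator_def)
      thus ?thesis using z1 by simp
    qed
    have "AE y in lborel. Re (indicator ?I y *\<^sub>R w y) = 0"
    proof (rule AE_zero_of_half_lines)
      show "integrable lborel (\<lambda>y. Re (indicator ?I y *\<^sub>R w y))" using i0 by (rule integrable_Re)
      show "(LINT y|lborel. indicator {x<..} y * Re (indicator ?I y *\<^sub>R w y)) = 0" for x
        using integral_Re[OF i[of x]] 0[of x] by (simp add: mult.assoc)
    qed
    moreover have "AE y in lborel. Im (indicator ?I y *\<^sub>R w y) = 0"
    proof (rule AE_zero_of_half_lines)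
      show "integrable lborel (\<lambda>y. Im (indicator ?I y *\<^sub>R w y))" using i0 by (rule integrable_Im)
      show "(LINT y|lborel. indicator {x<..} y * Im (indicator ?I y *\<^sub>R w y)) = 0" for x
        using integral_Im[OF i[of x]] 0[of x] by (simp add: mult.assoc)
    qed
    ultimately show ?thesis by eventually_elim (auto simp: complex_eq_iff indicator_def)
  qed
  hence "AE x in lborel. \<forall>n. x \<in> {-real n<..<real n} \<longrightarrow> w x = 0" unfolding AE_all_countable by blast
  thus ?thesis
  proof eventually_elim
    fix x assume a: "\<forall>n. x \<in> {-real n<..<real n} \<longrightarrow> w x = 0"
    obtain n where "\<bar>x\<bar> < real n" using reals_Archimedean2 by blast
    hence "x \<in> {-real n<..<real n}" by auto
    thus "w x = 0" using a by blast
  qed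
qed

section \<open>Locally absolutely continuous functions\<close>

lemma integral_segment:
  fixes g :: "real \<Rightarrow> 'a::euclidean_space"
  assumes g: "continuous_on {a..b} g"
  shows "integrable lborel (\<lambda>y. if a \<le> y \<and> y < b then g y else 0)"
    "(LINT y|lborel. (if a \<le> y \<and> y < b then g y else 0)) = integral {a..b} g"
proof -
  have s: "set_integrable lborel {a..b} g" by (rule borel_integrable_atLeastAtMost'[OF g])
  have i: "integrable lborel (\<lambda>y. indicator {a..b} y *\<^sub>R g y)" using s unfolding set_integrable_def .
  have e: "(\<lambda>y. if a \<le> y \<and> y < b then g y else 0) = (\<lambda>y. if y < b then indicator {a..b} y *\<^sub>R g y else 0)"
    by (auto simp: fun_eq_iff indicator_def)
  show i2: "integrable lborel (\<lambda>y. if a \<le> y \<and> y < b then g y else 0)" unfolding e using i by (rule integrable_below)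
  have "(LINT y|lborel. (if a \<le> y \<and> y < b then g y else 0)) = (LINT y|lborel. indicator {a..b} y *\<^sub>R g y)"
    using AE_neq_real[of b] borel_measurable_integrable[OF i] borel_measurable_integrable[OF i2]
    by (intro integral_cong_AE) (auto elim!: eventually_mono simp: indicator_def)
  also have "\<dots> = integral {a..b} g" using set_borel_integral_eq_integral(2)[OF s] unfolding set_lebesgue_integral_def .
  finally show "(LINT y|lborel. (if a \<le> y \<and> y < b then g y else 0)) = integral {a..b} g" .
qed

text \<open>Half-open at the right, so that adjacent segments add up exactly
  (\<open>seg_split\<close>) and match the cut-off y < x in \<open>cum\<close>.\<close>

definition seg :: "(real \<Rightarrow> 'a::zero) \<Rightarrow> real \<Rightarrow> real \<Rightarrow> real \<Rightarrow> 'a" where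
  "seg g a b y = (if a \<le> y \<and> y < b then g y else 0)"

text \<open>\<open>ac f g\<close>: \<open>f\<close> is locally absolutely continuous with derivative \<open>g\<close> almost everywhere.\<close>

definition ac :: "(real \<Rightarrow> complex) \<Rightarrow> (real \<Rightarrow> complex) \<Rightarrow> bool" where
  "ac f g \<longleftrightarrow> (\<forall>a b. a \<le> b \<longrightarrow> integrable lborel (seg g a b) \<and> f b - f a = (LINT y|lborel. seg g a b y))"

lemma acD: assumes "ac f g" "a \<le> b" shows "integrable lborel (seg g a b)" "f b = f a + (LINT y|lborel. seg g a b y)"
proof -
  have *: "integrable lborel (seg g a b) \<and> f b - f a = (LINT y|lborel. seg g a b y)"
    using assms unfolding ac_def by blast
  show "integrable lborel (seg g a b)" using * ..
  show "f b = f a + (LINT y|lborel. seg g a b y)" by (simp add: *[THEN conjunct2, symmetric])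
qed

lemma seg_cum: "x \<le> b \<Longrightarrow> cum (seg g a b) x = (LINT y|lborel. seg g a x y)"
  unfolding cum_def seg_def by (intro Bochner_Integration.integral_cong) auto

lemma ac_cum_eq: assumes "ac f g" "a \<le> x" "x \<le> b" shows "f x = f a + cum (seg g a b) x"
  using acD(2)[OF assms(1,2)] seg_cum[OF assms(3), of g a] by simp

lemma ac_continuous: assumes "ac f g" shows "continuous_on UNIV f"
proof (intro continuous_at_imp_continuous_on ballI)
  fix x0 :: real
  let ?a = "x0 - 1" and ?b = "x0 + 1"
  have "continuous_on {?a<..<?b} (\<lambda>x. f ?a + cum (seg g ?a ?b) x)"
    by (intro continuous_on_add continuous_on_const continuous_on_subset[OF cum_continuous[OF acD(1)[OF assms]]]) auto
  hence "continuous_on {?a<..<?b} f"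
    by (rule continuous_on_eq) (rule ac_cum_eq[OF assms, symmetric], auto)
  thus "isCont f x0"
    by (rule continuous_on_eq_continuous_at[OF open_greaterThanLessThan, THEN iffD1, rule_format]) simp
qed

lemma ac_measurable: "ac f g \<Longrightarrow> f \<in> borel_measurable borel"
  by (rule borel_measurable_continuous_onI[OF ac_continuous])

lemma seg_continuous_integrable:
  "continuous_on UNIV (g :: real \<Rightarrow> complex) \<Longrightarrow> integrable lborel (seg g a b)"
  unfolding seg_def[abs_def] by (rule integral_segment(1)) (rule continuous_on_subset, auto)

lemma seg_mult_integrable:
  assumes g: "integrable lborel (seg g a b)" and f: "continuous_on UNIV (f :: real \<Rightarrow> complex)"
  shows "integrable lborel (seg (\<lambda>y. g y * f y) a b)"
proof -
  have "compact (f ` {a..b})" using f by (intro compact_continuous_image) (auto intro: continuous_on_subset)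
  hence "bounded (f ` {a..b})" by (rule compact_imp_bounded)
  then obtain C where "\<forall>x\<in>f ` {a..b}. cmod x \<le> C" unfolding bounded_iff by blast
  hence C: "\<And>x. x \<in> {a..b} \<Longrightarrow> cmod (f x) \<le> C" by simp
  have [measurable]: "f \<in> borel_measurable borel" using f by (rule borel_measurable_continuous_onI)
  let ?f = "\<lambda>y. if y \<in> {a..b} then f y else 0"
  have m: "?f \<in> borel_measurable borel" by measurable
  have "integrable lborel (\<lambda>y. seg g a b y * ?f y)"
    by (rule integrable_bounded_mult[OF g m, of "max 0 C"]) (use C in \<open>auto intro: max.coboundedI2\<close>)
  moreover have "(\<lambda>y. seg g a b y * ?f y) = seg (\<lambda>y. g y * f y) a b" by (auto simp: seg_def fun_eq_iff)
  ultimately show ?thesis by simp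
qed

lemma ac_C1:
  assumes D: "\<And>x. (f has_vector_derivative g x) (at x)" and c: "continuous_on UNIV g"
  shows "ac f g"
  unfolding ac_def
proof (intro allI impI conjI)
  fix a b :: real assume ab: "a \<le> b"
  show "integrable lborel (seg g a b)" by (rule seg_continuous_integrable[OF c])
  have "(g has_integral (f b - f a)) {a..b}"
    using ab D by (intro fundamental_theorem_of_calculus) (auto intro: has_vector_derivative_at_within)
  moreover have "(LINT y|lborel. seg g a b y) = integral {a..b} g"
    unfolding seg_def by (rule integral_segment(2)) (rule continuous_on_subset[OF c], auto)
  ultimately show "f b - f a = (LINT y|lborel. seg g a b y)" by (simp add: integral_unique)
qed

text \<open>On [a, b] each factor is its value at a plus a cumulative integral, and
  \<open>int_product\<close> multiplies the two integrals.\<close>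

lemma ac_mult:
  assumes f: "ac f f'" and g: "ac g g'"
  shows "ac (\<lambda>x. f x * g x) (\<lambda>x. f' x * g x + f x * g' x)"
  unfolding ac_def
proof (intro allI impI conjI)
  fix a b :: real assume ab: "a \<le> b"
  let ?F = "seg f' a b" and ?G = "seg g' a b"
  note iF = acD(1)[OF f ab] and iG = acD(1)[OF g ab]
  have i1: "integrable lborel (seg (\<lambda>x. f' x * g x) a b)" by (rule seg_mult_integrable[OF iF ac_continuous[OF g]])
  have i2: "integrable lborel (seg (\<lambda>x. f x * g' x) a b)" using seg_mult_integrable[OF iG ac_continuous[OF f]] by (simp add: mult.commute)
  have s: "seg (\<lambda>x. f' x * g x + f x * g' x) a b = (\<lambda>x. seg (\<lambda>x. f' x * g x) a b x + seg (\<lambda>x. f x * g' x) a b x)"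
    by (auto simp: seg_def fun_eq_iff)
  show "integrable lborel (seg (\<lambda>x. f' x * g x + f x * g' x) a b)" unfolding s using i1 i2 by simp
  have e: "?F y * cum ?G y + cum ?F y * ?G y = seg (\<lambda>x. f' x * g x + f x * g' x) a b y - ?F y * g a - f a * ?G y" for y
    using ac_cum_eq[OF f, of a y b] ac_cum_eq[OF g, of a y b] by (cases "a \<le> y \<and> y < b") (auto simp: seg_def algebra_simps)
  have "(LINT y|lborel. ?F y) * (LINT y|lborel. ?G y) = (LINT y|lborel. seg (\<lambda>x. f' x * g x + f x * g' x) a b y - ?F y * g a - f a * ?G y)"
    unfolding int_product[OF iF iG] e ..
  also have "\<dots> = (LINT y|lborel. seg (\<lambda>x. f' x * g x + f x * g' x) a b y) - (LINT y|lborel. ?F y) * g a - f a * (LINT y|lborel. ?G y)"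
    using i1 i2 iF iG unfolding s by simp
  finally show "f b * g b - f a * g a = (LINT y|lborel. seg (\<lambda>x. f' x * g x + f x * g' x) a b y)"
    using acD(2)[OF f ab] acD(2)[OF g ab] by (simp add: algebra_simps)
qed

lemma ac_add:
  assumes f: "ac f f'" and g: "ac g g'"
  shows "ac (\<lambda>x. f x + g x) (\<lambda>x. f' x + g' x)"
proof -
  have s: "seg (\<lambda>x. f' x + g' x) a b = (\<lambda>x. seg f' a b x + seg g' a b x)" for a b
    by (auto simp: seg_def fun_eq_iff)
  show ?thesis using f g unfolding ac_def s by (auto simp: algebra_simps)
qed

lemma ac_cmult:
  assumes f: "ac f f'" shows "ac (\<lambda>x. k * f x) (\<lambda>x. k * f' x)"
proof -
  have s: "seg (\<lambda>x. k * f' x) a b = (\<lambda>x. k * seg f' a b x)" for a b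
    by (auto simp: seg_def fun_eq_iff)
  show ?thesis using f unfolding ac_def s by (auto simp: right_diff_distrib[symmetric])
qed

lemma ac_diff:
  assumes f: "ac f f'" and g: "ac g g'"
  shows "ac (\<lambda>x. f x - g x) (\<lambda>x. f' x - g' x)"
  using ac_add[OF f ac_cmult[OF g, of "-1"]] by simp

lemma ac_const: "ac (\<lambda>x. k) (\<lambda>x. 0)"
  unfolding ac_def seg_def by simp

lemma ac_cnj: assumes f: "ac f f'" shows "ac (\<lambda>x. cnj (f x)) (\<lambda>x. cnj (f' x))"
proof -
  have s: "seg (\<lambda>x. cnj (f' x)) a b = (\<lambda>x. cnj (seg f' a b x))" for a b
    by (auto simp: seg_def fun_eq_iff)
  show ?thesis unfolding ac_def s
  proof (intro allI impI conjI)
    fix a b :: real assume ab: "a \<le> b"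
    show "integrable lborel (\<lambda>x. cnj (seg f' a b x))" using acD(1)[OF f ab] by simp
    show "cnj (f b) - cnj (f a) = (LINT x|lborel. cnj (seg f' a b x))" using acD(2)[OF f ab] by simp
  qed
qed

lemma ac_cong_AE:
  assumes f: "ac f g" and g: "AE x in lborel. g x = g' x" and m: "g' \<in> borel_measurable borel"
  shows "ac f g'"
  unfolding ac_def
proof (intro allI impI)
  fix a b :: real assume ab: "a \<le> b"
  have m': "seg g' a b \<in> borel_measurable lborel" unfolding seg_def[abs_def] using m by measurable
  have e: "AE y in lborel. seg g a b y = seg g' a b y" using g by eventually_elim (simp add: seg_def)
  have i: "integrable lborel (seg g a b)" by (rule acD(1)[OF f ab])
  have i': "integrable lborel (seg g' a b)" using integrable_cong_AE[OF borel_measurable_integrable[OF i] m' e] i by simp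
  have "f b - f a = (LINT y|lborel. seg g a b y)" using acD(2)[OF f ab] by simp
  also have "\<dots> = (LINT y|lborel. seg g' a b y)" using borel_measurable_integrable[OF i] m' e by (rule integral_cong_AE)
  finally show "integrable lborel (seg g' a b) \<and> f b - f a = (LINT y|lborel. seg g' a b y)" using i' by simp
qed

lemma seg_split:
  assumes "integrable lborel (seg g a b)" "integrable lborel (seg g b c)" "a \<le> b" "b \<le> c"
  shows "(LINT y|lborel. seg g a c y) = (LINT y|lborel. seg g a b y) + (LINT y|lborel. (seg g b c y :: complex))"
proof -
  have "seg g a c = (\<lambda>y. seg g a b y + seg g b c y)" using assms(3,4) by (auto simp: seg_def fun_eq_iff)
  thus ?thesis using assms(1,2) by simp
qed

lemma ac_primitive:
  assumes g: "\<And>a b. integrable lborel (seg g a b)"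
  shows "ac (\<lambda>x. if 0 \<le> x then LINT y|lborel. seg g 0 x y else - (LINT y|lborel. seg g x 0 y)) g"
  unfolding ac_def
proof (intro allI impI conjI g)
  fix a b :: real assume ab: "a \<le> b"
  let ?G = "\<lambda>x. if 0 \<le> x then LINT y|lborel. seg g 0 x y else - (LINT y|lborel. seg g x 0 y)"
  consider "0 \<le> a" | "a < 0" "0 \<le> b" | "b < 0" by linarith
  thus "?G b - ?G a = (LINT y|lborel. seg g a b y)"
  proof cases
    case 1
    have "(LINT y|lborel. seg g 0 b y) = (LINT y|lborel. seg g 0 a y) + (LINT y|lborel. seg g a b y)"
      by (rule seg_split[OF g g 1 ab])
    thus ?thesis using 1 ab by simp
  next
    case 2
    have "(LINT y|lborel. seg g a b y) = (LINT y|lborel. seg g a 0 y) + (LINT y|lborel. seg g 0 b y)"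
      by (rule seg_split[OF g g _ 2(2)]) (use 2 in simp)
    thus ?thesis using 2 by simp
  next
    case 3
    have "(LINT y|lborel. seg g a 0 y) = (LINT y|lborel. seg g a b y) + (LINT y|lborel. seg g b 0 y)"
      by (rule seg_split[OF g g ab]) (use 3 in simp)
    thus ?thesis using 3 ab by simp
  qed
qed

lemma ac_cum: assumes g: "integrable lborel g" shows "ac (cum g) g"
  unfolding ac_def
proof (intro allI impI conjI)
  fix a b :: real assume ab: "a \<le> b"
  show i: "integrable lborel (seg g a b)" unfolding seg_def[abs_def] by (rule integrable_if[OF g]) auto
  have "(\<lambda>y. if y < b then g y else 0) = (\<lambda>y. (if y < a then g y else 0) + seg g a b y)" using ab by (auto simp: seg_def fun_eq_iff)
  hence "cum g b = cum g a + (LINT y|lborel. seg g a b y)" unfolding cum_def using g i by simp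
  thus "cum g b - cum g a = (LINT y|lborel. seg g a b y)" by simp
qed

section \<open>From weak derivatives to absolute continuity\<close>

lemma ac_weak_deriv:
  assumes f: "ac f g" and \<psi>: "test_function \<psi>" and g: "locally_integrable g"
  shows "(LINT x|lborel. deriv \<psi> x *\<^sub>R f x) = - (LINT x|lborel. \<psi> x *\<^sub>R g x)"
proof -
  obtain R C where R: "0 < R" "\<And>x. \<bar>x\<bar> > R \<Longrightarrow> \<psi> x = 0" "\<And>x. \<bar>x\<bar> > R \<Longrightarrow> deriv \<psi> x = 0" "\<And>x. \<bar>\<psi> x\<bar> \<le> C"
    and D: "\<And>x. (\<psi> has_real_derivative deriv \<psi> x) (at x)" and c: "continuous_on UNIV \<psi>" "continuous_on UNIV (deriv \<psi>)"
    using \<psi> by (rule test_functionD) blast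
  have a: "ac (\<lambda>x. complex_of_real (\<psi> x)) (\<lambda>x. complex_of_real (deriv \<psi> x))"
  proof (rule ac_C1)
    show "((\<lambda>x. complex_of_real (\<psi> x)) has_vector_derivative complex_of_real (deriv \<psi> x)) (at x)" for x
      using D[of x] by (intro has_vector_derivative_of_real) (simp add: has_real_derivative_iff_has_vector_derivative)
  qed (use c in \<open>auto intro!: continuous_intros\<close>)
  \<comment> \<open>One unit beyond the support bound, so that \<psi> vanishes at both end points
    and the boundary terms of the product rule drop out.\<close>
  let ?a = "- R - 1" and ?b = "R + 1"
  let ?p = "\<lambda>x. complex_of_real (deriv \<psi> x) * f x" and ?q = "\<lambda>x. complex_of_real (\<psi> x) * g x"
  have ab: "?a \<le> ?b" using R by simp
  have s1: "seg ?p ?a ?b = ?p" "seg ?q ?a ?b = ?q" using R(2,3) by (auto simp: seg_def fun_eq_iff)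
  have ip: "integrable lborel ?p" using seg_mult_integrable[OF acD(1)[OF a ab] ac_continuous[OF f]] unfolding s1 .
  have iq: "integrable lborel ?q" using test_mult_integrable[OF g c(1) R(2) R(4)] by (simp add: scaleR_conv_of_real)
  have "complex_of_real (\<psi> ?b) * f ?b = complex_of_real (\<psi> ?a) * f ?a + (LINT y|lborel. seg (\<lambda>x. ?p x + ?q x) ?a ?b y)"
    by (rule acD(2)[OF ac_mult[OF a f] ab])
  moreover have "seg (\<lambda>x. ?p x + ?q x) ?a ?b = (\<lambda>x. seg ?p ?a ?b x + seg ?q ?a ?b x)" by (auto simp: seg_def fun_eq_iff)
  ultimately have "0 = (LINT y|lborel. ?p y + ?q y)" using R unfolding s1 by simp
  also have "\<dots> = (LINT y|lborel. ?p y) + (LINT y|lborel. ?q y)" using ip iq by simp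
  finally show ?thesis by (simp add: scaleR_conv_of_real eq_neg_iff_add_eq_0)
qed

text \<open>Subtracting from \<eta> its integral times a fixed bump of integral 1 leaves a function
  of mean zero, whose primitive is again a test function. Hence testing w against \<eta> gives the
  integral of \<eta> times a constant k, and \<open>fundamental_lemma\<close> applies to w -
  k.\<close>

lemma weak_const:
  assumes w: "locally_integrable w" and z: "\<And>\<psi>. test_function \<psi> \<Longrightarrow> (LINT x|lborel. deriv \<psi> x *\<^sub>R w x) = 0"
  obtains k where "AE x in lborel. w x = k"
proof -
  have tI: "integrable lborel \<eta>" if t: "test_function \<eta>" for \<eta>
  proof -
    obtain R C where R: "0 < R" "\<And>x. \<bar>x\<bar> > R \<Longrightarrow> \<eta> x = 0" "\<And>x. \<bar>\<eta> x\<bar> \<le> C" and c: "continuous_on UNIV \<eta>"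
      using t by (rule test_functionD) blast
    have [measurable]: "\<eta> \<in> borel_measurable borel" using c by (rule borel_measurable_continuous_onI)
    show ?thesis
    proof (rule Bochner_Integration.integrable_bound[where f="\<lambda>x. C * indicator {-R..R} x"])
      show "AE x in lborel. norm (\<eta> x) \<le> norm (C * indicator {-R..R} x)"
      proof (rule AE_I2)
        fix x show "norm (\<eta> x) \<le> norm (C * indicator {-R..R} x)"
          using R(2)[of x] R(3)[of x] by (cases "\<bar>x\<bar> > R") (auto simp: indicator_def)
      qed
      show "integrable lborel (\<lambda>x. C * indicator {-R..R} x)"
        by (intro integrable_mult_right integrable_real_indicator) (auto simp: emeasure_lborel_Icc_eq)
    qed auto
  qed
  define \<rho>0 where "\<rho>0 = bump 0 0 1"
  have t0: "test_function \<rho>0" unfolding \<rho>0_def by (rule test_bump)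
  define J where "J = (LINT x|lborel. \<rho>0 x)"
  have J: "J \<noteq> 0"
  proof
    assume "J = 0"
    hence "AE x in lborel. \<rho>0 x = 0"
      using integral_nonneg_eq_0_iff_AE[OF tI[OF t0]] bump_bounds(1)[of 0 0 1] unfolding J_def \<rho>0_def by simp
    hence "AE x in lborel. x \<notin> {0<..<1::real}"
      by eventually_elim (use bump_bounds(3)[of _ 0 1 0] in \<open>force simp: \<rho>0_def\<close>)
    hence "emeasure lborel {0<..<1::real} = 0" by (subst (asm) AE_iff_measurable[where N="{0<..<1}"]) auto
    thus False by simp
  qed
  define \<rho> where "\<rho> = (\<lambda>x. 1 / J * \<rho>0 x)"
  define k where "k = (LINT x|lborel. \<rho> x *\<^sub>R w x)"
  have \<rho>s: "smooth \<rho>" unfolding \<rho>_def using t0 by (intro smooth_mult smooth_const) (simp add: test_function_iff)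
  have \<rho>t: "test_function \<rho>" using \<rho>s t0 unfolding test_function_iff \<rho>_def by auto
  have \<rho>1: "(LINT x|lborel. \<rho> x) = 1" using J unfolding \<rho>_def J_def by simp
  have tw: "integrable lborel (\<lambda>x. \<eta> x *\<^sub>R w x)" if t: "test_function \<eta>" for \<eta>
  proof -
    obtain R C where R: "0 < R" "\<And>x. \<bar>x\<bar> > R \<Longrightarrow> \<eta> x = 0" "\<And>x. \<bar>\<eta> x\<bar> \<le> C" and c: "continuous_on UNIV \<eta>"
      using t by (rule test_functionD) blast
    show ?thesis by (rule test_mult_integrable[OF w c R(2,3)])
  qed
  have main: "(LINT x|lborel. \<eta> x *\<^sub>R w x) = (LINT x|lborel. \<eta> x) *\<^sub>R k" if t: "test_function \<eta>" for \<eta>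
  proof -
    define m where "m = (LINT x|lborel. \<eta> x)"
    define \<zeta> where "\<zeta> = (\<lambda>x. \<eta> x + (- m) * \<rho> x)"
    have \<zeta>s: "smooth \<zeta>" unfolding \<zeta>_def using t \<rho>s by (intro smooth_add smooth_mult smooth_const) (simp_all add: test_function_iff)
    obtain R1 R2 where "\<And>x. \<bar>x\<bar> > R1 \<Longrightarrow> \<eta> x = 0" "\<And>x. \<bar>x\<bar> > R2 \<Longrightarrow> \<rho> x = 0"
      using t \<rho>t unfolding test_function_iff by blast
    hence \<zeta>0: "\<zeta> x = 0" if "\<bar>x\<bar> > max R1 R2" for x using that by (auto simp: \<zeta>_def)
    have i\<zeta>: "integrable lborel \<zeta>" unfolding \<zeta>_def by (intro Bochner_Integration.integrable_add integrable_mult_right tI t \<rho>t)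
    have I0: "(LINT x|lborel. \<zeta> x) = 0"
      unfolding \<zeta>_def using tI[OF t] tI[OF \<rho>t] by (simp add: \<rho>1 m_def)
    define \<psi> where "\<psi> = cum \<zeta>"
    have D: "(\<psi> has_real_derivative \<zeta> x) (at x)" for x
    proof -
      let ?a = "x - 1" and ?b = "x + 1"
      have cz: "continuous_on {?a..?b} \<zeta>" using smooth_continuous[OF \<zeta>s] continuous_on_subset by blast
      have "((\<lambda>t. integral {?a..t} \<zeta>) has_real_derivative \<zeta> x) (at x within {?a..?b})"
        by (rule integral_has_real_derivative[OF cz]) simp
      hence "((\<lambda>t. integral {?a..t} \<zeta>) has_real_derivative \<zeta> x) (at x)" by (simp add: at_within_Icc_at)
      hence "((\<lambda>t. cum \<zeta> ?a + integral {?a..t} \<zeta>) has_real_derivative \<zeta> x) (at x)"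
        by (auto intro!: derivative_eq_intros)
      thus ?thesis
      proof (rule has_field_derivative_transform_within_open[where S="{?a<..<?b}"])
        fix t assume "t \<in> {?a<..<?b}"
        hence t: "?a \<le> t" by simp
        have cs: "continuous_on {?a..t} \<zeta>" using smooth_continuous[OF \<zeta>s] continuous_on_subset by blast
        have "(\<lambda>y. if y < t then \<zeta> y else 0) = (\<lambda>y. (if y < ?a then \<zeta> y else 0) + (if ?a \<le> y \<and> y < t then \<zeta> y else 0))"
          using t by (auto simp: fun_eq_iff)
        hence "cum \<zeta> t = cum \<zeta> ?a + (LINT y|lborel. (if ?a \<le> y \<and> y < t then \<zeta> y else 0))"
          unfolding cum_def using i\<zeta> integral_segment(1)[OF cs] by simp
        thus "cum \<zeta> ?a + integral {?a..t} \<zeta> = \<psi> t" unfolding integral_segment(2)[OF cs] \<psi>_def by simp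
      qed auto
    qed
    have "\<psi> x = 0" if x: "\<bar>x\<bar> > max R1 R2" for x
    proof (cases "x \<ge> 0")
      case True
      have "\<psi> x = (LINT y|lborel. \<zeta> y)"
        unfolding \<psi>_def cum_def using \<zeta>0 True x by (intro Bochner_Integration.integral_cong) auto
      thus ?thesis using I0 by simp
    next
      case False
      have "\<psi> x = (LINT y|(lborel::real measure). 0)"
        unfolding \<psi>_def cum_def using \<zeta>0 False x by (intro Bochner_Integration.integral_cong) auto
      thus ?thesis by simp
    qed
    hence "test_function \<psi>" using smooth_antiderivative[OF \<zeta>s D] unfolding test_function_iff by blast
    hence "(LINT x|lborel. deriv \<psi> x *\<^sub>R w x) = 0" by (rule z)
    hence "(LINT x|lborel. \<eta> x *\<^sub>R w x + (- m) *\<^sub>R (\<rho> x *\<^sub>R w x)) = 0"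
      using DERIV_imp_deriv[OF D] by (simp add: \<zeta>_def scaleR_add_left scaleR_diff_left)
    moreover have "(LINT x|lborel. \<eta> x *\<^sub>R w x + (- m) *\<^sub>R (\<rho> x *\<^sub>R w x)) = (LINT x|lborel. \<eta> x *\<^sub>R w x) + (LINT x|lborel. (- m) *\<^sub>R (\<rho> x *\<^sub>R w x))"
      by (intro Bochner_Integration.integral_add integrable_scaleR_right tw t \<rho>t)
    moreover have "(LINT x|lborel. (- m) *\<^sub>R (\<rho> x *\<^sub>R w x)) = - (m *\<^sub>R k)"
      unfolding k_def integral_scaleR_right by simp
    ultimately show ?thesis unfolding m_def by simp
  qed
  have wk: "locally_integrable (\<lambda>x. w x - k)"
  proof -
    have "set_integrable lborel {-R..R} (\<lambda>x. w x - k)" for R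
      using w borel_integrable_atLeastAtMost'[of "-R" R "\<lambda>_. k"] unfolding locally_integrable_def by (intro set_integral_diff(1)) auto
    thus ?thesis unfolding locally_integrable_def by blast
  qed
  have "AE x in lborel. w x - k = 0"
  proof (rule fundamental_lemma[OF wk])
    fix \<eta> assume t: "test_function \<eta>"
    have "(LINT x|lborel. \<eta> x *\<^sub>R (w x - k)) = (LINT x|lborel. \<eta> x *\<^sub>R w x - \<eta> x *\<^sub>R k)"
      by (simp add: scaleR_diff_right)
    also have "\<dots> = (LINT x|lborel. \<eta> x *\<^sub>R w x) - (LINT x|lborel. \<eta> x) *\<^sub>R k"
      using tI[OF t] tw[OF t] by simp
    finally show "(LINT x|lborel. \<eta> x *\<^sub>R (w x - k)) = 0" using main[OF t] by simp
  qed
  hence "AE x in lborel. w x = k" by eventually_elim simp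
  thus thesis by (rule that)
qed

text \<open>The difference of f and a primitive of g has weak derivative 0, hence is constant almost
  everywhere.\<close>

lemma weak_deriv_ac:
  assumes "has_weak_deriv f g"
  obtains v where "ac v g" "AE x in lborel. f x = v x"
proof -
  have lf: "locally_integrable f" and lg: "locally_integrable g" and wd: "\<And>\<psi>. test_function \<psi> \<Longrightarrow> (LINT x|lborel. deriv \<psi> x *\<^sub>R f x) = - (LINT x|lborel. \<psi> x *\<^sub>R g x)"
    using assms unfolding has_weak_deriv_def by auto
  obtain G where G: "ac G g" using ac_primitive[of g] locally_integrableD(2)[OF lg] unfolding seg_def[abs_def] by blast
  have lG: "locally_integrable G"
    unfolding locally_integrable_def using ac_continuous[OF G] by (auto intro!: borel_integrable_atLeastAtMost' intro: continuous_on_subset)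
  have lw: "locally_integrable (\<lambda>x. f x - G x)"
    using lf lG unfolding locally_integrable_def by (auto intro!: set_integral_diff(1))
  obtain k where k: "AE x in lborel. f x - G x = k"
  proof (rule weak_const[OF lw])
    fix \<psi> assume t: "test_function \<psi>"
    then obtain R C where R: "\<And>x. \<bar>deriv \<psi> x\<bar> \<le> C" "\<And>x. \<bar>x\<bar> > R \<Longrightarrow> deriv \<psi> x = 0" and c: "continuous_on UNIV (deriv \<psi>)"
      by (rule test_functionD) blast
    have "(LINT x|lborel. deriv \<psi> x *\<^sub>R (f x - G x)) = (LINT x|lborel. deriv \<psi> x *\<^sub>R f x) - (LINT x|lborel. deriv \<psi> x *\<^sub>R G x)"
      unfolding scaleR_diff_right by (intro Bochner_Integration.integral_diff test_mult_integrable[OF lf c R(2,1)] test_mult_integrable[OF lG c R(2,1)])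
    thus "(LINT x|lborel. deriv \<psi> x *\<^sub>R (f x - G x)) = 0" using wd[OF t] ac_weak_deriv[OF G t lg] by simp
  qed
  have "ac (\<lambda>x. G x + k) g" using ac_add[OF G ac_const[of k]] by simp
  moreover have "AE x in lborel. f x = G x + k" using k by eventually_elim (simp add: algebra_simps)
  ultimately show thesis by (rule that)
qed

lemma has_weak_deriv_unique:
  assumes "has_weak_deriv f g" "has_weak_deriv f g'"
  shows "AE x in lborel. g x = g' x"
proof -
  have l: "locally_integrable g" "locally_integrable g'" using assms unfolding has_weak_deriv_def by auto
  hence lw: "locally_integrable (\<lambda>x. g x - g' x)"
    unfolding locally_integrable_def by (auto intro!: set_integral_diff(1))
  have "AE x in lborel. g x - g' x = 0"
  proof (rule fundamental_lemma[OF lw])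
    fix \<psi> assume t: "test_function \<psi>"
    then obtain R C where R: "\<And>x. \<bar>\<psi> x\<bar> \<le> C" "\<And>x. \<bar>x\<bar> > R \<Longrightarrow> \<psi> x = 0" and c: "continuous_on UNIV \<psi>"
      by (rule test_functionD) blast
    have "(LINT x|lborel. \<psi> x *\<^sub>R (g x - g' x)) = (LINT x|lborel. \<psi> x *\<^sub>R g x) - (LINT x|lborel. \<psi> x *\<^sub>R g' x)"
      unfolding scaleR_diff_right by (intro Bochner_Integration.integral_diff test_mult_integrable[OF l(1) c R(2,1)] test_mult_integrable[OF l(2) c R(2,1)])
    moreover have "(LINT x|lborel. \<psi> x *\<^sub>R g x) = (LINT x|lborel. \<psi> x *\<^sub>R g' x)"
    proof -
      have "(LINT x|lborel. deriv \<psi> x *\<^sub>R f x) = - (LINT x|lborel. \<psi> x *\<^sub>R g x)"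
        using assms(1) t unfolding has_weak_deriv_def by blast
      moreover have "(LINT x|lborel. deriv \<psi> x *\<^sub>R f x) = - (LINT x|lborel. \<psi> x *\<^sub>R g' x)"
        using assms(2) t unfolding has_weak_deriv_def by blast
      ultimately show ?thesis by simp
    qed
    ultimately show "(LINT x|lborel. \<psi> x *\<^sub>R (g x - g' x)) = 0" by simp
  qed
  thus ?thesis by eventually_elim simp
qed

lemma integrable_limit_zero:
  fixes f :: "real \<Rightarrow> complex"
  assumes f: "integrable lborel f" and L: "(f \<longlongrightarrow> L) at_top"
  shows "L = 0"
proof (rule ccontr)
  assume "L \<noteq> 0"
  hence "\<forall>\<^sub>F x in at_top. dist (f x) L < cmod L / 2" using L by (intro tendstoD) auto
  then obtain X where X: "\<And>x. x \<ge> X \<Longrightarrow> dist (f x) L < cmod L / 2" unfolding eventually_at_top_linorder by blast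
  have i: "integrable lborel (\<lambda>y. indicator {X..} y * (cmod L / 2))"
  proof (rule Bochner_Integration.integrable_bound[OF f])
    show "AE x in lborel. norm (indicator {X..} x * (cmod L / 2)) \<le> cmod (f x)"
    proof (rule AE_I2)
      fix x
      have "cmod L / 2 \<le> cmod (f x)" if "x \<ge> X"
        using X[OF that] norm_triangle_ineq2[of L "f x"] by (simp add: dist_norm norm_minus_commute)
      thus "norm (indicator {X..} x * (cmod L / 2)) \<le> cmod (f x)" by (auto simp: indicator_def)
    qed
  qed auto
  have le: "real n * (cmod L / 2) \<le> (LINT y|lborel. indicator {X..} y * (cmod L / 2))" for n
  proof -
    have "real n * (cmod L / 2) = (LINT y|lborel. indicator {X..X + real n} y * (cmod L / 2))" by simp
    also have "\<dots> \<le> (LINT y|lborel. indicator {X..} y * (cmod L / 2))"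
    proof (rule integral_mono[OF _ i])
      show "integrable lborel (\<lambda>y. indicator {X..X + real n} y * (cmod L / 2))"
        by (intro integrable_mult_left integrable_real_indicator) (auto simp: emeasure_lborel_Icc_eq)
    qed (auto simp: indicator_def)
    finally show ?thesis .
  qed
  obtain n where "(LINT y|lborel. indicator {X..} y * (cmod L / 2)) / (cmod L / 2) < real n" using reals_Archimedean2 by blast
  hence "(LINT y|lborel. indicator {X..} y * (cmod L / 2)) < real n * (cmod L / 2)" using \<open>L \<noteq> 0\<close> by (simp add: pos_divide_less_eq)
  thus False using le[of n] by simp
qed

text \<open>Integrability of the derivative gives limits at both ends, and an integrable function
  can only have the limit 0 there.\<close>

lemma ac_vanish:
  assumes f: "ac f g" and fi: "integrable lborel f" and gi: "integrable lborel g"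
  shows "f x = cum g x" "(f \<longlongrightarrow> 0) at_top" "(f \<longlongrightarrow> 0) at_bot"
proof -
  define k where "k = f 0 - cum g 0"
  have e: "f x = k + cum g x" for x
  proof (cases "0 \<le> x")
    case True
    show ?thesis using acD(2)[OF f True] acD(2)[OF ac_cum[OF gi] True] by (simp add: k_def)
  next
    case False
    hence "x \<le> 0" by simp
    show ?thesis using acD(2)[OF f \<open>x \<le> 0\<close>] acD(2)[OF ac_cum[OF gi] \<open>x \<le> 0\<close>] by (simp add: k_def)
  qed
  have fe: "f = (\<lambda>x. k + cum g x)" using e by auto
  have top: "(f \<longlongrightarrow> k + (LINT y|lborel. g y)) at_top"
    unfolding fe by (intro tendsto_intros tendsto_at_topI_sequentially cum_at_top[OF gi])
  have bot: "(f \<longlongrightarrow> k + 0) at_bot"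
  proof -
    have "((\<lambda>x. f (- x)) \<longlongrightarrow> k + 0) at_top"
      unfolding fe by (intro tendsto_intros tendsto_at_topI_sequentially cum_at_bot[OF gi]) (simp add: filterlim_uminus_at_bot)
    thus ?thesis by (simp add: filterlim_at_bot_mirror)
  qed
  have "integrable lborel (\<lambda>x. f (- x))" using lborel_integrable_real_affine[OF fi, of "-1" 0] by simp
  moreover have "((\<lambda>x. f (- x)) \<longlongrightarrow> k) at_top" using bot by (simp add: filterlim_at_bot_mirror)
  ultimately have k: "k = 0" by (rule integrable_limit_zero)
  show "f x = cum g x" using e k by simp
  show "(f \<longlongrightarrow> 0) at_bot" using bot k by simp
  show "(f \<longlongrightarrow> 0) at_top" using top integrable_limit_zero[OF fi top] by simp
qed

section \<open>Jost solutions and scattering coefficients\<close>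

text \<open>For s = \<infinity> or s = -\<infinity>: y lies between s and x. Together with the sign
  \<open>orient\<close> this lets the Jost solutions from both ends share one formula.\<close>

definition beyond :: "ereal \<Rightarrow> real \<Rightarrow> real \<Rightarrow> bool" where
  "beyond s x y \<longleftrightarrow> (if s = \<infinity> then x < y else y < x)"

definition orient :: "ereal \<Rightarrow> complex" where
  "orient s = (if s = \<infinity> then -1 else 1)"

lemma beyond_einterval:
  fixes F :: "real \<Rightarrow> 'a::{banach,second_countable_topology}"
  assumes "s = \<infinity> \<or> s = -\<infinity>"
  shows "interval_lebesgue_integrable lborel s (ereal x) F \<longleftrightarrow> integrable lborel (\<lambda>y. if beyond s x y then F y else 0)"
    and "(LBINT y=s..ereal x. F y) = (if s = \<infinity> then -1 else 1 :: real) *\<^sub>R (LINT y|lborel. (if beyond s x y then F y else 0))"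
proof -
  have *: "(\<lambda>y. indicator (einterval (-\<infinity>) (ereal x)) y *\<^sub>R F y) = (\<lambda>y. if y < x then F y else 0)"
    "(\<lambda>y. indicator (einterval (ereal x) \<infinity>) y *\<^sub>R F y) = (\<lambda>y. if x < y then F y else 0)"
    by (auto simp: fun_eq_iff einterval_def indicator_def)
  have e: "einterval (-\<infinity>) (ereal x) = {..<x}" "einterval (ereal x) \<infinity> = {x<..}" by (auto simp: einterval_def)
  note * = *[unfolded e]
  show "interval_lebesgue_integrable lborel s (ereal x) F \<longleftrightarrow> integrable lborel (\<lambda>y. if beyond s x y then F y else 0)"
    using assms unfolding interval_lebesgue_integrable_def beyond_def set_integrable_def by (auto simp: *)
  show "(LBINT y=s..ereal x. F y) = (if s = \<infinity> then -1 else 1 :: real) *\<^sub>R (LINT y|lborel. (if beyond s x y then F y else 0))"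
    using assms unfolding interval_lebesgue_integral_def beyond_def set_lebesgue_integral_def by (auto simp: *)
qed

lemma integrable_vec2_iff:
  fixes F :: "real \<Rightarrow> complex^2"
  shows "integrable lborel F \<longleftrightarrow> (\<forall>i. integrable lborel (\<lambda>y. F y $ i))"
proof
  assume "integrable lborel F"
  thus "\<forall>i. integrable lborel (\<lambda>y. F y $ i)"
    by (auto intro: integrable_bounded_linear[OF bounded_linear_vec_nth])
next
  assume a: "\<forall>i. integrable lborel (\<lambda>y. F y $ i)"
  have bl: "bounded_linear (axis i :: complex \<Rightarrow> complex^2)" for i
    by (rule linear_conv_bounded_linear[THEN iffD1], rule linearI) (auto simp: vec_eq_iff axis_def)
  have "integrable lborel (\<lambda>y. (axis 1 (F y $ 1) + axis 2 (F y $ 2) :: complex^2))"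
    using a by (intro Bochner_Integration.integrable_add integrable_bounded_linear[OF bl]) auto
  moreover have "(\<lambda>y. axis 1 (F y $ 1) + axis 2 (F y $ 2)) = F"
    by (auto simp: fun_eq_iff vec_eq_iff axis_def forall_2)
  ultimately show "integrable lborel F" by simp
qed

lemma integral_vec2_nth:
  fixes F :: "real \<Rightarrow> complex^2"
  assumes "integrable lborel F" shows "(LINT y|lborel. F y) $ i = (LINT y|lborel. F y $ i)"
  using integral_bounded_linear[OF bounded_linear_vec_nth assms, of i] by simp

lemma integrable_cmult_iff:
  fixes f :: "real \<Rightarrow> complex"
  assumes "t \<noteq> 0" shows "integrable lborel (\<lambda>y. t * f y) \<longleftrightarrow> integrable lborel f"
proof
  assume "integrable lborel (\<lambda>y. t * f y)"
  from integrable_mult_right[OF this, of "inverse t"] show "integrable lborel f" using assms by (simp add: mult.assoc[symmetric])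
qed simp

lemma diag2_mult: "(diag2 p q *v w) $ 1 = p * w $ 1" "(diag2 p q *v w) $ 2 = q * w $ 2"
  by (simp_all add: matrix_vector_mult_def diag2_def sum_2)

locale jost_data =
  fixes u :: "real \<Rightarrow> complex" and k :: complex and z :: real
  assumes k2: "k\<^sup>2 = complex_of_real z" and um: "u \<in> borel_measurable borel"
    and ui: "integrable lborel u" and ui2: "integrable lborel (\<lambda>y. (cmod (u y))\<^sup>2)"
begin

definition ph :: "real \<Rightarrow> complex" where "ph x = cis (2 * (z + 1) * x)"

text \<open>The matrix \<open>Q\<close> conjugated by the phases. The diagonal propagator, which
  depends on x - y, is absorbed, so that the kernel depends on y alone as
  \<open>volterra_unique\<close> requires.\<close>

definition N :: "2 \<Rightarrow> 2 \<Rightarrow> real \<Rightarrow> complex" where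
  "N i j y = (if i = 1 then if j = 1 then \<i> / 2 * complex_of_real ((cmod (u y))\<^sup>2) else k * u y * ph y
     else if j = 1 then - k * cnj (u y) * cnj (ph y) else - (\<i> / 2 * complex_of_real ((cmod (u y))\<^sup>2)))"

definition kap :: "real \<Rightarrow> real" where "kap y = (\<Sum>i\<in>UNIV. \<Sum>j\<in>UNIV. cmod (N i j y))"

lemma ph_measurable [measurable]: "ph \<in> borel_measurable borel" unfolding ph_def[abs_def] by measurable
lemma ph_cnj: "ph x * cnj (ph x) = 1" "cnj (ph x) * ph x = 1" "cmod (ph x) = 1"
  unfolding ph_def by (auto simp: cis_cnj cis_mult)
lemma ph_exp: "exp (2 * \<i> * (k\<^sup>2 + 1) * complex_of_real t) = ph t" "exp (- 2 * \<i> * (k\<^sup>2 + 1) * complex_of_real t) = cnj (ph t)"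
proof -
  show *: "exp (2 * \<i> * (k\<^sup>2 + 1) * complex_of_real t) = ph t" for t
    unfolding ph_def k2 cis_conv_exp by (auto simp: mult_ac)
  have "exp (- 2 * \<i> * (k\<^sup>2 + 1) * complex_of_real t) = ph (- t)" using *[of "- t"] by simp
  thus "exp (- 2 * \<i> * (k\<^sup>2 + 1) * complex_of_real t) = cnj (ph t)" by (simp add: ph_def cis_cnj)
qed
lemma ph_diff: "ph (x - y) = ph x * cnj (ph y)"
  unfolding ph_def cis_cnj cis_mult by (simp add: algebra_simps)

lemma N_measurable: "N i j \<in> borel_measurable borel"
  using um unfolding N_def[abs_def] by measurable

lemma kap_integrable: "integrable lborel kap"
proof -
  have [measurable]: "u \<in> borel_measurable borel" by (rule um)
  have "integrable lborel (\<lambda>y. cmod (N i j y))" for i j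
  proof (rule Bochner_Integration.integrable_bound[where f="\<lambda>y. (cmod (u y))\<^sup>2 + cmod k * cmod (u y)"])
    show "integrable lborel (\<lambda>y. (cmod (u y))\<^sup>2 + cmod k * cmod (u y))" using ui ui2 by simp
    show "(\<lambda>y. cmod (N i j y)) \<in> borel_measurable lborel" using N_measurable by measurable
    show "AE y in lborel. norm (cmod (N i j y)) \<le> norm ((cmod (u y))\<^sup>2 + cmod k * cmod (u y))"
    proof (rule AE_I2)
      fix y
      have n: "0 \<le> cmod k * cmod (u y)" "0 \<le> (cmod (u y))\<^sup>2" by auto
      have "cmod (N i j y) \<le> (cmod (u y))\<^sup>2 + cmod k * cmod (u y)"
        using n by (auto simp: N_def norm_mult norm_power ph_cnj)
      thus "norm (cmod (N i j y)) \<le> norm ((cmod (u y))\<^sup>2 + cmod k * cmod (u y))" using n by simp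
    qed
  qed
  thus ?thesis unfolding kap_def[abs_def] by simp
qed

definition nsol :: "ereal \<Rightarrow> (2 \<Rightarrow> complex) \<Rightarrow> (2 \<Rightarrow> real \<Rightarrow> complex) \<Rightarrow> bool" where
  "nsol s e g \<longleftrightarrow> (\<forall>i x. integrable lborel (\<lambda>y. if beyond s x y then \<Sum>j\<in>UNIV. N i j y * g j y else 0) \<and>
     g i x = e i + orient s * (LINT y|lborel. (if beyond s x y then \<Sum>j\<in>UNIV. N i j y * g j y else 0)))"

lemma nsol_diff:
  assumes g: "nsol s e g" and g': "nsol s e' g'"
  shows "nsol s (\<lambda>i. e i - e' i) (\<lambda>i x. g i x - g' i x)"
  unfolding nsol_def
proof (intro allI)
  fix i x
  let ?a = "\<lambda>y. if beyond s x y then \<Sum>j\<in>UNIV. N i j y * g j y else 0"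
  let ?b = "\<lambda>y. if beyond s x y then \<Sum>j\<in>UNIV. N i j y * g' j y else 0"
  have i: "integrable lborel ?a" "integrable lborel ?b" and e: "g i x = e i + orient s * (LINT y|lborel. ?a y)" "g' i x = e' i + orient s * (LINT y|lborel. ?b y)"
    using g g' unfolding nsol_def by blast+
  have ab: "(\<lambda>y. if beyond s x y then \<Sum>j\<in>UNIV. N i j y * (g j y - g' j y) else 0) = (\<lambda>y. ?a y - ?b y)"
    by (auto simp: fun_eq_iff right_diff_distrib sum_subtractf)
  have d: "(LINT y|lborel. ?a y - ?b y) = (LINT y|lborel. ?a y) - (LINT y|lborel. ?b y)" using i by simp
  thus "integrable lborel (\<lambda>y. if beyond s x y then \<Sum>j\<in>UNIV. N i j y * (g j y - g' j y) else 0) \<and>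
     g i x - g' i x = e i - e' i + orient s * (LINT y|lborel. (if beyond s x y then \<Sum>j\<in>UNIV. N i j y * (g j y - g' j y) else 0))"
    unfolding ab e d using Bochner_Integration.integrable_diff[OF i] by (simp only: right_diff_distrib) simp
qed

lemma nsol_scale:
  assumes g: "nsol s e g"
  shows "nsol s (\<lambda>i. t * e i) (\<lambda>i x. t * g i x)"
  unfolding nsol_def
proof (intro allI)
  fix i x
  let ?a = "\<lambda>y. if beyond s x y then \<Sum>j\<in>UNIV. N i j y * g j y else 0"
  have i: "integrable lborel ?a" and e: "g i x = e i + orient s * (LINT y|lborel. ?a y)"
    using g unfolding nsol_def by blast+
  have ab: "(\<lambda>y. if beyond s x y then \<Sum>j\<in>UNIV. N i j y * (t * g j y) else 0) = (\<lambda>y. t * ?a y)"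
    by (auto simp: fun_eq_iff sum_distrib_left mult_ac)
  show "integrable lborel (\<lambda>y. if beyond s x y then \<Sum>j\<in>UNIV. N i j y * (t * g j y) else 0) \<and>
     t * g i x = t * e i + orient s * (LINT y|lborel. (if beyond s x y then \<Sum>j\<in>UNIV. N i j y * (t * g j y) else 0))"
    unfolding ab e using integrable_mult_right[OF i, of t] by (simp add: algebra_simps)
qed

lemma LINT_reflect:
  fixes F :: "real \<Rightarrow> complex"
  shows "(LINT y|lborel. F (- y)) = (LINT y|lborel. F y)" "integrable lborel (\<lambda>y. F (- y)) \<longleftrightarrow> integrable lborel F"
proof -
  show "(LINT y|lborel. F (- y)) = (LINT y|lborel. F y)"
    using lborel_integral_real_affine[of "-1" F 0] by simp
  show "integrable lborel (\<lambda>y. F (- y)) \<longleftrightarrow> integrable lborel F"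
    using lborel_integrable_real_affine_iff[of "-1" F 0] by simp
qed

text \<open>The equation from minus infinity is the one of \<open>volterra_unique\<close>; the
  reflection y -> -y carries the equation from plus infinity into it.\<close>

lemma nsol_zero:
  assumes s: "s = \<infinity> \<or> s = -\<infinity>" and g: "nsol s (\<lambda>_. 0) g"
  shows "g i x = 0"
proof (cases "s = \<infinity>")
  case False
  show ?thesis
  proof (rule volterra_unique[where N=N and k=kap])
    show "integrable lborel (\<lambda>y. if y < x then \<Sum>j\<in>UNIV. N i j y * g j y else 0)" for i x
      using g False unfolding nsol_def beyond_def by auto
    have "g i x = 0 + orient s * (LINT y|lborel. (if beyond s x y then \<Sum>j\<in>UNIV. N i j y * g j y else 0))" for i x
      using g unfolding nsol_def by blast
    thus "g i x = cum (\<lambda>y. \<Sum>j\<in>UNIV. N i j y * g j y) x" for i x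
      unfolding cum_def using False by (simp add: beyond_def orient_def)
  qed (use N_measurable kap_integrable in \<open>auto simp: kap_def\<close>)
next
  case True
  define G where "G = (\<lambda>i x. g i (- x))"
  define N' where "N' = (\<lambda>i j y. - N i j (- y))"
  have "G i (- x) = 0"
  proof (rule volterra_unique[where N=N' and k="\<lambda>y. kap (- y)"])
    show "N' i j \<in> borel_measurable borel" for i j unfolding N'_def using N_measurable by measurable
    show "(\<Sum>i\<in>UNIV. \<Sum>j\<in>UNIV. cmod (N' i j y)) \<le> kap (- y)" for y by (simp add: N'_def kap_def)
    show "integrable lborel (\<lambda>y. kap (- y))" using lborel_integrable_real_affine[OF kap_integrable, of "-1" 0] by simp
    have e: "(\<lambda>y. if y < x then \<Sum>j\<in>UNIV. N' i j y * G j y else 0) = (\<lambda>y. - (\<lambda>y. if beyond s (- x) y then \<Sum>j\<in>UNIV. N i j y * g j y else 0) (- y))" for i x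
      using True by (auto simp: fun_eq_iff beyond_def N'_def G_def sum_negf)
    show "integrable lborel (\<lambda>y. if y < x then \<Sum>j\<in>UNIV. N' i j y * G j y else 0)" for i x
    proof -
      have "integrable lborel (\<lambda>y. if beyond s (- x) y then \<Sum>j\<in>UNIV. N i j y * g j y else 0)" using g unfolding nsol_def by blast
      thus ?thesis unfolding e using LINT_reflect(2)[of "\<lambda>y. if beyond s (- x) y then \<Sum>j\<in>UNIV. N i j y * g j y else 0"] by simp
    qed
    show "G i x = cum (\<lambda>y. \<Sum>j\<in>UNIV. N' i j y * G j y) x" for i x
    proof -
      have "g i (- x) = 0 + orient s * (LINT y|lborel. (if beyond s (- x) y then \<Sum>j\<in>UNIV. N i j y * g j y else 0))" using g unfolding nsol_def by blast
      thus ?thesis unfolding cum_def e using LINT_reflect(1)[of "\<lambda>y. if beyond s (- x) y then \<Sum>j\<in>UNIV. N i j y * g j y else 0"] True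
        by (simp add: G_def orient_def)
    qed
  qed
  thus ?thesis by (simp add: G_def)
qed

lemma nsol_unique: "s = \<infinity> \<or> s = -\<infinity> \<Longrightarrow> nsol s e g \<Longrightarrow> nsol s e g' \<Longrightarrow> g = g'"
proof (intro ext)
  fix i x assume a: "s = \<infinity> \<or> s = -\<infinity>" "nsol s e g" "nsol s e g'"
  have "nsol s (\<lambda>i. 0) (\<lambda>i x. g i x - g' i x)" using nsol_diff[OF a(2,3)] by simp
  from nsol_zero[OF a(1) this, of i x] show "g i x = g' i x" by simp
qed

lemma nsol_infinity_exists:
  obtains g where "nsol \<infinity> e g" "\<And>i. integrable lborel (\<lambda>y. \<Sum>j\<in>UNIV. N i j y * g j y)"
proof -
  define N' where "N' = (\<lambda>i j (x::real) y. - N i j (- y))"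
  interpret V: volterra N' "\<lambda>y. kap (- y)" e
  proof
    show "(\<lambda>p. N' i j (fst p) (snd p)) \<in> borel_measurable (borel \<Otimes>\<^sub>M borel)" for i j
      unfolding N'_def using N_measurable by measurable
    show "(\<Sum>i\<in>UNIV. \<Sum>j\<in>UNIV. cmod (N' i j x y)) \<le> kap (- y)" for x y by (simp add: N'_def kap_def)
    show "integrable lborel (\<lambda>y. kap (- y))" using lborel_integrable_real_affine[OF kap_integrable, of "-1" 0] by simp
  qed
  define g where "g = (\<lambda>i x. volsol N' e i (- x))"
  have e: "(\<lambda>y. \<Sum>j\<in>UNIV. N' i j x y * volsol N' e j y) = (\<lambda>y. - (\<lambda>y. \<Sum>j\<in>UNIV. N i j y * g j y) (- y))" for i x
    by (auto simp: fun_eq_iff N'_def g_def sum_negf)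
  have i: "integrable lborel (\<lambda>y. \<Sum>j\<in>UNIV. N i j y * g j y)" for i
    using V.volsol_integrable[of i 0] unfolding e using LINT_reflect(2)[of "\<lambda>y. \<Sum>j\<in>UNIV. N i j y * g j y"] by simp
  have "nsol \<infinity> e g"
    unfolding nsol_def
  proof (intro allI conjI)
    fix i x
    show "integrable lborel (\<lambda>y. if beyond \<infinity> x y then \<Sum>j\<in>UNIV. N i j y * g j y else 0)"
      by (rule integrable_if[OF i]) (simp add: beyond_def)
    have "g i x = e i + (LINT y|lborel. (if y < - x then - (\<lambda>y. \<Sum>j\<in>UNIV. N i j y * g j y) (- y) else 0))"
      unfolding g_def[of ] by (subst V.volsol_eq, unfold e cum_def g_def) (rule refl)
    also have "(\<lambda>y. if y < - x then - (\<lambda>y. \<Sum>j\<in>UNIV. N i j y * g j y) (- y) else 0) = (\<lambda>y. - (\<lambda>y. if beyond \<infinity> x y then \<Sum>j\<in>UNIV. N i j y * g j y else 0) (- y))"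
      by (auto simp: fun_eq_iff beyond_def)
    also have "(LINT y|lborel. - (\<lambda>y. if beyond \<infinity> x y then \<Sum>j\<in>UNIV. N i j y * g j y else 0) (- y)) = - (LINT y|lborel. (if beyond \<infinity> x y then \<Sum>j\<in>UNIV. N i j y * g j y else 0))"
      using LINT_reflect(1)[of "\<lambda>y. if beyond \<infinity> x y then \<Sum>j\<in>UNIV. N i j y * g j y else 0"] by simp
    finally show "g i x = e i + orient \<infinity> * (LINT y|lborel. (if beyond \<infinity> x y then \<Sum>j\<in>UNIV. N i j y * g j y else 0))"
      by (simp add: orient_def)
  qed
  thus thesis using i by (rule that)
qed

text \<open>Both Jost normalisations are diagonal conjugates of the same system: \<open>\<tau> = (1, ph)\<close> for
  \<open>jost1\<close> and \<open>\<tau> = (cnj ph, 1)\<close> for \<open>jost2\<close>.\<close>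

lemma solves_iff_nsol:
  fixes E :: "complex^2"
  assumes s: "s = \<infinity> \<or> s = -\<infinity>"
    and \<tau>: "\<And>x. cmod (\<tau> 1 x) = 1" "\<And>x. \<tau> 2 x = ph x * \<tau> 1 x"
    and D: "\<And>x y. D (x - y) = diag2 (\<tau> 1 x * cnj (\<tau> 1 y)) (\<tau> 2 x * cnj (\<tau> 2 y))"
    and e: "\<And>i x. \<tau> i x * e i = e i" and ev: "\<And>i. E $ i = e i"
  shows "solves_volterra s E D u k (\<lambda>x. \<chi> i. \<tau> i x * g i x) \<longleftrightarrow> nsol s e g"
proof -
  let ?\<phi> = "\<lambda>x. \<chi> i. \<tau> i x * g i x"
  let ?F = "\<lambda>x y. D (x - y) *v (Qmat u y k *v ?\<phi> y)"
  have t1: "cnj (\<tau> 1 y) * \<tau> 1 y = 1" for y by (subst mult.commute, subst complex_norm_square[symmetric]) (simp add: \<tau>(1))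
  have t2: "cnj (\<tau> 2 y) * \<tau> 2 y = 1" for y
  proof -
    have "cnj (\<tau> 2 y) * \<tau> 2 y = (cnj (ph y) * ph y) * (cnj (\<tau> 1 y) * \<tau> 1 y)" by (simp add: \<tau>(2))
    thus ?thesis by (simp add: t1 ph_cnj)
  qed
  \<comment> \<open>The off-diagonal entries see only the ratio of the two factors, which is
    \<open>ph\<close> by assumption. Hence both normalisations lead to the same
    \<open>N\<close>.\<close>
  have t12: "cnj (\<tau> 1 y) * \<tau> 2 y = ph y" "cnj (\<tau> 2 y) * \<tau> 1 y = cnj (ph y)" for y
  proof -
    have "cnj (\<tau> 1 y) * \<tau> 2 y = (cnj (\<tau> 1 y) * \<tau> 1 y) * ph y" by (simp add: \<tau>(2))
    thus "cnj (\<tau> 1 y) * \<tau> 2 y = ph y" by (simp add: t1)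
    have "cnj (\<tau> 2 y) * \<tau> 1 y = (cnj (\<tau> 1 y) * \<tau> 1 y) * cnj (ph y)" by (simp add: \<tau>(2))
    thus "cnj (\<tau> 2 y) * \<tau> 1 y = cnj (ph y)" by (simp add: t1)
  qed
  have tt: "cnj (\<tau> i y) * \<tau> i y = 1" for i y using exhaust_2[of i] by (elim disjE) (simp_all only: t1 t2)
  have Q: "(Qmat u y k *v w) $ 1 = \<i> / 2 * complex_of_real ((cmod (u y))\<^sup>2) * w $ 1 + k * u y * w $ 2"
    "(Qmat u y k *v w) $ 2 = - k * cnj (u y) * w $ 1 + - (\<i> / 2 * complex_of_real ((cmod (u y))\<^sup>2)) * w $ 2" for y w
    by (simp_all add: matrix_vector_mult_def Qmat_def sum_2)
  have F: "?F x y $ i = \<tau> i x * (\<Sum>j\<in>UNIV. N i j y * g j y)" for x y i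
  proof -
    have "?F x y $ 1 = \<tau> 1 x * (\<i> / 2 * complex_of_real ((cmod (u y))\<^sup>2) * (cnj (\<tau> 1 y) * \<tau> 1 y) * g 1 y + k * u y * (cnj (\<tau> 1 y) * \<tau> 2 y) * g 2 y)"
      unfolding D diag2_mult Q by (simp add: algebra_simps)
    hence 1: "?F x y $ 1 = \<tau> 1 x * (\<Sum>j\<in>UNIV. N 1 j y * g j y)" unfolding t1 t12 by (simp add: N_def sum_2)
    have "?F x y $ 2 = \<tau> 2 x * (- k * cnj (u y) * (cnj (\<tau> 2 y) * \<tau> 1 y) * g 1 y + - (\<i> / 2 * complex_of_real ((cmod (u y))\<^sup>2)) * (cnj (\<tau> 2 y) * \<tau> 2 y) * g 2 y)"
      unfolding D diag2_mult Q by (simp add: algebra_simps)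
    hence 2: "?F x y $ 2 = \<tau> 2 x * (\<Sum>j\<in>UNIV. N 2 j y * g j y)" unfolding t2 t12 by (simp add: N_def sum_2)
    show ?thesis using exhaust_2[of i] by (elim disjE) (simp_all only: 1 2)
  qed
  let ?I = "\<lambda>i x y. if beyond s x y then \<Sum>j\<in>UNIV. N i j y * g j y else 0"
  have FI: "(if beyond s x y then ?F x y else 0) $ i = \<tau> i x * ?I i x y" for x y i using F by simp
  have tn: "\<tau> i x \<noteq> 0" for i x using tt[of i x] by auto
  have int: "interval_lebesgue_integrable lborel s (ereal x) (?F x) \<longleftrightarrow> (\<forall>i. integrable lborel (?I i x))" for x
    unfolding beyond_einterval(1)[OF s] integrable_vec2_iff FI integrable_cmult_iff[OF tn] ..
  have eq: "?\<phi> x = E + (LBINT y=s..ereal x. ?F x y) \<longleftrightarrow> (\<forall>i. g i x = e i + orient s * (LINT y|lborel. ?I i x y))"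
    if i: "\<forall>i. integrable lborel (?I i x)" for x
  proof -
    have iF: "integrable lborel (\<lambda>y. if beyond s x y then ?F x y else 0)"
      unfolding integrable_vec2_iff FI using i by simp
    have L: "(LBINT y=s..ereal x. ?F x y) $ i = orient s * (\<tau> i x * (LINT y|lborel. ?I i x y))" for i
    proof -
      have "(LBINT y=s..ereal x. ?F x y) $ i = (if s = \<infinity> then -1 else 1 :: real) *\<^sub>R (LINT y|lborel. (if beyond s x y then ?F x y else 0) $ i)"
        unfolding beyond_einterval(2)[OF s] vector_scaleR_component integral_vec2_nth[OF iF] ..
      also have "(LINT y|lborel. (if beyond s x y then ?F x y else 0) $ i) = \<tau> i x * (LINT y|lborel. ?I i x y)"
        unfolding FI by (rule integral_mult_right_zero)
      finally show ?thesis by (simp add: orient_def)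
    qed
    have "\<tau> i x * g i x = e i + orient s * (\<tau> i x * (LINT y|lborel. ?I i x y)) \<longleftrightarrow> g i x = e i + orient s * (LINT y|lborel. ?I i x y)" for i
    proof -
      have "e i + orient s * (\<tau> i x * (LINT y|lborel. ?I i x y)) = \<tau> i x * (e i + orient s * (LINT y|lborel. ?I i x y))"
        unfolding distrib_left e by (simp only: mult.left_commute)
      thus ?thesis using tn[of i x] by (simp only: mult_cancel_left simp_thms)
    qed
    thus ?thesis unfolding vec_eq_iff by (simp only: vector_add_component L ev vec_lambda_beta)
  qed
  have "solves_volterra s E D u k ?\<phi> \<longleftrightarrow> (\<forall>x. (\<forall>i. integrable lborel (?I i x)) \<and> (\<forall>i. g i x = e i + orient s * (LINT y|lborel. ?I i x y)))"
    unfolding solves_volterra_def int by (intro iff_allI conj_cong refl) (rule eq)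
  thus ?thesis unfolding nsol_def by blast
qed

definition e1 :: "2 \<Rightarrow> complex" where "e1 i = (if i = 1 then 1 else 0)"
definition e2 :: "2 \<Rightarrow> complex" where "e2 i = (if i = 1 then 0 else 1)"
definition tau1 :: "2 \<Rightarrow> real \<Rightarrow> complex" where "tau1 i x = (if i = 1 then 1 else ph x)"
definition tau2 :: "2 \<Rightarrow> real \<Rightarrow> complex" where "tau2 i x = (if i = 1 then cnj (ph x) else 1)"

lemma solves1:
  assumes s: "s = \<infinity> \<or> s = -\<infinity>"
  shows "solves_volterra s (vector [1, 0]) (\<lambda>t. diag2 1 (exp (2 * \<i> * (k\<^sup>2 + 1) * complex_of_real t))) u k (\<lambda>x. \<chi> i. tau1 i x * g i x) \<longleftrightarrow> nsol s e1 g"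
proof (rule solves_iff_nsol[OF s])
  show "(vector [1, 0] :: complex^2) $ i = e1 i" for i using exhaust_2[of i] by (auto simp: e1_def)
  show "diag2 1 (exp (2 * \<i> * (k\<^sup>2 + 1) * complex_of_real (x - y))) = diag2 (tau1 1 x * cnj (tau1 1 y)) (tau1 2 x * cnj (tau1 2 y))" for x y
    unfolding ph_exp ph_diff by (simp add: tau1_def)
qed (auto simp: tau1_def e1_def)

lemma solves2:
  assumes s: "s = \<infinity> \<or> s = -\<infinity>"
  shows "solves_volterra s (vector [0, 1]) (\<lambda>t. diag2 (exp (- 2 * \<i> * (k\<^sup>2 + 1) * complex_of_real t)) 1) u k (\<lambda>x. \<chi> i. tau2 i x * g i x) \<longleftrightarrow> nsol s e2 g"
proof (rule solves_iff_nsol[OF s])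
  show "(vector [0, 1] :: complex^2) $ i = e2 i" for i using exhaust_2[of i] by (auto simp: e2_def)
  show "diag2 (exp (- 2 * \<i> * (k\<^sup>2 + 1) * complex_of_real (x - y))) 1 = diag2 (tau2 1 x * cnj (tau2 1 y)) (tau2 2 x * cnj (tau2 2 y))" for x y
    unfolding ph_exp ph_diff by (simp add: tau2_def)
qed (auto simp: tau2_def e2_def ph_cnj)

lemma tau_cancel: "tau1 i x * (cnj (tau1 i x) * w) = w" "tau2 i x * (cnj (tau2 i x) * w) = w"
  using ph_cnj(1,2)[of x] by (auto simp: tau1_def tau2_def mult.assoc[symmetric])

lemma jost1_eq:
  assumes s: "s = \<infinity> \<or> s = -\<infinity>" and g: "nsol s e1 g"
  shows "jost1 s u k = (\<lambda>x. \<chi> i. tau1 i x * g i x)"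
  unfolding jost1_def
proof (rule the_equality)
  show "solves_volterra s (vector [1, 0]) (\<lambda>t. diag2 1 (exp (2 * \<i> * (k\<^sup>2 + 1) * complex_of_real t))) u k (\<lambda>x. \<chi> i. tau1 i x * g i x)"
    using solves1[OF s] g by blast
  fix \<phi> assume a: "solves_volterra s (vector [1, 0]) (\<lambda>t. diag2 1 (exp (2 * \<i> * (k\<^sup>2 + 1) * complex_of_real t))) u k \<phi>"
  define g' where "g' = (\<lambda>i x. cnj (tau1 i x) * \<phi> x $ i)"
  have \<phi>: "\<phi> = (\<lambda>x. \<chi> i. tau1 i x * g' i x)" by (auto simp: fun_eq_iff vec_eq_iff g'_def tau_cancel)
  have "nsol s e1 g'" using a solves1[OF s] unfolding \<phi> by blast
  hence "g' = g" using nsol_unique[OF s _ g] by blast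
  thus "\<phi> = (\<lambda>x. \<chi> i. tau1 i x * g i x)" using \<phi> by simp
qed

lemma jost2_eq:
  assumes s: "s = \<infinity> \<or> s = -\<infinity>" and g: "nsol s e2 g"
  shows "jost2 s u k = (\<lambda>x. \<chi> i. tau2 i x * g i x)"
  unfolding jost2_def
proof (rule the_equality)
  show "solves_volterra s (vector [0, 1]) (\<lambda>t. diag2 (exp (- 2 * \<i> * (k\<^sup>2 + 1) * complex_of_real t)) 1) u k (\<lambda>x. \<chi> i. tau2 i x * g i x)"
    using solves2[OF s] g by blast
  fix \<phi> assume a: "solves_volterra s (vector [0, 1]) (\<lambda>t. diag2 (exp (- 2 * \<i> * (k\<^sup>2 + 1) * complex_of_real t)) 1) u k \<phi>"
  define g' where "g' = (\<lambda>i x. cnj (tau2 i x) * \<phi> x $ i)"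
  have \<phi>: "\<phi> = (\<lambda>x. \<chi> i. tau2 i x * g' i x)" by (auto simp: fun_eq_iff vec_eq_iff g'_def tau_cancel)
  have "nsol s e2 g'" using a solves2[OF s] unfolding \<phi> by blast
  hence "g' = g" using nsol_unique[OF s _ g] by blast
  thus "\<phi> = (\<lambda>x. \<chi> i. tau2 i x * g i x)" using \<phi> by simp
qed

lemma nsol_minus_infinity:
  assumes i: "\<And>i. integrable lborel (\<lambda>y. \<Sum>j\<in>UNIV. N i j y * g j y)" and eq: "\<And>i x. g i x = e i + cum (\<lambda>y. \<Sum>j\<in>UNIV. N i j y * g j y) x"
  shows "nsol (-\<infinity>) e g"
  unfolding nsol_def
proof (intro allI conjI)
  fix j x
  show "integrable lborel (\<lambda>y. if beyond (-\<infinity>) x y then \<Sum>i\<in>UNIV. N j i y * g i y else 0)"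
    by (rule integrable_if[OF i]) (simp add: beyond_def)
  show "g j x = e j + orient (-\<infinity>) * (LINT y|lborel. (if beyond (-\<infinity>) x y then \<Sum>i\<in>UNIV. N j i y * g i y else 0))"
    using eq[of j x] unfolding cum_def by (simp add: orient_def beyond_def)
qed

text \<open>The integral up to x is the total integral minus the integral beyond x, so a solution
  issued from minus infinity is also the solution from plus infinity with its own limit as end
  value.\<close>

lemma nsol_infinity_of_minus:
  assumes i: "\<And>i. integrable lborel (\<lambda>y. \<Sum>j\<in>UNIV. N i j y * g j y)" and eq: "\<And>i x. g i x = e i + cum (\<lambda>y. \<Sum>j\<in>UNIV. N i j y * g j y) x"
  shows "nsol \<infinity> (\<lambda>i. e i + (LINT y|lborel. (\<Sum>j\<in>UNIV. N i j y * g j y))) g"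
  unfolding nsol_def
proof (intro allI conjI)
  fix j x
  show "integrable lborel (\<lambda>y. if beyond \<infinity> x y then \<Sum>i\<in>UNIV. N j i y * g i y else 0)"
    by (rule integrable_if[OF i]) (simp add: beyond_def)
  show "g j x = e j + (LINT y|lborel. (\<Sum>i\<in>UNIV. N j i y * g i y)) + orient \<infinity> * (LINT y|lborel. (if beyond \<infinity> x y then \<Sum>i\<in>UNIV. N j i y * g i y else 0))"
    using eq[of j x] int_gt_eq[OF i[of j], of x] by (simp add: orient_def beyond_def)
qed

lemma nsol_infinity_limit:
  assumes g: "nsol \<infinity> e g" and i: "\<And>i. integrable lborel (\<lambda>y. \<Sum>j\<in>UNIV. N i j y * g j y)"
  shows "(\<lambda>n. g i (real n)) \<longlonglongrightarrow> e i"
proof -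
  have "g i x = e i + - ((LINT y|lborel. (\<Sum>j\<in>UNIV. N i j y * g j y)) - cum (\<lambda>y. \<Sum>j\<in>UNIV. N i j y * g j y) x)" for x
    using g int_gt_eq[OF i[of i], of x] unfolding nsol_def by (simp add: orient_def beyond_def)
  hence "g i = (\<lambda>x. e i + - ((LINT y|lborel. (\<Sum>j\<in>UNIV. N i j y * g j y)) - cum (\<lambda>y. \<Sum>j\<in>UNIV. N i j y * g j y) x))" by (rule ext)
  moreover have "(\<lambda>n. e i + - ((LINT y|lborel. (\<Sum>j\<in>UNIV. N i j y * g j y)) - cum (\<lambda>y. \<Sum>j\<in>UNIV. N i j y * g j y) (real n))) \<longlonglongrightarrow> e i + - ((LINT y|lborel. (\<Sum>j\<in>UNIV. N i j y * g j y)) - (LINT y|lborel. (\<Sum>j\<in>UNIV. N i j y * g j y)))"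
    by (intro tendsto_intros cum_at_top[OF i] filterlim_real_sequentially)
  ultimately show ?thesis by simp
qed

text \<open>Both sides of the defining relation solve the system from plus infinity. Their end
  values agree when (a, b) is the limit of g, so uniqueness gives the relation; conversely the
  limits at infinity, where g1 and g2 tend to the unit vectors, determine a and b.\<close>

lemma scattering_eq:
  assumes i: "\<And>i. integrable lborel (\<lambda>y. \<Sum>j\<in>UNIV. N i j y * g j y)" and eq: "\<And>i x. g i x = e1 i + cum (\<lambda>y. \<Sum>j\<in>UNIV. N i j y * g j y) x"
    and la: "(\<lambda>n. g 1 (real n)) \<longlonglongrightarrow> a" and lb: "(\<lambda>n. g 2 (real n)) \<longlonglongrightarrow> b"
  shows "scattering u k = (a, b)"
proof -
  obtain g1 where g1: "nsol \<infinity> e1 g1" "\<And>i. integrable lborel (\<lambda>y. \<Sum>j\<in>UNIV. N i j y * g1 j y)" by (rule nsol_infinity_exists) blast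
  obtain g2 where g2: "nsol \<infinity> e2 g2" "\<And>i. integrable lborel (\<lambda>y. \<Sum>j\<in>UNIV. N i j y * g2 j y)" by (rule nsol_infinity_exists) blast
  have J: "jost1 (-\<infinity>) u k = (\<lambda>x. \<chi> i. tau1 i x * g i x)" by (rule jost1_eq) (auto intro: nsol_minus_infinity i eq)
  have J1: "jost1 \<infinity> u k = (\<lambda>x. \<chi> i. tau1 i x * g1 i x)" by (rule jost1_eq) (auto intro: g1)
  have J2: "jost2 \<infinity> u k = (\<lambda>x. \<chi> i. tau2 i x * g2 i x)" by (rule jost2_eq) (auto intro: g2)
  have iff: "(\<forall>x. jost1 (-\<infinity>) u k x = a' *s jost1 \<infinity> u k x + (b' * exp (2 * \<i> * (k\<^sup>2 + 1) * complex_of_real x)) *s jost2 \<infinity> u k x)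
     \<longleftrightarrow> (\<forall>x i. g i x = a' * g1 i x + b' * g2 i x)" for a' b'
  proof -
    have "tau1 i x * g i x = a' * (tau1 i x * g1 i x) + b' * ph x * (tau2 i x * g2 i x) \<longleftrightarrow> g i x = a' * g1 i x + b' * g2 i x" for i x
    proof -
      \<comment> \<open>The exponential next to b in the definition of the coefficients is exactly
        what converts the normalisation of \<open>jost2\<close> into that of
        \<open>jost1\<close>.\<close>
      have "ph x * tau2 i x = tau1 i x" by (simp add: tau1_def tau2_def ph_cnj)
      moreover have "b' * ph x * (tau2 i x * g2 i x) = b' * (ph x * tau2 i x) * g2 i x" by simp
      ultimately have "a' * (tau1 i x * g1 i x) + b' * ph x * (tau2 i x * g2 i x) = tau1 i x * (a' * g1 i x + b' * g2 i x)"
        by (simp add: distrib_left mult_ac)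
      moreover have "tau1 i x \<noteq> 0" using ph_cnj(3)[of x] by (auto simp: tau1_def)
      ultimately show ?thesis by simp
    qed
    thus ?thesis unfolding J J1 J2 ph_exp vec_eq_iff by simp
  qed
  have l1: "(\<lambda>n. g1 i (real n)) \<longlonglongrightarrow> e1 i" for i by (rule nsol_infinity_limit[OF g1])
  have l2: "(\<lambda>n. g2 i (real n)) \<longlonglongrightarrow> e2 i" for i by (rule nsol_infinity_limit[OF g2])
  let ?L = "\<lambda>i. e1 i + (LINT y|lborel. (\<Sum>j\<in>UNIV. N i j y * g j y))"
  have lg: "(\<lambda>n. g i (real n)) \<longlonglongrightarrow> ?L i" for i
    by (subst eq) (intro tendsto_intros cum_at_top[OF i] filterlim_real_sequentially)
  have L: "?L 1 = a" "?L 2 = b" using LIMSEQ_unique[OF lg la] LIMSEQ_unique[OF lg lb] by auto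
  have Lf: "?L = (\<lambda>i. a * e1 i + b * e2 i)"
  proof
    fix i :: 2 show "?L i = a * e1 i + b * e2 i" using L exhaust_2[of i] by (auto simp: e1_def e2_def)
  qed
  have sol: "g i x = a * g1 i x + b * g2 i x" for i x
  proof -
    have "nsol \<infinity> (\<lambda>i. (?L i - a * e1 i) - b * e2 i) (\<lambda>i x. (g i x - a * g1 i x) - b * g2 i x)"
      by (intro nsol_diff nsol_infinity_of_minus[OF i eq] nsol_scale g1 g2)
    moreover have "(\<lambda>i. (?L i - a * e1 i) - b * e2 i) = (\<lambda>_. 0)" using fun_cong[OF Lf] by (auto simp: fun_eq_iff)
    ultimately have "nsol \<infinity> (\<lambda>_. 0) (\<lambda>i x. (g i x - a * g1 i x) - b * g2 i x)" by simp
    from nsol_zero[OF _ this, of i x] show ?thesis by (simp add: algebra_simps)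
  qed
  show ?thesis unfolding scattering_def iff
  proof (rule the_equality)
    show "case (a, b) of (a', b') \<Rightarrow> \<forall>x i. g i x = a' * g1 i x + b' * g2 i x" using sol by simp
    fix ab assume "case ab of (a', b') \<Rightarrow> \<forall>x i. g i x = a' * g1 i x + b' * g2 i x"
    then obtain a' b' where ab: "ab = (a', b')" "\<And>x i. g i x = a' * g1 i x + b' * g2 i x" by (cases ab) auto
    have lim: "(\<lambda>n. g i (real n)) \<longlonglongrightarrow> a' * e1 i + b' * e2 i" for i
      unfolding ab(2) by (intro tendsto_intros l1 l2)
    have "a' = a" using LIMSEQ_unique[OF lim la] by (simp add: e1_def e2_def)
    moreover have "b' = b" using LIMSEQ_unique[OF lim lb] by (simp add: e1_def e2_def)
    ultimately show "ab = (a, b)" using ab by simp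
  qed
qed

end

text \<open>Components 1, 2, 3 are \<open>p\<close>, \<open>w\<close>, \<open>q\<close>. In \<open>coef\<close> the factor \<open>cis\<close> absorbs the shift from \<open>z\<close> to \<open>z + 1\<close>.\<close>

definition sg :: "3 \<Rightarrow> real" where "sg i = (if i = 1 then 0 else 1)"
definition cc :: "3 \<Rightarrow> 3 \<Rightarrow> real" where "cc i j = sg j - sg i"
definition ev :: "3 \<Rightarrow> complex" where "ev i = (if i = 1 then 1 else 0)"

interpretation P3: phased cc ev sg
  by unfold_locales (auto simp: cc_def sg_def ev_def)

text \<open>Coefficient of p in w', apart from the phase: the conjugate of u' comes from
  differentiating conj u, and the cubic term from replacing 2 i (z + 1) q in the |u|^2 term by conj
  u p - w.\<close>

definition mm :: "(real \<Rightarrow> complex) \<Rightarrow> (real \<Rightarrow> complex) \<Rightarrow> real \<Rightarrow> complex" where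
  "mm v d y = cnj (d y) + \<i> / 2 * (v y * cnj (v y) * cnj (v y))"

text \<open>The system for (p, w, q) after 2 i (z + 1) q has been replaced by conj u p - w. In p'
  the two |u|^2 p terms cancel, in w' the two |u|^2 w terms; the linear terms 2 i (z + 1) w and 2 i
  (z + 1) q have gone into the phases.\<close>

definition ent :: "(real \<Rightarrow> complex) \<Rightarrow> (real \<Rightarrow> complex) \<Rightarrow> 3 \<Rightarrow> 3 \<Rightarrow> real \<Rightarrow> complex" where
  "ent v d i j y = (if i = 1 then if j = 1 then 0 else if j = 2 then \<i> / 2 * v y else - v y
    else if i = 2 then if j = 1 then mm v d y else if j = 2 then 0 else - (v y * cnj (v y))
    else if j = 1 then - cnj (v y) else if j = 2 then 0 else - (\<i> / 2 * (v y * cnj (v y))))"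

definition coef :: "(real \<Rightarrow> complex) \<Rightarrow> (real \<Rightarrow> complex) \<Rightarrow> 3 \<Rightarrow> 3 \<Rightarrow> real \<Rightarrow> complex" where
  "coef v d i j y = cis (2 * cc i j * y) * ent v d i j y"

definition pot :: "(real \<Rightarrow> complex) \<Rightarrow> (real \<Rightarrow> complex) \<Rightarrow> real \<Rightarrow> bool" where
  "pot v d B \<longleftrightarrow> ac v d \<and> L21b v B \<and> L21b d B"

lemma potD:
  assumes "pot v d B"
  shows "ac v d" "L21b v B" "L21b d B" "0 \<le> B" "cmod (v x) \<le> 2 * B" "(v \<longlongrightarrow> 0) at_top" "(v \<longlongrightarrow> 0) at_bot"
    "v \<in> borel_measurable borel" "d \<in> borel_measurable borel"
proof -
  show a: "ac v d" and v: "L21b v B" and d: "L21b d B" using assms unfolding pot_def by auto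
  note V = ac_vanish[OF a L21b_integrable(1)[OF v] L21b_integrable(1)[OF d]]
  show "0 \<le> B" by (rule L21b_nonneg[OF v])
  show "cmod (v x) \<le> 2 * B"
    unfolding V(1)[of x] by (rule order_trans[OF norm_cum_le[OF L21b_integrable(1)[OF d]] L21b_integrable(2)[OF d]])
  show "(v \<longlongrightarrow> 0) at_top" "(v \<longlongrightarrow> 0) at_bot" by (rule V)+
  show "v \<in> borel_measurable borel" "d \<in> borel_measurable borel" by (rule L21b_measurable[OF v], rule L21b_measurable[OF d])
qed

lemma pot_diff:
  assumes "pot v d B" "pot v' d' B" "L21b (\<lambda>x. v x - v' x) \<delta>" "L21b (\<lambda>x. d x - d' x) \<delta>"
  shows "pot (\<lambda>x. v x - v' x) (\<lambda>x. d x - d' x) \<delta>"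
  using assms ac_diff unfolding pot_def by auto

lemma L21b_cnj: "L21b f B \<Longrightarrow> L21b (\<lambda>x. cnj (f x)) B"
  by (rule L21b_mono) (auto intro: cnj_measurable L21b_measurable)

lemma L21b_uminus: "L21b f B \<Longrightarrow> L21b (\<lambda>x. - f x) B"
  by (rule L21b_mono) (auto intro: L21b_measurable borel_measurable_uminus)

lemma L21b_cmult: "L21b f B \<Longrightarrow> L21b (\<lambda>x. c * f x) (cmod c * B)"
  by (rule L21b_mult) auto

text \<open>Sums of the bounds for the individual entries: B, 2 B^2 and B + 2 B^3 for the
  coefficients, and 1, 4 B and 1 + 6 B^2 for their Lipschitz factors. A quadratic or cubic term
  keeps the weight on one factor and estimates the others by the sup bound 2 B.\<close>

definition "BM B = B + 2 * B\<^sup>2 + 2 * B ^ 3 "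
definition "DM B = 1 + 4 * B + 6 * B\<^sup>2 "

lemma cubic_L21b:
  assumes "pot v d B"
  shows "L21b (\<lambda>y. v y * cnj (v y)) (2 * B\<^sup>2)" "L21b (\<lambda>y. v y * cnj (v y) * cnj (v y)) (4 * B ^ 3)"
proof -
  note D = potD[OF assms]
  show *: "L21b (\<lambda>y. v y * cnj (v y)) (2 * B\<^sup>2)"
    using L21b_mult[OF L21b_cnj[OF D(2)] D(8,5)] by (simp add: power2_eq_square mult.assoc)
  have "L21b (\<lambda>y. cnj (v y) * (v y * cnj (v y))) (2 * B * (2 * B\<^sup>2))"
    by (rule L21b_mult[OF *]) (use D(5) cnj_measurable[OF D(8)] in auto)
  thus "L21b (\<lambda>y. v y * cnj (v y) * cnj (v y)) (4 * B ^ 3)" by (simp add: mult_ac power2_eq_square power3_eq_cube)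
qed

lemma quad_diff_L21b:
  assumes p: "pot v d B" and p': "pot v' d' B" and \<delta>: "L21b (\<lambda>x. v x - v' x) \<delta>"
  shows "L21b (\<lambda>y. v y * cnj (v y) - v' y * cnj (v' y)) (4 * B * \<delta>)"
    "L21b (\<lambda>y. v y * cnj (v y) * cnj (v y) - v' y * cnj (v' y) * cnj (v' y)) (12 * B\<^sup>2 * \<delta>)"
proof -
  note D = potD[OF p] and D' = potD[OF p']
  have "L21b (\<lambda>y. v y * cnj (v y - v' y) + cnj (v' y) * (v y - v' y)) (2 * B * \<delta> + 2 * B * \<delta>)"
    by (intro L21b_add L21b_mult[OF L21b_cnj[OF \<delta>] D(8,5)] L21b_mult[OF \<delta> cnj_measurable[OF D'(8)]]) (use D'(5) in simp)
  thus *: "L21b (\<lambda>y. v y * cnj (v y) - v' y * cnj (v' y)) (4 * B * \<delta>)" by (simp add: algebra_simps)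
  have "L21b (\<lambda>y. (v y * cnj (v y)) * cnj (v y - v' y) + cnj (v' y) * (v y * cnj (v y) - v' y * cnj (v' y))) ((2 * B) * (2 * B) * \<delta> + 2 * B * (4 * B * \<delta>))"
  proof (intro L21b_add L21b_mult[OF L21b_cnj[OF \<delta>]] L21b_mult[OF * cnj_measurable[OF D'(8)]])
    show "(\<lambda>y. v y * cnj (v y)) \<in> borel_measurable borel" using D(8) by measurable
    show "cmod (v y * cnj (v y)) \<le> (2 * B) * (2 * B)" for y
      unfolding norm_mult complex_mod_cnj by (intro mult_mono D(5)) (use D(4) in auto)
  qed (use D'(5) in simp)
  thus "L21b (\<lambda>y. v y * cnj (v y) * cnj (v y) - v' y * cnj (v' y) * cnj (v' y)) (12 * B\<^sup>2 * \<delta>)"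
    by (simp add: algebra_simps power2_eq_square)
qed

lemma mm_L21b: assumes "pot v d B" shows "L21b (mm v d) (B + 2 * B ^ 3)"
proof -
  have "L21b (\<lambda>y. cnj (d y) + \<i> / 2 * (v y * cnj (v y) * cnj (v y))) (B + cmod (\<i> / 2) * (4 * B ^ 3))"
    by (intro L21b_add L21b_cmult L21b_cnj potD(3)[OF assms] cubic_L21b(2)[OF assms])
  thus ?thesis unfolding mm_def[abs_def] by (simp add: norm_divide)
qed

lemma mm_diff_L21b:
  assumes p: "pot v d B" and p': "pot v' d' B" and \<delta>: "L21b (\<lambda>x. v x - v' x) \<delta>" "L21b (\<lambda>x. d x - d' x) \<delta>"
  shows "L21b (\<lambda>y. mm v d y - mm v' d' y) (\<delta> + 6 * B\<^sup>2 * \<delta>)"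
proof -
  have "L21b (\<lambda>y. cnj (d y - d' y) + \<i> / 2 * (v y * cnj (v y) * cnj (v y) - v' y * cnj (v' y) * cnj (v' y))) (\<delta> + cmod (\<i> / 2) * (12 * B\<^sup>2 * \<delta>))"
    by (intro L21b_add L21b_cmult L21b_cnj quad_diff_L21b(2)[OF p p'] \<delta>)
  thus ?thesis unfolding mm_def[abs_def] by (simp add: norm_divide algebra_simps)
qed

lemma coef_L21b: assumes p: "pot v d B" shows "L21b (coef v d i j) (BM B)"
proof -
  note D = potD[OF p]
  have h: "L21b (\<lambda>y. \<i> / 2 * v y) B" "L21b (\<lambda>y. \<i> / 2 * (v y * cnj (v y))) (2 * B\<^sup>2)"
    by (rule L21b_mono[OF D(2)]; use D(8) in \<open>auto simp: norm_mult norm_divide\<close>)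
      (rule L21b_mono[OF cubic_L21b(1)[OF p]]; use D(8) in \<open>auto simp: norm_mult norm_divide intro!: cnj_measurable borel_measurable_times\<close>)
  have "B \<le> BM B" "2 * B\<^sup>2 \<le> BM B" "B + 2 * B ^ 3 \<le> BM B" "0 \<le> BM B" unfolding BM_def using D(4) by auto
  hence "L21b (ent v d i j) (BM B)"
    using exhaust_3[of i] exhaust_3[of j] D(2) h mm_L21b[OF p] cubic_L21b(1)[OF p]
    by (elim disjE) (auto simp: ent_def[abs_def] intro!: L21b_uminus L21b_cnj elim: L21b_bound_mono)
  from L21b_mult[OF this, of "\<lambda>y. cis (2 * cc i j * y)" 1] show ?thesis unfolding coef_def[abs_def] by simp
qed

lemma coef_diff_L21b:
  assumes p: "pot v d B" and p': "pot v' d' B" and \<delta>: "L21b (\<lambda>x. v x - v' x) \<delta>" "L21b (\<lambda>x. d x - d' x) \<delta>"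
  shows "L21b (\<lambda>y. coef v d i j y - coef v' d' i j y) (DM B * \<delta>)"
proof -
  note D = potD[OF p] and D' = potD[OF p']
  have d0: "0 \<le> \<delta>" by (rule L21b_nonneg[OF \<delta>(1)])
  have [measurable]: "v \<in> borel_measurable borel" "v' \<in> borel_measurable borel" by (rule D, rule D')
  have h: "L21b (\<lambda>y. \<i> / 2 * v y - \<i> / 2 * v' y) \<delta>"
    using L21b_bound_mono[OF L21b_cmult[OF \<delta>(1), of "\<i> / 2"], of \<delta>] d0 by (simp add: right_diff_distrib norm_divide)
  have h3: "L21b (\<lambda>y. v' y * cnj (v' y) - v y * cnj (v y)) (4 * B * \<delta>)"
    by (rule L21b_mono[OF quad_diff_L21b(1)[OF p p' \<delta>(1)]]) (auto simp: norm_minus_commute)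
  have h2: "L21b (\<lambda>y. \<i> / 2 * (v' y * cnj (v' y)) - \<i> / 2 * (v y * cnj (v y))) (4 * B * \<delta>)"
    using L21b_bound_mono[OF L21b_cmult[OF h3, of "\<i> / 2"], of "4 * B * \<delta>"] d0 D(4) by (simp add: right_diff_distrib norm_divide)
  have h4: "L21b (\<lambda>y. v' y - v y) \<delta>" by (rule L21b_mono[OF \<delta>(1)]) (auto simp: norm_minus_commute)
  have h5: "L21b (\<lambda>y. cnj (v' y) - cnj (v y)) \<delta>" using L21b_cnj[OF h4] by simp
  have "\<delta> \<le> DM B * \<delta>" "4 * B * \<delta> \<le> DM B * \<delta>" "\<delta> + 6 * B\<^sup>2 * \<delta> \<le> DM B * \<delta>" "0 \<le> DM B * \<delta>"
    unfolding DM_def using d0 D(4) by (auto simp: algebra_simps)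
  hence "L21b (\<lambda>y. ent v d i j y - ent v' d' i j y) (DM B * \<delta>)"
    using exhaust_3[of i] exhaust_3[of j] h h2 h3 h4 h5 mm_diff_L21b[OF p p' \<delta>]
    by (elim disjE) (auto simp: ent_def elim: L21b_bound_mono)
  from L21b_mult[OF this, of "\<lambda>y. cis (2 * cc i j * y)" 1] show ?thesis unfolding coef_def[abs_def] by (simp add: right_diff_distrib)
qed

text \<open>Only the first initial value is nonzero, and the only phase-free entry acting on it is
  (1,1), whose coefficient the choice of w has cancelled.\<close>

lemma adm_coef: "pot v d B \<Longrightarrow> P3.adm (coef v d) (BM B)"
  unfolding P3.adm_def
proof (intro conjI allI impI coef_L21b)
  fix i j :: 3 assume "cc i j = 0" "ev j \<noteq> 0"
  hence "j = 1" "i = 1" by (auto simp: ev_def cc_def sg_def split: if_splits)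
  thus "coef v d i j = (\<lambda>_. 0)" by (simp add: coef_def ent_def fun_eq_iff)
qed

definition osc_sol :: "(real \<Rightarrow> complex) \<Rightarrow> (real \<Rightarrow> complex) \<Rightarrow> real \<Rightarrow> 3 \<Rightarrow> real \<Rightarrow> complex" where
  "osc_sol v d z = volsol (\<lambda>i j x y. iker cc (coef v d) z i j y) ev"

lemma osc_sol: "pot v d B \<Longrightarrow> isol cc (coef v d) ev (osc_sol v d)"
  unfolding osc_sol_def[abs_def] by (rule P3.isol_exists) (rule coef_L21b)

lemma iker_coef: "iker cc (coef v d) z i j y = cis (2 * (z + 1) * cc i j * y) * ent v d i j y"
proof -
  have "cis (2 * z * cc i j * y) * cis (2 * cc i j * y) = cis (2 * (z + 1) * cc i j * y)"
    unfolding cis_mult by (simp add: algebra_simps)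
  thus ?thesis unfolding iker_def coef_def by (simp add: mult.assoc[symmetric])
qed

lemma rhs:
  defines "E \<equiv> \<lambda>z y. cis (2 * (z + 1) * y)"
  shows "(\<Sum>j\<in>UNIV. iker cc (coef v d) z 1 j y * g j) = E z y * (\<i> / 2 * v y * g 2 - v y * g 3)"
    "(\<Sum>j\<in>UNIV. iker cc (coef v d) z 2 j y * g j) = cnj (E z y) * mm v d y * g 1 - v y * cnj (v y) * g 3"
    "(\<Sum>j\<in>UNIV. iker cc (coef v d) z 3 j y * g j) = - (cnj (E z y) * cnj (v y) * g 1) - \<i> / 2 * (v y * cnj (v y)) * g 3"
  unfolding E_def by (simp_all add: sum_3 iker_coef ent_def cc_def sg_def cis_cnj algebra_simps)

lemma cum_cong_AE:
  fixes f g :: "real \<Rightarrow> complex"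
  assumes "AE y in lborel. f y = g y" "f \<in> borel_measurable borel" "g \<in> borel_measurable borel"
  shows "cum f x = cum g x"
  unfolding cum_def using assms by (intro integral_cong_AE) (auto elim: eventually_mono)

lemma cum_of_limit:
  assumes f: "ac f g" and gi: "integrable lborel g" and l: "(f \<longlongrightarrow> 0) at_bot"
  shows "f x = cum g x"
proof -
  define k where "k = f 0 - cum g 0"
  have e: "f x = k + cum g x" for x
  proof (cases "0 \<le> x")
    case True
    show ?thesis using acD(2)[OF f True] acD(2)[OF ac_cum[OF gi] True] by (simp add: k_def)
  next
    case False
    hence "x \<le> 0" by simp
    show ?thesis using acD(2)[OF f \<open>x \<le> 0\<close>] acD(2)[OF ac_cum[OF gi] \<open>x \<le> 0\<close>] by (simp add: k_def)
  qed
  have X: "filterlim (\<lambda>n. - real n) at_bot sequentially" by (simp add: filterlim_uminus_at_bot filterlim_real_sequentially)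
  have "(\<lambda>n. f (- real n)) \<longlonglongrightarrow> k + 0"
    unfolding e by (intro tendsto_intros cum_at_bot[OF gi X])
  moreover have "(\<lambda>n. f (- real n)) \<longlonglongrightarrow> 0" by (rule filterlim_compose[OF l X])
  ultimately have "k + 0 = 0" by (rule LIMSEQ_unique)
  thus ?thesis using e by simp
qed

section \<open>Constraint and scattering coefficients\<close>

context
  fixes v d :: "real \<Rightarrow> complex" and B z :: real
  assumes p: "pot v d B"
begin

abbreviation "sol \<equiv> osc_sol v d z"
abbreviation (input) "E \<equiv> \<lambda>y. cis (2 * (z + 1) * y)"

lemma sol_facts:
  shows "sol i \<in> borel_measurable borel" "cmod (sol i x) \<le> P3.EB (BM B)"
    "integrable lborel (\<lambda>y. \<Sum>j\<in>UNIV. iker cc (coef v d) z i j y * sol j y)"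
    "sol i x = ev i + cum (\<lambda>y. \<Sum>j\<in>UNIV. iker cc (coef v d) z i j y * sol j y) x"
    "(\<lambda>n. sol i (real n)) \<longlonglongrightarrow> P3.amp (coef v d) (osc_sol v d) z i"
  by (rule P3.isolD[OF adm_coef[OF p] osc_sol[OF p]] P3.amp_tendsto[OF adm_coef[OF p] osc_sol[OF p]])+

lemma sol_ac: "ac (sol i) (\<lambda>y. \<Sum>j\<in>UNIV. iker cc (coef v d) z i j y * sol j y)"
proof -
  have "ac (\<lambda>x. ev i + cum (\<lambda>y. \<Sum>j\<in>UNIV. iker cc (coef v d) z i j y * sol j y) x) (\<lambda>y. 0 + (\<Sum>j\<in>UNIV. iker cc (coef v d) z i j y * sol j y))"
    by (intro ac_add ac_const ac_cum sol_facts(3))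
  thus ?thesis using sol_facts(4)[of i] by (metis (no_types, lifting) add_0 ext)
qed

lemma ac_phase: "ac (\<lambda>y. cnj (E y)) (\<lambda>y. - (2 * \<i> * complex_of_real (z + 1)) * cnj (E y))"
proof (rule ac_C1)
  fix x
  have "((\<lambda>t. exp ((- (2 * \<i> * complex_of_real (z + 1))) * t)) has_field_derivative (- (2 * \<i> * complex_of_real (z + 1))) * exp ((- (2 * \<i> * complex_of_real (z + 1))) * complex_of_real x)) (at (complex_of_real x))"
    by (auto intro!: derivative_eq_intros)
  from has_vector_derivative_real_field[OF this]
  have "((\<lambda>t. exp ((- (2 * \<i> * complex_of_real (z + 1))) * complex_of_real t)) has_vector_derivative (- (2 * \<i> * complex_of_real (z + 1))) * exp ((- (2 * \<i> * complex_of_real (z + 1))) * complex_of_real x)) (at x)" .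
  moreover have "exp ((- (2 * \<i> * complex_of_real (z + 1))) * complex_of_real t) = cnj (E t)" for t
    unfolding cis_cnj unfolding cis_conv_exp by (simp add: algebra_simps)
  ultimately show "((\<lambda>y. cnj (E y)) has_vector_derivative - (2 * \<i> * complex_of_real (z + 1)) * cnj (E x)) (at x)" by simp
qed (auto simp: cis_conv_exp intro!: continuous_intros)

text \<open>The relation that defined w, with the phases taken off. Its defect \<open>C\<close>
  satisfies C' = -(i/2) |v|^2 C and tends to 0 at minus infinity, since the initial values of w and
  q are 0 and v vanishes there; hence it is zero by uniqueness.\<close>

lemma constraint: "sol 2 x - cnj (E x) * cnj (v x) * sol 1 x + 2 * \<i> * complex_of_real (z + 1) * sol 3 x = 0"
proof -
  note D = potD[OF p]
  note [measurable] = D(8) sol_facts(1)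
  let ?z = "complex_of_real (z + 1)"
  define C where "C = (\<lambda>x. sol 2 x - cnj (E x) * cnj (v x) * sol 1 x + 2 * \<i> * ?z * sol 3 x)"
  define C' where "C' = (\<lambda>x. - (\<i> / 2 * (v x * cnj (v x))) * C x)"
  have EE: "cnj (E x) * E x = 1" for x by (simp add: cis_cnj cis_mult)
  have "ac C (\<lambda>x. (\<Sum>j\<in>UNIV. iker cc (coef v d) z 2 j x * sol j x) - (((- (2 * \<i> * ?z) * cnj (E x)) * cnj (v x) + cnj (E x) * cnj (d x)) * sol 1 x
      + cnj (E x) * cnj (v x) * (\<Sum>j\<in>UNIV. iker cc (coef v d) z 1 j x * sol j x)) + 2 * \<i> * ?z * (\<Sum>j\<in>UNIV. iker cc (coef v d) z 3 j x * sol j x))"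
    unfolding C_def by (intro ac_add ac_diff ac_mult ac_cmult sol_ac ac_phase ac_cnj D(1))
  also have "(\<lambda>x. (\<Sum>j\<in>UNIV. iker cc (coef v d) z 2 j x * sol j x) - (((- (2 * \<i> * ?z) * cnj (E x)) * cnj (v x) + cnj (E x) * cnj (d x)) * sol 1 x
      + cnj (E x) * cnj (v x) * (\<Sum>j\<in>UNIV. iker cc (coef v d) z 1 j x * sol j x)) + 2 * \<i> * ?z * (\<Sum>j\<in>UNIV. iker cc (coef v d) z 3 j x * sol j x)) = C'"
  proof
    fix x
    define e where "e = cnj (E x)"
    define V where "V = v x" define cV where "cV = cnj (v x)"
    define P where "P = sol 1 x" define W where "W = sol 2 x" define Q where "Q = sol 3 x"
    define D where "D = cnj (d x)"
    have "cnj (E x) * cnj (v x) * (E x * (\<i> / 2 * v x * W - v x * Q)) = (cnj (E x) * E x) * cV * (\<i> / 2 * V * W - V * Q)"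
      by (simp add: V_def cV_def)
    hence 1: "cnj (E x) * cnj (v x) * (E x * (\<i> / 2 * v x * W - v x * Q)) = cV * (\<i> / 2 * V * W - V * Q)" by (simp only: EE mult_1_left)
    have "(e * (D + \<i> / 2 * (V * cV * cV)) * P - V * cV * Q) - (((- (2 * \<i> * ?z) * e) * cV + e * D) * P
      + cV * (\<i> / 2 * V * W - V * Q)) + 2 * \<i> * ?z * (- (e * cV * P) - \<i> / 2 * (V * cV) * Q) = - (\<i> / 2 * (V * cV)) * (W - e * cV * P + 2 * \<i> * ?z * Q)"
      by (simp add: algebra_simps)
    thus "(\<Sum>j\<in>UNIV. iker cc (coef v d) z 2 j x * sol j x) - (((- (2 * \<i> * ?z) * cnj (E x)) * cnj (v x) + cnj (E x) * cnj (d x)) * sol 1 x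
      + cnj (E x) * cnj (v x) * (\<Sum>j\<in>UNIV. iker cc (coef v d) z 1 j x * sol j x)) + 2 * \<i> * ?z * (\<Sum>j\<in>UNIV. iker cc (coef v d) z 3 j x * sol j x) = C' x"
      unfolding rhs C'_def C_def P_def[symmetric] W_def[symmetric] Q_def[symmetric] 1 mm_def
      unfolding e_def[symmetric] cV_def[symmetric] D_def[symmetric] unfolding V_def[symmetric] .
  qed
  finally have ac: "ac C C'" .
  define K where "K = P3.EB (BM B) + 2 * B * P3.EB (BM B) + cmod (2 * \<i> * ?z) * P3.EB (BM B)"
  have EB0: "0 \<le> P3.EB (BM B)" by (rule order_trans[OF norm_ge_zero sol_facts(2)])
  have Cm: "C \<in> borel_measurable borel" by (rule ac_measurable[OF ac])
  have Cb: "cmod (C x) \<le> K" for x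
  proof -
    have "cmod (C x) \<le> cmod (sol 2 x) + cmod (cnj (E x) * cnj (v x) * sol 1 x) + cmod (2 * \<i> * ?z * sol 3 x)"
      unfolding C_def by (rule order_trans[OF norm_triangle_ineq add_right_mono[OF norm_triangle_ineq4]])
    also have "cmod (cnj (E x) * cnj (v x) * sol 1 x) \<le> 2 * B * P3.EB (BM B)"
      unfolding norm_mult complex_mod_cnj norm_cis mult_1_left using D(4) by (intro mult_mono D(5) sol_facts(2)) auto
    also have "cmod (2 * \<i> * ?z * sol 3 x) \<le> cmod (2 * \<i> * ?z) * P3.EB (BM B)"
      unfolding norm_mult[of _ "sol 3 x"] by (intro mult_left_mono sol_facts(2)) auto
    finally show ?thesis using sol_facts(2)[of 2 x] unfolding K_def by linarith
  qed
  have vi: "integrable lborel (\<lambda>y. - (\<i> / 2 * (v y * cnj (v y))))"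
    using L21b_integrable(1)[OF cubic_L21b(1)[OF p]] by (intro Bochner_Integration.integrable_minus integrable_mult_right)
  have C'i: "integrable lborel C'" unfolding C'_def by (rule integrable_bounded_mult[OF vi Cm Cb])
  have lim: "(C \<longlongrightarrow> 0) at_bot"
  proof -
    have s: "(sol i \<longlongrightarrow> ev i + 0) at_bot" for i
    proof -
      have "((\<lambda>x. cum (\<lambda>y. \<Sum>j\<in>UNIV. iker cc (coef v d) z i j y * sol j y) (- x)) \<longlongrightarrow> 0) at_top"
        by (intro tendsto_at_topI_sequentially cum_at_bot[OF sol_facts(3)]) (simp add: filterlim_uminus_at_bot)
      hence "((\<lambda>x. cum (\<lambda>y. \<Sum>j\<in>UNIV. iker cc (coef v d) z i j y * sol j y) x) \<longlongrightarrow> 0) at_bot" by (simp add: filterlim_at_bot_mirror)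
      hence "((\<lambda>x. ev i + cum (\<lambda>y. \<Sum>j\<in>UNIV. iker cc (coef v d) z i j y * sol j y) x) \<longlongrightarrow> ev i + 0) at_bot" by (intro tendsto_intros)
      thus ?thesis using sol_facts(4)[of i] by (metis (no_types, lifting) ext)
    qed
    have "((\<lambda>x. cnj (E x) * cnj (v x)) \<longlongrightarrow> 0) at_bot"
    proof (rule tendsto_norm_zero_cancel)
      show "((\<lambda>x. norm (cnj (E x) * cnj (v x))) \<longlongrightarrow> 0) at_bot"
        using tendsto_norm[OF D(7)] by (simp add: norm_mult)
    qed
    hence "((\<lambda>x. sol 2 x - (cnj (E x) * cnj (v x)) * sol 1 x + 2 * \<i> * ?z * sol 3 x) \<longlongrightarrow> (ev 2 + 0) - 0 * (ev 1 + 0) + 2 * \<i> * ?z * (ev 3 + 0)) at_bot"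
      by (intro tendsto_intros s)
    thus ?thesis unfolding C_def by (simp add: ev_def)
  qed
  have Ceq: "C x = cum C' x" for x by (rule cum_of_limit[OF ac C'i lim])
  have s1: "(\<Sum>j\<in>(UNIV::unit set). t) = t" for t :: complex by (simp add: UNIV_unit)
  \<comment> \<open>The scalar equation is read as a system with the one-element index type.\<close>
  have "C x = 0"
  proof (rule volterra_unique[where N="\<lambda>_ _ y. - (\<i> / 2 * (v y * cnj (v y)))" and d="\<lambda>_::unit. C" and k="\<lambda>y. cmod (- (\<i> / 2 * (v y * cnj (v y))))"])
    show "C x = cum (\<lambda>y. \<Sum>j\<in>(UNIV::unit set). - (\<i> / 2 * (v y * cnj (v y))) * C y) x" for x
      using Ceq[of x] unfolding C'_def s1 .
    show "integrable lborel (\<lambda>y. if y < x then \<Sum>j\<in>(UNIV::unit set). - (\<i> / 2 * (v y * cnj (v y))) * C y else 0)" for x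
      using integrable_below[OF C'i, of x] unfolding C'_def s1 .
    show "integrable lborel (\<lambda>y. cmod (- (\<i> / 2 * (v y * cnj (v y)))))" using vi by (rule integrable_norm)
    show "(\<lambda>y. - (\<i> / 2 * (v y * cnj (v y)))) \<in> borel_measurable borel" by measurable
  qed simp
  thus ?thesis unfolding C_def .
qed

text \<open>The limit of \<open>constraint\<close> at plus infinity, where the term with v
  disappears.\<close>

lemma constraint_amp:
  "\<i> / 2 * P3.amp (coef v d) (osc_sol v d) z 2 = complex_of_real (z + 1) * P3.amp (coef v d) (osc_sol v d) z 3"
proof -
  let ?z = "complex_of_real (z + 1)"
  let ?a = "P3.amp (coef v d) (osc_sol v d) z"
  have "(\<lambda>n. cnj (E (real n)) * cnj (v (real n))) \<longlonglongrightarrow> 0"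
  proof (rule tendsto_norm_zero_cancel)
    have "(\<lambda>n. v (real n)) \<longlonglongrightarrow> 0" by (rule filterlim_compose[OF potD(6)[OF p] filterlim_real_sequentially])
    thus "(\<lambda>n. norm (cnj (E (real n)) * cnj (v (real n)))) \<longlonglongrightarrow> 0"
      using tendsto_norm by (fastforce simp: norm_mult)
  qed
  hence "(\<lambda>n. sol 2 (real n) - cnj (E (real n)) * cnj (v (real n)) * sol 1 (real n) + 2 * \<i> * ?z * sol 3 (real n)) \<longlonglongrightarrow> ?a 2 - 0 * ?a 1 + 2 * \<i> * ?z * ?a 3"
    by (intro tendsto_intros sol_facts(5))
  hence "?a 2 - 0 * ?a 1 + 2 * \<i> * ?z * ?a 3 = 0"
    unfolding constraint by (simp add: LIMSEQ_const_iff)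
  hence "?a 2 = - (2 * \<i> * ?z * ?a 3)" by (simp add: eq_neg_iff_add_eq_0)
  thus ?thesis by simp
qed

text \<open>With \<open>constraint\<close> the component w can be eliminated again:
  \<open>(sol 1, k * sol 3)\<close> solves the original two-component system, so its limits are the
  scattering data. Since u and v agree only almost everywhere, the integrands do so as well, which
  \<open>cum\<close> does not see.\<close>

lemma scattering_coef:
  assumes um: "u \<in> borel_measurable borel" and uv: "AE x in lborel. u x = v x" and k: "k\<^sup>2 = complex_of_real z"
  shows "scattering u k = (P3.amp (coef v d) (osc_sol v d) z 1, k * P3.amp (coef v d) (osc_sol v d) z 3)"
proof -
  note D = potD[OF p]
  note [measurable] = um D(8) sol_facts(1)
  have vi: "integrable lborel v" by (rule L21b_integrable(1)[OF D(2)])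
  have vi2: "integrable lborel (\<lambda>y. (cmod (v y))\<^sup>2)"
    using integrable_norm[OF L21b_integrable(1)[OF cubic_L21b(1)[OF p]]] by (simp add: norm_mult power2_eq_square)
  interpret J: jost_data u k z
  proof
    show "integrable lborel u" using integrable_cong_AE[of u lborel v] uv vi by simp
    have "AE y in lborel. (cmod (u y))\<^sup>2 = (cmod (v y))\<^sup>2" using uv by eventually_elim simp
    thus "integrable lborel (\<lambda>y. (cmod (u y))\<^sup>2)" using integrable_cong_AE[of "\<lambda>y. (cmod (u y))\<^sup>2" lborel "\<lambda>y. (cmod (v y))\<^sup>2"] vi2 by simp
  qed (use k um in auto)
  let ?r = "\<lambda>i y. \<Sum>j\<in>UNIV. iker cc (coef v d) z i j y * sol j y"
  define g where "g = (\<lambda>(i::2) x. if i = 1 then sol 1 x else k * sol 3 x)"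
  define R where "R = (\<lambda>(i::2) y. if i = 1 then ?r 1 y else k * ?r 3 y)"
  have Ri: "integrable lborel (R i)" for i using sol_facts(3)[of 1] sol_facts(3)[of 3] unfolding R_def by (cases "i = 1") simp_all
  have gm: "g i \<in> borel_measurable borel" for i unfolding g_def by measurable
  have Nm: "(\<lambda>y. \<Sum>j\<in>UNIV. J.N i j y * g j y) \<in> borel_measurable borel" for i using J.N_measurable gm by measurable
  have NR: "AE y in lborel. (\<Sum>j\<in>UNIV. J.N i j y * g j y) = R i y" for i
    using uv
  proof eventually_elim
    fix y assume uv: "u y = v y"
    have c: "sol 2 y = cnj (E y) * cnj (v y) * sol 1 y - 2 * \<i> * complex_of_real (z + 1) * sol 3 y"
      using constraint[of y] by (simp add: algebra_simps)
    have EE: "E y * cnj (E y) = 1" by (simp add: cis_cnj cis_mult)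
    have n: "complex_of_real ((cmod (v y))\<^sup>2) = v y * cnj (v y)" by (rule complex_norm_square)
    have n': "(complex_of_real (cmod (v y)))\<^sup>2 = v y * cnj (v y)" using n by simp
    define e where "e = cnj (E y)"
    have "?r 1 y = \<i> / 2 * v y * (E y * cnj (E y)) * cnj (v y) * sol 1 y + E y * (- (\<i> / 2 * 2 * \<i> * complex_of_real (z + 1)) - 1) * v y * sol 3 y"
      unfolding rhs c by (simp add: algebra_simps)
    \<comment> \<open>The first product is -(z + 1), so the coefficient is (z + 1) - 1 = z = k^2:
      the factor removed by introducing w reappears.\<close>
    also have "- (\<i> / 2 * 2 * \<i> * complex_of_real (z + 1)) - 1 = k * k" using k by (simp add: power2_eq_square)
    finally have 1: "?r 1 y = (\<Sum>j\<in>UNIV. J.N 1 j y * g j y)"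
      unfolding EE by (simp add: sum_2 J.N_def g_def uv n' J.ph_def mult_ac)
    have 2: "k * ?r 3 y = (\<Sum>j\<in>UNIV. J.N 2 j y * g j y)"
      unfolding rhs by (simp add: sum_2 J.N_def g_def uv n' J.ph_def algebra_simps)
    show "(\<Sum>j\<in>UNIV. J.N i j y * g j y) = R i y"
      using exhaust_2[of i] 1 2 by (auto simp: R_def)
  qed
  have Ni: "integrable lborel (\<lambda>y. \<Sum>j\<in>UNIV. J.N i j y * g j y)" for i
    using integrable_cong_AE[of "\<lambda>y. \<Sum>j\<in>UNIV. J.N i j y * g j y" lborel "R i"] Nm borel_measurable_integrable[OF Ri] NR Ri by simp
  have geq: "g i x = J.e1 i + cum (\<lambda>y. \<Sum>j\<in>UNIV. J.N i j y * g j y) x" for i x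
  proof -
    have c: "cum (\<lambda>y. \<Sum>j\<in>UNIV. J.N i j y * g j y) x = cum (R i) x"
      using borel_measurable_integrable[OF Ri[of i]] by (intro cum_cong_AE NR Nm) simp
    have "g i x = J.e1 i + cum (R i) x"
    proof (cases "i = 1")
      case True
      have "sol 1 x = ev 1 + cum (?r 1) x" by (rule sol_facts(4))
      thus ?thesis using True by (simp add: g_def R_def J.e1_def ev_def)
    next
      case False
      have "sol 3 x = ev 3 + cum (?r 3) x" by (rule sol_facts(4))
      hence "k * sol 3 x = k * cum (?r 3) x" by (simp add: ev_def)
      also have "\<dots> = cum (\<lambda>y. k * ?r 3 y) x" by (rule cum_mult[symmetric])
      finally show ?thesis using False by (simp add: g_def R_def J.e1_def)
    qed
    thus ?thesis unfolding c .
  qed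
  show ?thesis
  proof (rule J.scattering_eq[OF Ni geq])
    show "(\<lambda>n. g 1 (real n)) \<longlonglongrightarrow> P3.amp (coef v d) (osc_sol v d) z 1" using sol_facts(5)[of 1] by (simp add: g_def)
    show "(\<lambda>n. g 2 (real n)) \<longlonglongrightarrow> k * P3.amp (coef v d) (osc_sol v d) z 3" using tendsto_mult_left[OF sol_facts(5)[of 3], of k] by (simp add: g_def)
  qed
qed

end

section \<open>Decay for twice differentiable potentials\<close>

text \<open>\<open>mmp\<close> is the derivative of \<open>mm\<close>. The coefficients \<open>bb\<close> are what remains of \<open>2 \<i> (z + 1) w'\<close> after the
  oscillating term is integrated by parts; \<open>bw\<close> truncates them because \<open>mmp\<close> need not be integrable.\<close>

definition mmp :: "(real \<Rightarrow> complex) \<Rightarrow> (real \<Rightarrow> complex) \<Rightarrow> (real \<Rightarrow> complex) \<Rightarrow> real \<Rightarrow> complex" where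
  "mmp v d d2 y = cnj (d2 y) + \<i> / 2 * (d y * cnj (v y) * cnj (v y) + cnj (d y) * v y * cnj (v y) + cnj (d y) * v y * cnj (v y))"

definition bb :: "(real \<Rightarrow> complex) \<Rightarrow> (real \<Rightarrow> complex) \<Rightarrow> (real \<Rightarrow> complex) \<Rightarrow> 3 \<Rightarrow> real \<Rightarrow> complex" where
  "bb v d d2 j y = (if j = 1 then mmp v d d2 y - v y * cnj (v y) * cnj (v y)
     else if j = 2 then \<i> / 2 * (v y * mm v d y) + v y * cnj (v y) else - (v y * mm v d y))"

definition bw :: "nat \<Rightarrow> (real \<Rightarrow> complex) \<Rightarrow> (real \<Rightarrow> complex) \<Rightarrow> (real \<Rightarrow> complex) \<Rightarrow> 3 \<Rightarrow> 3 \<Rightarrow> real \<Rightarrow> complex" where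
  "bw n v d d2 i j y = (if i = 2 then cis (2 * cc i j * y) * seg (bb v d d2 j) (- real n) (real n) y else 0)"

definition pot2 :: "(real \<Rightarrow> complex) \<Rightarrow> (real \<Rightarrow> complex) \<Rightarrow> (real \<Rightarrow> complex) \<Rightarrow> real \<Rightarrow> bool" where
  "pot2 v d d2 B \<longleftrightarrow> pot v d B \<and> ac d d2 \<and> L2b d2 B"

definition "KB B = B + 4 * B\<^sup>2 + 10 * B ^ 3 + 4 * B ^ 4"
definition "KD B = 1 + 10 * B + 30 * B\<^sup>2 + 16 * B ^ 3"

lemma L2b_cnj: "L2b f B \<Longrightarrow> L2b (\<lambda>x. cnj (f x)) B"
  by (rule L2b_mono) (auto intro: cnj_measurable L2bD)

lemma L2b_triple:
  assumes x: "L2b x B" and m: "a \<in> borel_measurable borel" "b \<in> borel_measurable borel"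
    and s: "\<And>y. cmod (a y) \<le> 2 * B" "\<And>y. cmod (b y) \<le> 2 * B"
  shows "L2b (\<lambda>y. x y * a y * b y) (4 * B ^ 3)"
proof -
  have B: "0 \<le> B" by (rule L2bD(2)[OF x])
  have "L2b (\<lambda>y. (a y * b y) * x y) ((2 * B) * (2 * B) * B)"
    proof (rule L2b_mult[OF x])
    show "(\<lambda>y. a y * b y) \<in> borel_measurable borel" using m by measurable
    show "cmod (a y * b y) \<le> 2 * B * (2 * B)" for y unfolding norm_mult by (intro mult_mono s) (use B in auto)
  qed
  thus ?thesis by (simp add: mult_ac power3_eq_cube)
qed

lemma L2b_triple_diff:
  assumes x: "L2b x' B" "L2b (\<lambda>y. x y - x' y) \<delta>"
    and m: "a \<in> borel_measurable borel" "b \<in> borel_measurable borel" "a' \<in> borel_measurable borel" "b' \<in> borel_measurable borel"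
    and s: "\<And>y. cmod (a y) \<le> 2 * B" "\<And>y. cmod (b y) \<le> 2 * B" "\<And>y. cmod (a' y) \<le> 2 * B"
    and d: "\<And>y. cmod (a y - a' y) \<le> 2 * \<delta>" "\<And>y. cmod (b y - b' y) \<le> 2 * \<delta>"
  shows "L2b (\<lambda>y. x y * a y * b y - x' y * a' y * b' y) (12 * B\<^sup>2 * \<delta>)"
proof -
  have B: "0 \<le> B" "0 \<le> \<delta>" by (rule L2bD(2)[OF x(1)], rule L2bD(2)[OF x(2)])
  have "L2b (\<lambda>y. (a y * b y) * (x y - x' y) + (a y - a' y) * b y * x' y + a' y * (b y - b' y) * x' y)
    ((2 * B) * (2 * B) * \<delta> + (2 * \<delta>) * (2 * B) * B + (2 * B) * (2 * \<delta>) * B)"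
  proof (intro L2b_add L2b_mult x)
    note [measurable] = m
    show "(\<lambda>y. a y * b y) \<in> borel_measurable borel" "(\<lambda>y. (a y - a' y) * b y) \<in> borel_measurable borel"
      "(\<lambda>y. a' y * (b y - b' y)) \<in> borel_measurable borel" by measurable
    show "cmod (a y * b y) \<le> 2 * B * (2 * B)" "cmod ((a y - a' y) * b y) \<le> 2 * \<delta> * (2 * B)"
      "cmod (a' y * (b y - b' y)) \<le> 2 * B * (2 * \<delta>)" for y
      unfolding norm_mult using B by (intro mult_mono s d; simp)+
  qed
  thus ?thesis by (simp add: algebra_simps power2_eq_square)
qed

lemma pot2D:
  assumes "pot2 v d d2 B"
  shows "pot v d B" "ac d d2" "L2b d2 B"
  using assms unfolding pot2_def by auto

text \<open>The coefficient of p contains the second derivative and is only L^2, which suffices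
  because the entry (2,1) oscillates. The entries (2,2) and (2,3) are phase-free and must be
  integrable, hence the weighted bounds for the other two coefficients.\<close>

lemma bb_bounds:
  assumes p: "pot2 v d d2 B"
  shows "L2b (mmp v d d2) (KB B)" "L2b (bb v d d2 1) (KB B)" "j \<noteq> 1 \<Longrightarrow> L21b (bb v d d2 j) (KB B)"
proof -
  note P = pot2D[OF p] note D = potD[OF P(1)]
  note [measurable] = D(8)
  have d: "L2b d B" "L2b (\<lambda>y. cnj (d y)) B" "L2b v B" using L21b_L2b(1)[OF D(3)] L21b_L2b(1)[OF D(2)] L2b_cnj by auto
  have 1: "L2b (mmp v d d2) (B + cmod (\<i> / 2) * (4 * B ^ 3 + 4 * B ^ 3 + 4 * B ^ 3))"
    unfolding mmp_def[abs_def] by (intro L2b_add L2b_cmult L2b_cnj[OF P(3)] L2b_triple d) (use D(5) in auto)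
  show "L2b (mmp v d d2) (KB B)"
    by (rule L2b_bound_mono[OF 1]) (use D(4) in \<open>simp add: KB_def norm_divide\<close>)
  have 2: "L2b (\<lambda>y. mmp v d d2 y - v y * cnj (v y) * cnj (v y)) (B + cmod (\<i> / 2) * (4 * B ^ 3 + 4 * B ^ 3 + 4 * B ^ 3) + 4 * B ^ 3)"
    by (intro L2b_diff 1 L2b_triple d) (use D(5) in auto)
  have "L2b (\<lambda>y. mmp v d d2 y - v y * cnj (v y) * cnj (v y)) (KB B)"
    by (rule L2b_bound_mono[OF 2]) (use D(4) in \<open>simp add: KB_def norm_divide\<close>)
  thus "L2b (bb v d d2 1) (KB B)" unfolding bb_def[abs_def] by simp
  have 3: "L21b (\<lambda>y. v y * mm v d y) (2 * B * (B + 2 * B ^ 3))" by (rule L21b_mult[OF mm_L21b[OF P(1)] D(8,5)])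
  have 4: "L21b (\<lambda>y. - (v y * mm v d y)) (KB B)"
    by (rule L21b_bound_mono[OF L21b_uminus[OF 3]]) (use D(4) in \<open>simp add: KB_def algebra_simps power2_eq_square power3_eq_cube power4_eq_xxxx\<close>)
  have 5: "L21b (\<lambda>y. \<i> / 2 * (v y * mm v d y) + v y * cnj (v y)) (cmod (\<i> / 2) * (2 * B * (B + 2 * B ^ 3)) + 2 * B\<^sup>2)"
    by (intro L21b_add L21b_cmult 3 cubic_L21b(1)[OF P(1)])
  have 6: "L21b (\<lambda>y. \<i> / 2 * (v y * mm v d y) + v y * cnj (v y)) (KB B)"
    by (rule L21b_bound_mono[OF 5]) (use D(4) in \<open>simp add: KB_def norm_divide algebra_simps power2_eq_square power3_eq_cube power4_eq_xxxx\<close>)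
  show "L21b (bb v d d2 j) (KB B)" if "j \<noteq> 1" using 4 6 that unfolding bb_def[abs_def] by (cases "j = 2") simp_all
qed

lemma bb_diff_bounds:
  assumes p: "pot2 v d d2 B" and p': "pot2 v' d' d2' B"
    and \<delta>: "L21b (\<lambda>x. v x - v' x) \<delta>" "L21b (\<lambda>x. d x - d' x) \<delta>" "L2b (\<lambda>x. d2 x - d2' x) \<delta>"
  shows "L2b (\<lambda>y. bb v d d2 1 y - bb v' d' d2' 1 y) (KD B * \<delta>)" "j \<noteq> 1 \<Longrightarrow> L21b (\<lambda>y. bb v d d2 j y - bb v' d' d2' j y) (KD B * \<delta>)"
proof -
  note P = pot2D[OF p] and P' = pot2D[OF p'] note D = potD[OF P(1)] and D' = potD[OF P'(1)]
  note [measurable] = D(8) D'(8)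
  have dd: "cmod (v x - v' x) \<le> 2 * \<delta>" for x by (rule potD(5)[OF pot_diff[OF P(1) P'(1) \<delta>(1,2)]])
  have dc: "cmod (cnj (v x) - cnj (v' x)) \<le> 2 * \<delta>" for x
    unfolding complex_cnj_diff[symmetric] complex_mod_cnj by (rule dd)
  have d0: "0 \<le> \<delta>" by (rule L21b_nonneg[OF \<delta>(1)])
  have L: "L2b d' B" "L2b (\<lambda>x. cnj (d' x)) B" "L2b (\<lambda>x. d x - d' x) \<delta>" "L2b (\<lambda>x. cnj (d x) - cnj (d' x)) \<delta>"
     "L2b v' B" "L2b (\<lambda>x. v x - v' x) \<delta>"
    using L21b_L2b(1)[OF D'(3)] L21b_L2b(1)[OF D'(2)] L2b_cnj L21b_L2b(1)[OF \<delta>(2)] L21b_L2b(1)[OF \<delta>(1)] L2b_cnj[OF L21b_L2b(1)[OF \<delta>(2)]] by auto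
  define t1 where "t1 = (\<lambda>y. d y * cnj (v y) * cnj (v y) - d' y * cnj (v' y) * cnj (v' y))"
  define t2 where "t2 = (\<lambda>y. cnj (d y) * v y * cnj (v y) - cnj (d' y) * v' y * cnj (v' y))"
  define t3 where "t3 = (\<lambda>y. v y * cnj (v y) * cnj (v y) - v' y * cnj (v' y) * cnj (v' y))"
  have t: "L2b t1 (12 * B\<^sup>2 * \<delta>)" "L2b t2 (12 * B\<^sup>2 * \<delta>)" "L2b t3 (12 * B\<^sup>2 * \<delta>)"
    unfolding t1_def t2_def t3_def by (rule L2b_triple_diff; use L D(5) D'(5) dd dc in simp)+
  have 1: "L2b (\<lambda>y. cnj (d2 y - d2' y) + \<i> / 2 * (t1 y + t2 y + t2 y) - t3 y) (\<delta> + cmod (\<i> / 2) * (12 * B\<^sup>2 * \<delta> + 12 * B\<^sup>2 * \<delta> + 12 * B\<^sup>2 * \<delta>) + 12 * B\<^sup>2 * \<delta>)"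
    by (intro L2b_add L2b_diff L2b_cmult L2b_cnj[OF \<delta>(3)] t)
  have e: "(\<lambda>y. cnj (d2 y - d2' y) + \<i> / 2 * (t1 y + t2 y + t2 y) - t3 y) = (\<lambda>y. bb v d d2 1 y - bb v' d' d2' 1 y)"
    unfolding bb_def mmp_def t1_def t2_def t3_def by (simp add: fun_eq_iff algebra_simps)
  have Bd: "0 \<le> B * \<delta>" "0 \<le> B\<^sup>2 * \<delta>" "0 \<le> B ^ 3 * \<delta>" using D(4) d0 by auto
  show "L2b (\<lambda>y. bb v d d2 1 y - bb v' d' d2' 1 y) (KD B * \<delta>)"
    unfolding e[symmetric] by (rule L2b_bound_mono[OF 1]) (use Bd in \<open>simp add: KD_def norm_divide algebra_simps\<close>)
  have "L21b (\<lambda>y. v y * (mm v d y - mm v' d' y) + (v y - v' y) * mm v' d' y) (2 * B * (\<delta> + 6 * B\<^sup>2 * \<delta>) + 2 * \<delta> * (B + 2 * B ^ 3))"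
    by (intro L21b_add L21b_mult[OF mm_diff_L21b[OF P(1) P'(1) \<delta>(1,2)] D(8,5)] L21b_mult[OF mm_L21b[OF P'(1)] _ dd]) measurable
  hence 3: "L21b (\<lambda>y. v y * mm v d y - v' y * mm v' d' y) ((4 * B + 16 * B ^ 3) * \<delta>)"
    by (simp add: algebra_simps power2_eq_square power3_eq_cube)
  have 4: "L21b (\<lambda>y. - (v y * mm v d y - v' y * mm v' d' y)) (KD B * \<delta>)"
    by (rule L21b_bound_mono[OF L21b_uminus[OF 3]]) (use Bd d0 in \<open>simp add: KD_def algebra_simps\<close>)
  have 5: "L21b (\<lambda>y. \<i> / 2 * (v y * mm v d y - v' y * mm v' d' y) + (v y * cnj (v y) - v' y * cnj (v' y))) (cmod (\<i> / 2) * ((4 * B + 16 * B ^ 3) * \<delta>) + 4 * B * \<delta>)"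
    by (intro L21b_add L21b_cmult 3 quad_diff_L21b(1)[OF P(1) P'(1) \<delta>(1)])
  have 6: "L21b (\<lambda>y. \<i> / 2 * (v y * mm v d y - v' y * mm v' d' y) + (v y * cnj (v y) - v' y * cnj (v' y))) (KD B * \<delta>)"
    by (rule L21b_bound_mono[OF 5]) (use Bd d0 in \<open>simp add: KD_def norm_divide algebra_simps\<close>)
  show "L21b (\<lambda>y. bb v d d2 j y - bb v' d' d2' j y) (KD B * \<delta>)" if "j \<noteq> 1"
    using 4 6 that unfolding bb_def by (cases "j = 2") (simp_all add: algebra_simps)
qed

text \<open>Truncation makes the entries integrable and leaves their bounds independent of n. The
  coefficients b are arbitrary so that \<open>bb\<close> and differences of \<open>bb\<close> are
  both covered; only row 2 is populated.\<close>

lemma bw_bounds: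
  fixes n :: nat
  assumes b: "L2b (b 1) \<beta>" "\<And>j. j \<noteq> 1 \<Longrightarrow> L21b (b j) \<beta>"
  defines "A \<equiv> \<lambda>(i::3) (j::3) y. if i = 2 then cis (2 * cc i j * y) * seg (b j) (- real n) (real n) y else 0"
  shows "integrable lborel (A i j)" "L2b (A i j) (2 * \<beta>)"
    "cc i j = 0 \<Longrightarrow> A i j = (\<lambda>_. 0) \<or> (ev j = 0 \<and> (LINT y|lborel. cmod (A i j y)) \<le> 2 * \<beta>)"
proof -
  have L: "L2b (b j) \<beta>" for j using b L21b_L2b(1) by (cases "j = 1") auto
  have \<beta>: "0 \<le> \<beta>" by (rule L2bD(2)[OF L])
  have i: "integrable lborel (seg (b j) (- real n) (real n))"
    using locally_integrableD(2)[OF L2b_locally_integrable[OF L]] unfolding seg_def[abs_def] .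
  have [measurable]: "seg (b j) (- real n) (real n) \<in> borel_measurable borel" using borel_measurable_integrable[OF i] by simp
  have s: "L2b (seg (b j) (- real n) (real n)) \<beta>"
    by (rule L2b_mono[OF L]) (auto simp: seg_def)
  have Am: "A i j \<in> borel_measurable borel" unfolding A_def by (cases "i = 2") simp_all
  have le: "cmod (A i j y) \<le> cmod (seg (b j) (- real n) (real n) y)" for y by (simp add: A_def norm_mult)
  show Ai: "integrable lborel (A i j)"
    by (rule Bochner_Integration.integrable_bound[OF i]) (use Am le in auto)
  show "L2b (A i j) (2 * \<beta>)" by (rule L2b_bound_mono[OF L2b_mono[OF s Am le]]) (use \<beta> in simp)
  show "A i j = (\<lambda>_. 0) \<or> (ev j = 0 \<and> (LINT y|lborel. cmod (A i j y)) \<le> 2 * \<beta>)" if c: "cc i j = 0"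
  proof (cases "i = 2")
    case True
    hence j: "j \<noteq> 1" using c by (auto simp: cc_def sg_def)
    have "(LINT y|lborel. cmod (A i j y)) \<le> (LINT y|lborel. cmod (b j y))"
    proof (rule integral_mono)
      show "cmod (A i j y) \<le> cmod (b j y)" for y by (rule order_trans[OF le]) (simp add: seg_def)
    qed (use Ai L21b_integrable(1)[OF b(2)[OF j]] in auto)
    also have "\<dots> \<le> 2 * \<beta>" by (rule L21b_integrable(2)[OF b(2)[OF j]])
    finally show ?thesis using j by (simp add: ev_def)
  qed (simp add: A_def)
qed

definition bint :: "nat \<Rightarrow> (real \<Rightarrow> complex) \<Rightarrow> (real \<Rightarrow> complex) \<Rightarrow> (real \<Rightarrow> complex) \<Rightarrow> real \<Rightarrow> complex" where
  "bint n v d d2 z = cum (\<lambda>y. \<Sum>j\<in>UNIV. iker cc (bw n v d d2) z 2 j y * osc_sol v d z j y) (real n)"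

text \<open>\<open>mmp\<close> is known only to be L^2, so \<open>ac_vanish\<close> is applied to
  the square of \<open>mm\<close>, whose derivative 2 \<open>mm\<close> \<open>mmp\<close> is
  integrable as a product of L^2 functions.\<close>

lemma mm_vanish:
  assumes p: "pot2 v d d2 B"
  shows "ac (mm v d) (mmp v d d2)" "(mm v d \<longlongrightarrow> 0) at_top" "(mm v d \<longlongrightarrow> 0) at_bot"
proof -
  note P = pot2D[OF p] note D = potD[OF P(1)]
  have "ac (\<lambda>y. cnj (d y) + \<i> / 2 * (v y * cnj (v y) * cnj (v y)))
    (\<lambda>y. cnj (d2 y) + \<i> / 2 * ((d y * cnj (v y) + v y * cnj (d y)) * cnj (v y) + v y * cnj (v y) * cnj (d y)))"
    by (intro ac_add ac_cmult ac_mult ac_cnj P(2) D(1))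
  thus a: "ac (mm v d) (mmp v d d2)" unfolding mm_def[abs_def] mmp_def[abs_def] by (simp add: algebra_simps)
  have L: "L2b (mm v d) (B + 2 * B ^ 3)" by (rule L21b_L2b(1)[OF mm_L21b[OF P(1)]])
  note V = ac_vanish[OF ac_mult[OF a a] L2b_product(1)[OF L L] Bochner_Integration.integrable_add[OF L2b_product(1)[OF bb_bounds(1)[OF p] L] L2b_product(1)[OF L bb_bounds(1)[OF p]]]]
  have s: "(mm v d \<longlongrightarrow> 0) F" if "((\<lambda>x. mm v d x * mm v d x) \<longlongrightarrow> 0) F" for F
  proof (rule tendsto_norm_zero_cancel)
    have "((\<lambda>x. sqrt (norm (mm v d x * mm v d x))) \<longlongrightarrow> sqrt 0) F"
      by (intro tendsto_real_sqrt tendsto_norm_zero that)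
    thus "((\<lambda>x. norm (mm v d x)) \<longlongrightarrow> 0) F" by (simp add: norm_mult)
  qed
  show "(mm v d \<longlongrightarrow> 0) at_top" "(mm v d \<longlongrightarrow> 0) at_bot" by (rule s, rule V)+
qed

text \<open>In 2 i (z + 1) w' the term with the phase equals, up to sign, the part of the derivative
  of \<open>F\<close> in which the phase is differentiated. Adding F' cancels it and leaves the
  coefficients \<open>bb\<close>. The boundary values of \<open>F\<close> vanish in the limit
  because \<open>mm\<close> does.\<close>

lemma bint_tendsto:
  assumes p: "pot2 v d d2 B"
  shows "(\<lambda>n. bint n v d d2 z) \<longlonglongrightarrow> 2 * \<i> * complex_of_real (z + 1) * P3.amp (coef v d) (osc_sol v d) z 2"
proof -
  note P = pot2D[OF p] note D = potD[OF P(1)]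
  note S = sol_facts[OF P(1), of z]
  let ?z = "complex_of_real (z + 1)"
  let ?s = "osc_sol v d z"
  define F where "F = (\<lambda>y. cnj (cis (2 * (z + 1) * y)) * mm v d y * ?s 1 y)"
  let ?r = "\<lambda>i y. \<Sum>j\<in>UNIV. iker cc (coef v d) z i j y * ?s j y"
  define F' where "F' = (\<lambda>y. ((- (2 * \<i> * ?z) * cnj (cis (2 * (z + 1) * y))) * mm v d y + cnj (cis (2 * (z + 1) * y)) * mmp v d d2 y) * ?s 1 y
    + cnj (cis (2 * (z + 1) * y)) * mm v d y * ?r 1 y)"
  have F: "ac F F'" unfolding F_def F'_def
    by (intro ac_mult ac_phase[OF P(1)] mm_vanish(1)[OF p] sol_ac[OF P(1)])
  have W: "ac (?s 2) (?r 2)" by (rule sol_ac[OF P(1)])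
  have pt: "F' y + 2 * \<i> * ?z * ?r 2 y = (\<Sum>j\<in>UNIV. cis (2 * (z + 1) * cc 2 j * y) * bb v d d2 j y * ?s j y)" for y
  proof -
    define e where "e = cis (2 * (z + 1) * y)"
    define P' where "P' = ?s 1 y" define W' where "W' = ?s 2 y" define Q' where "Q' = ?s 3 y"
    \<comment> \<open>The remaining term with the factor z + 1 is the one with q; the constraint
      trades it for p and w.\<close>
    have c: "2 * \<i> * ?z * Q' = cnj e * cnj (v y) * P' - W'"
      using constraint[OF P(1), of z y] unfolding e_def P'_def W'_def Q'_def by (simp add: algebra_simps)
    have ee: "cnj e * e = 1" by (simp add: e_def cis_cnj cis_mult)
    have "2 * \<i> * ?z * (cnj e * mm v d y * P' - v y * cnj (v y) * Q') = 2 * \<i> * ?z * (cnj e * mm v d y * P') - v y * cnj (v y) * (2 * \<i> * ?z * Q')"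
      by (simp add: algebra_simps)
    also have "\<dots> = 2 * \<i> * ?z * (cnj e * mm v d y * P') - v y * cnj (v y) * (cnj e * cnj (v y) * P' - W')" unfolding c ..
    finally have 2: "2 * \<i> * ?z * ?r 2 y = 2 * \<i> * ?z * (cnj e * mm v d y * P') - v y * cnj (v y) * (cnj e * cnj (v y) * P' - W')"
      unfolding rhs e_def P'_def W'_def Q'_def .
    have 1: "cnj e * mm v d y * ?r 1 y = mm v d y * (\<i> / 2 * v y * W' - v y * Q')"
    proof -
      have "cnj e * mm v d y * ?r 1 y = (cnj e * e) * (mm v d y * (\<i> / 2 * v y * W' - v y * Q'))"
        unfolding rhs e_def P'_def W'_def Q'_def by (simp only: mult_ac)
      thus ?thesis unfolding ee by simp
    qed
    show ?thesis unfolding F'_def 2 e_def[symmetric] 1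
      by (simp add: sum_3 cc_def sg_def bb_def P'_def[symmetric] W'_def[symmetric] Q'_def[symmetric] e_def cis_cnj algebra_simps)
  qed
  have bint: "bint n v d d2 z = (F (real n) - F (- real n)) + 2 * \<i> * ?z * (?s 2 (real n) - ?s 2 (- real n))" for n
  proof -
    have le: "- real n \<le> real n" by simp
    have "bint n v d d2 z = (LINT y|lborel. seg F' (- real n) (real n) y + 2 * \<i> * ?z * seg (?r 2) (- real n) (real n) y)"
      unfolding bint_def cum_def
    proof (rule Bochner_Integration.integral_cong)
      fix y
      have k: "iker cc (bw n v d d2) z 2 j y = cis (2 * (z + 1) * cc 2 j * y) * seg (bb v d d2 j) (- real n) (real n) y" for j
      proof -
        have "cis (2 * z * cc 2 j * y) * cis (2 * cc 2 j * y) = cis (2 * (z + 1) * cc 2 j * y)"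
          unfolding cis_mult by (simp add: algebra_simps)
        thus ?thesis unfolding iker_def bw_def by (simp add: mult.assoc[symmetric])
      qed
      show "(if y < real n then \<Sum>j\<in>UNIV. iker cc (bw n v d d2) z 2 j y * ?s j y else 0) = seg F' (- real n) (real n) y + 2 * \<i> * ?z * seg (?r 2) (- real n) (real n) y"
        unfolding k seg_def using pt[of y] by simp
    qed simp
    also have "\<dots> = (LINT y|lborel. seg F' (- real n) (real n) y) + 2 * \<i> * ?z * (LINT y|lborel. seg (?r 2) (- real n) (real n) y)"
      using acD(1)[OF F le] acD(1)[OF W le] by simp
    also have "\<dots> = (F (real n) - F (- real n)) + 2 * \<i> * ?z * (?s 2 (real n) - ?s 2 (- real n))"
      using acD(2)[OF F le] acD(2)[OF W le] by simp
    finally show ?thesis .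
  qed
  have X: "filterlim (\<lambda>n. - real n) at_bot sequentially" by (simp add: filterlim_uminus_at_bot filterlim_real_sequentially)
  have Fl: "(\<lambda>n. F (Y n)) \<longlonglongrightarrow> 0" if "(\<lambda>n. mm v d (Y n)) \<longlonglongrightarrow> 0" for Y
  proof (rule Lim_null_comparison)
    show "(\<lambda>n. norm (mm v d (Y n)) * P3.EB (BM B)) \<longlonglongrightarrow> 0" using tendsto_mult_left_zero[OF tendsto_norm_zero[OF that]] .
    show "\<forall>\<^sub>F n in sequentially. norm (F (Y n)) \<le> norm (mm v d (Y n)) * P3.EB (BM B)"
      unfolding F_def norm_mult complex_mod_cnj norm_cis mult_1_left by (intro always_eventually allI mult_left_mono S(2)) simp
  qed
  have s2: "(\<lambda>n. ?s 2 (- real n)) \<longlonglongrightarrow> ev 2 + 0"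
    by (subst S(4)) (intro tendsto_intros cum_at_bot[OF S(3) X])
  have "(\<lambda>n. bint n v d d2 z) \<longlonglongrightarrow> (0 - 0) + 2 * \<i> * ?z * (P3.amp (coef v d) (osc_sol v d) z 2 - (ev 2 + 0))"
    unfolding bint
    by (intro tendsto_intros Fl S(5) s2 filterlim_compose[OF mm_vanish(2)[OF p] filterlim_real_sequentially] filterlim_compose[OF mm_vanish(3)[OF p] X])
  thus ?thesis by (simp add: ev_def)
qed

definition "C7 B = P3.n * (2 * KB B) * (2 * P3.R (BM B) + P3.C3 (BM B))"
definition "C8 B = P3.n * (2 * KB B) * (2 * (P3.R2 (BM B) * DM B) + P3.C4 (BM B) * DM B) + P3.n * (2 * KD B) * (2 * P3.R (BM B) + P3.C3 (BM B))"

lemma bw_eq: "bw n v d d2 = (\<lambda>i j y. if i = 2 then cis (2 * cc i j * y) * seg (bb v d d2 j) (- real n) (real n) y else 0)"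
  by (simp add: bw_def fun_eq_iff)

lemma bw_diff: "(\<lambda>i j y. bw n v d d2 i j y - bw n v' d' d2' i j y) =
  (\<lambda>i j y. if i = 2 then cis (2 * cc i j * y) * seg (\<lambda>y. bb v d d2 j y - bb v' d' d2' j y) (- real n) (real n) y else 0)"
  by (simp add: bw_def seg_def fun_eq_iff algebra_simps)

text \<open>The truncated integrals are forcing terms in the sense of \<open>sol_forcing\<close>,
  bounded uniformly in n, and Fatou's lemma passes to the limit.\<close>

lemma amp_weighted:
  assumes p: "pot2 v d d2 B"
  shows "L2b (\<lambda>z. 2 * \<i> * complex_of_real (z + 1) * P3.amp (coef v d) (osc_sol v d) z 2) (C7 B)"
proof (rule L2b_lim[OF _ bint_tendsto[OF p]])
  note P = pot2D[OF p] note D = potD[OF P(1)]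
  have b: "integrable lborel (bw n v d d2 i j)" "L2b (bw n v d d2 i j) (2 * KB B)"
    "cc i j = 0 \<Longrightarrow> bw n v d d2 i j = (\<lambda>_. 0) \<or> (ev j = 0 \<and> (LINT y|lborel. cmod (bw n v d d2 i j y)) \<le> 2 * KB B)" for i j n
    unfolding bw_eq by (rule bw_bounds[where b="bb v d d2" and \<beta>="KB B", OF bb_bounds(2,3)[OF p]]; assumption?)+
  have BM0: "0 \<le> BM B" using D(4) by (simp add: BM_def)
  show "L2b (bint n v d d2) (C7 B)" for n
    unfolding bint_def C7_def
    by (rule P3.sol_forcing[where A="bw n v d d2", OF adm_coef[OF P(1)] osc_sol[OF P(1)]]; (rule b(1,2))?; use b(3) P3.nonneg[OF BM0] in blast)
qed

text \<open>As in \<open>sol_diff_eq\<close>: the first coefficients act on the difference of the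
  solutions, the difference of the coefficients on the second solution. Both parts are linear in
  \<delta>, uniformly in n.\<close>

lemma amp_weighted_diff:
  assumes p: "pot2 v d d2 B" and p': "pot2 v' d' d2' B"
    and \<delta>: "L21b (\<lambda>x. v x - v' x) \<delta>" "L21b (\<lambda>x. d x - d' x) \<delta>" "L2b (\<lambda>x. d2 x - d2' x) \<delta>"
  shows "L2b (\<lambda>z. 2 * \<i> * complex_of_real (z + 1) * P3.amp (coef v d) (osc_sol v d) z 2
     - 2 * \<i> * complex_of_real (z + 1) * P3.amp (coef v' d') (osc_sol v' d') z 2) (C8 B * \<delta>)"
proof (rule L2b_lim[OF _ tendsto_diff[OF bint_tendsto[OF p] bint_tendsto[OF p']]])
  fix n
  note P = pot2D[OF p] and P' = pot2D[OF p'] note D = potD[OF P(1)]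
  note M = adm_coef[OF P(1)] and M' = adm_coef[OF P'(1)] and f = osc_sol[OF P(1)] and f' = osc_sol[OF P'(1)]
  have B: "0 \<le> B" by (rule D(4))
  have BM0: "0 \<le> BM B" using B by (simp add: BM_def)
  have d0: "0 \<le> \<delta>" by (rule L21b_nonneg[OF \<delta>(1)])
  have DM0: "0 \<le> DM B" using B by (simp add: DM_def)
  have b: "integrable lborel (bw n v d d2 i j)" "L2b (bw n v d d2 i j) (2 * KB B)"
    "cc i j = 0 \<Longrightarrow> bw n v d d2 i j = (\<lambda>_. 0) \<or> (ev j = 0 \<and> (LINT y|lborel. cmod (bw n v d d2 i j y)) \<le> 2 * KB B)" for i j
    unfolding bw_eq by (rule bw_bounds[where b="bb v d d2" and \<beta>="KB B", OF bb_bounds(2,3)[OF p]]; assumption?)+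
  have b': "integrable lborel (bw n v' d' d2' i j)" "L2b (bw n v' d' d2' i j) (2 * KB B)"
    "cc i j = 0 \<Longrightarrow> bw n v' d' d2' i j = (\<lambda>_. 0) \<or> (ev j = 0 \<and> (LINT y|lborel. cmod (bw n v' d' d2' i j y)) \<le> 2 * KB B)" for i j
    unfolding bw_eq by (rule bw_bounds[where b="bb v' d' d2'" and \<beta>="KB B", OF bb_bounds(2,3)[OF p']]; assumption?)+
  define \<Delta> where "\<Delta> = (\<lambda>i j y. bw n v d d2 i j y - bw n v' d' d2' i j y)"
  have b2: "integrable lborel (\<Delta> i j)" "L2b (\<Delta> i j) (2 * (KD B * \<delta>))"
    "cc i j = 0 \<Longrightarrow> \<Delta> i j = (\<lambda>_. 0) \<or> (ev j = 0 \<and> (LINT y|lborel. cmod (\<Delta> i j y)) \<le> 2 * (KD B * \<delta>))" for i j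
    unfolding \<Delta>_def bw_diff
    using bw_bounds[where b="\<lambda>j y. bb v d d2 j y - bb v' d' d2' j y" and \<beta>="KD B * \<delta>" and i=i and n=n and j=j, OF bb_diff_bounds[OF p p' \<delta>]] by auto
  have 1: "L2b (\<lambda>z. cum (\<lambda>y. \<Sum>j\<in>UNIV. iker cc (bw n v d d2) z 2 j y * (osc_sol v d z j y - osc_sol v' d' z j y)) (real n))
     (P3.n * (2 * KB B) * (2 * (P3.R2 (BM B) * (DM B * \<delta>)) + P3.C4 (BM B) * (DM B * \<delta>)))"
    by (rule P3.sol_diff_forcing[where A="bw n v d d2", OF M f M' f' coef_diff_L21b[OF P(1) P'(1) \<delta>(1,2)]]; (rule b(1,2))?;
      use b(3) mult_nonneg_nonneg[OF P3.nonneg(7)[OF BM0] mult_nonneg_nonneg[OF DM0 d0]] in blast)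
  have 2: "L2b (\<lambda>z. cum (\<lambda>y. \<Sum>j\<in>UNIV. iker cc \<Delta> z 2 j y * osc_sol v' d' z j y) (real n))
     (P3.n * (2 * (KD B * \<delta>)) * (2 * P3.R (BM B) + P3.C3 (BM B)))"
    by (rule P3.sol_forcing[where A=\<Delta>, OF M' f']; (rule b2(1,2))?; use b2(3) P3.nonneg[OF BM0] in blast)
  have e: "bint n v d d2 z - bint n v' d' d2' z = cum (\<lambda>y. \<Sum>j\<in>UNIV. iker cc (bw n v d d2) z 2 j y * (osc_sol v d z j y - osc_sol v' d' z j y)) (real n)
     + cum (\<lambda>y. \<Sum>j\<in>UNIV. iker cc \<Delta> z 2 j y * osc_sol v' d' z j y) (real n)" for z
  proof -
    note S = sol_facts[OF P(1), of z] and S' = sol_facts[OF P'(1), of z]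
    have i: "integrable lborel (\<lambda>y. \<Sum>j\<in>UNIV. iker cc A z 2 j y * g j y)"
      if "\<And>i j. integrable lborel (A i j)" "\<And>j. g j \<in> borel_measurable borel" "\<And>j y. cmod (g j y) \<le> P3.EB (BM B) + P3.EB (BM B)" for A g
      by (intro Bochner_Integration.integrable_sum integrable_bounded_mult[OF P3.iker_integrable[OF that(1)] that(2,3)])
    have EB: "0 \<le> P3.EB (BM B)" using P3.nonneg[OF BM0] by simp
    have s: "cmod (osc_sol v d z j y - osc_sol v' d' z j y) \<le> P3.EB (BM B) + P3.EB (BM B)" "cmod (osc_sol v' d' z j y) \<le> P3.EB (BM B) + P3.EB (BM B)"
      "cmod (osc_sol v d z j y) \<le> P3.EB (BM B) + P3.EB (BM B)" for j y
      using norm_triangle_ineq4[of "osc_sol v d z j y" "osc_sol v' d' z j y"] S(2)[of j y] S'(2)[of j y] EB by linarith+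
    note i1 = i[of "bw n v d d2" "\<lambda>j y. osc_sol v d z j y - osc_sol v' d' z j y", OF b(1) borel_measurable_diff[OF S(1) S'(1)] s(1)]
    note i2 = i[of \<Delta>, OF b2(1) S'(1) s(2)]
    note i3 = i[of "bw n v d d2", OF b(1) S(1) s(3)]
    note i4 = i[of "bw n v' d' d2'", OF b'(1) S'(1) s(2)]
    show ?thesis unfolding bint_def cum_add[OF i1 i2, symmetric] cum_diff[OF i3 i4, symmetric]
      unfolding sum.distrib[symmetric] sum_subtractf[symmetric] \<Delta>_def P3.iker_diff
      by (rule arg_cong2[where f=cum, OF _ refl], rule ext, rule sum.cong) (simp_all add: algebra_simps)
  qed
  have "P3.n * (2 * KB B) * (2 * (P3.R2 (BM B) * (DM B * \<delta>)) + P3.C4 (BM B) * (DM B * \<delta>)) + P3.n * (2 * (KD B * \<delta>)) * (2 * P3.R (BM B) + P3.C3 (BM B)) = C8 B * \<delta>"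
    unfolding C8_def by (simp add: algebra_simps)
  with L2b_add[OF 1 2] show "L2b (\<lambda>z. bint n v d d2 z - bint n v' d' d2' z) (C8 B * \<delta>)" unfolding e by simp
qed

section \<open>The scattering maps\<close>

lemma L2b_norm_L2: assumes f: "f \<in> L2" shows "L2b f (norm_L2 f)"
proof -
  have i: "integrable lborel (\<lambda>x. (cmod (f x))\<^sup>2)" and m: "f \<in> borel_measurable borel" using f by (auto simp: L2_def)
  have "0 \<le> (LINT x|lborel. (cmod (f x))\<^sup>2)" by simp
  thus ?thesis unfolding L2b_def norm_L2_def
    using nn_integral_eq_integral[OF i] m by simp
qed

lemma L2b_L2: assumes f: "L2b f B" shows "f \<in> L2" "norm_L2 f \<le> B"
proof -
  note D = L2bD[OF f]
  have [measurable]: "f \<in> borel_measurable borel" by (rule D)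
  have i: "integrable lborel (\<lambda>x. (cmod (f x))\<^sup>2)"
  proof (rule integrableI_nonneg)
    show "(\<integral>\<^sup>+ x. ennreal ((cmod (f x))\<^sup>2) \<partial>lborel) < \<infinity>" using D(3) by (rule le_less_trans) simp
  qed auto
  thus "f \<in> L2" by (simp add: L2_def)
  have "ennreal (LINT x|lborel. (cmod (f x))\<^sup>2) \<le> ennreal (B\<^sup>2)" using nn_integral_eq_integral[OF i] D(3) by simp
  hence "(LINT x|lborel. (cmod (f x))\<^sup>2) \<le> B\<^sup>2" by simp
  thus "norm_L2 f \<le> B" unfolding norm_L2_def using D(2) by (simp add: real_le_lsqrt)
qed

lemma L21b_norm_L21: "f \<in> L21 \<Longrightarrow> L21b f (norm_L21 f)"
  unfolding L21_def L21b_def norm_L21_def by (simp add: L2b_norm_L2)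

lemma L21b_L21: assumes "L21b f B" shows "f \<in> L21" "norm_L21 f \<le> B"
  using L2b_L2[OF assms[unfolded L21b_def]] by (simp_all add: L21_def norm_L21_def)

lemma L21b_cong_AE:
  assumes "L21b g B" "f \<in> borel_measurable borel" "AE x in lborel. f x = g x"
  shows "L21b f B"
  unfolding L21b_def
proof (rule L2b_cong_AE[OF assms(1)[unfolded L21b_def]])
  note [measurable] = assms(2)
  show "(\<lambda>x. jbracket x *\<^sub>R f x) \<in> borel_measurable borel" by measurable
  show "AE x in lborel. jbracket x *\<^sub>R f x = jbracket x *\<^sub>R g x" using assms(3) by eventually_elim simp
qed

lemma L21b_of_L2b:
  assumes f: "L2b f A" and g: "L2b (\<lambda>x. complex_of_real x * f x) A'"
  shows "L21b f (A + A')"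
  unfolding L21b_def
proof (rule L2b_mono[OF L2b_add[OF L2b_norm[OF f] L2b_norm[OF g]]])
  note [measurable] = L2bD(1)[OF f]
  show "(\<lambda>x. jbracket x *\<^sub>R f x) \<in> borel_measurable borel" by measurable
  fix x :: real
  have "jbracket x \<le> 1 + \<bar>x\<bar>" unfolding jbracket_def by (rule real_le_lsqrt) (auto simp: power2_eq_square algebra_simps)
  hence "jbracket x * cmod (f x) \<le> (1 + \<bar>x\<bar>) * cmod (f x)" by (rule mult_right_mono) simp
  thus "norm (jbracket x *\<^sub>R f x) \<le> norm (norm (f x) + norm (complex_of_real x * f x))"
    using jbracket_ge(3)[of x] by (simp add: norm_mult algebra_simps)
qed

lemma has_weak_derivD: assumes "has_weak_deriv f g" shows "locally_integrable f" "locally_integrable g"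
    "f \<in> borel_measurable borel" "g \<in> borel_measurable borel"
  using assms locally_integrableD(1) unfolding has_weak_deriv_def by auto

lemma has_weak_deriv_weak_deriv: "has_weak_deriv f g \<Longrightarrow> has_weak_deriv f (weak_deriv f)"
  unfolding weak_deriv_def by (rule someI[of "has_weak_deriv f"])

lemma weak_deriv_AE: "has_weak_deriv f g \<Longrightarrow> AE x in lborel. weak_deriv f x = g x"
  by (rule has_weak_deriv_unique[OF has_weak_deriv_weak_deriv])

lemma locally_integrable_cong_AE:
  assumes f: "locally_integrable f" and m: "f' \<in> borel_measurable borel" and e: "AE x in lborel. f' x = f x"
  shows "locally_integrable f'"
  unfolding locally_integrable_def set_integrable_def
proof
  fix R :: real
  note [measurable] = m locally_integrableD(1)[OF f]
  have "AE x in lborel. indicator {- R..R} x *\<^sub>R f' x = indicator {- R..R} x *\<^sub>R f x" using e by eventually_elim simp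
  thus "integrable lborel (\<lambda>x. indicator {- R..R} x *\<^sub>R f' x)"
    using locally_integrableD(3)[OF f, of R] by (subst integrable_cong_AE) auto
qed

lemma has_weak_deriv_cong_AE:
  assumes f: "has_weak_deriv f g" and m: "f' \<in> borel_measurable borel" and e: "AE x in lborel. f' x = f x"
  shows "has_weak_deriv f' g"
  unfolding has_weak_deriv_def
proof (intro conjI allI impI)
  note [measurable] = m has_weak_derivD(3)[OF f]
  show "locally_integrable f'" by (rule locally_integrable_cong_AE[OF has_weak_derivD(1)[OF f] m e])
  show "locally_integrable g" by (rule has_weak_derivD[OF f])
  fix \<psi> assume \<psi>: "test_function \<psi>"
  obtain R C where T: "0 < R" "0 \<le> C" "\<And>x. \<bar>x\<bar> > R \<Longrightarrow> \<psi> x = 0" "\<And>x. \<bar>\<psi> x\<bar> \<le> C" "\<And>x. \<bar>deriv \<psi> x\<bar> \<le> C"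
    "\<And>x. \<bar>x\<bar> > R \<Longrightarrow> deriv \<psi> x = 0" "\<And>x. (\<psi> has_real_derivative deriv \<psi> x) (at x)"
    "continuous_on UNIV \<psi>" "continuous_on UNIV (deriv \<psi>)" by (rule test_functionD[OF \<psi>]) (rule that; assumption)
  have [measurable]: "deriv \<psi> \<in> borel_measurable borel" by (rule borel_measurable_continuous_onI[OF T(9)])
  have "(LINT x|lborel. deriv \<psi> x *\<^sub>R f' x) = (LINT x|lborel. deriv \<psi> x *\<^sub>R f x)"
    by (rule integral_cong_AE) (use e in \<open>auto elim: eventually_mono\<close>)
  thus "(LINT x|lborel. deriv \<psi> x *\<^sub>R f' x) = - (LINT x|lborel. \<psi> x *\<^sub>R g x)"
    using f \<psi> by (simp add: has_weak_deriv_def)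
qed

text \<open>The combination has this shape because k b is (i/2) times one amplitude minus another; c
  = 1 gives differences.\<close>

lemma has_weak_deriv_comb:
  assumes f: "has_weak_deriv f g" and f': "has_weak_deriv f' g'"
  shows "has_weak_deriv (\<lambda>x. c * f x - f' x) (\<lambda>x. c * g x - g' x)"
  unfolding has_weak_deriv_def
proof (intro conjI allI impI)
  have l: "locally_integrable (\<lambda>x. c * h x - h' x)" if "locally_integrable h" "locally_integrable h'" for h h'
    unfolding locally_integrable_def set_integrable_def
  proof
    fix R :: real
    have e: "(\<lambda>x. indicator {- R..R} x *\<^sub>R (c * h x - h' x)) = (\<lambda>x. c * (indicator {- R..R} x *\<^sub>R h x) - indicator {- R..R} x *\<^sub>R h' x)"
      by (simp add: fun_eq_iff algebra_simps)
    show "integrable lborel (\<lambda>x. indicator {- R..R} x *\<^sub>R (c * h x - h' x))"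
      unfolding e by (intro Bochner_Integration.integrable_diff integrable_mult_right locally_integrableD(3) that)
  qed
  note D = has_weak_derivD[OF f] and D' = has_weak_derivD[OF f']
  show "locally_integrable (\<lambda>x. c * f x - f' x)" "locally_integrable (\<lambda>x. c * g x - g' x)" by (intro l D D')+
  fix \<psi> assume \<psi>: "test_function \<psi>"
  obtain R C where T: "0 < R" "0 \<le> C" "\<And>x. \<bar>x\<bar> > R \<Longrightarrow> \<psi> x = 0" "\<And>x. \<bar>\<psi> x\<bar> \<le> C" "\<And>x. \<bar>deriv \<psi> x\<bar> \<le> C"
    "\<And>x. \<bar>x\<bar> > R \<Longrightarrow> deriv \<psi> x = 0" "\<And>x. (\<psi> has_real_derivative deriv \<psi> x) (at x)"
    "continuous_on UNIV \<psi>" "continuous_on UNIV (deriv \<psi>)" by (rule test_functionD[OF \<psi>]) (rule that; assumption)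
  have i: "(LINT x|lborel. \<eta> x *\<^sub>R (c * h x - h' x)) = c * (LINT x|lborel. \<eta> x *\<^sub>R h x) - (LINT x|lborel. \<eta> x *\<^sub>R h' x)"
    if "integrable lborel (\<lambda>x. \<eta> x *\<^sub>R h x)" "integrable lborel (\<lambda>x. \<eta> x *\<^sub>R h' x)" for \<eta> :: "real \<Rightarrow> real" and h h'
  proof -
    have e: "(\<lambda>x. \<eta> x *\<^sub>R (c * h x - h' x)) = (\<lambda>x. c * (\<eta> x *\<^sub>R h x) - \<eta> x *\<^sub>R h' x)" by (simp add: fun_eq_iff algebra_simps)
    show ?thesis
      unfolding e Bochner_Integration.integral_diff[OF integrable_mult_right[OF that(1)] that(2)] integral_mult_right_zero ..
  qed
  have t: "integrable lborel (\<lambda>x. deriv \<psi> x *\<^sub>R w x)" if "locally_integrable w" for w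
    by (rule test_mult_integrable[OF that T(9) T(6) T(5)])
  have t': "integrable lborel (\<lambda>x. \<psi> x *\<^sub>R w x)" if "locally_integrable w" for w
    by (rule test_mult_integrable[OF that T(8) T(3) T(4)])
  have e: "(LINT x|lborel. deriv \<psi> x *\<^sub>R f x) = - (LINT x|lborel. \<psi> x *\<^sub>R g x)"
    "(LINT x|lborel. deriv \<psi> x *\<^sub>R f' x) = - (LINT x|lborel. \<psi> x *\<^sub>R g' x)"
    using f f' \<psi> by (auto simp: has_weak_deriv_def)
  have "(LINT x|lborel. deriv \<psi> x *\<^sub>R (c * f x - f' x)) = c * (LINT x|lborel. deriv \<psi> x *\<^sub>R f x) - (LINT x|lborel. deriv \<psi> x *\<^sub>R f' x)"
    by (rule i[OF t[OF D(1)] t[OF D'(1)]])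
  also have "\<dots> = - (c * (LINT x|lborel. \<psi> x *\<^sub>R g x) - (LINT x|lborel. \<psi> x *\<^sub>R g' x))" unfolding e by simp
  also have "c * (LINT x|lborel. \<psi> x *\<^sub>R g x) - (LINT x|lborel. \<psi> x *\<^sub>R g' x) = (LINT x|lborel. \<psi> x *\<^sub>R (c * g x - g' x))"
    by (rule i[OF t'[OF D(2)] t'[OF D'(2)], symmetric])
  finally show "(LINT x|lborel. deriv \<psi> x *\<^sub>R (c * f x - f' x)) = - (LINT x|lborel. \<psi> x *\<^sub>R (c * g x - g' x))" .
qed

lemma has_weak_deriv_diff:
  "has_weak_deriv f g \<Longrightarrow> has_weak_deriv f' g' \<Longrightarrow> has_weak_deriv (\<lambda>x. f x - f' x) (\<lambda>x. g x - g' x)"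
  using has_weak_deriv_comb[of f g f' g' 1] by simp

lemma H1b_comb:
  assumes "H1b f A" "H1b f' B" shows "H1b (\<lambda>x. c * f x - f' x) (cmod c * A + B)"
proof -
  obtain g g' where "has_weak_deriv f g" "L2b g A" "has_weak_deriv f' g'" "L2b g' B" using assms unfolding H1b_def by auto
  moreover have "L2b (\<lambda>x. c * f x - f' x) (cmod c * A + B)" using assms by (intro L2b_diff L2b_cmult) (auto simp: H1b_def)
  moreover have "L2b (\<lambda>x. c * g x - g' x) (cmod c * A + B)" using calculation by (intro L2b_diff L2b_cmult)
  ultimately show ?thesis unfolding H1b_def using has_weak_deriv_comb by blast
qed

lemma H1b_cong_AE:
  assumes f: "H1b f B" and m: "f' \<in> borel_measurable borel" and e: "AE x in lborel. f' x = f x"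
  shows "H1b f' B"
  using f L2b_cong_AE[OF _ m e] has_weak_deriv_cong_AE[OF _ m e] unfolding H1b_def by blast

lemma H1b_Hm: assumes "H1b f B" shows "f \<in> Hm 1" "norm_Hm 1 f \<le> 2 * B"
proof -
  obtain g where f: "L2b f B" and g: "has_weak_deriv f g" "L2b g B" using assms unfolding H1b_def by auto
  show "f \<in> Hm 1" using L2b_L2(1)[OF f] L2b_L2(1)[OF g(2)] g(1) by auto
  have w: "L2b (weak_deriv f) B"
    by (rule L2b_cong_AE[OF g(2) has_weak_derivD(4)[OF has_weak_deriv_weak_deriv[OF g(1)]] weak_deriv_AE[OF g(1)]])
  have "0 \<le> norm_L2 h" for h unfolding norm_L2_def by simp
  hence "norm_Hm 1 f \<le> norm_L2 f + norm_L2 (weak_deriv f)"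
    unfolding norm_Hm_def by (simp add: sqrt_sum_squares_le_sum)
  also have "\<dots> \<le> 2 * B" using L2b_L2(2)[OF f] L2b_L2(2)[OF w] by simp
  finally show "norm_Hm 1 f \<le> 2 * B" .
qed

text \<open>Elements of the spaces matter only up to null sets, whereas the constraint and the
  boundary terms use point values and limits at infinity. Hence the passage to an absolutely
  continuous representative with derivative \<open>weak_deriv f\<close>.\<close>

definition rep :: "(real \<Rightarrow> complex) \<Rightarrow> real \<Rightarrow> complex" where
  "rep f = (SOME v. ac v (weak_deriv f) \<and> (AE x in lborel. f x = v x))"

lemma rep: assumes "has_weak_deriv f g" shows "ac (rep f) (weak_deriv f)" "AE x in lborel. f x = rep f x" "AE x in lborel. rep f x = f x"
proof -
  obtain v where "ac v (weak_deriv f)" "AE x in lborel. f x = v x"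
    using weak_deriv_ac[OF has_weak_deriv_weak_deriv[OF assms]] .
  hence "ac v (weak_deriv f) \<and> (AE x in lborel. f x = v x)" ..
  hence r: "ac (rep f) (weak_deriv f) \<and> (AE x in lborel. f x = rep f x)" unfolding rep_def by (rule someI[where P="\<lambda>v. ac v (weak_deriv f) \<and> (AE x in lborel. f x = v x)"])
  show "ac (rep f) (weak_deriv f)" by (rule conjunct1[OF r])
  show a: "AE x in lborel. f x = rep f x" by (rule conjunct2[OF r])
  show "AE x in lborel. rep f x = f x" using a by (rule eventually_mono) (rule sym)
qed

lemma norm_L21_nonneg: "0 \<le> norm_L21 f"
  unfolding norm_L21_def norm_L2_def by simp

lemma H11D:
  assumes "u \<in> H11"
  shows "u \<in> L21" "has_weak_deriv u (weak_deriv u)" "u \<in> borel_measurable borel" "weak_deriv u \<in> L21"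
    "L21b u (norm_H11 u)" "L21b (weak_deriv u) (norm_H11 u)"
proof -
  obtain g where u: "u \<in> L21" and g: "g \<in> L21" "has_weak_deriv u g" using assms unfolding H11_def by auto
  show "u \<in> L21" by (rule u)
  show w: "has_weak_deriv u (weak_deriv u)" by (rule has_weak_deriv_weak_deriv[OF g(2)])
  show "u \<in> borel_measurable borel" by (rule has_weak_derivD[OF w])
  show d: "weak_deriv u \<in> L21"
    by (rule L21b_L21(1)[OF L21b_cong_AE[OF L21b_norm_L21[OF g(1)] has_weak_derivD(4)[OF w] weak_deriv_AE[OF g(2)]]])
  show "L21b u (norm_H11 u)" "L21b (weak_deriv u) (norm_H11 u)"
    using L21b_bound_mono[OF L21b_norm_L21[OF u]] L21b_bound_mono[OF L21b_norm_L21[OF d]] norm_L21_nonneg by (simp_all add: norm_H11_def)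
qed

text \<open>\<open>weak_deriv\<close> makes a choice for each function separately, so it is additive
  only almost everywhere.\<close>

lemma H11_diff:
  assumes "u \<in> H11" "u' \<in> H11"
  shows "(\<lambda>x. u x - u' x) \<in> H11" "AE x in lborel. weak_deriv (\<lambda>x. u x - u' x) x = weak_deriv u x - weak_deriv u' x"
proof -
  note D = H11D[OF assms(1)] and D' = H11D[OF assms(2)]
  have w: "has_weak_deriv (\<lambda>x. u x - u' x) (\<lambda>x. weak_deriv u x - weak_deriv u' x)" by (rule has_weak_deriv_diff[OF D(2) D'(2)])
  thus "AE x in lborel. weak_deriv (\<lambda>x. u x - u' x) x = weak_deriv u x - weak_deriv u' x" by (rule weak_deriv_AE)
  show "(\<lambda>x. u x - u' x) \<in> H11"
    unfolding H11_def using L21b_L21(1)[OF L21b_diff[OF D(5) D'(5)]] L21b_L21(1)[OF L21b_diff[OF D(6) D'(6)]] w by auto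
qed

text \<open>The derivative \<open>d\<close> is a parameter because the second part needs its continuous representative.\<close>

definition good :: "(real \<Rightarrow> complex) \<Rightarrow> (real \<Rightarrow> complex) \<Rightarrow> bool" where
  "good u d \<longleftrightarrow> u \<in> H11 \<and> d \<in> borel_measurable borel \<and> (AE x in lborel. d x = weak_deriv u x)"

lemma good_pot:
  assumes g: "good u d" and B: "norm_H11 u \<le> B"
  shows "pot (rep u) d B"
proof -
  note D = H11D[of u] have u: "u \<in> H11" and dm: "d \<in> borel_measurable borel" and d: "AE x in lborel. d x = weak_deriv u x"
    using g by (auto simp: good_def)
  note R = rep[OF D(2)[OF u]]
  have "ac (rep u) d" by (rule ac_cong_AE[OF R(1) eventually_mono[OF d] dm]) (rule sym)
  moreover have "L21b (rep u) (norm_H11 u)" by (rule L21b_cong_AE[OF D(5)[OF u] ac_measurable[OF R(1)] R(3)])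
  moreover have "L21b d (norm_H11 u)" by (rule L21b_cong_AE[OF D(6)[OF u] dm d])
  ultimately show ?thesis unfolding pot_def using L21b_bound_mono B by blast
qed

lemma good_diff:
  assumes g: "good u d" and g': "good u' d'"
  shows "L21b (\<lambda>x. rep u x - rep u' x) (norm_H11 (\<lambda>x. u x - u' x))" "L21b (\<lambda>x. d x - d' x) (norm_H11 (\<lambda>x. u x - u' x))"
proof -
  have u: "u \<in> H11" "u' \<in> H11" and dm: "d \<in> borel_measurable borel" "d' \<in> borel_measurable borel"
    and d: "AE x in lborel. d x = weak_deriv u x" "AE x in lborel. d' x = weak_deriv u' x"
    using g g' by (auto simp: good_def)
  note R = rep[OF H11D(2)[OF u(1)]] and R' = rep[OF H11D(2)[OF u(2)]]
  note w = H11_diff[OF u]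
  note [measurable] = ac_measurable[OF R(1)] ac_measurable[OF R'(1)] dm
  show "L21b (\<lambda>x. rep u x - rep u' x) (norm_H11 (\<lambda>x. u x - u' x))"
  proof (rule L21b_cong_AE[OF H11D(5)[OF w(1)]])
    show "AE x in lborel. rep u x - rep u' x = u x - u' x" using R(3) R'(3) by eventually_elim simp
  qed measurable
  show "L21b (\<lambda>x. d x - d' x) (norm_H11 (\<lambda>x. u x - u' x))"
  proof (rule L21b_cong_AE[OF H11D(6)[OF w(1)]])
    show "AE x in lborel. d x - d' x = weak_deriv (\<lambda>x. u x - u' x) x" using d w(2) by eventually_elim simp
  qed measurable
qed

lemma good_weak_deriv: "u \<in> H11 \<Longrightarrow> good u (weak_deriv u)"
  using has_weak_derivD(4)[OF H11D(2)] by (simp add: good_def)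

section \<open>Estimates for the three scattering maps\<close>

abbreviation "am u d z i \<equiv> P3.amp (coef (rep u) d) (osc_sol (rep u) d) z i"

text \<open>k b appears in two forms: as a combination of amplitudes without the factor z, for the
  H^1 estimates, and as z times the third amplitude, for the weighted ones. The initial values
  \<open>ev\<close> are subtracted to match \<open>amp_H1\<close>; those of components 2 and 3 are
  0.\<close>

lemma good_maps:
  assumes g: "good u d"
  shows "k\<^sup>2 = complex_of_real z \<Longrightarrow> scat_a u k = am u d z 1"
    "map_a u z = am u d z 1 - ev 1" "map_kb u z = \<i> / 2 * (am u d z 2 - ev 2) - (am u d z 3 - ev 3)"
    "map_kb u z = complex_of_real z * am u d z 3"
    "map_b_over_k u z = (if z = 0 then 0 else am u d z 3 - ev 3)"
    "\<i> / 2 * am u d z 2 = complex_of_real (z + 1) * am u d z 3"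
proof -
  note p = good_pot[OF g order_refl]
  have u: "u \<in> H11" using g by (simp add: good_def)
  have s: "scattering u k = (am u d z 1, k * am u d z 3)" if "k\<^sup>2 = complex_of_real z" for k
    by (rule scattering_coef[OF p H11D(3)[OF u] rep(2)[OF H11D(2)[OF u]] that])
  show "k\<^sup>2 = complex_of_real z \<Longrightarrow> scat_a u k = am u d z 1" by (simp add: scat_a_def s)
  note c = s[OF power2_csqrt]
  show "map_a u z = am u d z 1 - ev 1" by (simp add: map_a_def in_z_def scat_a_def c ev_def)
  have kk: "csqrt (complex_of_real z) * csqrt (complex_of_real z) = complex_of_real z"
    using power2_csqrt[of "complex_of_real z"] by (simp only: power2_eq_square)
  have "map_kb u z = (csqrt (complex_of_real z) * csqrt (complex_of_real z)) * am u d z 3"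
    unfolding map_kb_def in_z_def scat_b_def c by (simp only: snd_conv mult.assoc)
  thus kb: "map_kb u z = complex_of_real z * am u d z 3" unfolding kk .
  show e: "\<i> / 2 * am u d z 2 = complex_of_real (z + 1) * am u d z 3" by (rule constraint_amp[OF p])
  show "map_kb u z = \<i> / 2 * (am u d z 2 - ev 2) - (am u d z 3 - ev 3)"
    unfolding kb using e by (simp add: ev_def algebra_simps)
  show "map_b_over_k u z = (if z = 0 then 0 else am u d z 3 - ev 3)"
    by (simp add: map_b_over_k_def in_z_def scat_b_def c ev_def)
qed

lemma AE_b_over_k: "good u d \<Longrightarrow> AE z in lborel. map_b_over_k u z = am u d z 3 - ev 3"
  using AE_neq_real[of 0] by eventually_elim (simp add: good_maps(5))

lemma b_over_k_measurable:
  assumes "good u d" shows "map_b_over_k u \<in> borel_measurable borel"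
proof -
  note p = good_pot[OF assms order_refl]
  have [measurable]: "(\<lambda>z. am u d z 3 - ev 3) \<in> borel_measurable borel"
    by (rule L2bD(1)[OF P3.amp_minus_init_L2[OF adm_coef[OF p] osc_sol[OF p]]])
  show ?thesis unfolding good_maps(5)[OF assms, abs_def] by measurable
qed

lemma maps_H1:
  assumes g: "good u d" and F: "F \<in> {map_a, map_kb, map_b_over_k}"
  shows "F u \<in> Hm 1"
proof -
  note p = good_pot[OF g order_refl]
  note H = P3.amp_H1[OF adm_coef[OF p] osc_sol[OF p]]
  have "H1b (map_a u) (P3.C3 (BM (norm_H11 u)) + P3.C5 (BM (norm_H11 u)))"
    unfolding good_maps(2)[OF g, abs_def] by (rule H)
  moreover have "\<exists>B. H1b (map_kb u) B"
    unfolding good_maps(3)[OF g, abs_def] using H1b_comb[OF H H] by blast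
  moreover have "\<exists>B. H1b (map_b_over_k u) B"
    using H1b_cong_AE[OF H b_over_k_measurable[OF g] AE_b_over_k[OF g]] by blast
  ultimately show ?thesis using F H1b_Hm(1) by blast
qed

definition "LH B = (P3.C4 (BM B) + 2 * P3.C6 (BM B)) * DM B"

text \<open>The factor 4 combines two roundings: k b needs 1/2 + 1 \<le> 2 times the bound for one
  amplitude, and passing from \<open>H1b\<close> to the norm doubles once more.\<close>

lemma maps_diff_H1:
  assumes g: "good u d" "norm_H11 u \<le> B" and g': "good u' d'" "norm_H11 u' \<le> B"
    and F: "F \<in> {map_a, map_kb, map_b_over_k}"
  shows "norm_Hm 1 (\<lambda>z. F u z - F u' z) \<le> 4 * LH B * norm_H11 (\<lambda>x. u x - u' x)"
proof -
  note p = good_pot[OF g] and p' = good_pot[OF g'] note \<delta> = good_diff[OF g(1) g'(1)]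
  define \<delta> where "\<delta> = norm_H11 (\<lambda>x. u x - u' x)"
  have L: "0 \<le> LH B * \<delta>"
    using P3.nonneg[of "BM B"] potD(4)[OF p] L21b_nonneg[OF \<delta>(1)] by (simp add: LH_def BM_def DM_def \<delta>_def)
  have H: "H1b (\<lambda>z. am u d z i - am u' d' z i) (LH B * \<delta>)" for i
    using P3.amp_diff_H1[OF adm_coef[OF p] osc_sol[OF p] adm_coef[OF p'] osc_sol[OF p'] coef_diff_L21b[OF p p' \<delta>]]
    unfolding LH_def \<delta>_def by (simp add: mult.assoc)
  have mono: "H1b f (2 * (LH B * \<delta>))" if "H1b f K" "K \<le> 2 * (LH B * \<delta>)" for f K
    using that L2b_bound_mono unfolding H1b_def by blast
  have le: "LH B * \<delta> \<le> 2 * (LH B * \<delta>)" using L by linarith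
  have 1: "H1b (\<lambda>z. map_a u z - map_a u' z) (2 * (LH B * \<delta>))"
    unfolding good_maps(2)[OF g(1)] good_maps(2)[OF g'(1)] by (rule mono[OF _ le]) (use H[of 1] in simp)
  have "(\<lambda>z. map_kb u z - map_kb u' z) = (\<lambda>z. \<i> / 2 * (am u d z 2 - am u' d' z 2) - (am u d z 3 - am u' d' z 3))"
    unfolding good_maps(3)[OF g(1)] good_maps(3)[OF g'(1)] by (simp add: fun_eq_iff algebra_simps)
  moreover have "H1b (\<lambda>z. \<i> / 2 * (am u d z 2 - am u' d' z 2) - (am u d z 3 - am u' d' z 3)) (2 * (LH B * \<delta>))"
    by (rule mono[OF H1b_comb[OF H H]]) (simp only: norm_divide norm_ii norm_numeral, use L in linarith)
  ultimately have 2: "H1b (\<lambda>z. map_kb u z - map_kb u' z) (2 * (LH B * \<delta>))" by simp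
  have 3: "H1b (\<lambda>z. map_b_over_k u z - map_b_over_k u' z) (2 * (LH B * \<delta>))"
  proof (rule mono[OF H1b_cong_AE[OF H[of 3]]])
    show "AE z in lborel. map_b_over_k u z - map_b_over_k u' z = am u d z 3 - am u' d' z 3"
      using AE_b_over_k[OF g(1)] AE_b_over_k[OF g'(1)] by eventually_elim simp
    show "(\<lambda>z. map_b_over_k u z - map_b_over_k u' z) \<in> borel_measurable borel"
      using b_over_k_measurable[OF g(1)] b_over_k_measurable[OF g'(1)] by measurable
  qed (use L in linarith)
  have "H1b (\<lambda>z. F u z - F u' z) (2 * (LH B * \<delta>))" using F 1 2 3 by blast
  from H1b_Hm(2)[OF this] show ?thesis by (simp add: \<delta>_def mult.assoc)
qed

text \<open>The relation between the two amplitudes gains a power of z: z \<alpha>3 = (i/2)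
  \<alpha>2 - \<alpha>3, and multiplied by z it expresses z^2 \<alpha>3 through z \<alpha>2, that
  is, through the weighted third hypothesis. Being linear, the statement serves amplitudes and
  differences of amplitudes alike.\<close>

lemma b_coefficients_L21b:
  assumes e: "\<And>z. \<i> / 2 * \<alpha>2 z = complex_of_real (z + 1) * \<alpha>3 z"
    and L: "L2b \<alpha>2 K" "L2b \<alpha>3 K" "L2b (\<lambda>z. 2 * \<i> * complex_of_real (z + 1) * \<alpha>2 z) K'"
  shows "L21b (\<lambda>z. complex_of_real z * \<alpha>3 z) (4 * K + K')" "L21b \<alpha>3 (4 * K + K')"
proof -
  have K: "0 \<le> K" "0 \<le> K'" by (rule L2bD(2)[OF L(1)], rule L2bD(2)[OF L(3)])
  have e1: "complex_of_real z * \<alpha>3 z = \<i> / 2 * \<alpha>2 z - \<alpha>3 z" for z using e[of z] by (simp add: algebra_simps)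
  have "L2b (\<lambda>z. \<i> / 2 * \<alpha>2 z - \<alpha>3 z) (cmod (\<i> / 2) * K + K)" by (intro L2b_diff L2b_cmult L)
  hence 1: "L2b (\<lambda>z. complex_of_real z * \<alpha>3 z) (3 / 2 * K)" unfolding e1 by (simp add: norm_divide)
  show "L21b \<alpha>3 (4 * K + K')" by (rule L21b_bound_mono[OF L21b_of_L2b[OF L(2) 1]]) (use K in simp)
  have e2: "complex_of_real z * (complex_of_real z * \<alpha>3 z) = 1 / 4 * (2 * \<i> * complex_of_real (z + 1) * \<alpha>2 z) - \<i> * \<alpha>2 z + \<alpha>3 z" for z
  proof -
    define a b Z where "a = \<alpha>2 z" and "b = \<alpha>3 z" and "Z = complex_of_real z"
    have h: "Z * b = \<i> / 2 * a - b" using e1[of z] by (simp only: a_def b_def Z_def)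
    have Z: "complex_of_real (z + 1) = Z + 1" by (simp add: Z_def)
    have "Z * (Z * b) = Z * (\<i> / 2 * a - b)" unfolding h ..
    also have "\<dots> = \<i> / 2 * (Z * a) - Z * b" by (simp only: right_diff_distrib mult_ac)
    finally have "Z * (Z * b) = \<i> / 2 * (Z * a) - (\<i> / 2 * a - b)" unfolding h[symmetric] .
    also have "\<dots> = 1 / 4 * (2 * \<i> * (Z + 1) * a) - \<i> * a + b" by (simp add: field_simps)
    finally show ?thesis unfolding Z a_def b_def Z_def .
  qed
  have "L2b (\<lambda>z. 1 / 4 * (2 * \<i> * complex_of_real (z + 1) * \<alpha>2 z) - \<i> * \<alpha>2 z + \<alpha>3 z) (cmod (1 / 4) * K' + cmod \<i> * K + K)"
    by (intro L2b_add L2b_diff L2b_cmult L)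
  hence 2: "L2b (\<lambda>z. complex_of_real z * (complex_of_real z * \<alpha>3 z)) (1 / 4 * K' + 2 * K)" unfolding e2 by (rule L2b_bound_mono) (simp add: norm_divide)
  show "L21b (\<lambda>z. complex_of_real z * \<alpha>3 z) (4 * K + K')"
    by (rule L21b_bound_mono[OF L21b_of_L2b[OF 1 2]]) (use K in simp)
qed

text \<open>Membership in \<open>Hm 2\<close> provides some weak derivatives, while the norms speak
  of the chosen \<open>weak_deriv\<close>; uniqueness almost everywhere connects the two. The
  derivative d is taken absolutely continuous so that \<open>mm\<close> can be integrated by
  parts.\<close>

lemma Hm2_H11:
  assumes "u \<in> Hm 2 \<inter> H11"
  defines "d \<equiv> rep (weak_deriv u)" and "d2 \<equiv> weak_deriv (weak_deriv u)"
  shows "good u d" "norm_H2_H11 u \<le> B \<Longrightarrow> norm_H11 u \<le> B" "norm_H2_H11 u \<le> B \<Longrightarrow> pot2 (rep u) d d2 B"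
    "has_weak_deriv (weak_deriv u) d2" "L2b d2 (norm_H2_H11 u)"
proof -
  obtain g h where g: "has_weak_deriv u g" "has_weak_deriv g h" and h: "h \<in> L2"
    using assms(1) by (auto simp: numeral_2_eq_2)
  have u: "u \<in> H11" using assms by simp
  have wm: "weak_deriv u \<in> borel_measurable borel" by (rule has_weak_derivD(4)[OF H11D(2)[OF u]])
  have w: "has_weak_deriv (weak_deriv u) h" by (rule has_weak_deriv_cong_AE[OF g(2) wm weak_deriv_AE[OF g(1)]])
  show w2: "has_weak_deriv (weak_deriv u) d2" unfolding d2_def by (rule has_weak_deriv_weak_deriv[OF w])
  have d2L: "d2 \<in> L2"
    by (rule L2b_L2(1)[OF L2b_cong_AE[OF L2b_norm_L2[OF h] has_weak_derivD(4)[OF w2]]]) (simp add: d2_def weak_deriv_AE[OF w])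
  note R = rep[OF w]
  show gd: "good u d" unfolding good_def d_def using u R(3) ac_measurable[OF R(1)] by auto
  have H: "0 \<le> norm_H11 u" by (rule L21b_nonneg[OF H11D(5)[OF u]])
  have S: "0 \<le> norm_Hm 2 u" unfolding norm_Hm_def by (simp add: sum_nonneg)
  show B: "norm_H2_H11 u \<le> B \<Longrightarrow> norm_H11 u \<le> B" for B using S by (simp add: norm_H2_H11_def)
  have "norm_L2 d2 = sqrt ((norm_L2 ((weak_deriv ^^ 2) u))\<^sup>2)" unfolding d2_def by (simp add: numeral_2_eq_2 norm_L2_def)
  also have "\<dots> \<le> norm_Hm 2 u" unfolding norm_Hm_def
    by (intro real_sqrt_le_mono member_le_sum) auto
  finally have n: "norm_L2 d2 \<le> norm_H2_H11 u" using H by (simp add: norm_H2_H11_def)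
  show L: "L2b d2 (norm_H2_H11 u)" by (rule L2b_bound_mono[OF L2b_norm_L2[OF d2L] n])
  show "pot2 (rep u) d d2 B" if "norm_H2_H11 u \<le> B"
    unfolding pot2_def using good_pot[OF gd B[OF that]] R(1) L2b_bound_mono[OF L that] by (simp add: d_def d2_def)
qed

lemma maps_L21:
  assumes u: "u \<in> Hm 2 \<inter> H11" and F: "F \<in> {map_kb, map_b_over_k}"
  shows "F u \<in> L21"
proof -
  note h = Hm2_H11[OF u] note g = h(1) and p2 = h(3)[OF order_refl]
  note p = pot2D(1)[OF p2]
  have a: "L2b (\<lambda>z. am u (rep (weak_deriv u)) z i) (P3.C3 (BM (norm_H2_H11 u)))" if "ev i = 0" for i
    using P3.amp_minus_init_L2[OF adm_coef[OF p] osc_sol[OF p], of i] that by simp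
  note b = b_coefficients_L21b[OF good_maps(6)[OF g] a a amp_weighted[OF p2]]
  have "map_kb u \<in> L21" unfolding good_maps(4)[OF g, abs_def] by (rule L21b_L21(1)[OF b(1)]) (simp_all add: ev_def)
  moreover have "map_b_over_k u \<in> L21"
  proof (rule L21b_L21(1)[OF L21b_cong_AE[OF b(2) b_over_k_measurable[OF g]]])
    show "AE x in lborel. map_b_over_k u x = am u (rep (weak_deriv u)) x 3" using AE_b_over_k[OF g] by (simp add: ev_def)
  qed (simp_all add: ev_def)
  ultimately show ?thesis using F by blast
qed

definition "LW B = 4 * (P3.C4 (BM B) * DM B) + C8 B"

lemma maps_diff_L21:
  assumes u: "u \<in> Hm 2 \<inter> H11" "norm_H2_H11 u \<le> B" and u': "u' \<in> Hm 2 \<inter> H11" "norm_H2_H11 u' \<le> B"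
    and F: "F \<in> {map_kb, map_b_over_k}"
  shows "norm_L21 (\<lambda>z. F u z - F u' z) \<le> LW B * norm_H2_H11 (\<lambda>x. u x - u' x)" "0 \<le> norm_H2_H11 (\<lambda>x. u x - u' x)"
proof -
  note h = Hm2_H11[OF u(1)] and h' = Hm2_H11[OF u'(1)]
  note g = h(1) and g' = h'(1) and q = h(3)[OF u(2)] and q' = h'(3)[OF u'(2)]
  note p = pot2D(1)[OF q] and p' = pot2D(1)[OF q']
  define \<delta> where "\<delta> = norm_H2_H11 (\<lambda>x. u x - u' x)"
  let ?d = "rep (weak_deriv u)" and ?d' = "rep (weak_deriv u')"
  have uH: "u \<in> H11" "u' \<in> H11" using u u' by auto
  have wd: "has_weak_deriv (\<lambda>x. weak_deriv u x - weak_deriv u' x) (\<lambda>x. weak_deriv (weak_deriv u) x - weak_deriv (weak_deriv u') x)"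
    by (rule has_weak_deriv_diff[OF h(4) h'(4)])
  have dm: "weak_deriv (\<lambda>x. u x - u' x) \<in> borel_measurable borel"
    by (rule has_weak_derivD(4)[OF H11D(2)[OF H11_diff(1)[OF uH]]])
  have L2d: "(\<lambda>x. weak_deriv (weak_deriv u) x - weak_deriv (weak_deriv u') x) \<in> L2" by (rule L2b_L2(1)[OF L2b_diff[OF h(5) h'(5)]])
  have dH: "(\<lambda>x. u x - u' x) \<in> Hm 2 \<inter> H11"
  proof
    have "(\<lambda>x. u x - u' x) \<in> L2" by (rule L2b_L2(1)[OF L21b_L2b(1)[OF H11D(5)[OF H11_diff(1)[OF uH]]]])
    moreover have "has_weak_deriv (\<lambda>x. u x - u' x) (\<lambda>x. weak_deriv u x - weak_deriv u' x)"
      by (rule has_weak_deriv_diff[OF H11D(2)[OF uH(1)] H11D(2)[OF uH(2)]])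
    moreover have "(\<lambda>x. weak_deriv u x - weak_deriv u' x) \<in> L2"
      by (rule L2b_L2(1)[OF L2b_diff[OF L21b_L2b(1)[OF H11D(6)[OF uH(1)]] L21b_L2b(1)[OF H11D(6)[OF uH(2)]]]])
    ultimately show "(\<lambda>x. u x - u' x) \<in> Hm 2" using wd L2d by (auto simp: numeral_2_eq_2)
  qed (rule H11_diff(1)[OF uH])
  note hd = Hm2_H11[OF dH]
  have \<delta>H: "norm_H11 (\<lambda>x. u x - u' x) \<le> \<delta>" unfolding \<delta>_def by (rule hd(2)[OF order_refl])
  have \<delta>1: "L21b (\<lambda>x. rep u x - rep u' x) \<delta>" "L21b (\<lambda>x. ?d x - ?d' x) \<delta>"
    by (rule L21b_bound_mono[OF good_diff(1)[OF g g'] \<delta>H], rule L21b_bound_mono[OF good_diff(2)[OF g g'] \<delta>H])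
  \<comment> \<open>The chosen derivative of u - u' is only almost everywhere the difference of the
    chosen derivatives; it is exchanged for that difference before its own weak derivative is
    compared.\<close>
  have \<delta>2: "L2b (\<lambda>x. weak_deriv (weak_deriv u) x - weak_deriv (weak_deriv u') x) \<delta>"
  proof (rule L2b_cong_AE[OF hd(5)[folded \<delta>_def] has_weak_derivD(4)[OF wd]])
    have "has_weak_deriv (weak_deriv (\<lambda>x. u x - u' x)) (\<lambda>x. weak_deriv (weak_deriv u) x - weak_deriv (weak_deriv u') x)"
      by (rule has_weak_deriv_cong_AE[OF wd dm H11_diff(2)[OF uH]])
    from has_weak_deriv_unique[OF this hd(4)]
    show "AE x in lborel. weak_deriv (weak_deriv u) x - weak_deriv (weak_deriv u') x = weak_deriv (weak_deriv (\<lambda>x. u x - u' x)) x" .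
  qed
  show d0: "0 \<le> norm_H2_H11 (\<lambda>x. u x - u' x)" using L21b_nonneg[OF \<delta>1(1)] by (simp add: \<delta>_def)
  have a: "L2b (\<lambda>z. am u ?d z i - am u' ?d' z i) (P3.C4 (BM B) * (DM B * \<delta>))" for i
    by (rule P3.amp_diff_L2[OF adm_coef[OF p] osc_sol[OF p] adm_coef[OF p'] osc_sol[OF p'] coef_diff_L21b[OF p p' \<delta>1]])
  have w: "L2b (\<lambda>z. 2 * \<i> * complex_of_real (z + 1) * (am u ?d z 2 - am u' ?d' z 2)) (C8 B * \<delta>)"
    using amp_weighted_diff[OF q q' \<delta>1 \<delta>2] by (simp only: right_diff_distrib)
  have e: "\<i> / 2 * (am u ?d z 2 - am u' ?d' z 2) = complex_of_real (z + 1) * (am u ?d z 3 - am u' ?d' z 3)" for z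
    unfolding right_diff_distrib good_maps(6)[OF g] good_maps(6)[OF g'] ..
  note b = b_coefficients_L21b[OF e a a w]
  have K: "4 * (P3.C4 (BM B) * (DM B * \<delta>)) + C8 B * \<delta> = LW B * \<delta>" by (simp add: LW_def algebra_simps)
  have "(\<lambda>z. map_kb u z - map_kb u' z) = (\<lambda>z. complex_of_real z * (am u ?d z 3 - am u' ?d' z 3))"
    unfolding good_maps(4)[OF g] good_maps(4)[OF g'] by (simp add: right_diff_distrib)
  hence 1: "L21b (\<lambda>z. map_kb u z - map_kb u' z) (LW B * \<delta>)" using b(1) unfolding K by simp
  have 2: "L21b (\<lambda>z. map_b_over_k u z - map_b_over_k u' z) (LW B * \<delta>)"
  proof (rule L21b_cong_AE[OF b(2)[unfolded K]])
    show "AE z in lborel. map_b_over_k u z - map_b_over_k u' z = am u ?d z 3 - am u' ?d' z 3"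
      using AE_b_over_k[OF g] AE_b_over_k[OF g'] by eventually_elim simp
    show "(\<lambda>z. map_b_over_k u z - map_b_over_k u' z) \<in> borel_measurable borel"
      using b_over_k_measurable[OF g] b_over_k_measurable[OF g'] by measurable
  qed
  show "norm_L21 (\<lambda>z. F u z - F u' z) \<le> LW B * norm_H2_H11 (\<lambda>x. u x - u' x)"
    using F L21b_L21(2)[OF 1] L21b_L21(2)[OF 2] by (auto simp: \<delta>_def)
qed

text \<open>The definition asks for a positive constant, hence |K B| + 1; enlarging K B is
  legitimate because the norm of the difference is nonnegative.\<close>

lemma lipschitz_on_bounded_setsI:
  assumes "\<And>u. u \<in> X \<Longrightarrow> F u \<in> Y"
    and "\<And>B u v. u \<in> X \<Longrightarrow> v \<in> X \<Longrightarrow> nX u \<le> B \<Longrightarrow> nX v \<le> B \<Longrightarrow>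
       nY (\<lambda>z. F u z - F v z) \<le> K B * nX (\<lambda>x. u x - v x) \<and> 0 \<le> nX (\<lambda>x. u x - v x)"
  shows "lipschitz_on_bounded_sets X nX Y nY F"
  unfolding lipschitz_on_bounded_sets_def
proof (intro conjI ballI allI impI exI)
  fix B :: real
  show "0 < \<bar>K B\<bar> + 1" by simp
  fix u v assume "u \<in> X" "v \<in> X" "nX u \<le> B" "nX v \<le> B"
  note * = assms(2)[OF this]
  have "K B * nX (\<lambda>x. u x - v x) \<le> (\<bar>K B\<bar> + 1) * nX (\<lambda>x. u x - v x)" using * by (intro mult_right_mono) auto
  thus "nY (\<lambda>z. F u z - F v z) \<le> (\<bar>K B\<bar> + 1) * nX (\<lambda>x. u x - v x)" using * by linarith
qed (rule assms(1))

theorem lemma4: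
  shows
    "(\<forall>u \<in> H11.
        (\<exists>A. A holomorphic_on {z. Im z > 0} \<and> continuous_on {z. Im z \<ge> 0} A \<and>
             (\<forall>k. k \<in> \<real> \<or> Re k = 0 \<longrightarrow> A (k\<^sup>2) = scat_a u k)) \<and>
        map_a u \<in> Hm 1 \<and> map_kb u \<in> Hm 1 \<and> map_b_over_k u \<in> Hm 1) \<and>
     (\<forall>u \<in> Hm 2 \<inter> H11. map_kb u \<in> L21 \<and> map_b_over_k u \<in> L21) \<and>
     (\<forall>F \<in> {map_a, map_kb, map_b_over_k}.
        lipschitz_on_bounded_sets H11 norm_H11 (Hm 1) (norm_Hm 1) F) \<and>
     (\<forall>F \<in> {map_kb, map_b_over_k}.
        lipschitz_on_bounded_sets (Hm 2 \<inter> H11) norm_H2_H11 L21 norm_L21 F)"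
proof (intro conjI ballI)
  fix u assume u: "u \<in> H11"
  note g = good_weak_deriv[OF u]
  note p = good_pot[OF g order_refl]
  note M = adm_coef[OF p]
  show "\<exists>A. A holomorphic_on {z. Im z > 0} \<and> continuous_on {z. Im z \<ge> 0} A \<and>
             (\<forall>k. k \<in> \<real> \<or> Re k = 0 \<longrightarrow> A (k\<^sup>2) = scat_a u k)"
  proof (intro exI conjI allI impI)
    \<comment> \<open>Component 1 carries no phase, so on the real axis its continuation coincides
      with the amplitude a.\<close>
    let ?A = "P3.hamp (coef (rep u) (weak_deriv u)) 1"
    show "?A holomorphic_on {z. Im z > 0}" "continuous_on {z. Im z \<ge> 0} ?A" by (rule P3.hamp_analytic[OF M])+
    fix k :: complex assume "k \<in> \<real> \<or> Re k = 0"
    \<comment> \<open>For real or purely imaginary k the square is real, which is the situation of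
      \<open>scattering_coef\<close>.\<close>
    hence "k\<^sup>2 = complex_of_real (Re (k\<^sup>2))" by (auto simp: complex_eq_iff power2_eq_square complex_is_Real_iff)
    then obtain z where z: "k\<^sup>2 = complex_of_real z" by blast
    show "?A (k\<^sup>2) = scat_a u k"
      unfolding good_maps(1)[OF g z] z by (rule P3.hamp_amp[OF M osc_sol[OF p]]) (simp add: sg_def)
  qed
  show "map_a u \<in> Hm 1" "map_kb u \<in> Hm 1" "map_b_over_k u \<in> Hm 1" by (rule maps_H1[OF g], simp)+
next
  fix u assume u: "u \<in> Hm 2 \<inter> H11"
  show "map_kb u \<in> L21" "map_b_over_k u \<in> L21" by (rule maps_L21[OF u], simp)+
next
  fix F assume F: "F \<in> {map_a, map_kb, map_b_over_k}"
  show "lipschitz_on_bounded_sets H11 norm_H11 (Hm 1) (norm_Hm 1) F"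
  proof (rule lipschitz_on_bounded_setsI[where K="\<lambda>B. 4 * LH B"])
    show "F u \<in> Hm 1" if "u \<in> H11" for u by (rule maps_H1[OF good_weak_deriv[OF that] F])
    show "norm_Hm 1 (\<lambda>z. F u z - F v z) \<le> 4 * LH B * norm_H11 (\<lambda>x. u x - v x) \<and> 0 \<le> norm_H11 (\<lambda>x. u x - v x)"
      if "u \<in> H11" "v \<in> H11" "norm_H11 u \<le> B" "norm_H11 v \<le> B" for B u v
      using maps_diff_H1[OF good_weak_deriv[OF that(1)] that(3) good_weak_deriv[OF that(2)] that(4) F]
        L21b_nonneg[OF H11D(5)[OF H11_diff(1)[OF that(1,2)]]] by simp
  qed
next
  fix F assume F: "F \<in> {map_kb, map_b_over_k}"
  show "lipschitz_on_bounded_sets (Hm 2 \<inter> H11) norm_H2_H11 L21 norm_L21 F"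
  proof (rule lipschitz_on_bounded_setsI[where K=LW])
    show "F u \<in> L21" if "u \<in> Hm 2 \<inter> H11" for u by (rule maps_L21[OF that F])
    show "norm_L21 (\<lambda>z. F u z - F v z) \<le> LW B * norm_H2_H11 (\<lambda>x. u x - v x) \<and> 0 \<le> norm_H2_H11 (\<lambda>x. u x - v x)"
      if "u \<in> Hm 2 \<inter> H11" "v \<in> Hm 2 \<inter> H11" "norm_H2_H11 u \<le> B" "norm_H2_H11 v \<le> B" for B u v
      using maps_diff_L21[OF that(1,3,2,4) F] by simp
  qed
qed

end
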